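(* Let $n\ge 1$, $L\ge 0$, $N\ge 1$. The sequence $$1\rightarrow\pi_1\left(\mathrm{Conf}_n(D(L,N))\right)\xrightarrow{\mathrm{Push}_n^{orb}}\mathrm{Map}_n^{\mathrm{id},orb}(\Sigma_\Gamma(L))\xrightarrow{\mathrm{Forget}_n^{orb}}\mathrm{Map}^{\mathrm{id},orb}(\Sigma_\Gamma(L))\rightarrow 1$$ is a short exact sequence of groups, and its quotient term $\mathrm{Map}^{\mathrm{id},orb}(\Sigma_\Gamma(L))$ is trivial.
   Context: Orbifold $\Sigma_\Gamma(L)$. Let $\Gamma=\mathbb{Z}_{m_1}*\dots*\mathbb{Z}_{m_N}$ be a free product of finite cyclic groups ($m_\nu\ge2$) with chosen generators of the factors, viewed as the fundamental group of the graph of groups whose graph is a path with $N$ vertices, with vertex groups $\mathbb{Z}_{m_\nu}$ and trivial edge groups. Let $T$ be its Bass–Serre tree. The chosen generators give a cyclic order on the link of each vertex; embed $T$ properly in $\mathbb{C}$ respecting these cyclic orders, and let $\Sigma$ be a (closed) regular neighborhood of $T$, a planar contractible surface with boundary. $\Gamma$ acts properly and orientation-preservingly on $\Sigma$, vertex stabilizers acting as rotations. The points with non-trivial stabilizer (cone points) are exactly the vertices of $T$; they form $N$ orbits. There is a fundamental domain $F$, a closed disk containing exactly $N$ cone points $c_1,\dots,c_N$, all on $\partial F$, with $\mathrm{Stab}_\Gamma(c_\nu)=\mathbb{Z}_{m_\nu}$; each $c_\nu$ has exactly two adjacent arcs in $\partial F$ running to $\partial\Sigma$, which are identified by $\mathbb{Z}_{m_\nu}$,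 and the rest of $\partial F$ lies in $\partial\Sigma$. Fix points $r_1,\dots,r_L$ in the interior of $F$ with distinct $\Gamma$-orbits, and put $\Sigma(L)=\Sigma\setminus\Gamma(\{r_1,\dots,r_L\})$, $F(L)=F\setminus\{r_1,\dots,r_L\}$. $\Sigma_\Gamma(L)$ denotes $\Sigma(L)$ with its $\Gamma$-action. Orbifold mapping class groups. Homeomorphisms are orientation preserving; homeomorphism groups carry the compact-open topology. Fix distinct marked points $p_1,\dots,p_n$ in the interior of $F(L)$. $\mathrm{Homeo}_n^{orb}(\Sigma_\Gamma(L),\partial\Sigma(L))$ is the group of $\Gamma$-equivariant self-homeomorphisms of $\Sigma(L)$ that fix $\partial\Sigma(L)$ pointwise and preserve the set $\Gamma(\{p_1,\dots,p_n\})$; $\mathrm{Map}_n^{orb}(\Sigma_\Gamma(L))$ is its quotient by the relation of being connected by a continuous path (ambient isotopy) in this group. For $n=0$ the index is omitted. $\mathrm{Forget}_n^{orb}:\mathrm{Map}_n^{orb}(\Sigma_\Gamma(L))\to\mathrm{Map}^{orb}(\Sigma_\Gamma(L))$ forgets the marked points, and $\mathrm{Map}_n^{\mathrm{id},orb}(\Sigma_\Gamma(L))$ is its kernel (for $n=0$, the subgroup of classes of homeomorphisms ambient isotopic to the identity). Disk. $\Sigma/\Gamma$ is a disk $D$; let $\bar r_\lambda,\bar c_\nu,\bar p_j$ be the images of $r_\lambda,c_\nu,p_j$, and let $D(L,N)$ be $D$ punctured at all $\bar r_\lambda$ and $\bar c_\nu$. $\mathrm{Conf}_n(D(L,N))$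 is the unordered configuration space of $n$ distinct points in $D(L,N)$, based at $\{\bar p_1,\dots,\bar p_n\}$. $\mathrm{Map}_n(D(L,N))$ is the group of self-homeomorphisms of $D(L,N)$ fixing $\partial D$ pointwise and preserving $\{\bar p_1,\dots,\bar p_n\}$ as a set, modulo isotopy through such maps; $\mathrm{Map}_n^{\mathrm{id}}(D(L,N))$ is the kernel of the map to $\mathrm{Map}(D(L,N))$ forgetting the marked points. $\mathrm{Push}_n:\pi_1(\mathrm{Conf}_n(D(L,N)))\to\mathrm{Map}_n(D(L,N))$ is the usual point-pushing homomorphism (extend the loop of configurations to an isotopy of $D(L,N)$ starting at the identity and fixing $\partial D$, and take the class of its end map); its image lies in $\mathrm{Map}_n^{\mathrm{id}}(D(L,N))$. The map $\mathrm{Push}_n^{orb}$. Define $\varphi_{\mathrm{Map}}:\mathrm{Map}_n^{\mathrm{id}}(D(L,N))\to\mathrm{Map}_n^{\mathrm{id},orb}(\Sigma_\Gamma(L))$ as follows: if $\bar H$ represents a class, choose an isotopy of $D(L,N)$ rel $\partial D$ (forgetting the marked points) from the identity to $\bar H$, lift it to a $\Gamma$-equivariant isotopy of $\Sigma$ minus the cone points and minus $\Gamma(\{r_1,\dots,r_L\})$ starting at the identity, and extend its end map by fixing the cone points; $\varphi_{\mathrm{Map}}([\bar H])$ is the class of the resulting homeomorphism of $\Sigma(L)$. Then $\mathrm{Push}_n^{orb}=\varphi_{\mathrm{Map}}\circ\mathrm{Push}_n$. *)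

theory Defs
  imports "HOL-Complex_Analysis.Complex_Analysis" "HOL-Algebra.Group_Action"
    "HOL-Algebra.Elementary_Groups" "HOL-Algebra.Multiplicative_Group"
begin

section \<open>Free products of finite cyclic groups and their Bass--Serre trees\<close>

text \<open>A group is the (internal) free product of subgroups \<open>H i\<close> if these generate it and no
  nonempty reduced word represents the identity.\<close>

definition reduced_word :: "'i set \<Rightarrow> ('i \<Rightarrow> 'g set) \<Rightarrow> 'g \<Rightarrow> ('i \<times> 'g) list \<Rightarrow> bool" where
  "reduced_word I H e ws \<longleftrightarrow>
     (\<forall>(i, x) \<in> set ws. i \<in> I \<and> x \<in> H i \<and> x \<noteq> e) \<and> successively (\<lambda>a b. fst a \<noteq> fst b) ws"

definition free_product :: "('g, 'b) monoid_scheme \<Rightarrow> 'i set \<Rightarrow> ('i \<Rightarrow> 'g set) \<Rightarrow> bool" where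
  "free_product G I H \<longleftrightarrow>
     group G \<and> (\<forall>i\<in>I. subgroup (H i) G) \<and> generate G (\<Union>i\<in>I. H i) = carrier G \<and>
     (\<forall>ws. reduced_word I H \<one>\<^bsub>G\<^esub> ws \<and> ws \<noteq> [] \<longrightarrow>
        foldr (\<lambda>(i, x) y. x \<otimes>\<^bsub>G\<^esub> y) ws \<one>\<^bsub>G\<^esub> \<noteq> \<one>\<^bsub>G\<^esub>)"

definition cyclic_factor :: "('g, 'b) monoid_scheme \<Rightarrow> (nat \<Rightarrow> 'g) \<Rightarrow> nat \<Rightarrow> 'g set" where
  "cyclic_factor G g \<nu> = generate G {g \<nu>}"

text \<open>The Bass--Serre tree of the path of groups with \<open>N\<close> vertex groups \<open>cyclic_factor G g \<nu>\<close> and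
  trivial edge groups: vertices are the cosets of the vertex groups, edges over the \<open>\<nu>\<close>-th edge of
  the path are the cosets of the trivial group, that is, the group elements.\<close>

definition bs_vertices :: "('g, 'b) monoid_scheme \<Rightarrow> (nat \<Rightarrow> 'g) \<Rightarrow> nat \<Rightarrow> (nat \<times> 'g set) set" where
  "bs_vertices G g N = {(\<nu>, \<gamma> <#\<^bsub>G\<^esub> cyclic_factor G g \<nu>) | \<nu> \<gamma>. \<nu> < N \<and> \<gamma> \<in> carrier G}"

definition bs_edges :: "('g, 'b) monoid_scheme \<Rightarrow> nat \<Rightarrow> (nat \<times> 'g) set" where
  "bs_edges G N = {(\<nu>, \<gamma>). Suc \<nu> < N \<and> \<gamma> \<in> carrier G}"

definition bs_source :: "('g, 'b) monoid_scheme \<Rightarrow> (nat \<Rightarrow> 'g) \<Rightarrow> nat \<times> 'g \<Rightarrow> nat \<times> 'g set" where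
  "bs_source G g e = (fst e, snd e <#\<^bsub>G\<^esub> cyclic_factor G g (fst e))"

definition bs_target :: "('g, 'b) monoid_scheme \<Rightarrow> (nat \<Rightarrow> 'g) \<Rightarrow> nat \<times> 'g \<Rightarrow> nat \<times> 'g set" where
  "bs_target G g e = (Suc (fst e), snd e <#\<^bsub>G\<^esub> cyclic_factor G g (Suc (fst e)))"

text \<open>Proper embeddings of a graph in the plane: \<open>V\<close> places the vertices, \<open>E\<close> gives the edges as
  arcs from source to target.\<close>

definition planar_embedding ::
  "'v set \<Rightarrow> 'e set \<Rightarrow> ('e \<Rightarrow> 'v) \<Rightarrow> ('e \<Rightarrow> 'v) \<Rightarrow> ('v \<Rightarrow> complex) \<Rightarrow> ('e \<Rightarrow> real \<Rightarrow> complex) \<Rightarrow> bool"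
  where
  "planar_embedding verts edges src tgt V E \<longleftrightarrow>
     inj_on V verts \<and>
     (\<forall>e\<in>edges. arc (E e) \<and> pathstart (E e) = V (src e) \<and> pathfinish (E e) = V (tgt e) \<and>
        path_image (E e) \<inter> V ` verts = {V (src e), V (tgt e)}) \<and>
     (\<forall>e\<in>edges. \<forall>e'\<in>edges. e \<noteq> e' \<longrightarrow>
        path_image (E e) \<inter> path_image (E e') \<subseteq> {V (src e), V (tgt e)}) \<and>
     (\<forall>K. compact K \<longrightarrow>
        finite {v \<in> verts. V v \<in> K} \<and> finite {e \<in> edges. path_image (E e) \<inter> K \<noteq> {}})"

definition embedded_graph ::
  "'v set \<Rightarrow> 'e set \<Rightarrow> ('v \<Rightarrow> complex) \<Rightarrow> ('e \<Rightarrow> real \<Rightarrow> complex) \<Rightarrow> complex set" where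
  "embedded_graph verts edges V E = V ` verts \<union> (\<Union>e\<in>edges. path_image (E e))"


section \<open>Planar surfaces\<close>

definition planar_surface :: "complex set \<Rightarrow> bool" where
  "planar_surface S \<longleftrightarrow>
     (\<forall>z\<in>S. \<exists>U W. z \<in> U \<and> openin (top_of_set S) U \<and>
        openin (top_of_set {w. 0 \<le> Im w}) W \<and> U homeomorphic W)"

text \<open>For a planar surface this is the manifold boundary: the points without a Euclidean
  neighbourhood (see \<open>bd_iff\<close>). Unlike \<open>frontier S\<close> it does not contain isolated punctures.\<close>

definition bd :: "complex set \<Rightarrow> complex set" where
  "bd S = S - interior S"

lemma bd_iff:
  "z \<in> bd S \<longleftrightarrow> z \<in> S \<and>
     \<not> (\<exists>U. z \<in> U \<and> openin (top_of_set S) U \<and> U homeomorphic ball (0::complex) 1)"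
proof -
  have "z \<in> interior S \<longleftrightarrow>
     (\<exists>U. z \<in> U \<and> openin (top_of_set S) U \<and> U homeomorphic ball (0::complex) 1)"
  proof
    assume "z \<in> interior S"
    then obtain e where e: "e > 0" "ball z e \<subseteq> S"
      by (auto simp: mem_interior)
    have "openin (top_of_set S) (ball z e)"
      using e by (simp add: open_subset)
    moreover have "ball z e homeomorphic ball (0::complex) 1"
      using e by (intro homeomorphic_balls) auto
    ultimately show "\<exists>U. z \<in> U \<and> openin (top_of_set S) U \<and> U homeomorphic ball (0::complex) 1"
      using e by (intro exI[of _ "ball z e"]) auto
  next
    assume "\<exists>U. z \<in> U \<and> openin (top_of_set S) U \<and> U homeomorphic ball (0::complex) 1"
    then obtain U where U: "z \<in> U" "openin (top_of_set S) U" "U homeomorphic ball (0::complex) 1"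
      by blast
    then obtain f k where fk: "homeomorphism (ball (0::complex) 1) U f k"
      using homeomorphic_sym homeomorphic_def by metis
    have "inj_on f (ball 0 1)"
      using fk unfolding homeomorphism_def by (metis inj_onI)
    moreover have "continuous_on (ball 0 1) f"
      using fk by (simp add: homeomorphism_def)
    ultimately have "open (f ` ball 0 1)"
      using invariance_of_domain open_ball by blast
    then have "open U" using fk by (simp add: homeomorphism_def)
    moreover have "U \<subseteq> S" using U(2) by (auto simp: openin_open)
    ultimately show "z \<in> interior S" using U(1) by (meson interiorI)
  qed
  then show ?thesis by (auto simp: bd_def)
qed

text \<open>Local degree one at every interior point, for an injective continuous map.\<close>

definition orientation_preserving :: "complex set \<Rightarrow> (complex \<Rightarrow> complex) \<Rightarrow> bool" where
  "orientation_preserving S h \<longleftrightarrow>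
     (\<forall>z r. 0 < r \<and> cball z r \<subseteq> S \<longrightarrow> winding_number (h \<circ> circlepath z r) (h z) = 1)"

text \<open>\<open>S\<close> is a closed regular neighbourhood of \<open>T\<close> in the plane, in topological terms:
  a closed contractible surface with \<open>T\<close> in its interior that properly deformation retracts
  onto \<open>T\<close>.\<close>

definition regular_neighbourhood :: "complex set \<Rightarrow> complex set \<Rightarrow> bool" where
  "regular_neighbourhood S T \<longleftrightarrow>
     closed S \<and> planar_surface S \<and> contractible S \<and> T \<subseteq> interior S \<and>
     (\<exists>h :: real \<times> complex \<Rightarrow> complex.
        continuous_on ({0..1} \<times> S) h \<and> h ` ({0..1} \<times> S) \<subseteq> S \<and>
        (\<forall>x\<in>S. h (0, x) = x \<and> h (1, x) \<in> T) \<and>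
        (\<forall>t\<in>{0..1}. \<forall>x\<in>T. h (t, x) = x) \<and>
        (\<forall>K. compact K \<and> K \<subseteq> S \<longrightarrow> compact {z \<in> {0..1} \<times> S. h z \<in> K}))"

definition homeos :: "complex set \<Rightarrow> (complex \<Rightarrow> complex) set" where
  "homeos S = {h \<in> extensional S. (\<exists>k. homeomorphism S S h k) \<and> orientation_preserving S h}"


section \<open>The orbifold\<close>

definition saturation :: "('g, 'b) monoid_scheme \<Rightarrow> ('g \<Rightarrow> 'a \<Rightarrow> 'a) \<Rightarrow> 'a set \<Rightarrow> 'a set" where
  "saturation G act A = (\<Union>x\<in>A. orbit G act x)"

definition base_vertex ::
  "('g, 'b) monoid_scheme \<Rightarrow> (nat \<Rightarrow> 'g) \<Rightarrow> (nat \<times> 'g set \<Rightarrow> complex) \<Rightarrow> nat \<Rightarrow> complex" where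
  "base_vertex G g V \<nu> = V (\<nu>, cyclic_factor G g \<nu>)"

text \<open>\<open>F\<close> is a closed disk and a fundamental domain. The boundary arcs \<open>a \<nu>\<close>, \<open>b \<nu>\<close> run from the
  cone point \<open>c \<nu>\<close> to the boundary of \<open>S\<close> and are identified by the generator \<open>g \<nu>\<close>.\<close>

definition fundamental_disk ::
  "('g, 'b) monoid_scheme \<Rightarrow> ('g \<Rightarrow> complex \<Rightarrow> complex) \<Rightarrow> complex set \<Rightarrow> nat \<Rightarrow> (nat \<Rightarrow> 'g) \<Rightarrow>
   (nat \<Rightarrow> complex) \<Rightarrow> complex set \<Rightarrow> bool" where
  "fundamental_disk G act S N g c F \<longleftrightarrow>
     F homeomorphic cball (0::complex) 1 \<and>
     (\<Union>\<gamma>\<in>carrier G. act \<gamma> ` F) = S \<and>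
     (\<forall>\<gamma>\<in>carrier G. \<gamma> \<noteq> \<one>\<^bsub>G\<^esub> \<longrightarrow> act \<gamma> ` interior F \<inter> F = {}) \<and>
     inj_on c {..<N} \<and>
     {x \<in> F. stabilizer G act x \<noteq> {\<one>\<^bsub>G\<^esub>}} = c ` {..<N} \<and>
     c ` {..<N} \<subseteq> frontier F \<and>
     (\<forall>\<nu><N. stabilizer G act (c \<nu>) = cyclic_factor G g \<nu>) \<and>
     (\<exists>a b :: nat \<Rightarrow> real \<Rightarrow> complex.
        (\<forall>\<nu><N. arc (a \<nu>) \<and> pathstart (a \<nu>) = c \<nu> \<and> path_image (a \<nu>) \<subseteq> frontier F \<and>
               path_image (a \<nu>) \<inter> bd S = {pathfinish (a \<nu>)} \<and>
               arc (b \<nu>) \<and> pathstart (b \<nu>) = c \<nu> \<and> path_image (b \<nu>) \<subseteq> frontier F \<and>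
               path_image (b \<nu>) \<inter> bd S = {pathfinish (b \<nu>)} \<and>
               path_image (a \<nu>) \<inter> path_image (b \<nu>) = {c \<nu>} \<and>
               act (g \<nu>) ` path_image (a \<nu>) = path_image (b \<nu>)) \<and>
        (\<forall>\<nu><N. \<forall>\<mu><N. \<nu> \<noteq> \<mu> \<longrightarrow>
               (path_image (a \<nu>) \<union> path_image (b \<nu>)) \<inter> (path_image (a \<mu>) \<union> path_image (b \<mu>)) = {}) \<and>
        frontier F - (\<Union>\<nu><N. path_image (a \<nu>) \<union> path_image (b \<nu>)) \<subseteq> bd S)"

locale orbifold_surface = group_action G S act
  for G :: "'g monoid" (structure)
    and S :: "complex set"
    and act :: "'g \<Rightarrow> complex \<Rightarrow> complex" +
  fixes N :: nat
    and m :: "nat \<Rightarrow> nat"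
    and g :: "nat \<Rightarrow> 'g"
    and V :: "nat \<times> 'g set \<Rightarrow> complex"
    and E :: "nat \<times> 'g \<Rightarrow> real \<Rightarrow> complex"
    and F :: "complex set"
  assumes N_pos: "1 \<le> N"
    and m_ge_2: "\<And>\<nu>. \<nu> < N \<Longrightarrow> 2 \<le> m \<nu>"
    and gen_carrier: "\<And>\<nu>. \<nu> < N \<Longrightarrow> g \<nu> \<in> carrier G"
    and gen_ord: "\<And>\<nu>. \<nu> < N \<Longrightarrow> group.ord G (g \<nu>) = m \<nu>"
    and free: "free_product G {..<N} (cyclic_factor G g)"
    and embedding: "planar_embedding (bs_vertices G g N) (bs_edges G N)
                      (bs_source G g) (bs_target G g) V E"
    and surface: "regular_neighbourhood S (embedded_graph (bs_vertices G g N) (bs_edges G N) V E)"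
    and act_homeo: "\<And>\<gamma>. \<gamma> \<in> carrier G \<Longrightarrow> act \<gamma> \<in> homeos S"
    and act_proper: "\<And>K. compact K \<Longrightarrow> K \<subseteq> S \<Longrightarrow> finite {\<gamma> \<in> carrier G. act \<gamma> ` K \<inter> K \<noteq> {}}"
    and act_vertex: "\<And>\<gamma> \<nu> C. \<gamma> \<in> carrier G \<Longrightarrow> (\<nu>, C) \<in> bs_vertices G g N \<Longrightarrow>
                       act \<gamma> (V (\<nu>, C)) = V (\<nu>, \<gamma> <# C)"
    and act_edge: "\<And>\<gamma> \<nu> \<delta> t. \<gamma> \<in> carrier G \<Longrightarrow> (\<nu>, \<delta>) \<in> bs_edges G N \<Longrightarrow> t \<in> {0..1} \<Longrightarrow>
                     act \<gamma> (E (\<nu>, \<delta>) t) = E (\<nu>, \<gamma> \<otimes> \<delta>) t"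
    and cone_points: "{x \<in> S. stabilizer G act x \<noteq> {\<one>}} = V ` bs_vertices G g N"
    \<comment> \<open>Near a vertex, in a suitable chart, the distinguished generator of its stabilizer is the
      rotation by \<open>2 * pi / m \<nu>\<close> and the incident edges are radii. Hence the edges of one orbit occur
      around the vertex in the cyclic order in which the generator permutes them.\<close>
    and rotation: "\<And>\<nu> \<gamma>. \<nu> < N \<Longrightarrow> \<gamma> \<in> carrier G \<Longrightarrow>
       \<exists>U \<phi> \<psi>. open U \<and> U \<subseteq> S \<and> V (\<nu>, \<gamma> <# cyclic_factor G g \<nu>) \<in> U \<and>
         homeomorphism U (ball 0 1) \<phi> \<psi> \<and> orientation_preserving U \<phi> \<and>
         \<phi> (V (\<nu>, \<gamma> <# cyclic_factor G g \<nu>)) = 0 \<and>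
         act (\<gamma> \<otimes> g \<nu> \<otimes> inv \<gamma>) ` U = U \<and>
         (\<forall>x\<in>U. \<phi> (act (\<gamma> \<otimes> g \<nu> \<otimes> inv \<gamma>) x) = cis (2 * pi / real (m \<nu>)) * \<phi> x) \<and>
         (\<forall>e\<in>bs_edges G N. (\<nu>, \<gamma> <# cyclic_factor G g \<nu>) \<in> {bs_source G g e, bs_target G g e} \<longrightarrow>
            (\<exists>\<theta>. \<phi> ` (U \<inter> path_image (E e)) = {complex_of_real s * cis \<theta> | s. 0 \<le> s \<and> s < 1}))"
    and domain: "fundamental_disk G act S N g (base_vertex G g V) F"

definition orbit_disk ::
  "('g, 'b) monoid_scheme \<Rightarrow> ('g \<Rightarrow> complex \<Rightarrow> complex) \<Rightarrow> complex set \<Rightarrow> (complex \<Rightarrow> complex) \<Rightarrow>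
   complex set \<Rightarrow> bool" where
  "orbit_disk G act S q D \<longleftrightarrow>
     D homeomorphic cball (0::complex) 1 \<and>
     quotient_map (top_of_set S) (top_of_set D) q \<and>
     (\<forall>x\<in>S. \<forall>y\<in>S. q x = q y \<longleftrightarrow> orbit G act x = orbit G act y)"


section \<open>Mapping class groups\<close>

definition compact_open :: "'a topology \<Rightarrow> 'b topology \<Rightarrow> ('a \<Rightarrow> 'b) topology" where
  "compact_open X Y = topology_generated_by
     {{f \<in> extensional (topspace X). continuous_map X Y f \<and> f ` K \<subseteq> U} | K U.
        compactin X K \<and> openin Y U}"

definition homeos_fixing :: "complex set \<Rightarrow> complex set \<Rightarrow> (complex \<Rightarrow> complex) set" where
  "homeos_fixing S M = {h \<in> homeos S. (\<forall>x\<in>bd S. h x = x) \<and> h ` M = M}"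

definition equivariant_homeos ::
  "('g, 'b) monoid_scheme \<Rightarrow> ('g \<Rightarrow> complex \<Rightarrow> complex) \<Rightarrow> complex set \<Rightarrow> (complex \<Rightarrow> complex) set" where
  "equivariant_homeos G act S =
     {h \<in> homeos S. \<forall>\<gamma>\<in>carrier G. \<forall>x\<in>S. h (act \<gamma> x) = act \<gamma> (h x)}"

definition homeos_orb ::
  "('g, 'b) monoid_scheme \<Rightarrow> ('g \<Rightarrow> complex \<Rightarrow> complex) \<Rightarrow> complex set \<Rightarrow> complex set \<Rightarrow>
   (complex \<Rightarrow> complex) set" where
  "homeos_orb G act S M = equivariant_homeos G act S \<inter> homeos_fixing S (saturation G act M)"

abbreviation homeo_space :: "complex set \<Rightarrow> (complex \<Rightarrow> complex) set \<Rightarrow> (complex \<Rightarrow> complex) topology"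
  where "homeo_space S A \<equiv> subtopology (compact_open (top_of_set S) (top_of_set S)) A"

text \<open>A continuous path of homeomorphisms starting at the identity.\<close>

definition isotopy :: "complex set \<Rightarrow> (complex \<Rightarrow> complex) set \<Rightarrow> (real \<Rightarrow> complex \<Rightarrow> complex) \<Rightarrow> bool"
  where "isotopy S A H \<longleftrightarrow> pathin (homeo_space S A) H \<and> H 0 = (\<lambda>x\<in>S. x)"

definition mapping_class ::
  "complex set \<Rightarrow> (complex \<Rightarrow> complex) set \<Rightarrow> (complex \<Rightarrow> complex) \<Rightarrow> (complex \<Rightarrow> complex) set" where
  "mapping_class S A f = path_component_of_set (homeo_space S A) f"

text \<open>The group \<open>A\<close> of homeomorphisms of \<open>S\<close> modulo path components; the product of two components
  is their elementwise composite \<open>f \<circ> h\<close>, \<open>h\<close> applied first.\<close>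

definition mcg :: "complex set \<Rightarrow> (complex \<Rightarrow> complex) set \<Rightarrow> (complex \<Rightarrow> complex) set monoid" where
  "mcg S A = \<lparr>carrier = path_components_of (homeo_space S A),
              mult = set_mult (BijGroup S),
              one = mapping_class S A (\<lambda>x\<in>S. x)\<rparr>"

text \<open>For \<open>A \<subseteq> B\<close>, the map induced by the inclusion; all sets in the union coincide.\<close>

definition forget ::
  "complex set \<Rightarrow> (complex \<Rightarrow> complex) set \<Rightarrow> (complex \<Rightarrow> complex) set \<Rightarrow> (complex \<Rightarrow> complex) set" where
  "forget S B c = (\<Union>f\<in>c. mapping_class S B f)"

definition mcg_pure ::
  "complex set \<Rightarrow> (complex \<Rightarrow> complex) set \<Rightarrow> (complex \<Rightarrow> complex) set \<Rightarrow>
   (complex \<Rightarrow> complex) set monoid" where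
  "mcg_pure S A B = (mcg S A)\<lparr>carrier := kernel (mcg S A) (mcg S B) (forget S B)\<rparr>"

text \<open>The \<open>\<Gamma>\<close>-equivariant groups with marked points \<open>P\<close>, the case \<open>n = 0\<close> being separate.\<close>

definition map_id_orb ::
  "('g, 'b) monoid_scheme \<Rightarrow> ('g \<Rightarrow> complex \<Rightarrow> complex) \<Rightarrow> complex set \<Rightarrow> complex set \<Rightarrow>
   (complex \<Rightarrow> complex) set monoid" where
  "map_id_orb G act S P = mcg_pure S (homeos_orb G act S P) (homeos_orb G act S {})"

definition map_id_orb_unmarked ::
  "('g, 'b) monoid_scheme \<Rightarrow> ('g \<Rightarrow> complex \<Rightarrow> complex) \<Rightarrow> complex set \<Rightarrow>
   (complex \<Rightarrow> complex) set monoid" where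
  "map_id_orb_unmarked G act S = (mcg S (homeos_orb G act S {}))
     \<lparr>carrier := {mapping_class S (homeos_orb G act S {}) f | f.
        path_component_of (homeo_space S (homeos_orb G act S {})) (\<lambda>x\<in>S. x) f}\<rparr>"

definition forget_orb ::
  "('g, 'b) monoid_scheme \<Rightarrow> ('g \<Rightarrow> complex \<Rightarrow> complex) \<Rightarrow> complex set \<Rightarrow>
   (complex \<Rightarrow> complex) set \<Rightarrow> (complex \<Rightarrow> complex) set" where
  "forget_orb G act S = forget S (homeos_orb G act S {})"


section \<open>Configuration spaces and fundamental groups\<close>

definition ordered_conf :: "nat \<Rightarrow> 'a topology \<Rightarrow> (nat \<Rightarrow> 'a) topology" where
  "ordered_conf n X = subtopology (product_topology (\<lambda>_. X) {..<n}) {x. inj_on x {..<n}}"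

text \<open>Unordered configurations are \<open>n\<close>-element sets, with the quotient topology.\<close>

definition conf :: "nat \<Rightarrow> 'a topology \<Rightarrow> 'a set topology" where
  "conf n X = topology (\<lambda>\<U>. \<U> \<subseteq> {A. A \<subseteq> topspace X \<and> finite A \<and> card A = n} \<and>
     openin (ordered_conf n X) {x \<in> topspace (ordered_conf n X). x ` {..<n} \<in> \<U>})"

lemma openin_conf:
  "openin (conf n X) \<U> \<longleftrightarrow> \<U> \<subseteq> {A. A \<subseteq> topspace X \<and> finite A \<and> card A = n} \<and>
     openin (ordered_conf n X) {x \<in> topspace (ordered_conf n X). x ` {..<n} \<in> \<U>}"
proof -
  let ?Y = "ordered_conf n X"
  let ?T = "\<lambda>\<U>. {x \<in> topspace ?Y. x ` {..<n} \<in> \<U>}"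
  have Int: "?T (A \<inter> B) = ?T A \<inter> ?T B" for A B by auto
  have Un: "?T (\<Union>K) = (\<Union>A\<in>K. ?T A)" for K by auto
  let ?P = "\<lambda>\<U>. \<U> \<subseteq> {A. A \<subseteq> topspace X \<and> finite A \<and> card A = n} \<and> openin ?Y (?T \<U>)"
  have "?P (A \<inter> B)" if "?P A" "?P B" for A B
    using that unfolding Int by (simp add: le_infI1 openin_Int)
  moreover have "?P (\<Union>K)" if "\<forall>A\<in>K. ?P A" for K
  proof
    show "\<Union>K \<subseteq> {A. A \<subseteq> topspace X \<and> finite A \<and> card A = n}"
      by (rule Union_least) (use that in simp)
    show "openin ?Y (?T (\<Union>K))"
      unfolding Un by (rule openin_Union) (use that in auto)
  qed
  ultimately have "istopology ?P"
    unfolding istopology_def by simp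
  then show ?thesis
    unfolding conf_def by (simp add: topology_inverse')
qed

definition loops :: "'a topology \<Rightarrow> 'a \<Rightarrow> (real \<Rightarrow> 'a) set" where
  "loops X b = {p. pathin X p \<and> p 0 = b \<and> p 1 = b}"

definition loop_class :: "'a topology \<Rightarrow> 'a \<Rightarrow> (real \<Rightarrow> 'a) \<Rightarrow> (real \<Rightarrow> 'a) set" where
  "loop_class X b p = {q \<in> loops X b.
     homotopic_with (\<lambda>h. h 0 = b \<and> h 1 = b) (top_of_set {0..1}) X p q}"

definition join_loops :: "(real \<Rightarrow> 'a) \<Rightarrow> (real \<Rightarrow> 'a) \<Rightarrow> real \<Rightarrow> 'a" where
  "join_loops p q t = (if t \<le> 1/2 then p (2 * t) else q (2 * t - 1))"

text \<open>The product of two classes traverses the right factor first. This matches composition of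
  maps in \<open>mcg\<close>, so that point-pushing is a homomorphism and not an antihomomorphism.\<close>

definition pi1 :: "'a topology \<Rightarrow> 'a \<Rightarrow> (real \<Rightarrow> 'a) set monoid" where
  "pi1 X b = \<lparr>carrier = loop_class X b ` loops X b,
              mult = (\<lambda>P Q. \<Union>p\<in>P. \<Union>q\<in>Q. loop_class X b (join_loops q p)),
              one = loop_class X b (\<lambda>_. b)\<rparr>"


section \<open>Point-pushing\<close>

text \<open>Loops of configurations that meet the boundary do not extend to an isotopy fixing the
  boundary, hence the choice of a representing loop.\<close>

definition push :: "complex set \<Rightarrow> complex set \<Rightarrow> (real \<Rightarrow> complex set) set \<Rightarrow> (complex \<Rightarrow> complex) set"
  where
  "push X P l = (THE c. \<exists>p\<in>l. \<exists>H. isotopy X (homeos_fixing X {}) H \<and>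
     (\<forall>t\<in>{0..1}. H t ` P = p t) \<and> c = mapping_class X (homeos_fixing X P) (H 1))"

text \<open>\<open>S\<close> is the punctured surface, \<open>C\<close> its set of cone points, \<open>X\<close> the punctured disk and \<open>q\<close> the
  quotient map. The isotopy \<open>K\<close> downstairs is lifted to the isotopy \<open>H\<close> on \<open>S - C\<close>.\<close>

definition phi_map ::
  "('g, 'b) monoid_scheme \<Rightarrow> ('g \<Rightarrow> complex \<Rightarrow> complex) \<Rightarrow> complex set \<Rightarrow> complex set \<Rightarrow>
   complex set \<Rightarrow> (complex \<Rightarrow> complex) \<Rightarrow> complex set \<Rightarrow>
   (complex \<Rightarrow> complex) set \<Rightarrow> (complex \<Rightarrow> complex) set" where
  "phi_map G act S C X q P c = (THE d. \<exists>K H.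
     isotopy X (homeos_fixing X {}) K \<and> K 1 \<in> c \<and>
     isotopy (S - C) (equivariant_homeos G act (S - C)) H \<and>
     (\<forall>t\<in>{0..1}. \<forall>x\<in>S - C. q (H t x) = K t (q x)) \<and>
     d = mapping_class S (homeos_orb G act S P) (\<lambda>x\<in>S. if x \<in> C then x else H 1 x))"

definition push_orb ::
  "('g, 'b) monoid_scheme \<Rightarrow> ('g \<Rightarrow> complex \<Rightarrow> complex) \<Rightarrow> complex set \<Rightarrow> complex set \<Rightarrow>
   complex set \<Rightarrow> (complex \<Rightarrow> complex) \<Rightarrow> complex set \<Rightarrow>
   (real \<Rightarrow> complex set) set \<Rightarrow> (complex \<Rightarrow> complex) set" where
  "push_orb G act S C X q P = phi_map G act S C X q P \<circ> push X (q ` P)"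


section \<open>Short exact sequences\<close>

text \<open>The library's \<open>exact_seq\<close> requires all groups to have the same element type.\<close>

definition short_exact ::
  "('a, 'x) monoid_scheme \<Rightarrow> ('b, 'y) monoid_scheme \<Rightarrow> ('c, 'z) monoid_scheme \<Rightarrow>
   ('a \<Rightarrow> 'b) \<Rightarrow> ('b \<Rightarrow> 'c) \<Rightarrow> bool" where
  "short_exact A B C f h \<longleftrightarrow>
     group_hom A B f \<and> group_hom B C h \<and> inj_on f (carrier A) \<and>
     f ` carrier A = kernel B C h \<and> h ` carrier B = carrier C"

end

theory Submission
  imports Defs
begin

text \<open>An equivariant isotopy of the punctured surface that starts at the identity fixes every cone
  point, so it restricts to the complement of the cone points, which covers the punctured disk, and
  descends there. Conversely, isotopies of the punctured disk lift through this covering, and the lifts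
  extend over the cone points by the identity. Hence every class in the kernel of the forgetful map is the
  end of a lifted isotopy, and the motion of the marked points downstairs is a loop of configurations
  whose push is that class. Every loop arises in this way by isotopy extension, once it has been pushed
  off the boundary. If the end map is trivial, then comparing the two isotopies gives a loop of
  homeomorphisms of the punctured disk fixing the boundary. It drags along a path of configurations that
  ends on the boundary, and this contracts the loop.\<close>

section \<open>Families of homeomorphisms\<close>

text \<open>\<open>push\<close> and \<open>phi_map\<close> are definite descriptions that choose a
  loop, an isotopy and a lift. They are evaluated together through one correspondence: if
  \<open>F\<close> is an equivariant isotopy from the identity to a map preserving the marked
  orbits, then \<open>push_orb\<close> sends the class of the loop traced by the images of
  \<open>M\<close> under \<open>F t\<close> and \<open>q\<close> to the class of \<open>F 1\<close>.
  The homomorphism property, the kernel and the image are all read off from this correspondence.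
  Independence of the choices has two sources. Downstairs, a homotopy of loops of configurations is
  itself extended to a two-parameter family of homeomorphisms. Upstairs, two lifts of one map of the
  punctured disk agree as soon as they agree at one point, and a boundary point, which every lifted
  isotopy fixes, serves for this. Cone points turn into punctures because an equivariant isotopy can
  move them only within a locally finite set.\<close>

lemma joint_compose:
  assumes "continuous_on (T \<times> Y) (\<lambda>z. F (fst z) (snd z))"
    and "continuous_on A a" "continuous_on A b" "\<And>x. x \<in> A \<Longrightarrow> a x \<in> T" "\<And>x. x \<in> A \<Longrightarrow> b x \<in> Y"
  shows "continuous_on A (\<lambda>x. F (a x) (b x))"
proof -
  have "continuous_on A ((\<lambda>z. F (fst z) (snd z)) \<circ> (\<lambda>x. (a x, b x)))"
    using assms by (intro continuous_on_compose continuous_on_Pair)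
      (auto intro: continuous_on_subset)
  then show ?thesis by (simp add: o_def)
qed

text \<open>The inverse family is carried along as data, so that inverse isotopies arise by symmetry
  and composites by substitution. No starting map and no values outside \<open>Y\<close> are
  prescribed.\<close>

definition ambient :: "'a::topological_space set \<Rightarrow> (real \<Rightarrow> 'a \<Rightarrow> 'a) \<Rightarrow> (real \<Rightarrow> 'a \<Rightarrow> 'a) \<Rightarrow> bool" where
  "ambient Y F G \<longleftrightarrow>
     continuous_on ({0..1} \<times> Y) (\<lambda>z. F (fst z) (snd z)) \<and>
     continuous_on ({0..1} \<times> Y) (\<lambda>z. G (fst z) (snd z)) \<and>
     (\<forall>t\<in>{0..1}. \<forall>x\<in>Y. F t x \<in> Y \<and> G t x \<in> Y \<and> G t (F t x) = x \<and> F t (G t x) = x)"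

lemma ambient_cont: "ambient Y F G \<Longrightarrow> continuous_on ({0..1} \<times> Y) (\<lambda>z. F (fst z) (snd z))"
  and ambient_sym: "ambient Y F G \<Longrightarrow> ambient Y G F"
  and ambient_in: "ambient Y F G \<Longrightarrow> 0 \<le> t \<Longrightarrow> t \<le> 1 \<Longrightarrow> x \<in> Y \<Longrightarrow> F t x \<in> Y"
  and ambient_inv: "ambient Y F G \<Longrightarrow> 0 \<le> t \<Longrightarrow> t \<le> 1 \<Longrightarrow> x \<in> Y \<Longrightarrow> G t (F t x) = x"
  by (auto simp: ambient_def)

lemma ambient_compose:
  assumes "ambient Y F G" "continuous_on A a" "continuous_on A b"
    "\<And>x. x \<in> A \<Longrightarrow> 0 \<le> a x" "\<And>x. x \<in> A \<Longrightarrow> a x \<le> 1" "\<And>x. x \<in> A \<Longrightarrow> b x \<in> Y"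
  shows "continuous_on A (\<lambda>x. F (a x) (b x))"
  using assms by (intro joint_compose[OF ambient_cont[OF assms(1)]]) auto

lemma ambient_comp:
  assumes F: "ambient Y F G" and F': "ambient Y F' G'"
  shows "ambient Y (\<lambda>t x. F t (F' t x)) (\<lambda>t x. G' t (G t x))"
proof -
  note 1 = ambient_in[OF F] ambient_in[OF F'] ambient_in[OF ambient_sym[OF F]]
    ambient_in[OF ambient_sym[OF F']] ambient_inv[OF F] ambient_inv[OF F']
    ambient_inv[OF ambient_sym[OF F]] ambient_inv[OF ambient_sym[OF F']]
  have "continuous_on ({0..1} \<times> Y) (\<lambda>z. F (fst z) (F' (fst z) (snd z)))"
    by (rule ambient_compose[OF F _ ambient_cont[OF F']])
      (use 1 in \<open>auto intro!: continuous_intros\<close>)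
  moreover have "continuous_on ({0..1} \<times> Y) (\<lambda>z. G' (fst z) (G (fst z) (snd z)))"
    by (rule ambient_compose[OF ambient_sym[OF F'] _ ambient_cont[OF ambient_sym[OF F]]])
      (use 1 in \<open>auto intro!: continuous_intros\<close>)
  ultimately show ?thesis using 1 by (simp add: ambient_def)
qed

lemma ambient_const:
  assumes "homeomorphism Y Y f g"
  shows "ambient Y (\<lambda>_. f) (\<lambda>_. g)"
proof -
  have "continuous_on ({0..1} \<times> Y) (\<lambda>z. f (snd z))" "continuous_on ({0..1} \<times> Y) (\<lambda>z. g (snd z))"
    using assms by (auto intro!: continuous_intros continuous_on_compose2[where f = snd and t = Y] simp: homeomorphism_def)
  then show ?thesis using assms unfolding ambient_def homeomorphism_def by auto
qed

lemma ambient_homeomorphism: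
  assumes F: "ambient Y F G" and t: "t \<in> {0..1}"
  shows "homeomorphism Y Y (F t) (G t)"
proof (rule homeomorphismI)
  show "continuous_on Y (F t)" "continuous_on Y (G t)"
    using t by (auto intro!: ambient_compose[OF F] ambient_compose[OF ambient_sym[OF F]] continuous_intros)
qed (use F t in \<open>auto simp: ambient_def\<close>)

text \<open>Elements of \<open>homeos\<close> are \<open>undefined\<close> off their surface,
  whereas isotopies are built from unrestricted formulas; this passes between the two.\<close>

lemma ambient_cong:
  assumes F: "ambient Y F G" and F': "\<And>t x. t \<in> {0..1} \<Longrightarrow> x \<in> Y \<Longrightarrow> F' t x = F t x"
    and G': "\<And>t x. t \<in> {0..1} \<Longrightarrow> x \<in> Y \<Longrightarrow> G' t x = G t x"
  shows "ambient Y F' G'"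
proof -
  have "continuous_on ({0..1} \<times> Y) (\<lambda>z. F' (fst z) (snd z))"
    by (rule continuous_on_eq[OF ambient_cont[OF F]]) (simp add: F' mem_Times_iff)
  moreover have "continuous_on ({0..1} \<times> Y) (\<lambda>z. G' (fst z) (snd z))"
    by (rule continuous_on_eq[OF ambient_cont[OF ambient_sym[OF F]]]) (simp add: G' mem_Times_iff)
  ultimately show ?thesis using F F' G' by (simp add: ambient_def)
qed

text \<open>Arens' argument that inversion is continuous: a connected neighbourhood of the image point
  that avoids the image of the boundary of a small compact set lies in the image of that set.\<close>

lemma family_inverse_continuous:
  fixes Y :: "'a::heine_borel set" and F :: "real \<Rightarrow> 'a \<Rightarrow> 'a"
  assumes lc: "locally compact Y" and lcn: "locally connected Y" and T: "compact T"
    and cont: "continuous_on (T \<times> Y) (\<lambda>z. F (fst z) (snd z))"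
    and hom: "\<And>t. t \<in> T \<Longrightarrow> homeomorphism Y Y (F t) (G t)"
  shows "continuous_on (T \<times> Y) (\<lambda>z. G (fst z) (snd z))"
  unfolding continuous_on_topological
proof (intro ballI allI impI)
  fix z W assume z: "z \<in> T \<times> Y" and W: "open W" "G (fst z) (snd z) \<in> W"
  obtain t0 y0 where z0: "z = (t0, y0)" by fastforce
  define x0 where "x0 = G t0 y0"
  have t0: "t0 \<in> T" and y0: "y0 \<in> Y" using z z0 by auto
  have FG: "\<And>t x. t \<in> T \<Longrightarrow> x \<in> Y \<Longrightarrow> F t x \<in> Y \<and> G t x \<in> Y \<and> G t (F t x) = x \<and> F t (G t x) = x"
    using hom unfolding homeomorphism_def by blast
  have x0: "x0 \<in> Y" "F t0 x0 = y0" using FG t0 y0 by (auto simp: x0_def)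
  obtain u v where uv: "openin (top_of_set Y) u" "compact v" "x0 \<in> u" "u \<subseteq> v" "v \<subseteq> Y \<inter> W"
    using lc x0 W z0 unfolding locally_def
    by (metis Int_iff fst_conv inf_commute openin_open_Int snd_conv x0_def)
  \<comment> \<open>\<open>B\<close> plays the part of the boundary of \<open>v\<close>: a connected
    subset of \<open>Y\<close> that meets \<open>u\<close> and misses \<open>B\<close> lies in
    \<open>u\<close>, because \<open>u\<close> and the complement of \<open>v\<close> are disjoint
    open sets.\<close>
  define B where "B = v - u"
  have "closedin (top_of_set Y) B"
  proof -
    have "closedin (top_of_set Y) (v \<inter> (Y - u))"
      using uv by (intro closedin_Int) (auto simp: closed_subset compact_imp_closed)
    moreover have "v \<inter> (Y - u) = B" using uv by (auto simp: B_def)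
    ultimately show ?thesis by simp
  qed
  then have cB: "compact B"
    using closedin_closed_subset[of Y B v] closedin_compact[OF uv(2), of B] uv unfolding B_def
    by (metis Diff_subset Int_absorb2 le_inf_iff)
  have BY: "B \<subseteq> Y" using uv by (auto simp: B_def)
  \<comment> \<open>\<open>F t0\<close> is injective and \<open>x0\<close> lies in \<open>u\<close>,
    so the compact image of \<open>B\<close> keeps a positive distance \<open>e\<close> from
    \<open>y0\<close>.\<close>
  obtain e where e: "e > 0" "\<And>x. x \<in> B \<Longrightarrow> e \<le> dist y0 (F t0 x)"
  proof -
    have "continuous_on B (F t0)"
      using hom[OF t0] BY by (meson continuous_on_subset homeomorphism_def)
    then have "compact (F t0 ` B)" using cB compact_continuous_image by blast
    moreover have "y0 \<notin> F t0 ` B"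
    proof
      assume "y0 \<in> F t0 ` B"
      then obtain x where "x \<in> B" "y0 = F t0 x" by auto
      then have "x = x0" using FG[OF t0] BY by (metis subsetD x0_def)
      then show False using \<open>x \<in> B\<close> uv by (auto simp: B_def)
    qed
    ultimately show ?thesis
      using that separate_point_closed[of "F t0 ` B" y0] compact_imp_closed by (metis imageI)
  qed
  have "uniformly_continuous_on (T \<times> B) (\<lambda>z. F (fst z) (snd z))"
    using cont BY T cB by (intro compact_uniformly_continuous) (auto intro: continuous_on_subset compact_Times)
  then obtain d where d: "d > 0"
    "\<And>z z'. z \<in> T \<times> B \<Longrightarrow> z' \<in> T \<times> B \<Longrightarrow> dist z' z < d \<Longrightarrow>
       dist (F (fst z') (snd z')) (F (fst z) (snd z)) < e/2"
    using e unfolding uniformly_continuous_on_def by (metis half_gt_zero)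
  \<comment> \<open>For \<open>t\<close> near \<open>t0\<close> the map \<open>F t\<close> differs
    from \<open>F t0\<close> by less than \<open>e/2\<close> on \<open>B\<close>. Within the radius
    \<open>e/2\<close> around \<open>y0\<close> there is therefore no point of the image of
    \<open>B\<close> under \<open>F t\<close>.\<close>
  obtain u2 v2 where uv2: "openin (top_of_set Y) u2" "connected v2" "y0 \<in> u2" "u2 \<subseteq> v2" "v2 \<subseteq> Y \<inter> ball y0 (e/2)"
    using lcn y0 e unfolding locally_def
    by (metis (no_types, lifting) Int_iff centre_in_ball half_gt_zero open_ball openin_open_Int)
  obtain O2 where O2: "open O2" "u2 = Y \<inter> O2" using uv2 by (auto simp: openin_open)
  have "continuous_on T (\<lambda>t. F t x0)"
    by (rule joint_compose[OF cont]) (use x0 in \<open>auto intro!: continuous_intros\<close>)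
  then obtain A where A: "open A" "t0 \<in> A" "\<And>t. t \<in> T \<Longrightarrow> t \<in> A \<Longrightarrow> F t x0 \<in> O2"
    unfolding continuous_on_topological using t0 x0 O2 uv2 by (metis Int_iff)
  show "\<exists>A. open A \<and> z \<in> A \<and> (\<forall>y\<in>T \<times> Y. y \<in> A \<longrightarrow> G (fst y) (snd y) \<in> W)"
  proof (intro exI[of _ "(A \<inter> ball t0 d) \<times> O2"] conjI ballI impI)
    show "open ((A \<inter> ball t0 d) \<times> O2)" using A O2 by (intro open_Times) auto
    show "z \<in> (A \<inter> ball t0 d) \<times> O2" using z0 A d uv2 O2 by auto
    fix z' assume z': "z' \<in> T \<times> Y" "z' \<in> (A \<inter> ball t0 d) \<times> O2"
    then obtain t y where ty: "z' = (t, y)" "t \<in> T" "y \<in> Y" "t \<in> A" "dist t0 t < d" "y \<in> O2" by auto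
    have v2Y: "v2 \<subseteq> Y" using uv2 by auto
    have "continuous_on v2 (G t)"
      using hom[OF \<open>t \<in> T\<close>] v2Y by (meson continuous_on_subset homeomorphism_def)
    then have con: "connected (G t ` v2)" using uv2 connected_continuous_image by blast
    have "F t x0 \<in> v2" using A ty O2 FG x0 uv2(4) by auto
    then have x0v: "x0 \<in> G t ` v2" using FG ty x0 by (metis imageI)
    have dis: "G t ` v2 \<inter> B = {}"
    proof (rule ccontr)
      assume "G t ` v2 \<inter> B \<noteq> {}"
      then obtain y' where y': "y' \<in> v2" "G t y' \<in> B" by auto
      have eq: "F t (G t y') = y'" using FG ty y' v2Y by auto
      have "dist (F t (G t y')) (F t0 (G t y')) < e/2"
        using d(2)[of "(t0, G t y')" "(t, G t y')"] ty t0 y' by (simp add: dist_Pair_Pair dist_commute)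
      moreover have "dist y0 y' < e/2" using y' uv2(5) by auto
      moreover have "dist y0 (F t0 (G t y')) \<le> dist y0 y' + dist y' (F t0 (G t y'))"
        by (rule dist_triangle)
      ultimately show False using e(2)[OF y'(2)] eq by simp
    qed
    have GY: "G t ` v2 \<subseteq> Y" using FG ty v2Y by auto
    have "G t ` v2 \<subseteq> u"
    proof (rule ccontr)
      assume "\<not> G t ` v2 \<subseteq> u"
      obtain U1 where U1: "open U1" "u = Y \<inter> U1" using uv by (auto simp: openin_open)
      have "open (- v)" using uv by (simp add: compact_imp_closed open_Compl)
      moreover have "G t ` v2 \<subseteq> U1 \<union> - v"
        using dis U1 GY unfolding B_def by blast
      moreover have "U1 \<inter> - v \<inter> G t ` v2 = {}" using U1 uv GY by auto
      moreover have "U1 \<inter> G t ` v2 \<noteq> {}" using U1 uv x0v by auto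
      moreover have "- v \<inter> G t ` v2 \<noteq> {}"
        using \<open>\<not> G t ` v2 \<subseteq> u\<close> dis by (auto simp: B_def)
      ultimately show False using con U1 unfolding connected_def by (metis Int_assoc)
    qed
    moreover have "y \<in> v2" using ty O2 uv2 by auto
    ultimately show "G (fst z') (snd z') \<in> W" using ty uv by auto
  qed
qed

lemma ambientI:
  fixes Y :: "'a::heine_borel set"
  assumes "locally compact Y" "locally connected Y"
    and "continuous_on ({0..1} \<times> Y) (\<lambda>z. F (fst z) (snd z))"
    and "\<And>t. t \<in> {0..1} \<Longrightarrow> homeomorphism Y Y (F t) (G t)"
  shows "ambient Y F G"
  using family_inverse_continuous[OF assms(1,2) _ assms(3,4)] assms(3,4)
  unfolding ambient_def homeomorphism_def by fastforce

subsection \<open>The compact-open topology\<close>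

text \<open>By the tube lemma applied to \<open>{t} \<times> K\<close>, the times at which a compact
  \<open>K\<close> is carried into an open set form an open set. This is one half of the exponential
  law.\<close>

lemma continuous_map_compact_open:
  assumes "\<And>t. t \<in> T \<Longrightarrow> F t \<in> extensional Y"
    and "continuous_on (T \<times> Y) (\<lambda>z. F (fst z) (snd z))"
    and "\<And>t x. t \<in> T \<Longrightarrow> x \<in> Y \<Longrightarrow> F t x \<in> Y"
  shows "continuous_map (top_of_set T) (compact_open (top_of_set Y) (top_of_set Y)) F"
  unfolding compact_open_def continuous_on_generated_topo_iff
proof (intro conjI allI impI)
  have c: "continuous_on Y (F t)" if "t \<in> T" for t
    by (rule joint_compose[OF assms(2)]) (use that in \<open>auto intro!: continuous_intros\<close>)
  fix U assume "U \<in> {{f \<in> extensional (topspace (top_of_set Y)). continuous_map (top_of_set Y) (top_of_set Y) f \<and> f ` K \<subseteq> U} | K U.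
        compactin (top_of_set Y) K \<and> openin (top_of_set Y) U}"
  then obtain K V where U: "U = {f \<in> extensional Y. continuous_map (top_of_set Y) (top_of_set Y) f \<and> f ` K \<subseteq> V}"
    and K: "compact K" "K \<subseteq> Y" and V: "openin (top_of_set Y) V"
    by (auto simp: compactin_subtopology)
  have eq: "F -` U \<inter> topspace (top_of_set T) = {t \<in> T. \<forall>x\<in>K. F t x \<in> V}"
    using c assms(1,3) by (auto simp: U)
  obtain W where W: "open W" "V = Y \<inter> W" using V by (auto simp: openin_open)
  have "openin (top_of_set (T \<times> Y)) ((T \<times> Y) \<inter> (\<lambda>z. F (fst z) (snd z)) -` W)"
    using assms(2) W continuous_openin_preimage_gen by blast
  then obtain O1 where O1: "open O1" "(T \<times> Y) \<inter> (\<lambda>z. F (fst z) (snd z)) -` W = (T \<times> Y) \<inter> O1"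
    by (auto simp: openin_open)
  have "openin (top_of_set T) {t \<in> T. \<forall>x\<in>K. F t x \<in> V}"
    unfolding openin_subopen[of _ "{t \<in> T. \<forall>x\<in>K. F t x \<in> V}"]
  proof (intro ballI)
    fix t assume t: "t \<in> {t \<in> T. \<forall>x\<in>K. F t x \<in> V}"
    have "{t} \<times> K \<subseteq> O1"
    proof
      fix z assume "z \<in> {t} \<times> K"
      then have "z \<in> (T \<times> Y) \<inter> (\<lambda>z. F (fst z) (snd z)) -` W"
        using t K W by auto
      then show "z \<in> O1" using O1 by blast
    qed
    then obtain X0 where X0: "open X0" "t \<in> X0" "X0 \<times> K \<subseteq> O1"
      using K O1 by (metis Elementary_Topology.tube_lemma)
    have "F s x \<in> V" if "s \<in> T" "s \<in> X0" "x \<in> K" for s x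
    proof -
      have "(s, x) \<in> (T \<times> Y) \<inter> O1" using that X0 K by auto
      then have "F s x \<in> W" using O1(2) by fastforce
      then show ?thesis using assms(3) that K W by auto
    qed
    then show "\<exists>A. openin (top_of_set T) A \<and> t \<in> A \<and> A \<subseteq> {t \<in> T. \<forall>x\<in>K. F t x \<in> V}"
      using X0 t by (intro exI[of _ "T \<inter> X0"]) (auto simp: openin_open_Int)
  qed
  then show "openin (top_of_set T) (F -` U \<inter> topspace (top_of_set T))" using eq by simp
next
  have c: "continuous_on Y (F t)" if "t \<in> T" for t
    by (rule joint_compose[OF assms(2)]) (use that in \<open>auto intro!: continuous_intros\<close>)
  \<comment> \<open>The space generated by the subbasis is the union of its members; the member with
    \<open>K = {}\<close> and \<open>U = Y\<close> already consists of all continuous extensional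
    self-maps.\<close>
  let ?W = "{f \<in> extensional (topspace (top_of_set Y)). continuous_map (top_of_set Y) (top_of_set Y) f \<and> f ` {} \<subseteq> Y}"
  have "?W \<in> {{f \<in> extensional (topspace (top_of_set Y)). continuous_map (top_of_set Y) (top_of_set Y) f \<and> f ` K \<subseteq> U} | K U.
        compactin (top_of_set Y) K \<and> openin (top_of_set Y) U}"
    by (rule CollectI, rule exI[of _ "{}"], rule exI[of _ Y]) auto
  moreover have "F ` topspace (top_of_set T) \<subseteq> ?W"
    using c assms by auto
  ultimately show "F ` topspace (top_of_set T) \<subseteq>
    \<Union> {{f \<in> extensional (topspace (top_of_set Y)). continuous_map (top_of_set Y) (top_of_set Y) f \<and> f ` K \<subseteq> U} | K U.
        compactin (top_of_set Y) K \<and> openin (top_of_set Y) U}"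
    by blast
qed

text \<open>The other half of the exponential law. Local compactness gives a compact neighbourhood
  \<open>v\<close> of \<open>x0\<close> that \<open>F t0\<close> maps into the target, and the maps
  with this property form a subbasic open set.\<close>

lemma compact_open_joint_continuous:
  fixes Y :: "'a::t2_space set"
  assumes lc: "locally compact Y"
    and F: "continuous_map (top_of_set T) (compact_open (top_of_set Y) (top_of_set Y)) F"
  shows "continuous_on (T \<times> Y) (\<lambda>z. F (fst z) (snd z))"
  unfolding continuous_on_topological
proof (intro ballI allI impI)
  let ?\<U> = "{{f \<in> extensional (topspace (top_of_set Y)). continuous_map (top_of_set Y) (top_of_set Y) f \<and> f ` K \<subseteq> U} | K U.
        compactin (top_of_set Y) K \<and> openin (top_of_set Y) U}"
  have F1: "\<And>U. U \<in> ?\<U> \<Longrightarrow> openin (top_of_set T) (F -` U \<inter> T)" and F2: "F ` T \<subseteq> \<Union>?\<U>"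
    using F unfolding compact_open_def continuous_on_generated_topo_iff by auto
  fix z B assume z: "z \<in> T \<times> Y" and B: "open B" "F (fst z) (snd z) \<in> B"
  obtain t0 x0 where z0: "z = (t0, x0)" by fastforce
  have cF: "continuous_map (top_of_set Y) (top_of_set Y) (F t)" "F t \<in> extensional Y" if "t \<in> T" for t
    using F2 that by fastforce+
  have "openin (top_of_set Y) (Y \<inter> F t0 -` B)"
    using cF[of t0] z z0 B continuous_openin_preimage_gen by auto
  then obtain u v where uv: "openin (top_of_set Y) u" "compact v" "x0 \<in> u" "u \<subseteq> v" "v \<subseteq> Y \<inter> F t0 -` B"
    using lc z z0 B unfolding locally_def by (metis (no_types, lifting) Int_iff fst_conv mem_Sigma_iff snd_conv vimage_eq)
  define U where "U = {f \<in> extensional Y. continuous_map (top_of_set Y) (top_of_set Y) f \<and> f ` v \<subseteq> Y \<inter> B}"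
  have "compactin (top_of_set Y) v" "openin (top_of_set Y) (Y \<inter> B)"
    using uv B by (auto simp: compactin_subtopology openin_open_Int)
  then have "U \<in> ?\<U>" unfolding U_def topspace_euclidean_subtopology by blast
  then have "openin (top_of_set T) (F -` U \<inter> T)" by (rule F1)
  then obtain O1 where O1: "open O1" "F -` U \<inter> T = T \<inter> O1" by (auto simp: openin_open)
  obtain O2 where O2: "open O2" "u = Y \<inter> O2" using uv by (auto simp: openin_open)
  have "F t0 \<in> U" using cF[of t0] uv z z0 by (auto simp: U_def)
  then have t0: "t0 \<in> O1" using O1(2) z z0 by blast
  show "\<exists>A. open A \<and> z \<in> A \<and> (\<forall>y\<in>T \<times> Y. y \<in> A \<longrightarrow> F (fst y) (snd y) \<in> B)"
  proof (intro exI[of _ "O1 \<times> O2"] conjI ballI impI)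
    show "open (O1 \<times> O2)" using O1 O2 by (simp add: open_Times)
    show "z \<in> O1 \<times> O2" using t0 uv O2 z0 by auto
    fix y assume y: "y \<in> T \<times> Y" "y \<in> O1 \<times> O2"
    then have "F (fst y) \<in> U" using O1(2) by (metis IntE IntI SigmaE2 prod.collapse vimageD)
    moreover have "snd y \<in> v" using y O2 uv by auto
    ultimately show "F (fst y) (snd y) \<in> B" by (auto simp: U_def)
  qed
qed

text \<open>Together with \<open>pathin_homeo_spaceI\<close> this trades paths in a homeomorphism
  group for jointly continuous families, and the compact-open topology is not unfolded
  again.\<close>

lemma pathin_homeo_spaceD:
  assumes lc: "locally compact Y" and lcn: "locally connected Y" and A: "A \<subseteq> homeos Y"
    and p: "pathin (homeo_space Y A) F"
  shows "\<exists>G. ambient Y F G" "\<And>t. t \<in> {0..1} \<Longrightarrow> F t \<in> A"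
proof -
  have FA: "F t \<in> A" if "t \<in> {0..1}" for t
    using p that by (simp add: pathin_subtopology)
  then show "\<And>t. t \<in> {0..1} \<Longrightarrow> F t \<in> A" .
  have c: "continuous_on ({0..1} \<times> Y) (\<lambda>z. F (fst z) (snd z))"
    using p by (intro compact_open_joint_continuous[OF lc]) (simp add: pathin_def continuous_map_in_subtopology)
  have "\<forall>t\<in>{0..1}. \<exists>k. homeomorphism Y Y (F t) k"
    using FA A unfolding homeos_def by fast
  then obtain G where G: "\<And>t. t \<in> {0..1} \<Longrightarrow> homeomorphism Y Y (F t) (G t)"
    by metis
  then show "\<exists>G. ambient Y F G" using ambientI[OF lc lcn c] by blast
qed

lemma pathin_homeo_spaceI:
  assumes F: "ambient Y F G" and A: "\<And>t. t \<in> {0..1} \<Longrightarrow> restrict (F t) Y \<in> A"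
  shows "pathin (homeo_space Y A) (\<lambda>t. restrict (F t) Y)"
  unfolding pathin_def continuous_map_in_subtopology
proof (intro conjI)
  have "continuous_on ({0..1} \<times> Y) (\<lambda>z. restrict (F (fst z)) Y (snd z))"
    by (rule continuous_on_eq[OF ambient_cont[OF F]]) auto
  then show "continuous_map (top_of_set {0..1}) (compact_open (top_of_set Y) (top_of_set Y)) (\<lambda>t. restrict (F t) Y)"
    by (rule continuous_map_compact_open[rotated]) (use ambient_in[OF F] in \<open>auto simp: extensional_def\<close>)
qed (use A in auto)

lemma circlepath_in_cball: "0 \<le> r \<Longrightarrow> circlepath z r t \<in> cball z r"
  and circlepath_neq_centre: "r \<noteq> 0 \<Longrightarrow> circlepath z r t \<noteq> z"
  by (auto simp: circlepath dist_norm norm_mult)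

subsection \<open>Orientation\<close>

text \<open>The circles in the definition lie in \<open>Y\<close>, so only values on
  \<open>Y\<close> enter.\<close>

lemma orientation_preserving_cong:
  assumes "\<And>x. x \<in> Y \<Longrightarrow> f x = g x"
  shows "orientation_preserving Y f \<longleftrightarrow> orientation_preserving Y g"
proof -
  have "f \<circ> circlepath z r = g \<circ> circlepath z r \<and> f z = g z" if "0 < r" "cball z r \<subseteq> Y" for z r
  proof -
    have "circlepath z r t \<in> Y" for t
      using that circlepath_in_cball[of r z t] by auto
    moreover have "z \<in> Y" using that by auto
    ultimately show ?thesis using assms by (simp add: fun_eq_iff)
  qed
  then show ?thesis unfolding orientation_preserving_def by metis
qed

lemma orientation_preserving_id: "orientation_preserving Y (\<lambda>x. x)"
  unfolding orientation_preserving_def by (auto simp: o_def winding_number_circlepath_centre)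

text \<open>Homotopy invariance of the winding number: in \<open>h\<close> the moving centre is
  subtracted from the moving circle, and \<open>h\<close> avoids 0 because each \<open>F s\<close>
  is injective.\<close>

lemma orientation_preserving_ambient:
  assumes F: "ambient Y F G" and "orientation_preserving Y (F 0)" and t: "t \<in> {0..1}"
  shows "orientation_preserving Y (F t)"
  unfolding orientation_preserving_def
proof (intro allI impI)
  fix z r assume zr: "0 < r \<and> cball z r \<subseteq> Y"
  have cY: "circlepath z r s \<in> Y" "circlepath z r s \<noteq> z" for s
    using zr circlepath_in_cball[of r z s] circlepath_neq_centre[of r z s] by auto
  have zY: "z \<in> Y" using zr by auto
  define h where "h = (\<lambda>u. F (fst u) (circlepath z r (snd u)) - F (fst u) z)"
  have ch: "continuous_on ({0..1} \<times> {0..1}) h"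
    unfolding h_def
  proof (rule continuous_on_diff)
    have "continuous_on ({0..1} \<times> {0..1}) (\<lambda>u::real \<times> real. circlepath z r (snd u))"
      unfolding circlepath by (intro continuous_intros)
    then show "continuous_on ({0..1} \<times> {0..1}) (\<lambda>u. F (fst u) (circlepath z r (snd u)))"
      by (rule ambient_compose[OF F, rotated]) (use cY in \<open>auto intro!: continuous_intros\<close>)
    show "continuous_on ({0..1} \<times> {0..1}) (\<lambda>u. F (fst u) z)"
      by (rule ambient_compose[OF F]) (use zY in \<open>auto intro!: continuous_intros\<close>)
  qed
  have hn: "h (s, u) \<noteq> 0" if "s \<in> {0..1}" for s u
    using ambient_inv[OF F, of s z] ambient_inv[OF F, of s "circlepath z r u"] that cY[of u] zY
    by (auto simp: h_def)
  have "homotopic_loops (-{0}) (\<lambda>s. h (0, s)) (\<lambda>s. h (t, s))"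
    unfolding homotopic_loops
  proof (intro exI[of _ "\<lambda>u. h (t * fst u, snd u)"] conjI)
    show "continuous_on ({0..1} \<times> {0..1}) (\<lambda>u. h (t * fst u, snd u))"
      by (rule continuous_on_compose2[OF ch])
        (use t in \<open>auto intro!: continuous_intros mult_le_one\<close>)
    show "(\<lambda>u. h (t * fst u, snd u)) \<in> {0..1} \<times> {0..1} \<rightarrow> - {0}"
      using hn t by (auto simp: mult_le_one)
    show "\<forall>s\<in>{0..1}. pathfinish ((\<lambda>u. h (t * fst u, snd u)) \<circ> Pair s) =
      pathstart ((\<lambda>u. h (t * fst u, snd u)) \<circ> Pair s)"
      by (auto simp: pathfinish_def pathstart_def h_def circlepath)
  qed auto
  then have "winding_number (\<lambda>s. h (0, s)) 0 = winding_number (\<lambda>s. h (t, s)) 0"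
    by (rule winding_number_homotopic_loops)
  moreover have "winding_number (F s \<circ> circlepath z r) (F s z) = winding_number (\<lambda>u. h (s, u)) 0" for s
    by (subst winding_number_offset) (simp add: h_def o_def)
  ultimately show "winding_number (F t \<circ> circlepath z r) (F t z) = 1"
    using assms(2) zr unfolding orientation_preserving_def by metis
qed

lemma restrict_ambient_homeos:
  assumes F: "ambient Y F G" and "orientation_preserving Y (F 0)" and t: "t \<in> {0..1}"
  shows "restrict (F t) Y \<in> homeos Y"
proof -
  have "homeomorphism Y Y (restrict (F t) Y) (G t)"
    using ambient_homeomorphism[OF F t] by (rule homeomorphism_cong) auto
  moreover have "orientation_preserving Y (restrict (F t) Y)"
    using orientation_preserving_ambient[OF assms] orientation_preserving_cong[of Y "restrict (F t) Y" "F t"] by simp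
  ultimately show ?thesis by (auto simp: homeos_def)
qed

section \<open>Mapping class groups\<close>

text \<open>Closure under composition and inversion is required only within \<open>homeos Y\<close>, because
  preservation of orientation is only controlled along isotopies that start at the identity.\<close>

locale homeo_class =
  fixes Y :: "complex set" and A :: "(complex \<Rightarrow> complex) set"
  assumes loc_compact: "locally compact Y" and loc_connected: "locally connected Y"
    and sub_homeos: "A \<subseteq> homeos Y" and id_mem: "(\<lambda>x\<in>Y. x) \<in> A"
    and comp_mem: "\<And>f g. f \<in> A \<Longrightarrow> g \<in> A \<Longrightarrow> (\<lambda>x\<in>Y. f (g x)) \<in> homeos Y \<Longrightarrow> (\<lambda>x\<in>Y. f (g x)) \<in> A"
    and inv_mem: "\<And>f g. f \<in> A \<Longrightarrow> g \<in> homeos Y \<Longrightarrow> homeomorphism Y Y f g \<Longrightarrow> g \<in> A"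
begin

abbreviation isotopic :: "(complex \<Rightarrow> complex) \<Rightarrow> (complex \<Rightarrow> complex) \<Rightarrow> bool" where
  "isotopic \<equiv> path_component_of (homeo_space Y A)"

lemma restrict_mem: "f \<in> A \<Longrightarrow> restrict f Y = f"
  using sub_homeos extensional_restrict[of f Y] by (auto simp: homeos_def)

lemma isotopicI:
  assumes "ambient Y F G" "\<And>t. t \<in> {0..1} \<Longrightarrow> restrict (F t) Y \<in> A"
  shows "isotopic (restrict (F 0) Y) (restrict (F 1) Y)"
  unfolding path_component_of_def using pathin_homeo_spaceI[OF assms] by blast

lemma isotopicE:
  assumes "isotopic f g"
  obtains F G where "ambient Y F G" "\<forall>t\<in>{0..1}. F t \<in> A" "F 0 = f" "F 1 = g"
proof -
  obtain F where F: "pathin (homeo_space Y A) F" "F 0 = f" "F 1 = g"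
    using assms unfolding path_component_of_def by blast
  then show ?thesis using that pathin_homeo_spaceD[OF loc_compact loc_connected sub_homeos F(1)] by blast
qed

lemma mem_homeomorphism: "f \<in> A \<Longrightarrow> \<exists>g. homeomorphism Y Y f g"
  using sub_homeos by (auto simp: homeos_def)

lemma isotopic_refl: "f \<in> A \<Longrightarrow> isotopic f f"
proof -
  assume f: "f \<in> A"
  then obtain g where "homeomorphism Y Y f g" using mem_homeomorphism by blast
  from isotopicI[OF ambient_const[OF this]] show ?thesis using restrict_mem[OF f] f by simp
qed

text \<open>The constant path at an element of \<open>A\<close> shows that this element is a point
  of the space.\<close>

lemma topspace_homeo_space: "topspace (homeo_space Y A) = A"
proof
  show "A \<subseteq> topspace (homeo_space Y A)"
    using path_component_in_topspace[OF isotopic_refl] by (intro subsetI) simp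
qed (simp add: topspace_subtopology)

lemma mapping_class_eq_iff: "f \<in> A \<Longrightarrow> mapping_class Y A f = mapping_class Y A g \<longleftrightarrow> isotopic f g"
proof -
  assume f: "f \<in> A"
  show "mapping_class Y A f = mapping_class Y A g \<longleftrightarrow> isotopic f g"
  proof
    assume "mapping_class Y A f = mapping_class Y A g"
    moreover have "f \<in> mapping_class Y A f" using isotopic_refl[OF f] by (simp add: mapping_class_def)
    ultimately have "f \<in> mapping_class Y A g" by simp
    then show "isotopic f g" by (simp add: mapping_class_def path_component_of_sym)
  next
    assume fg: "isotopic f g"
    have "isotopic f h \<longleftrightarrow> isotopic g h" for h
      using path_component_of_trans[OF fg, of h] path_component_of_trans[OF path_component_of_sym[OF fg], of h] by blast
    then have "isotopic f = isotopic g" by (rule ext)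
    then show "mapping_class Y A f = mapping_class Y A g" unfolding mapping_class_def by simp
  qed
qed

lemma mem_mapping_class: "g \<in> mapping_class Y A f \<longleftrightarrow> isotopic f g"
  by (simp add: mapping_class_def)

lemma isotopic_mem: "isotopic f g \<Longrightarrow> f \<in> A \<and> g \<in> A"
  using path_component_in_topspace topspace_homeo_space by metis

end

text \<open>The maps \<open>F t \<circ> g\<close> form an isotopy that starts at \<open>g\<close>,
  and orientation is constant along it.\<close>

lemma comp_id_component_homeos:
  assumes F: "ambient Y F G" "\<And>x. x \<in> Y \<Longrightarrow> F 0 x = x" and g: "g \<in> homeos Y" and t: "t \<in> {0..1}"
  shows "(\<lambda>x\<in>Y. F t (g x)) \<in> homeos Y"
proof -
  obtain k where k: "homeomorphism Y Y g k" and o: "orientation_preserving Y g"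
    using g by (auto simp: homeos_def)
  have gY: "x \<in> Y \<Longrightarrow> g x \<in> Y" for x using k by (auto simp: homeomorphism_def)
  have "orientation_preserving Y (\<lambda>x. F 0 (g x)) = orientation_preserving Y g"
    by (rule orientation_preserving_cong) (simp add: F gY)
  then show ?thesis
    using restrict_ambient_homeos[OF ambient_comp[OF F(1) ambient_const[OF k]] _ t] o by simp
qed

lemma ambient_id_homeos:
  assumes F: "ambient Y F G" "\<And>x. x \<in> Y \<Longrightarrow> F 0 x = x" and t: "t \<in> {0..1}"
  shows "restrict (F t) Y \<in> homeos Y"
  using restrict_ambient_homeos[OF F(1) _ t] orientation_preserving_cong[of Y "F 0" "\<lambda>x. x"]
    orientation_preserving_id F(2) by blast

lemma id_homeos: "(\<lambda>x\<in>Y. x) \<in> homeos Y"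
proof -
  have "homeomorphism Y Y (\<lambda>x. x) (\<lambda>x. x)" by (simp add: homeomorphism_ident)
  from ambient_id_homeos[OF ambient_const[OF this], of 0] show ?thesis by simp
qed

section \<open>Classes that become trivial when marked points are forgotten\<close>

locale homeo_pair = A: homeo_class Y A + B: homeo_class Y B for Y A B +
  assumes sub: "A \<subseteq> B"
begin

text \<open>The kernel of the forgetful map on the level of homeomorphisms. Composites of its
  elements with orientation preserving homeomorphisms stay in \<open>homeos Y\<close>, which makes
  the closure conditions on \<open>A\<close> and \<open>B\<close> applicable.\<close>

definition null_isotopic :: "(complex \<Rightarrow> complex) set" where
  "null_isotopic = {f \<in> A. B.isotopic (\<lambda>x\<in>Y. x) f}"

lemma isotopic_mono: "A.isotopic f g \<Longrightarrow> B.isotopic f g"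
proof -
  assume "A.isotopic f g"
  then obtain F G where F: "ambient Y F G" "\<forall>t\<in>{0..1}. F t \<in> A" "F 0 = f" "F 1 = g"
    by (rule A.isotopicE)
  have "B.isotopic (restrict (F 0) Y) (restrict (F 1) Y)"
    by (rule B.isotopicI[OF F(1)]) (use F sub A.restrict_mem in auto)
  moreover have "F 0 \<in> A" "F 1 \<in> A" using F(2) by auto
  ultimately show ?thesis using F(3,4) A.restrict_mem by metis
qed

lemma null_isotopicE:
  assumes "f \<in> null_isotopic"
  obtains F G where "ambient Y F G" "\<forall>t\<in>{0..1}. F t \<in> B" "F 0 = (\<lambda>x\<in>Y. x)" "F 1 = f"
  using assms unfolding null_isotopic_def by (auto elim: B.isotopicE)

lemma null_isotopic_id: "(\<lambda>x\<in>Y. x) \<in> null_isotopic"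
  using A.id_mem B.id_mem B.isotopic_refl by (simp add: null_isotopic_def)

lemma null_isotopic_sub: "f \<in> null_isotopic \<Longrightarrow> f \<in> A"
  by (simp add: null_isotopic_def)

lemma null_isotopic_comp_homeos:
  assumes "f \<in> null_isotopic" "g \<in> homeos Y"
  shows "(\<lambda>x\<in>Y. f (g x)) \<in> homeos Y"
proof -
  obtain F G where F: "ambient Y F G" "F 0 = (\<lambda>x\<in>Y. x)" "F 1 = f"
    using assms(1) by (rule null_isotopicE)
  show ?thesis using comp_id_component_homeos[OF F(1) _ assms(2), of 1] F by simp
qed

lemma null_isotopic_comp:
  assumes f: "f \<in> null_isotopic" and g: "g \<in> null_isotopic"
  shows "(\<lambda>x\<in>Y. f (g x)) \<in> null_isotopic"
proof -
  obtain F F' where F: "ambient Y F F'" "\<forall>t\<in>{0..1}. F t \<in> B" "F 0 = (\<lambda>x\<in>Y. x)" "F 1 = f"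
    using f by (rule null_isotopicE)
  obtain G G' where G: "ambient Y G G'" "\<forall>t\<in>{0..1}. G t \<in> B" "G 0 = (\<lambda>x\<in>Y. x)" "G 1 = g"
    using g by (rule null_isotopicE)
  have "B.isotopic (restrict (\<lambda>x. F 0 (G 0 x)) Y) (restrict (\<lambda>x. F 1 (G 1 x)) Y)"
  proof (rule B.isotopicI[OF ambient_comp[OF F(1) G(1)]])
    fix t :: real assume t: "t \<in> {0..1}"
    have "(\<lambda>x\<in>Y. F t (G t x)) \<in> homeos Y"
      using comp_id_component_homeos[OF F(1) _ _ t, of "G t"] F(3) G(2)[rule_format, OF t] B.sub_homeos by auto
    then show "restrict (\<lambda>x. F t (G t x)) Y \<in> B" using B.comp_mem F(2) G(2) t by blast
  qed
  moreover have "restrict (\<lambda>x. F 0 (G 0 x)) Y = (\<lambda>x\<in>Y. x)"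
    using F(3) G(3) by (auto simp: fun_eq_iff)
  moreover have "(\<lambda>x\<in>Y. f (g x)) \<in> homeos Y"
    using null_isotopic_comp_homeos[OF f] null_isotopic_sub[OF g] A.sub_homeos by auto
  then have "(\<lambda>x\<in>Y. f (g x)) \<in> A" using A.comp_mem f g null_isotopic_sub by blast
  ultimately show ?thesis using F G by (simp add: null_isotopic_def)
qed

lemma null_isotopic_inv:
  assumes f: "f \<in> null_isotopic"
  obtains h where "h \<in> null_isotopic" "homeomorphism Y Y f h"
proof -
  obtain F G where F: "ambient Y F G" "\<forall>t\<in>{0..1}. F t \<in> B" "F 0 = (\<lambda>x\<in>Y. x)" "F 1 = f"
    using f by (rule null_isotopicE)
  define H where "H = (\<lambda>t. restrict (G t) Y)"
  have amb: "ambient Y H F"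
    by (rule ambient_cong[OF ambient_sym[OF F(1)]]) (auto simp: H_def)
  have H0: "H 0 x = x" if "x \<in> Y" for x
    using ambient_inv[OF F(1), of 0 x] F(3) that by (simp add: H_def)
  have hom: "homeomorphism Y Y (F t) (H t)" if "t \<in> {0..1}" for t
    using ambient_homeomorphism[OF ambient_sym[OF amb] that] .
  have Hh: "H t \<in> homeos Y" if "t \<in> {0..1}" for t
    using ambient_id_homeos[OF amb H0 that] unfolding H_def restrict_restrict by simp
  have HB: "H t \<in> B" if "t \<in> {0..1}" for t
    using B.inv_mem[OF F(2)[rule_format, OF that] Hh[OF that] hom[OF that]] .
  have "B.isotopic (restrict (H 0) Y) (restrict (H 1) Y)"
    using B.isotopicI[OF amb] HB by (simp add: H_def)
  moreover have "restrict (H 0) Y = (\<lambda>x\<in>Y. x)" using H0 by (auto simp: fun_eq_iff)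
  moreover have "H 1 \<in> A" using A.inv_mem[OF null_isotopic_sub[OF f] Hh[of 1]] hom[of 1] F by simp
  ultimately have "H 1 \<in> null_isotopic" by (simp add: null_isotopic_def H_def)
  then show ?thesis using that hom[of 1] F(4) by simp
qed

lemma null_isotopic_isotopic: "f \<in> null_isotopic \<Longrightarrow> A.isotopic f g \<Longrightarrow> g \<in> null_isotopic"
  using isotopic_mono[of f g] A.isotopic_mem[of f g] path_component_of_trans
  by (fastforce simp: null_isotopic_def)

lemma isotopic_comp_left:
  assumes f: "f \<in> null_isotopic" and g: "A.isotopic g g'"
  shows "A.isotopic (\<lambda>x\<in>Y. f (g x)) (\<lambda>x\<in>Y. f (g' x))"
proof -
  obtain G G' where G: "ambient Y G G'" "\<forall>t\<in>{0..1}. G t \<in> A" "G 0 = g" "G 1 = g'"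
    using g by (rule A.isotopicE)
  obtain h where "homeomorphism Y Y f h" using f by (rule null_isotopic_inv)
  note amb = ambient_comp[OF ambient_const[OF this] G(1)]
  have "A.isotopic (restrict (\<lambda>x. f (G 0 x)) Y) (restrict (\<lambda>x. f (G 1 x)) Y)"
  proof (rule A.isotopicI[OF amb])
    fix t :: real assume t: "t \<in> {0..1}"
    show "restrict (\<lambda>x. f (G t x)) Y \<in> A"
      using A.comp_mem[OF null_isotopic_sub[OF f] G(2)[rule_format, OF t] null_isotopic_comp_homeos[OF f]] G(2)[rule_format, OF t] A.sub_homeos
      by auto
  qed
  then show ?thesis using G by simp
qed

text \<open>The isotopy does not start at the identity, so the orientation of the composites is
  taken from time 0, where the left factor is null-isotopic.\<close>

lemma isotopic_comp_right:
  assumes f: "f \<in> null_isotopic" "A.isotopic f f'" and g: "g \<in> A"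
  shows "A.isotopic (\<lambda>x\<in>Y. f (g x)) (\<lambda>x\<in>Y. f' (g x))"
proof -
  obtain F G where F: "ambient Y F G" "\<forall>t\<in>{0..1}. F t \<in> A" "F 0 = f" "F 1 = f'"
    using f(2) by (rule A.isotopicE)
  obtain k where k: "homeomorphism Y Y g k" using A.mem_homeomorphism[OF g] by blast
  have fY: "g x \<in> Y" if "x \<in> Y" for x using k that by (auto simp: homeomorphism_def)
  have o: "orientation_preserving Y (\<lambda>x. F 0 (g x))"
  proof -
    have "(\<lambda>x\<in>Y. f (g x)) \<in> homeos Y"
      using null_isotopic_comp_homeos[OF f(1), of g] g A.sub_homeos by auto
    then have "orientation_preserving Y (\<lambda>x\<in>Y. f (g x))" by (simp add: homeos_def)
    then show ?thesis using F(3) orientation_preserving_cong[of Y "\<lambda>x\<in>Y. f (g x)" "\<lambda>x. f (g x)"] by simp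
  qed
  note amb = ambient_comp[OF F(1) ambient_const[OF k]]
  have "A.isotopic (restrict (\<lambda>x. F 0 (g x)) Y) (restrict (\<lambda>x. F 1 (g x)) Y)"
  proof (rule A.isotopicI[OF amb])
    fix t :: real assume t: "t \<in> {0..1}"
    show "restrict (\<lambda>x. F t (g x)) Y \<in> A"
      using A.comp_mem[OF F(2)[rule_format, OF t] g] restrict_ambient_homeos[OF amb o t] by simp
  qed
  then show ?thesis using F by simp
qed

text \<open>Replacing either factor by an isotopic one stays in the class of the composite. The
  product set exhausts that class because composing with \<open>f\<close> on the left can be undone
  by a null-isotopic inverse.\<close>

lemma mapping_class_mult:
  assumes f: "f \<in> null_isotopic" and g: "g \<in> null_isotopic"
  shows "set_mult (BijGroup Y) (mapping_class Y A f) (mapping_class Y A g) = mapping_class Y A (\<lambda>x\<in>Y. f (g x))"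
proof -
  have bij: "k \<in> Bij Y" if "k \<in> A" for k
  proof -
    have "bij_betw k Y Y"
      using A.mem_homeomorphism[OF that] unfolding homeomorphism_def bij_betw_def by (metis inj_onI)
    then show ?thesis using that A.sub_homeos by (auto simp: Bij_def homeos_def)
  qed
  have mult: "k \<otimes>\<^bsub>BijGroup Y\<^esub> l = (\<lambda>x\<in>Y. k (l x))" if "k \<in> A" "l \<in> A" for k l
    using that bij by (simp add: BijGroup_def compose_def)
  have eq: "A.isotopic (\<lambda>x\<in>Y. f (g x)) (\<lambda>x\<in>Y. f' (g' x))" if "A.isotopic f f'" "A.isotopic g g'" for f' g'
  proof -
    have "A.isotopic (\<lambda>x\<in>Y. f (g x)) (\<lambda>x\<in>Y. f' (g x))"
      using isotopic_comp_right[OF f that(1) null_isotopic_sub[OF g]] .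
    also have "A.isotopic \<dots> (\<lambda>x\<in>Y. f' (g' x))"
      using isotopic_comp_left[OF null_isotopic_isotopic[OF f that(1)] that(2)] .
    finally (path_component_of_trans) show ?thesis .
  qed
  \<comment> \<open>The second factor \<open>g'\<close> is \<open>k\<close> preceded by nothing and
    followed by the inverse \<open>h\<close> of \<open>f\<close>, that is,
    \<open>h \<circ> k\<close>.\<close>
  have ex: "\<exists>g'. A.isotopic g g' \<and> k = (\<lambda>x\<in>Y. f (g' x))" if k: "A.isotopic (\<lambda>x\<in>Y. f (g x)) k" for k
  proof -
    obtain h where h: "h \<in> null_isotopic" "homeomorphism Y Y f h" using f by (rule null_isotopic_inv)
    have inv: "h (f x) = x" "f (h x) = x" "h x \<in> Y" "f x \<in> Y" if "x \<in> Y" for x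
      using h(2) that by (auto simp: homeomorphism_def)
    have kA: "k \<in> A" "g \<in> A" using A.isotopic_mem[OF k] null_isotopic_sub[OF g] by auto
    have gY: "g x \<in> Y" "k x \<in> Y" if "x \<in> Y" for x
      using A.mem_homeomorphism kA that by (metis homeomorphism_image1 imageI)+
    have "A.isotopic (\<lambda>x\<in>Y. h ((\<lambda>x\<in>Y. f (g x)) x)) (\<lambda>x\<in>Y. h (k x))"
      by (rule isotopic_comp_left[OF h(1) k])
    moreover have "(\<lambda>x\<in>Y. h ((\<lambda>x\<in>Y. f (g x)) x)) = restrict g Y"
      using inv gY by (auto simp: fun_eq_iff)
    moreover have "k = (\<lambda>x\<in>Y. f ((\<lambda>x\<in>Y. h (k x)) x))"
      using inv gY by (subst A.restrict_mem[OF kA(1), symmetric]) (auto simp: fun_eq_iff)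
    ultimately show ?thesis using A.restrict_mem kA by metis
  qed
  have sub1: "set_mult (BijGroup Y) (mapping_class Y A f) (mapping_class Y A g) \<subseteq> mapping_class Y A (\<lambda>x\<in>Y. f (g x))"
  proof
    fix k assume "k \<in> set_mult (BijGroup Y) (mapping_class Y A f) (mapping_class Y A g)"
    then obtain f' g' where fg: "A.isotopic f f'" "A.isotopic g g'" "k = f' \<otimes>\<^bsub>BijGroup Y\<^esub> g'"
      by (auto simp: set_mult_def A.mem_mapping_class)
    then have "k = (\<lambda>x\<in>Y. f' (g' x))" using mult A.isotopic_mem by blast
    then show "k \<in> mapping_class Y A (\<lambda>x\<in>Y. f (g x))" using eq[OF fg(1,2)] by (simp add: A.mem_mapping_class)
  qed
  have sub2: "mapping_class Y A (\<lambda>x\<in>Y. f (g x)) \<subseteq> set_mult (BijGroup Y) (mapping_class Y A f) (mapping_class Y A g)"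
  proof
    fix k assume "k \<in> mapping_class Y A (\<lambda>x\<in>Y. f (g x))"
    then obtain g' where g': "A.isotopic g g'" "k = (\<lambda>x\<in>Y. f (g' x))"
      using ex A.mem_mapping_class by blast
    have "k = f \<otimes>\<^bsub>BijGroup Y\<^esub> g'" using g' mult A.isotopic_mem null_isotopic_sub[OF f] by metis
    then show "k \<in> set_mult (BijGroup Y) (mapping_class Y A f) (mapping_class Y A g)"
      using g' A.isotopic_refl[OF null_isotopic_sub[OF f]] A.mem_mapping_class unfolding set_mult_def by blast
  qed
  show ?thesis using sub1 sub2 by blast
qed

lemma forget_mapping_class: "f \<in> A \<Longrightarrow> forget Y B (mapping_class Y A f) = mapping_class Y B f"
proof -
  assume f: "f \<in> A"
  have "mapping_class Y B g = mapping_class Y B f" if "A.isotopic f g" for g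
    using isotopic_mono[OF that] B.mapping_class_eq_iff[of f g] f sub by blast
  then have "mapping_class Y B g = mapping_class Y B f" if "g \<in> mapping_class Y A f" for g
    using that by (simp add: A.mem_mapping_class)
  moreover have "f \<in> mapping_class Y A f" using A.isotopic_refl[OF f] by (simp add: A.mem_mapping_class)
  ultimately show ?thesis unfolding forget_def by blast
qed

lemma mcg_pure_carrier: "carrier (mcg_pure Y A B) = mapping_class Y A ` null_isotopic"
proof -
  have "forget Y B (mapping_class Y A f) = mapping_class Y B (\<lambda>x\<in>Y. x) \<longleftrightarrow> f \<in> null_isotopic" if "f \<in> A" for f
    using forget_mapping_class[OF that] B.mapping_class_eq_iff[OF B.id_mem, of f] that
    by (auto simp: null_isotopic_def)
  moreover have "path_components_of (homeo_space Y A) = mapping_class Y A ` A"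
    unfolding path_components_of_def A.topspace_homeo_space mapping_class_def ..
  ultimately show ?thesis
    using null_isotopic_sub by (auto simp: mcg_pure_def kernel_def mcg_def)
qed

lemma mcg_pure_mult:
  assumes "f \<in> null_isotopic" "g \<in> null_isotopic"
  shows "mapping_class Y A f \<otimes>\<^bsub>mcg_pure Y A B\<^esub> mapping_class Y A g = mapping_class Y A (\<lambda>x\<in>Y. f (g x))"
  using mapping_class_mult[OF assms] by (simp add: mcg_pure_def mcg_def)

lemma mcg_pure_one: "\<one>\<^bsub>mcg_pure Y A B\<^esub> = mapping_class Y A (\<lambda>x\<in>Y. x)"
  by (simp add: mcg_pure_def mcg_def)

lemma null_isotopic_in: "f \<in> null_isotopic \<Longrightarrow> x \<in> Y \<Longrightarrow> f x \<in> Y"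
  using null_isotopic_sub A.mem_homeomorphism by (metis homeomorphism_image1 imageI)

lemma null_isotopic_eqI: "f \<in> null_isotopic \<Longrightarrow> (\<And>x. x \<in> Y \<Longrightarrow> g x = f x) \<Longrightarrow> restrict g Y = f"
  using A.restrict_mem[OF null_isotopic_sub] by (metis restrict_ext)

lemma group_mcg_pure: "group (mcg_pure Y A B)"
proof (rule groupI)
  fix x y z assume "x \<in> carrier (mcg_pure Y A B)" "y \<in> carrier (mcg_pure Y A B)" "z \<in> carrier (mcg_pure Y A B)"
  then obtain f g h where fgh: "x = mapping_class Y A f" "y = mapping_class Y A g" "z = mapping_class Y A h"
    "f \<in> null_isotopic" "g \<in> null_isotopic" "h \<in> null_isotopic"
    by (auto simp: mcg_pure_carrier)
  have "(\<lambda>x\<in>Y. (\<lambda>x\<in>Y. f (g x)) (h x)) = (\<lambda>x\<in>Y. f ((\<lambda>x\<in>Y. g (h x)) x))"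
    using null_isotopic_in fgh by (auto simp: fun_eq_iff)
  then show "x \<otimes>\<^bsub>mcg_pure Y A B\<^esub> y \<otimes>\<^bsub>mcg_pure Y A B\<^esub> z = x \<otimes>\<^bsub>mcg_pure Y A B\<^esub> (y \<otimes>\<^bsub>mcg_pure Y A B\<^esub> z)"
    using fgh by (simp add: mcg_pure_mult null_isotopic_comp)
next
  fix x y assume "x \<in> carrier (mcg_pure Y A B)" "y \<in> carrier (mcg_pure Y A B)"
  then show "x \<otimes>\<^bsub>mcg_pure Y A B\<^esub> y \<in> carrier (mcg_pure Y A B)"
    by (auto simp: mcg_pure_carrier mcg_pure_mult null_isotopic_comp)
next
  show "\<one>\<^bsub>mcg_pure Y A B\<^esub> \<in> carrier (mcg_pure Y A B)"
    by (simp add: mcg_pure_carrier mcg_pure_one null_isotopic_id)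
next
  fix x assume "x \<in> carrier (mcg_pure Y A B)"
  then obtain f where f: "x = mapping_class Y A f" "f \<in> null_isotopic" by (auto simp: mcg_pure_carrier)
  have "(\<lambda>x\<in>Y. (\<lambda>x\<in>Y. x) (f x)) = f" using null_isotopic_in f by (intro null_isotopic_eqI) auto
  then show "\<one>\<^bsub>mcg_pure Y A B\<^esub> \<otimes>\<^bsub>mcg_pure Y A B\<^esub> x = x"
    using f by (simp add: mcg_pure_one mcg_pure_mult null_isotopic_id)
  obtain h where h: "h \<in> null_isotopic" "homeomorphism Y Y f h" using f(2) by (rule null_isotopic_inv)
  have "(\<lambda>x\<in>Y. h (f x)) = (\<lambda>x\<in>Y. x)" using h by (auto simp: homeomorphism_def fun_eq_iff)
  then show "\<exists>y\<in>carrier (mcg_pure Y A B). y \<otimes>\<^bsub>mcg_pure Y A B\<^esub> x = \<one>\<^bsub>mcg_pure Y A B\<^esub>"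
    using h f by (intro bexI[of _ "mapping_class Y A h"]) (auto simp: mcg_pure_carrier mcg_pure_mult mcg_pure_one)
qed

end

section \<open>Fundamental groups\<close>

abbreviation loop_homotopic :: "'a topology \<Rightarrow> 'a \<Rightarrow> (real \<Rightarrow> 'a) \<Rightarrow> (real \<Rightarrow> 'a) \<Rightarrow> bool" where
  "loop_homotopic X b \<equiv> homotopic_with (\<lambda>h. h 0 = b \<and> h 1 = b) (top_of_set {0..1}) X"

lemma loop_homotopic_iff:
  "loop_homotopic X b p q \<longleftrightarrow>
     (\<exists>h :: real \<times> real \<Rightarrow> 'a. continuous_map (top_of_set ({0..1} \<times> {0..1})) X h \<and> (\<forall>t\<in>{0..1}. h (0, t) = p t) \<and>
       (\<forall>t\<in>{0..1}. h (1, t) = q t) \<and> (\<forall>s\<in>{0..1}. h (s, 0) = b \<and> h (s, 1) = b))"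
  by (subst homotopic_with) simp_all

text \<open>A straight-line homotopy between two parameter paths in a convex set, composed with
  \<open>Q\<close>. The laws of the fundamental group and the later comparisons of traces are all
  instances with explicit \<open>u\<close> and \<open>v\<close>.\<close>

lemma square_homotopic:
  fixes K :: "'b::real_normed_vector set"
  assumes "convex K" and Q: "continuous_map (top_of_set K) X Q"
    and u: "continuous_on {0..1} u" "\<And>t. t \<in> {0..1} \<Longrightarrow> u t \<in> K"
    and v: "continuous_on {0..1} v" "\<And>t. t \<in> {0..1} \<Longrightarrow> v t \<in> K"
    and "u 0 = v 0" "u 1 = v 1" "Q (u 0) = b" "Q (u 1) = b"
    and p: "\<And>t. t \<in> {0..1} \<Longrightarrow> p t = Q (u t)" and q: "\<And>t. t \<in> {0..1} \<Longrightarrow> q t = Q (v t)"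
  shows "loop_homotopic X b p q"
  unfolding loop_homotopic_iff
proof (intro exI conjI ballI)
  let ?h = "\<lambda>z. (1 - fst z) *\<^sub>R u (snd z) + fst z *\<^sub>R v (snd z)"
  have c: "continuous_on ({0..1} \<times> {0..1}) (\<lambda>z::real \<times> real. u (snd z))"
    "continuous_on ({0..1} \<times> {0..1}) (\<lambda>z::real \<times> real. v (snd z))"
    by (rule continuous_on_compose2[OF u(1)], auto intro!: continuous_intros)
      (rule continuous_on_compose2[OF v(1)], auto intro!: continuous_intros)
  have "continuous_map (top_of_set ({0..1} \<times> {0..1})) (top_of_set K) ?h"
    using assms(1) u(2) v(2) c unfolding convex_alt
    by (auto intro!: continuous_intros)
  from continuous_map_compose[OF this Q]
  show "continuous_map (top_of_set ({0..1} \<times> {0..1})) X (Q \<circ> ?h)" .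
qed (use assms in \<open>auto simp: algebra_simps simp flip: scaleR_add_left\<close>)

text \<open>The extra parameter in \<open>T\<close> allows one pasting to join whole homotopies and
  not only loops.\<close>

lemma join_continuous_map:
  fixes T :: "'c::metric_space set"
  assumes f: "continuous_map (top_of_set (T \<times> {0..1::real})) X f" and g: "continuous_map (top_of_set (T \<times> {0..1})) X g"
    and "\<And>s. s \<in> T \<Longrightarrow> f (s, 1) = g (s, 0)"
  shows "continuous_map (top_of_set (T \<times> {0..1})) X
           (\<lambda>z. if snd z \<le> 1/2 then f (fst z, 2 * snd z) else g (fst z, 2 * snd z - 1))"
proof (rule continuous_map_cases_le)
  have eq: "(T \<times> {0..1}) \<inter> {x \<in> T \<times> {0..1}. P x} = {z \<in> T \<times> {0..1::real}. P z}" for P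
    by auto
  have "continuous_map (top_of_set {z \<in> T \<times> {0..1::real}. snd z \<le> 1/2}) (top_of_set (T \<times> {0..1})) (\<lambda>z. (fst z, 2 * snd z))"
    by (auto intro!: continuous_intros)
  from continuous_map_compose[OF this f]
  show "continuous_map (subtopology (top_of_set (T \<times> {0..1})) {x \<in> topspace (top_of_set (T \<times> {0..1})). snd x \<le> 1/2}) X
     (\<lambda>z. f (fst z, 2 * snd z))"
    by (simp add: o_def subtopology_subtopology eq)
  have "continuous_map (top_of_set {z \<in> T \<times> {0..1::real}. 1/2 \<le> snd z}) (top_of_set (T \<times> {0..1})) (\<lambda>z. (fst z, 2 * snd z - 1))"
    by (auto intro!: continuous_intros)
  from continuous_map_compose[OF this g]
  show "continuous_map (subtopology (top_of_set (T \<times> {0..1})) {x \<in> topspace (top_of_set (T \<times> {0..1})). 1/2 \<le> snd x}) X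
     (\<lambda>z. g (fst z, 2 * snd z - 1))"
    by (simp add: o_def subtopology_subtopology eq)
  fix x assume "x \<in> topspace (top_of_set (T \<times> {0..1::real}))" "snd x = 1/2"
  then show "f (fst x, 2 * snd x) = g (fst x, 2 * snd x - 1)" 
    using assms(3)[of "fst x"] by (cases x) (simp add: mem_Times_iff flip: eq_divide_eq_numeral1)
qed (auto intro!: continuous_intros)

lemma loopsD: "p \<in> loops X b \<Longrightarrow> continuous_map (top_of_set {0..1}) X p" "p \<in> loops X b \<Longrightarrow> p 0 = b"
  "p \<in> loops X b \<Longrightarrow> p 1 = b"
  by (auto simp: loops_def pathin_def)

lemma join_loops_homotopic:
  assumes p: "loop_homotopic X b p p'" and q: "loop_homotopic X b q q'"
  shows "loop_homotopic X b (join_loops p q) (join_loops p' q')"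
proof -
  obtain h where h: "continuous_map (top_of_set ({0..1} \<times> {0..1})) X h" "\<And>t. t\<in>{0..1} \<Longrightarrow> h (0, t) = p t"
       "\<And>t. t \<in> {0..1} \<Longrightarrow> h (1, t) = p' t" "\<And>s. s\<in>{0..1::real} \<Longrightarrow> h (s, 0) = b \<and> h (s, 1) = b"
    using p unfolding loop_homotopic_iff by metis
  obtain k where k: "continuous_map (top_of_set ({0..1} \<times> {0..1})) X k" "\<And>t. t\<in>{0..1} \<Longrightarrow> k (0, t) = q t"
       "\<And>t. t \<in> {0..1} \<Longrightarrow> k (1, t) = q' t" "\<And>s. s\<in>{0..1::real} \<Longrightarrow> k (s, 0) = b \<and> k (s, 1) = b"
    using q unfolding loop_homotopic_iff by metis
  show ?thesis unfolding loop_homotopic_iff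
    by (rule exI, intro conjI, rule join_continuous_map[OF h(1) k(1)])
      (use h k in \<open>auto simp: join_loops_def\<close>)
qed

text \<open>Constant homotopies of \<open>p\<close> and \<open>q\<close> are joined; continuity of
  the joined loop is part of the resulting homotopy.\<close>

lemma join_loops_in:
  assumes p: "p \<in> loops X b" and q: "q \<in> loops X b"
  shows "join_loops p q \<in> loops X b"
proof -
  have "loop_homotopic X b p p" "loop_homotopic X b q q"
    using loopsD p q by (auto simp: homotopic_with_refl)
  then have "loop_homotopic X b (join_loops p q) (join_loops p q)" by (rule join_loops_homotopic)
  then show ?thesis by (auto simp: homotopic_with_refl loops_def pathin_def)
qed

lemma mem_loop_class: "q \<in> loop_class X b p \<longleftrightarrow> q \<in> loops X b \<and> loop_homotopic X b p q"
  by (simp add: loop_class_def)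

lemma loop_class_eq_iff:
  assumes "p \<in> loops X b" "q \<in> loops X b"
  shows "loop_class X b p = loop_class X b q \<longleftrightarrow> loop_homotopic X b p q"
proof
  assume "loop_class X b p = loop_class X b q"
  moreover have "q \<in> loop_class X b q" using assms loopsD by (auto simp: mem_loop_class homotopic_with_refl)
  ultimately have "q \<in> loop_class X b p" by simp
  then show "loop_homotopic X b p q" by (simp add: mem_loop_class)
next
  assume "loop_homotopic X b p q"
  then show "loop_class X b p = loop_class X b q"
    unfolding loop_class_def by (metis (mono_tags, lifting) homotopic_with_symD homotopic_with_trans)
qed

lemma pi1_mult:
  assumes p: "p \<in> loops X b" and q: "q \<in> loops X b"
  shows "loop_class X b p \<otimes>\<^bsub>pi1 X b\<^esub> loop_class X b q = loop_class X b (join_loops q p)"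
proof -
  have "loop_class X b (join_loops q' p') = loop_class X b (join_loops q p)"
    if "p' \<in> loop_class X b p" "q' \<in> loop_class X b q" for p' q'
  proof -
    have 1: "p' \<in> loops X b" "q' \<in> loops X b" "loop_homotopic X b p p'" "loop_homotopic X b q q'"
      using that by (auto simp: mem_loop_class)
    have "loop_class X b (join_loops q p) = loop_class X b (join_loops q' p')"
      using loop_class_eq_iff[OF join_loops_in[OF q p] join_loops_in[OF 1(2,1)]]
        join_loops_homotopic[OF 1(4,3)] by simp
    then show ?thesis ..
  qed
  moreover have "p \<in> loop_class X b p" "q \<in> loop_class X b q"
    using p q loopsD by (auto simp: mem_loop_class homotopic_with_refl)
  ultimately have "(\<Union>p'\<in>loop_class X b p. \<Union>q'\<in>loop_class X b q. loop_class X b (join_loops q' p')) =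
      loop_class X b (join_loops q p)" by blast
  then show ?thesis by (simp add: pi1_def)
qed

lemma pi1_carrier: "carrier (pi1 X b) = loop_class X b ` loops X b"
  and pi1_one: "\<one>\<^bsub>pi1 X b\<^esub> = loop_class X b (\<lambda>_. b)"
  by (auto simp: pi1_def)

lemma group_pi1:
  assumes b: "b \<in> topspace X"
  shows "group (pi1 X b)"
proof (rule groupI)
  have c: "(\<lambda>_. b) \<in> loops X b" using b by (auto simp: loops_def pathin_def)
  then show "\<one>\<^bsub>pi1 X b\<^esub> \<in> carrier (pi1 X b)" by (auto simp: pi1_one pi1_carrier)
  fix x assume "x \<in> carrier (pi1 X b)"
  then obtain p where p: "p \<in> loops X b" "x = loop_class X b p" by (auto simp: pi1_carrier)
  note pl = loopsD[OF p(1)]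
  \<comment> \<open>\<open>min (2 * t) 1\<close> runs through \<open>p\<close> at double speed and
    then waits at its end, where \<open>p\<close> has the value \<open>b\<close>.\<close>
  have "loop_homotopic X b (join_loops p (\<lambda>_. b)) p"
    by (rule square_homotopic[OF _ pl(1), where u = "\<lambda>t. min (2 * t) 1" and v = "\<lambda>t. t"])
      (use pl in \<open>auto intro!: continuous_on_min continuous_intros simp: join_loops_def\<close>)
  then show "\<one>\<^bsub>pi1 X b\<^esub> \<otimes>\<^bsub>pi1 X b\<^esub> x = x"
    using p c by (simp add: pi1_one pi1_mult loop_class_eq_iff join_loops_in)
  define p' where "p' = (\<lambda>t. p (1 - t))"
  have "continuous_map (top_of_set {0..1}) (top_of_set {0..1}) (\<lambda>t::real. 1 - t)"
    by (auto intro!: continuous_intros)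
  from continuous_map_compose[OF this pl(1)]
  have p': "p' \<in> loops X b" using pl by (simp add: p'_def loops_def pathin_def o_def)
  \<comment> \<open>This parameter runs from 0 to 1 and back, so that \<open>p\<close> is traversed
    out and in reverse; it contracts to 0.\<close>
  have "continuous_on {0..1} (\<lambda>t::real. min (2 * t) (2 - 2 * t))" by (intro continuous_intros)
  note cm = this
  have "loop_homotopic X b (join_loops p p') (\<lambda>_. b)"
    by (rule square_homotopic[OF _ pl(1), where u = "\<lambda>t. min (2 * t) (2 - 2 * t)" and v = "\<lambda>t. 0"])
      (use pl cm in \<open>auto simp: join_loops_def p'_def min_def\<close>)
  then have "loop_class X b p' \<otimes>\<^bsub>pi1 X b\<^esub> x = \<one>\<^bsub>pi1 X b\<^esub>"
    using p p' c by (simp add: pi1_one pi1_mult loop_class_eq_iff join_loops_in)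
  then show "\<exists>y\<in>carrier (pi1 X b). y \<otimes>\<^bsub>pi1 X b\<^esub> x = \<one>\<^bsub>pi1 X b\<^esub>"
    using p' by (auto simp: pi1_carrier)
  fix y assume "y \<in> carrier (pi1 X b)"
  then obtain q where q: "q \<in> loops X b" "y = loop_class X b q" by (auto simp: pi1_carrier)
  show "x \<otimes>\<^bsub>pi1 X b\<^esub> y \<in> carrier (pi1 X b)"
    using p q by (auto simp: pi1_mult pi1_carrier join_loops_in)
  fix z assume "z \<in> carrier (pi1 X b)"
  then obtain r where r: "r \<in> loops X b" "z = loop_class X b r" by (auto simp: pi1_carrier)
  note j = loopsD[OF join_loops_in[OF join_loops_in[OF r(1) q(1)] p(1)]]
  \<comment> \<open>The piecewise linear map with slopes \<open>1/2\<close>, 1 and 2 that takes the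
    breakpoints \<open>1/2\<close>, \<open>3/4\<close> of one bracketing to the breakpoints
    \<open>1/4\<close>, \<open>1/2\<close> of the other. Being convex, it is the maximum of its
    three affine pieces.\<close>
  define u where "u = (\<lambda>t::real. max (t / 2) (max (t - 1/4) (2 * t - 1)))"
  have eq: "join_loops r (join_loops q p) t = join_loops (join_loops r q) p (u t)" if "t \<in> {0..1}" for t
  proof -
    consider "t \<le> 1/2" | "1/2 < t" "t \<le> 3/4" | "3/4 < t" by linarith
    then show ?thesis
    proof cases
      case 1
      then have "u t = t / 2" by (auto simp: u_def)
      moreover have "2 * (2 * (t / 2)) = 2 * t" by simp
      ultimately show ?thesis using 1 by (simp only: join_loops_def) simp
    next
      case 2
      then have "u t = t - 1/4" by (auto simp: u_def)
      moreover have "2 * (2 * (t - 1/4)) - 1 = 2 * (2 * t - 1)" by simp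
      ultimately show ?thesis using 2 by (simp add: join_loops_def del: mult_eq_if)
    next
      case 3
      then have "u t = 2 * t - 1" by (auto simp: u_def)
      then show ?thesis using 3 by (simp add: join_loops_def)
    qed
  qed
  have cu: "continuous_on {0..1} u" unfolding u_def by (intro continuous_intros) auto
  have ur: "u t \<in> {0..1}" if "t \<in> {0..1}" for t using that by (auto simp: u_def max_def)
  have u01: "u 0 = 0" "u 1 = 1" by (auto simp: u_def)
  have "loop_homotopic X b (join_loops r (join_loops q p)) (join_loops (join_loops r q) p)"
    by (rule square_homotopic[OF _ j(1) cu ur, where v = "\<lambda>t. t"])
      (use j(2,3) u01 eq in \<open>auto intro!: continuous_intros\<close>)
  then show "x \<otimes>\<^bsub>pi1 X b\<^esub> y \<otimes>\<^bsub>pi1 X b\<^esub> z = x \<otimes>\<^bsub>pi1 X b\<^esub> (y \<otimes>\<^bsub>pi1 X b\<^esub> z)"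
    using p q r by (simp add: pi1_mult loop_class_eq_iff join_loops_in homotopic_with_sym)
qed

section \<open>Configuration spaces\<close>

lemma openin_localI:
  assumes "\<And>x. x \<in> A \<Longrightarrow> \<exists>U. openin X U \<and> x \<in> U \<and> U \<subseteq> A"
  shows "openin X A"
  using openin_subopen[of X A] assms by blast

lemma topspace_ordered_conf:
  "topspace (ordered_conf n X) = {x \<in> ({..<n} \<rightarrow>\<^sub>E topspace X). inj_on x {..<n}}"
  by (auto simp: ordered_conf_def)

lemma topspace_conf: "topspace (conf n X) = {A. A \<subseteq> topspace X \<and> finite A \<and> card A = n}"
proof
  show "topspace (conf n X) \<subseteq> {A. A \<subseteq> topspace X \<and> finite A \<and> card A = n}"
    using openin_conf[of n X "topspace (conf n X)"] by simp
  let ?A = "{A. A \<subseteq> topspace X \<and> finite A \<and> card A = n}"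
  have "x ` {..<n} \<in> ?A" if "x \<in> topspace (ordered_conf n X)" for x
  proof -
    have "x \<in> {..<n} \<rightarrow>\<^sub>E topspace X" "inj_on x {..<n}" using that by (auto simp: topspace_ordered_conf)
    then show ?thesis by (auto simp: card_image)
  qed
  then have "{x \<in> topspace (ordered_conf n X). x ` {..<n} \<in> ?A} = topspace (ordered_conf n X)"
    by blast
  then have "openin (conf n X) ?A" by (simp add: openin_conf)
  then show "?A \<subseteq> topspace (conf n X)" by (rule openin_subset)
qed

text \<open>Known as lower hemicontinuity of a set-valued map. In this form the continuity of a
  motion of configurations is checked without labelling the points.\<close>

definition hits_open :: "'z::topological_space set \<Rightarrow> ('z \<Rightarrow> 'a::topological_space set) \<Rightarrow> bool" where
  "hits_open Z \<sigma> \<longleftrightarrow> (\<forall>U. open U \<longrightarrow> openin (top_of_set Z) {z \<in> Z. \<sigma> z \<inter> U \<noteq> {}})"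

lemma hits_openE:
  assumes "hits_open Z \<sigma>" "z \<in> Z" "a \<in> \<sigma> z" "open U" "a \<in> U"
  obtains N where "open N" "z \<in> N" "\<And>z'. z' \<in> Z \<Longrightarrow> z' \<in> N \<Longrightarrow> \<sigma> z' \<inter> U \<noteq> {}"
proof -
  have "openin (top_of_set Z) {z \<in> Z. \<sigma> z \<inter> U \<noteq> {}}" using assms by (simp add: hits_open_def)
  then obtain N where "open N" "{z \<in> Z. \<sigma> z \<inter> U \<noteq> {}} = Z \<inter> N" by (auto simp: openin_open)
  then show ?thesis using that[of N] assms(2,3,5) by blast
qed

lemma hits_openI:
  assumes "\<And>z a U. z \<in> Z \<Longrightarrow> a \<in> \<sigma> z \<Longrightarrow> open U \<Longrightarrow> a \<in> U \<Longrightarrow>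
     \<exists>N. open N \<and> z \<in> N \<and> (\<forall>z'\<in>Z \<inter> N. \<sigma> z' \<inter> U \<noteq> {})"
  shows "hits_open Z \<sigma>"
  unfolding hits_open_def
proof (intro allI impI)
  fix U :: "'b set" assume U: "open U"
  show "openin (top_of_set Z) {z \<in> Z. \<sigma> z \<inter> U \<noteq> {}}"
  proof (rule openin_localI)
    fix z assume "z \<in> {z \<in> Z. \<sigma> z \<inter> U \<noteq> {}}"
    then obtain a where "z \<in> Z" "a \<in> \<sigma> z" "a \<in> U" by auto
    then obtain N where "open N" "z \<in> N" "\<forall>z'\<in>Z \<inter> N. \<sigma> z' \<inter> U \<noteq> {}" using assms U by blast
    then show "\<exists>N. openin (top_of_set Z) N \<and> z \<in> N \<and> N \<subseteq> {z \<in> Z. \<sigma> z \<inter> U \<noteq> {}}"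
      using \<open>z \<in> Z\<close> by (intro exI[of _ "Z \<inter> N"]) (auto simp: openin_open_Int)
  qed
qed

lemma disjoint_neighbourhoods:
  fixes A :: "'a::t2_space set"
  assumes "finite A"
  shows "\<exists>U. (\<forall>a\<in>A. open (U a) \<and> a \<in> U a) \<and> (\<forall>a\<in>A. \<forall>b\<in>A. a \<noteq> b \<longrightarrow> U a \<inter> U b = {})"
proof -
  have "\<forall>a b :: 'a. \<exists>V W. a \<noteq> b \<longrightarrow> open V \<and> open W \<and> a \<in> V \<and> b \<in> W \<and> V \<inter> W = {}"
    by (meson hausdorff)
  then obtain V W where VW: "\<And>a b :: 'a. a \<noteq> b \<Longrightarrow> open (V a b) \<and> open (W a b) \<and> a \<in> V a b \<and> b \<in> W a b \<and> V a b \<inter> W a b = {}"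
    by metis
  define U where "U = (\<lambda>a. \<Inter>b\<in>A - {a}. V a b \<inter> W b a)"
  show ?thesis
  proof (intro exI[of _ U] conjI ballI impI)
    fix a assume "a \<in> A"
    show "open (U a)" unfolding U_def using assms VW by (intro open_INT) auto
    have "a \<in> V a b \<inter> W b a" if "b \<in> A - {a}" for b
      using VW[of a b] VW[of b a] that by auto
    then show "a \<in> U a" unfolding U_def by (rule INT_I)
    fix b assume "b \<in> A" "a \<noteq> b"
    then have "U a \<subseteq> V a b" "U b \<subseteq> W a b" using \<open>a \<in> A\<close> by (auto simp: U_def)
    then show "U a \<inter> U b = {}" using VW[OF \<open>a \<noteq> b\<close>] by blast
  qed
qed

text \<open>Since all configurations have the same cardinality, lower hemicontinuity is continuity.\<close>

lemma continuous_map_conf_iff: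
  fixes Y :: "'a::t2_space set"
  shows "continuous_map (top_of_set Z) (conf n (top_of_set Y)) \<sigma> \<longleftrightarrow>
    (\<forall>z\<in>Z. \<sigma> z \<subseteq> Y \<and> finite (\<sigma> z) \<and> card (\<sigma> z) = n) \<and> hits_open Z \<sigma>"
proof
  assume \<sigma>: "continuous_map (top_of_set Z) (conf n (top_of_set Y)) \<sigma>"
  have 1: "\<forall>z\<in>Z. \<sigma> z \<subseteq> Y \<and> finite (\<sigma> z) \<and> card (\<sigma> z) = n"
    using continuous_map_image_subset_topspace[OF \<sigma>] by (auto simp: topspace_conf)
  moreover have "openin (top_of_set Z) {z \<in> Z. \<sigma> z \<inter> U \<noteq> {}}" if U: "open U" for U
  proof -
    \<comment> \<open>In terms of a labelling, a configuration meets \<open>U\<close> when some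
      coordinate lies in \<open>U\<close>, which is a union of open conditions.\<close>
    let ?V = "{A. A \<subseteq> Y \<and> finite A \<and> card A = n \<and> A \<inter> U \<noteq> {}}"
    have op: "openin (product_topology (\<lambda>_. top_of_set Y) {..<n}) {x \<in> {..<n} \<rightarrow>\<^sub>E Y. x i \<in> U}" if "i < n" for i
    proof -
      have "continuous_map (product_topology (\<lambda>_. top_of_set Y) {..<n}) (top_of_set Y) (\<lambda>x. x i)"
        using that by (intro continuous_map_product_projection) auto
      from openin_continuous_map_preimage[OF this, of "Y \<inter> U"]
      have "openin (product_topology (\<lambda>_. top_of_set Y) {..<n}) {x \<in> {..<n} \<rightarrow>\<^sub>E Y. x i \<in> Y \<inter> U}"
        using U by (simp add: openin_open_Int)
      moreover have "{x \<in> {..<n} \<rightarrow>\<^sub>E Y. x i \<in> Y \<inter> U} = {x \<in> {..<n} \<rightarrow>\<^sub>E Y. x i \<in> U}"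
        using that by (auto simp: PiE_iff)
      ultimately show ?thesis by simp
    qed
    have "openin (ordered_conf n (top_of_set Y))
        ({x. inj_on x {..<n}} \<inter> (\<Union>i<n. {x \<in> {..<n} \<rightarrow>\<^sub>E Y. x i \<in> U}))"
      unfolding ordered_conf_def by (intro openin_subtopology_Int2 openin_Union) (use op in auto)
    also have "{x. inj_on x {..<n}} \<inter> (\<Union>i<n. {x \<in> {..<n} \<rightarrow>\<^sub>E Y. x i \<in> U}) =
       {x \<in> topspace (ordered_conf n (top_of_set Y)). x ` {..<n} \<in> ?V}"
    proof (intro equalityI subsetI)
      fix x assume "x \<in> {x. inj_on x {..<n}} \<inter> (\<Union>i<n. {x \<in> {..<n} \<rightarrow>\<^sub>E Y. x i \<in> U})"
      then obtain i where "inj_on x {..<n}" "x \<in> {..<n} \<rightarrow>\<^sub>E Y" "i < n" "x i \<in> U" by auto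
      then show "x \<in> {x \<in> topspace (ordered_conf n (top_of_set Y)). x ` {..<n} \<in> ?V}"
        by (auto simp: topspace_ordered_conf card_image)
    next
      fix x assume "x \<in> {x \<in> topspace (ordered_conf n (top_of_set Y)). x ` {..<n} \<in> ?V}"
      then show "x \<in> {x. inj_on x {..<n}} \<inter> (\<Union>i<n. {x \<in> {..<n} \<rightarrow>\<^sub>E Y. x i \<in> U})"
        by (auto simp: topspace_ordered_conf)
    qed
    finally have "openin (conf n (top_of_set Y)) ?V" by (auto simp: openin_conf)
    from openin_continuous_map_preimage[OF \<sigma> this]
    have "openin (top_of_set Z) {z \<in> Z. \<sigma> z \<in> ?V}" by simp
    moreover have "{z \<in> Z. \<sigma> z \<in> ?V} = {z \<in> Z. \<sigma> z \<inter> U \<noteq> {}}" using 1 by auto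
    ultimately show ?thesis by simp
  qed
  ultimately show "(\<forall>z\<in>Z. \<sigma> z \<subseteq> Y \<and> finite (\<sigma> z) \<and> card (\<sigma> z) = n) \<and> hits_open Z \<sigma>"
    by (simp add: hits_open_def)
next
  assume r: "(\<forall>z\<in>Z. \<sigma> z \<subseteq> Y \<and> finite (\<sigma> z) \<and> card (\<sigma> z) = n) \<and> hits_open Z \<sigma>"
  show "continuous_map (top_of_set Z) (conf n (top_of_set Y)) \<sigma>"
    unfolding continuous_map_alt
  proof (intro conjI allI impI)
    show "\<sigma> \<in> topspace (top_of_set Z) \<rightarrow> topspace (conf n (top_of_set Y))"
      using r by (auto simp: topspace_conf)
    fix \<U> assume "openin (conf n (top_of_set Y)) \<U>"
    then have \<U>: "openin (ordered_conf n (top_of_set Y)) {x \<in> topspace (ordered_conf n (top_of_set Y)). x ` {..<n} \<in> \<U>}"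
      by (simp add: openin_conf)
    show "openin (top_of_set Z) (\<sigma> -` \<U> \<inter> topspace (top_of_set Z))"
    proof (rule openin_localI)
      fix z0 assume "z0 \<in> \<sigma> -` \<U> \<inter> topspace (top_of_set Z)"
      then have z0: "z0 \<in> Z" "\<sigma> z0 \<in> \<U>" by auto
      obtain x0 where "bij_betw x0 {..<n} (\<sigma> z0)"
        using r z0 by (metis card_lessThan finite_lessThan finite_same_card_bij)
      define x where "x = restrict x0 {..<n}"
      have x: "inj_on x {..<n}" "x ` {..<n} = \<sigma> z0" "x \<in> extensional {..<n}"
        using \<open>bij_betw x0 {..<n} (\<sigma> z0)\<close> by (auto simp: x_def bij_betw_def inj_on_def)
      have xY: "x \<in> {..<n} \<rightarrow>\<^sub>E Y" using x r z0 by (auto simp: PiE_iff)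
      have "x \<in> {x \<in> topspace (ordered_conf n (top_of_set Y)). x ` {..<n} \<in> \<U>}"
        using x xY z0 by (simp add: topspace_ordered_conf)
      then obtain T where T: "openin (product_topology (\<lambda>_. top_of_set Y) {..<n}) T"
        "{x \<in> topspace (ordered_conf n (top_of_set Y)). x ` {..<n} \<in> \<U>} = T \<inter> {x. inj_on x {..<n}}" "x \<in> T"
        using \<U> unfolding ordered_conf_def openin_subtopology by blast
      then obtain U where U: "\<And>i. i < n \<Longrightarrow> openin (top_of_set Y) (U i)" "x \<in> Pi\<^sub>E {..<n} U" "Pi\<^sub>E {..<n} U \<subseteq> T"
        unfolding openin_product_topology_alt by (metis lessThan_iff)
      have "\<forall>i. \<exists>W. i < n \<longrightarrow> open W \<and> U i = Y \<inter> W" using U(1) by (metis openin_open)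
      then obtain W where W: "\<And>i. i < n \<Longrightarrow> open (W i) \<and> U i = Y \<inter> W i" by metis
      obtain D where D: "\<And>a. a \<in> \<sigma> z0 \<Longrightarrow> open (D a) \<and> a \<in> D a"
        "\<And>a b. a \<in> \<sigma> z0 \<Longrightarrow> b \<in> \<sigma> z0 \<Longrightarrow> a \<noteq> b \<Longrightarrow> D a \<inter> D b = {}"
        using disjoint_neighbourhoods[of "\<sigma> z0"] r z0 by metis
      \<comment> \<open>For parameters in \<open>N\<close> each \<open>x i\<close> has a point of
        \<open>\<sigma> z\<close> in its own neighbourhood \<open>D (x i)\<close>. These
        neighbourhoods are disjoint, so the \<open>n\<close> chosen points are distinct and make up
        all of \<open>\<sigma> z\<close>.\<close>
      define N where "N = Z \<inter> (\<Inter>i<n. {z \<in> Z. \<sigma> z \<inter> (W i \<inter> D (x i)) \<noteq> {}})"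
      have xi: "x i \<in> \<sigma> z0" "x i \<in> W i" if "i < n" for i
        using x that U(2) W by auto
      have z0N: "z0 \<in> {z \<in> Z. \<sigma> z \<inter> (W i \<inter> D (x i)) \<noteq> {}}" if "i < n" for i
        using xi[OF that] D(1)[OF xi(1)[OF that]] z0 by blast
      have "openin (top_of_set Z) N"
      proof (cases "n = 0")
        case False
        then show ?thesis unfolding N_def
        proof (intro openin_Int openin_INT2)
          fix i
          show "i \<in> {..<n} \<Longrightarrow> openin (top_of_set Z) {z \<in> Z. \<sigma> z \<inter> (W i \<inter> D (x i)) \<noteq> {}}"
          proof -
            assume "i \<in> {..<n}"
            then have "open (W i \<inter> D (x i))" using D(1)[OF xi(1)[of i]] W[of i] by auto
            then show ?thesis using r unfolding hits_open_def by simp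
          qed
        qed auto
      qed (simp add: N_def)
      moreover have "z0 \<in> N" using z0 z0N unfolding N_def by blast
      moreover have "N \<subseteq> \<sigma> -` \<U> \<inter> topspace (top_of_set Z)"
      proof
        fix z assume z: "z \<in> N"
        have "\<forall>i. \<exists>y. i < n \<longrightarrow> y \<in> \<sigma> z \<and> y \<in> W i \<and> y \<in> D (x i)" using z by (auto simp: N_def)
        then obtain y where y: "\<And>i. i < n \<Longrightarrow> y i \<in> \<sigma> z \<and> y i \<in> W i \<and> y i \<in> D (x i)" by metis
        define y' where "y' = restrict y {..<n}"
        have zZ: "z \<in> Z" using z by (simp add: N_def)
        have inj: "inj_on y' {..<n}"
        proof (rule inj_onI, rule ccontr)
          fix i j assume ij: "i \<in> {..<n}" "j \<in> {..<n}" "y' i = y' j" "i \<noteq> j"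
          then have "x i \<noteq> x j" using x by (auto simp: inj_on_def)
          then show False using D(2)[of "x i" "x j"] xi y ij unfolding y'_def
            by (metis disjoint_iff lessThan_iff restrict_apply')
        qed
        have "y i \<in> U i" if "i < n" for i using y[OF that] W[OF that] zZ r by blast
        then have "y' \<in> Pi\<^sub>E {..<n} U" by (auto simp: y'_def)
        then have "y' \<in> T \<inter> {x. inj_on x {..<n}}" using U inj by auto
        then have "y' ` {..<n} \<in> \<U>" using T(2) by blast
        moreover have "y' ` {..<n} = \<sigma> z"
        proof (rule card_subset_eq)
          show "y' ` {..<n} \<subseteq> \<sigma> z" using y by (auto simp: y'_def)
          show "finite (\<sigma> z)" "card (y' ` {..<n}) = card (\<sigma> z)" using r zZ inj by (auto simp: card_image)
        qed
        ultimately show "z \<in> \<sigma> -` \<U> \<inter> topspace (top_of_set Z)" using zZ by simp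
      qed
      ultimately show "\<exists>U. openin (top_of_set Z) U \<and> z0 \<in> U \<and> U \<subseteq> \<sigma> -` \<U> \<inter> topspace (top_of_set Z)" by blast
    qed
  qed
qed

lemma hits_open_family:
  fixes f :: "'i \<Rightarrow> 'z::topological_space \<Rightarrow> 'a::topological_space"
  assumes "\<And>i. i \<in> I \<Longrightarrow> continuous_on Z (f i)"
  shows "hits_open Z (\<lambda>z. (\<lambda>i. f i z) ` I)"
  unfolding hits_open_def
proof (intro allI impI)
  fix U :: "'a set" assume "open U"
  then have "openin (top_of_set Z) (\<Union>i\<in>I. Z \<inter> f i -` U)"
    using assms by (intro openin_Union) (auto intro: continuous_openin_preimage_gen)
  moreover have "(\<Union>i\<in>I. Z \<inter> f i -` U) = {z \<in> Z. (\<lambda>i. f i z) ` I \<inter> U \<noteq> {}}" by auto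
  ultimately show "openin (top_of_set Z) {z \<in> Z. (\<lambda>i. f i z) ` I \<inter> U \<noteq> {}}" by simp
qed

text \<open>Serves two purposes: moving a configuration by a continuous family of maps and, with
  \<open>h = snd\<close>, changing its parameter.\<close>

lemma hits_open_image:
  assumes \<sigma>: "hits_open Z \<sigma>" and h: "continuous_on (S \<times> Y) h" and Y: "\<And>z. z \<in> Z \<Longrightarrow> \<sigma> z \<subseteq> Y"
    and u: "continuous_on T u" "\<And>x. x \<in> T \<Longrightarrow> u x \<in> S" and v: "continuous_on T v" "\<And>x. x \<in> T \<Longrightarrow> v x \<in> Z"
  shows "hits_open T (\<lambda>x. (\<lambda>a. h (u x, a)) ` \<sigma> (v x))"
proof (rule hits_openI)
  fix x b U assume x: "x \<in> T" "b \<in> (\<lambda>a. h (u x, a)) ` \<sigma> (v x)" "open U" "b \<in> U"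
  then obtain a where a: "a \<in> \<sigma> (v x)" "h (u x, a) \<in> U" by auto
  have "(u x, a) \<in> S \<times> Y" using a x u v Y by auto
  then obtain W where W: "open W" "(u x, a) \<in> W" "\<And>y. y \<in> S \<times> Y \<Longrightarrow> y \<in> W \<Longrightarrow> h y \<in> U"
  proof -
    have "\<exists>W. open W \<and> (u x, a) \<in> W \<and> (\<forall>y\<in>S \<times> Y. y \<in> W \<longrightarrow> h y \<in> U)"
      by (rule h[unfolded continuous_on_topological, THEN bspec, OF \<open>(u x, a) \<in> S \<times> Y\<close>, THEN spec[of _ U], THEN mp, OF x(3), THEN mp, OF a(2)])
    then show ?thesis using that by auto
  qed
  then obtain A B where AB: "open A" "open B" "(u x, a) \<in> A \<times> B" "A \<times> B \<subseteq> W"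
    using open_prod_elim[OF W(1,2)] by metis
  obtain N where N: "open N" "v x \<in> N" "\<And>z'. z' \<in> Z \<Longrightarrow> z' \<in> N \<Longrightarrow> \<sigma> z' \<inter> B \<noteq> {}"
    using hits_openE[OF \<sigma> v(2)[OF x(1)] a(1), of B] AB by blast
  obtain M1 where M1: "open M1" "x \<in> M1" "\<And>y. y \<in> T \<Longrightarrow> y \<in> M1 \<Longrightarrow> u y \<in> A"
    using u(1) x AB unfolding continuous_on_topological by (metis SigmaD1)
  obtain M2 where M2: "open M2" "x \<in> M2" "\<And>y. y \<in> T \<Longrightarrow> y \<in> M2 \<Longrightarrow> v y \<in> N"
    using v(1) x N unfolding continuous_on_topological by metis
  show "\<exists>N. open N \<and> x \<in> N \<and> (\<forall>z'\<in>T \<inter> N. (\<lambda>a. h (u z', a)) ` \<sigma> (v z') \<inter> U \<noteq> {})"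
  proof (intro exI[of _ "M1 \<inter> M2"] conjI ballI)
    fix y assume "y \<in> T \<inter> (M1 \<inter> M2)"
    then have y: "y \<in> T" "u y \<in> A" "v y \<in> N" using M1 M2 by auto
    then obtain a' where a': "a' \<in> \<sigma> (v y)" "a' \<in> B" using N(3)[of "v y"] v by auto
    have "a' \<in> Y" using Y[OF v(2)[OF y(1)]] a' by blast
    then have "h (u y, a') \<in> U" using W(3)[of "(u y, a')"] AB(4) y a' u(2)[OF y(1)] by blast
    then show "(\<lambda>a. h (u y, a)) ` \<sigma> (v y) \<inter> U \<noteq> {}" using a' by auto
  qed (use M1 M2 in auto)
qed

section \<open>Isotopy extension\<close>

lemma continuous_on_localI:
  assumes "\<And>x. x \<in> S \<Longrightarrow> \<exists>T. open T \<and> x \<in> T \<and> continuous_on (S \<inter> T) f"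
  shows "continuous_on S f"
  unfolding continuous_on_topological
proof (intro ballI allI impI)
  fix x B assume x: "x \<in> S" "open B" "f x \<in> B"
  then obtain T where T: "open T" "x \<in> T" "continuous_on (S \<inter> T) f" using assms by blast
  then obtain A where A: "open A" "x \<in> A" "\<And>y. y \<in> S \<inter> T \<Longrightarrow> y \<in> A \<Longrightarrow> f y \<in> B"
    using x unfolding continuous_on_topological by (metis IntI)
  then show "\<exists>A. open A \<and> x \<in> A \<and> (\<forall>y\<in>S. y \<in> A \<longrightarrow> f y \<in> B)"
    using T by (intro exI[of _ "A \<inter> T"]) auto
qed

text \<open>The solutions of the equation are the fixed points of the contraction that sends
  \<open>x\<close> to \<open>y - g x\<close>.\<close>

lemma perturbation_bij:
  fixes g :: "'a::banach \<Rightarrow> 'a"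
  assumes "\<And>x y. dist (g x) (g y) \<le> 1/2 * dist x y"
  shows "\<exists>!x. x + g x = y"
proof -
  have "\<exists>!x. (\<lambda>x. y - g x) x = x"
  proof (rule banach_fix_type[of "1/2"])
    show "\<forall>u v. dist (y - g u) (y - g v) \<le> 1/2 * dist u v"
      using assms by (simp add: dist_norm norm_minus_commute)
  qed auto
  moreover have "y - g x = x \<longleftrightarrow> x + g x = y" for x by (auto simp: algebra_simps)
  ultimately show ?thesis by simp
qed

text \<open>Homeomorphisms of the whole plane supported in \<open>\<Omega>\<close>. Taking for
  \<open>\<Omega>\<close> the interior of the punctured disk produces maps that fix boundary and
  punctures.\<close>

definition homeo_family :: "'z::topological_space set \<Rightarrow> 'a::topological_space set \<Rightarrow> ('z \<Rightarrow> 'a \<Rightarrow> 'a) \<Rightarrow> ('z \<Rightarrow> 'a \<Rightarrow> 'a) \<Rightarrow> bool" where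
  "homeo_family Z \<Omega> \<Phi> \<Psi> \<longleftrightarrow>
     continuous_on (Z \<times> UNIV) (\<lambda>p. \<Phi> (fst p) (snd p)) \<and> continuous_on (Z \<times> UNIV) (\<lambda>p. \<Psi> (fst p) (snd p)) \<and>
     (\<forall>z\<in>Z. \<forall>x. \<Phi> z (\<Psi> z x) = x \<and> \<Psi> z (\<Phi> z x) = x \<and> (x \<notin> \<Omega> \<longrightarrow> \<Phi> z x = x))"

lemma homeo_family_perturbation:
  fixes g :: "'z::metric_space \<Rightarrow> 'a::banach \<Rightarrow> 'a"
  assumes c: "continuous_on (Z \<times> UNIV) (\<lambda>p. g (fst p) (snd p))"
    and lip: "\<And>z x y. z \<in> Z \<Longrightarrow> dist (g z x) (g z y) \<le> 1/2 * dist x y"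
    and "\<And>z x. z \<in> Z \<Longrightarrow> x \<notin> \<Omega> \<Longrightarrow> g z x = 0"
  shows "\<exists>\<Psi>. homeo_family Z \<Omega> (\<lambda>z x. x + g z x) \<Psi>"
proof -
  define \<Psi> where "\<Psi> = (\<lambda>z y. THE x. x + g z x = y)"
  have \<Psi>1: "\<Psi> z y + g z (\<Psi> z y) = y" if "z \<in> Z" for z y
    unfolding \<Psi>_def by (rule theI') (rule perturbation_bij[OF lip[OF that]])
  have \<Psi>2: "\<Psi> z (x + g z x) = x" if "z \<in> Z" for z x
    unfolding \<Psi>_def by (rule the1_equality) (use perturbation_bij[OF lip[OF that]] in auto)
  \<comment> \<open>The maps shrink distances by at most a factor of two. Comparing the inverse
    values with the single point \<open>x0\<close> then gives joint continuity of the inverse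
    family.\<close>
  have exp: "dist x y \<le> 2 * dist (x + g z x) (y + g z y)" if "z \<in> Z" for x y z
  proof -
    have "dist x y \<le> dist (x + g z x) (y + g z y) + dist (g z x) (g z y)"
      using norm_triangle_ineq4[of "(x + g z x) - (y + g z y)" "g z x - g z y"]
      by (simp add: dist_norm algebra_simps)
    then show ?thesis using lip[OF that, of x y] by linarith
  qed
  have c1: "continuous_on (Z \<times> UNIV) (\<lambda>p. snd p + g (fst p) (snd p))"
    by (intro continuous_intros c)
  have c2: "continuous_on (Z \<times> UNIV) (\<lambda>p. \<Psi> (fst p) (snd p))"
    unfolding continuous_on_def
  proof
    fix p0 assume p0: "p0 \<in> Z \<times> (UNIV :: 'a set)"
    define x0 where "x0 = \<Psi> (fst p0) (snd p0)"
    have "continuous_on (Z \<times> UNIV) (\<lambda>p. g (fst p) x0)"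
      by (intro joint_compose[OF c] continuous_intros) auto
    then have "continuous_on (Z \<times> UNIV) (\<lambda>p. 2 * dist (snd p) (x0 + g (fst p) x0))"
      by (intro continuous_intros)
    then have "((\<lambda>p. 2 * dist (snd p) (x0 + g (fst p) x0)) \<longlongrightarrow> 2 * dist (snd p0) (x0 + g (fst p0) x0)) (at p0 within Z \<times> UNIV)"
      using p0 by (auto simp: continuous_on_def)
    also have "2 * dist (snd p0) (x0 + g (fst p0) x0) = 0" using \<Psi>1 p0 by (auto simp: x0_def)
    finally have lim: "((\<lambda>p. 2 * dist (snd p) (x0 + g (fst p) x0)) \<longlongrightarrow> 0) (at p0 within Z \<times> UNIV)" .
    have "((\<lambda>p. dist (\<Psi> (fst p) (snd p)) x0) \<longlongrightarrow> 0) (at p0 within Z \<times> UNIV)"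
    proof (rule Lim_null_comparison[OF _ lim])
      show "\<forall>\<^sub>F p in at p0 within Z \<times> UNIV. norm (dist (\<Psi> (fst p) (snd p)) x0) \<le> 2 * dist (snd p) (x0 + g (fst p) x0)"
        unfolding eventually_at_filter
      proof (intro always_eventually allI impI)
        fix p :: "'z \<times> 'a" assume "p \<in> Z \<times> UNIV"
        then have "fst p \<in> Z" by auto
        then show "norm (dist (\<Psi> (fst p) (snd p)) x0) \<le> 2 * dist (snd p) (x0 + g (fst p) x0)"
          using exp[of "fst p" "\<Psi> (fst p) (snd p)" x0] \<Psi>1[of "fst p" "snd p"] by simp
      qed
    qed
    then show "((\<lambda>p. \<Psi> (fst p) (snd p)) \<longlongrightarrow> \<Psi> (fst p0) (snd p0)) (at p0 within Z \<times> UNIV)"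
      unfolding tendsto_dist_iff[of _ "\<Psi> (fst p0) (snd p0)"] x0_def .
  qed
  show ?thesis
    by (rule exI[of _ \<Psi>]) (use c1 c2 \<Psi>1 \<Psi>2 assms(3) in \<open>simp add: homeo_family_def\<close>)
qed

lemma homeo_family_id: "homeo_family Z \<Omega> (\<lambda>z x. x) (\<lambda>z x. x)"
  by (auto simp: homeo_family_def intro!: continuous_intros)

lemma homeo_family_comp:
  assumes 1: "homeo_family Z \<Omega> \<Phi> \<Psi>" and 2: "homeo_family Z \<Omega> \<Phi>' \<Psi>'"
  shows "homeo_family Z \<Omega> (\<lambda>z x. \<Phi> z (\<Phi>' z x)) (\<lambda>z x. \<Psi>' z (\<Psi> z x))"
proof -
  have "continuous_on (Z \<times> UNIV) (\<lambda>p. \<Phi> (fst p) (\<Phi>' (fst p) (snd p)))"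
    by (rule joint_compose[where T = Z and Y = UNIV]) (use 1 2 in \<open>auto simp: homeo_family_def intro!: continuous_intros\<close>)
  moreover have "continuous_on (Z \<times> UNIV) (\<lambda>p. \<Psi>' (fst p) (\<Psi> (fst p) (snd p)))"
    by (rule joint_compose[where T = Z and Y = UNIV]) (use 1 2 in \<open>auto simp: homeo_family_def intro!: continuous_intros\<close>)
  ultimately show ?thesis using 1 2 by (simp add: homeo_family_def)
qed

text \<open>Lower hemicontinuity provides a point of \<open>\<beta> y\<close> close to
  \<open>s z1\<close>; for \<open>y\<close> near \<open>z1\<close> it is still within
  \<open>r\<close> of \<open>c y\<close>, and uniqueness identifies it with
  \<open>s y\<close>.\<close>

lemma selection_continuous:
  fixes c :: "'z::metric_space \<Rightarrow> 'a::metric_space"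
  assumes \<beta>: "hits_open Z \<beta>" and c: "continuous_on N c" "N \<subseteq> Z"
    and s: "\<And>z. z \<in> N \<Longrightarrow> s z \<in> \<beta> z \<and> dist (c z) (s z) < r"
    and uniq: "\<And>z b. z \<in> N \<Longrightarrow> b \<in> \<beta> z \<Longrightarrow> dist (c z) b < r \<Longrightarrow> b = s z"
  shows "continuous_on N s"
  unfolding continuous_on_topological
proof (intro ballI allI impI)
  fix z1 B assume z1: "z1 \<in> N" "open B" "s z1 \<in> B"
  \<comment> \<open>Half of the slack in the strict inequality: one half pays for the motion of
    \<open>c\<close>, the other for the distance from \<open>s z1\<close>.\<close>
  define e where "e = (r - dist (c z1) (s z1)) / 2"
  have e: "e > 0" using s z1 by (simp add: e_def)
  obtain M where M: "open M" "z1 \<in> M" "\<And>z'. z' \<in> Z \<Longrightarrow> z' \<in> M \<Longrightarrow> \<beta> z' \<inter> (B \<inter> ball (s z1) e) \<noteq> {}"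
    using hits_openE[OF \<beta>, of z1 "s z1" "B \<inter> ball (s z1) e"] z1 s c(2) e by auto
  obtain A where A: "open A" "z1 \<in> A" "\<And>y. y \<in> N \<Longrightarrow> y \<in> A \<Longrightarrow> c y \<in> ball (c z1) e"
    using c(1) z1 e unfolding continuous_on_topological by (metis centre_in_ball open_ball)
  show "\<exists>A. open A \<and> z1 \<in> A \<and> (\<forall>y\<in>N. y \<in> A \<longrightarrow> s y \<in> B)"
  proof (intro exI[of _ "A \<inter> M"] conjI ballI impI)
    fix y assume y: "y \<in> N" "y \<in> A \<inter> M"
    then have "\<beta> y \<inter> (B \<inter> ball (s z1) e) \<noteq> {}" using M(3)[of y] c(2) by auto
    then obtain b where b: "b \<in> \<beta> y" "b \<in> B" "dist (s z1) b < e" by auto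
    have "dist (c y) b \<le> dist (c y) (c z1) + (dist (c z1) (s z1) + dist (s z1) b)"
      using dist_triangle[of "c y" b "c z1"] dist_triangle[of "c z1" b "s z1"] by linarith
    also have "\<dots> < e + (dist (c z1) (s z1) + e)" using A(3)[of y] y b by (auto simp: dist_commute)
    also have "\<dots> = r" by (simp add: e_def)
    finally have "b = s y" using uniq y b by blast
    then show "s y \<in> B" using b by simp
  qed (use A M in auto)
qed

definition separated :: "real \<Rightarrow> 'a::metric_space set \<Rightarrow> bool" where
  "separated \<delta> A \<longleftrightarrow> (\<forall>a\<in>A. \<forall>b\<in>A. a \<noteq> b \<longrightarrow> \<delta> \<le> dist a b)"

lemma separated_unique:
  assumes "separated \<delta> A" "a \<in> A" "b \<in> A" "dist c a < \<delta> / 2" "dist c b < \<delta> / 2"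
  shows "a = b"
proof (rule ccontr)
  assume "a \<noteq> b"
  then have "\<delta> \<le> dist a b" using assms by (auto simp: separated_def)
  also have "\<dots> \<le> dist c a + dist c b" using dist_triangle3[of a b c] by simp
  finally show False using assms by simp
qed

text \<open>A short move of a configuration extends to a homeomorphism that perturbs the identity by a sum
  of cone-shaped bumps around the old points.\<close>

lemma short_move:
  fixes \<alpha> \<beta> :: "'z::metric_space \<Rightarrow> complex set"
  assumes \<alpha>: "hits_open Z \<alpha>" "\<And>z. z \<in> Z \<Longrightarrow> finite (\<alpha> z) \<and> card (\<alpha> z) = n"
    and \<beta>: "hits_open Z \<beta>" "\<And>z. z \<in> Z \<Longrightarrow> finite (\<beta> z) \<and> card (\<beta> z) = n"
    and \<delta>: "0 < \<delta>" "\<And>z. z \<in> Z \<Longrightarrow> separated \<delta> (\<alpha> z) \<and> separated \<delta> (\<beta> z)"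
    and \<Omega>: "\<And>z a. z \<in> Z \<Longrightarrow> a \<in> \<alpha> z \<Longrightarrow> ball a \<delta> \<subseteq> \<Omega>"
    and near: "\<And>z a. z \<in> Z \<Longrightarrow> a \<in> \<alpha> z \<Longrightarrow> \<exists>b\<in>\<beta> z. dist a b < \<delta> / (4 * (real n + 1))"
  shows "\<exists>\<Phi> \<Psi>. homeo_family Z \<Omega> \<Phi> \<Psi> \<and> (\<forall>z\<in>Z. \<Phi> z ` \<alpha> z = \<beta> z) \<and> (\<forall>z\<in>Z. \<alpha> z = \<beta> z \<longrightarrow> \<Phi> z = (\<lambda>x. x))"
proof -
  \<comment> \<open>There are \<open>n\<close> bumps of Lipschitz constant
    \<open>2 / \<delta>\<close>, each multiplied by a displacement below \<open>\<eta>\<close>. This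
    choice makes their sum \<open>1/2\<close>-Lipschitz, and being below \<open>\<delta> / 2\<close>
    it also makes the target of each point unique.\<close>
  define \<eta> where "\<eta> = \<delta> / (4 * (real n + 1))"
  have "\<delta> * 1 \<le> \<delta> * (real n + 1)" using \<delta> by (intro mult_left_mono) auto
  moreover have "0 \<le> \<delta> * real n" using \<delta> by simp
  ultimately have \<eta>: "0 < \<eta>" "\<eta> < \<delta> / 2"
    using \<delta>(1) unfolding \<eta>_def by (simp, simp add: field_simps add_pos_nonneg)
  have "real n * \<delta> \<le> (real n + 1) * \<delta>" using \<delta> by (intro mult_right_mono) auto
  then have n\<eta>: "real n * \<eta> * (2 / \<delta>) \<le> 1 / 2"
    using \<delta> unfolding \<eta>_def by (simp add: field_simps)
  define m where "m = (\<lambda>z a. SOME b. b \<in> \<beta> z \<and> dist a b < \<eta>)"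
  have m: "m z a \<in> \<beta> z" "dist a (m z a) < \<eta>" if "z \<in> Z" "\<exists>b\<in>\<beta> z. dist a b < \<eta>" for z a
    using someI_ex[of "\<lambda>b. b \<in> \<beta> z \<and> dist a b < \<eta>"] that by (auto simp: m_def)
  have m\<alpha>: "m z a \<in> \<beta> z" "dist a (m z a) < \<eta>" if "z \<in> Z" "a \<in> \<alpha> z" for z a
    using m[OF that(1)] near[OF that] by (auto simp: \<eta>_def)
  have uniq: "b = m z a" if "z \<in> Z" "a \<in> \<alpha> z" "b \<in> \<beta> z" "dist a b < \<eta>" for z a b
    using separated_unique[of \<delta> "\<beta> z" b "m z a" a] \<delta>(2) that m\<alpha>[of z a] \<eta> by auto
  \<comment> \<open>A cone of height 1 over the disk of radius \<open>\<delta> / 2\<close> around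
    \<open>a\<close>.\<close>
  define w where "w = (\<lambda>x a :: complex. max 0 (1 - dist x a / (\<delta> / 2)))"
  define g where "g = (\<lambda>z x. \<Sum>a\<in>\<alpha> z. of_real (w x a) * (m z a - a))"
  have w_lip: "\<bar>w x a - w y a\<bar> \<le> dist x y * (2 / \<delta>)" for x y a :: complex
  proof -
    have "\<bar>w x a - w y a\<bar> \<le> \<bar>dist x a / (\<delta> / 2) - dist y a / (\<delta> / 2)\<bar>"
      unfolding w_def by (auto simp: max_def abs_if)
    also have "dist x a / (\<delta> / 2) - dist y a / (\<delta> / 2) = (dist x a - dist y a) * (2 / \<delta>)"
      using \<delta>(1) by (simp add: field_simps)
    also have "\<bar>\<dots>\<bar> = \<bar>dist x a - dist y a\<bar> * (2 / \<delta>)"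
      using \<delta>(1) by (simp only: abs_mult) simp
    also have "\<dots> \<le> dist x y * (2 / \<delta>)"
      using abs_dist_diff_le[of x a y] \<delta>(1) by (intro mult_right_mono) (auto simp: dist_commute)
    finally show ?thesis .
  qed
  have lip: "dist (g z x) (g z y) \<le> 1/2 * dist x y" if z: "z \<in> Z" for z x y
  proof -
    have "dist (g z x) (g z y) = norm (\<Sum>a\<in>\<alpha> z. of_real (w x a - w y a) * (m z a - a))"
      by (simp only: g_def dist_norm of_real_diff left_diff_distrib sum_subtractf)
    also have "\<dots> \<le> (\<Sum>a\<in>\<alpha> z. dist x y * (2 / \<delta>) * \<eta>)"
    proof (rule sum_norm_le)
      fix a assume "a \<in> \<alpha> z"
      have "norm (of_real (w x a - w y a) * (m z a - a)) = \<bar>w x a - w y a\<bar> * dist a (m z a)"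
        by (simp only: norm_mult norm_of_real dist_norm norm_minus_commute)
      also have "\<dots> \<le> dist x y * (2 / \<delta>) * \<eta>"
        using w_lip m\<alpha>(2)[OF z \<open>a \<in> \<alpha> z\<close>] \<delta>(1) by (intro mult_mono) auto
      finally show "norm (of_real (w x a - w y a) * (m z a - a)) \<le> dist x y * (2 / \<delta>) * \<eta>" .
    qed
    also have "\<dots> = real n * \<eta> * (2 / \<delta>) * dist x y" using \<alpha>(2)[OF z] by simp
    also have "\<dots> \<le> 1/2 * dist x y" using n\<eta> by (rule mult_right_mono) auto
    finally show ?thesis .
  qed
  have supp: "g z x = 0" if z: "z \<in> Z" and x: "x \<notin> \<Omega>" for z x
    unfolding g_def
  proof (rule sum.neutral, rule ballI)
    fix a assume "a \<in> \<alpha> z"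
    then have "\<delta> \<le> dist a x" using \<Omega>[OF z] x by (force simp: subset_iff not_less)
    then have "w x a = 0" using \<delta>(1) by (simp add: w_def dist_commute field_simps)
    then show "of_real (w x a) * (m z a - a) = 0" by simp
  qed
  \<comment> \<open>The configurations have no global labelling over \<open>Z\<close>. Near
    \<open>z0\<close> the points of \<open>\<alpha> z\<close> are labelled by those of
    \<open>\<alpha> z0\<close> through the branches \<open>f a\<close>, and the sum is reindexed
    accordingly.\<close>
  have cont: "continuous_on (Z \<times> UNIV) (\<lambda>p. g (fst p) (snd p))"
  proof (rule continuous_on_localI)
    fix p assume "p \<in> Z \<times> (UNIV :: complex set)"
    then have z0: "fst p \<in> Z" by auto
    define z0 where "z0 = fst p"
    note z0 = z0[folded z0_def]
    have "\<forall>a. \<exists>N. a \<in> \<alpha> z0 \<longrightarrow> open N \<and> z0 \<in> N \<and> (\<forall>z'\<in>Z. z' \<in> N \<longrightarrow> \<alpha> z' \<inter> ball a (\<delta>/2) \<noteq> {})"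
      using hits_openE[OF \<alpha>(1) z0] \<delta>(1) by (metis centre_in_ball half_gt_zero open_ball)
    then obtain N where N: "\<And>a. a \<in> \<alpha> z0 \<Longrightarrow> open (N a) \<and> z0 \<in> N a \<and> (\<forall>z'\<in>Z. z' \<in> N a \<longrightarrow> \<alpha> z' \<inter> ball a (\<delta>/2) \<noteq> {})"
      by metis
    define M where "M = (\<Inter>a\<in>\<alpha> z0. N a)"
    have M: "open M" "z0 \<in> M" using N \<alpha>(2)[OF z0] by (auto simp: M_def)
    define f where "f = (\<lambda>a z. SOME b. b \<in> \<alpha> z \<and> dist a b < \<delta>/2)"
    have f: "f a z \<in> \<alpha> z" "dist a (f a z) < \<delta>/2" if "a \<in> \<alpha> z0" "z \<in> Z \<inter> M" for a z
    proof -
      have "\<exists>b. b \<in> \<alpha> z \<and> dist a b < \<delta>/2" using N[OF that(1)] that by (auto simp: M_def)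
      from someI_ex[OF this] show "f a z \<in> \<alpha> z" "dist a (f a z) < \<delta>/2" by (auto simp: f_def)
    qed
    have cf: "continuous_on (Z \<inter> M) (f a)" if "a \<in> \<alpha> z0" for a
    proof (rule selection_continuous[OF \<alpha>(1), where c = "\<lambda>_. a" and r = "\<delta>/2"])
      fix z b assume "z \<in> Z \<inter> M" "b \<in> \<alpha> z" "dist a b < \<delta>/2"
      then show "b = f a z" using separated_unique[of \<delta> "\<alpha> z" b "f a z" a] f[OF that] \<delta>(2) by auto
    qed (use f[OF that] in auto)
    have cm: "continuous_on (Z \<inter> M) (\<lambda>z. m z (f a z))" if "a \<in> \<alpha> z0" for a
    proof (rule selection_continuous[OF \<beta>(1), where c = "f a" and r = "\<eta>"])
      show "continuous_on (Z \<inter> M) (f a)" by (rule cf[OF that])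
      fix z assume z: "z \<in> Z \<inter> M"
      show "m z (f a z) \<in> \<beta> z \<and> dist (f a z) (m z (f a z)) < \<eta>" using m\<alpha>[of z "f a z"] z f[OF that] by auto
      fix b assume "b \<in> \<beta> z" "dist (f a z) b < \<eta>"
      then show "b = m z (f a z)" using uniq[of z "f a z" b] z f[OF that] by auto
    qed auto
    have bij: "bij_betw (\<lambda>a. f a z) (\<alpha> z0) (\<alpha> z)" if z: "z \<in> Z \<inter> M" for z
    proof -
      have inj: "inj_on (\<lambda>a. f a z) (\<alpha> z0)"
      proof (rule inj_onI)
        fix a b assume ab: "a \<in> \<alpha> z0" "b \<in> \<alpha> z0" "f a z = f b z"
        then show "a = b"
          using separated_unique[of \<delta> "\<alpha> z0" a b "f a z"] f(2)[OF ab(1) z] f(2)[OF ab(2) z] \<delta>(2)[OF z0] by (simp add: dist_commute)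
      qed
      moreover have "(\<lambda>a. f a z) ` \<alpha> z0 = \<alpha> z"
        by (rule card_subset_eq) (use z f \<alpha>(2) z0 card_image[OF inj] in auto)
      ultimately show ?thesis by (simp add: bij_betw_def)
    qed
    have "continuous_on ((Z \<inter> M) \<times> UNIV) (\<lambda>p. \<Sum>a\<in>\<alpha> z0. of_real (w (snd p) (f a (fst p))) * (m (fst p) (f a (fst p)) - f a (fst p)))"
    proof (rule continuous_on_sum)
      fix a assume a: "a \<in> \<alpha> z0"
      have 1: "continuous_on ((Z \<inter> M) \<times> UNIV) (\<lambda>p. f a (fst p))"
        by (rule continuous_on_compose2[OF cf[OF a]]) (auto intro!: continuous_intros)
      have 2: "continuous_on ((Z \<inter> M) \<times> UNIV) (\<lambda>p. m (fst p) (f a (fst p)))"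
        by (rule continuous_on_compose2[OF cm[OF a]]) (auto intro!: continuous_intros)
      show "continuous_on ((Z \<inter> M) \<times> UNIV) (\<lambda>p. of_real (w (snd p) (f a (fst p))) * (m (fst p) (f a (fst p)) - f a (fst p)))"
        unfolding w_def by (intro continuous_intros 1 2) (use \<delta>(1) in auto)
    qed
    moreover have "g z x = (\<Sum>a\<in>\<alpha> z0. of_real (w x (f a z)) * (m z (f a z) - f a z))" if "z \<in> Z \<inter> M" for z x
      unfolding g_def by (rule sum.reindex_bij_betw[OF bij[OF that], symmetric])
    ultimately have "continuous_on ((Z \<inter> M) \<times> UNIV) (\<lambda>p. g (fst p) (snd p))"
      by (subst continuous_on_cong[OF refl]) auto
    moreover have "(Z \<times> UNIV) \<inter> (M \<times> UNIV) = (Z \<inter> M) \<times> (UNIV :: complex set)" by auto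
    ultimately show "\<exists>T. open T \<and> p \<in> T \<and> continuous_on (Z \<times> UNIV \<inter> T) (\<lambda>p. g (fst p) (snd p))"
      using M z0_def by (intro exI[of _ "M \<times> UNIV"]) (auto intro!: open_Times simp: mem_Times_iff)
  qed
  obtain \<Psi> where \<Psi>: "homeo_family Z \<Omega> (\<lambda>z x. x + g z x) \<Psi>"
    using homeo_family_perturbation[OF cont lip supp] by blast
  \<comment> \<open>At a point of the configuration all other bumps vanish, since their centres are
    at distance at least \<open>\<delta>\<close>.\<close>
  have at: "a + g z a = m z a" if z: "z \<in> Z" and a: "a \<in> \<alpha> z" for z a
  proof -
    have "g z a = (\<Sum>a'\<in>{a}. of_real (w a a') * (m z a' - a'))"
      unfolding g_def
    proof (rule sum.mono_neutral_right)
      show "\<forall>i\<in>\<alpha> z - {a}. of_real (w a i) * (m z i - i) = 0"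
      proof
        fix i assume "i \<in> \<alpha> z - {a}"
        then have "\<delta> \<le> dist a i" using \<delta>(2)[OF z] a by (auto simp: separated_def)
        then have "w a i = 0" using \<delta>(1) by (simp add: w_def field_simps)
        then show "of_real (w a i) * (m z i - i) = 0" by simp
      qed
    qed (use a \<alpha>(2)[OF z] in auto)
    then show ?thesis by (simp add: w_def)
  qed
  have "(\<lambda>x. x + g z x) ` \<alpha> z = \<beta> z" if z: "z \<in> Z" for z
  proof (rule card_subset_eq)
    show "(\<lambda>x. x + g z x) ` \<alpha> z \<subseteq> \<beta> z" using at[OF z] m\<alpha>[OF z] by auto
    have "\<Psi> z (x + g z x) = x" for x using \<Psi> z by (simp add: homeo_family_def)
    then have "inj_on (\<lambda>x. x + g z x) (\<alpha> z)" by (rule inj_on_inverseI)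
    from card_image[OF this] show "card ((\<lambda>x. x + g z x) ` \<alpha> z) = card (\<beta> z)"
      using \<alpha>(2)[OF z] \<beta>(2)[OF z] by simp
  qed (use \<beta>(2)[OF z] in auto)
  \<comment> \<open>Without displacement the perturbation is zero. When short moves are composed,
    this keeps every stage the identity at time 0.\<close>
  moreover have "(\<lambda>x. x + g z x) = (\<lambda>x. x)" if z: "z \<in> Z" "\<alpha> z = \<beta> z" for z
  proof -
    have "m z a = a" if "a \<in> \<alpha> z" for a
      using uniq[OF z(1) that, of a] that z(2) \<eta> by simp
    then have "g z x = 0" for x unfolding g_def by (intro sum.neutral) simp
    then show ?thesis by simp
  qed
  ultimately show ?thesis using \<Psi> by blast
qed

section \<open>Uniform constants by compactness, and extension in short time steps\<close>

lemma compact_uniform: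
  fixes Z :: "'z::metric_space set"
  assumes "compact Z" and "\<And>z. z \<in> Z \<Longrightarrow> \<exists>N. open N \<and> z \<in> N \<and> (\<exists>\<delta>>0. \<forall>z'\<in>Z \<inter> N. P z' (\<delta>::real))"
    and mono: "\<And>z \<delta> \<delta>'. P z \<delta> \<Longrightarrow> 0 < \<delta>' \<Longrightarrow> \<delta>' \<le> \<delta> \<Longrightarrow> P z \<delta>'"
  shows "\<exists>\<delta>>0. \<forall>z\<in>Z. P z \<delta>"
proof -
  obtain N \<delta> where N: "\<And>z. z \<in> Z \<Longrightarrow> open (N z) \<and> z \<in> N z \<and> 0 < (\<delta> z :: real) \<and> (\<forall>z'\<in>Z \<inter> N z. P z' (\<delta> z))"
    using assms(2) by metis
  obtain C where C: "C \<subseteq> Z" "finite C" "Z \<subseteq> (\<Union>c\<in>C. N c)"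
    by (rule compactE_image[OF assms(1), of Z N]) (use N in auto)
  define d where "d = Min (insert 1 (\<delta> ` C))"
  have "0 < d" unfolding d_def using C N by (subst Min_gr_iff) auto
  moreover have "P z d" if "z \<in> Z" for z
  proof -
    obtain c where c: "c \<in> C" "z \<in> N c" using C(3) \<open>z \<in> Z\<close> by blast
    have "d \<le> \<delta> c" unfolding d_def using C c by (intro Min_le) auto
    then show ?thesis using mono[of z "\<delta> c" d] N[of c] c C \<open>0 < d\<close> that by auto
  qed
  ultimately show ?thesis by blast
qed

text \<open>Each point of \<open>\<sigma> z0\<close> is assigned a point of
  \<open>\<sigma> z\<close> in its own disjoint neighbourhood. The assignment is injective, and
  equal cardinality makes it bijective.\<close>

lemma nearby_configuration:
  fixes \<sigma> :: "'z::metric_space \<Rightarrow> 'a::metric_space set"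
  assumes \<sigma>: "hits_open Z \<sigma>" "\<And>z. z \<in> Z \<Longrightarrow> finite (\<sigma> z) \<and> card (\<sigma> z) = n" and z0: "z0 \<in> Z" and e: "0 < e"
  obtains N f where "open N" "z0 \<in> N" "\<And>z. z \<in> Z \<Longrightarrow> z \<in> N \<Longrightarrow> bij_betw (f z) (\<sigma> z0) (\<sigma> z)"
    "\<And>z a. z \<in> Z \<Longrightarrow> z \<in> N \<Longrightarrow> a \<in> \<sigma> z0 \<Longrightarrow> dist a (f z a) < e"
proof -
  obtain D where D: "\<And>a. a \<in> \<sigma> z0 \<Longrightarrow> open (D a) \<and> a \<in> D a"
    "\<And>a b. a \<in> \<sigma> z0 \<Longrightarrow> b \<in> \<sigma> z0 \<Longrightarrow> a \<noteq> b \<Longrightarrow> D a \<inter> D b = {}"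
    using disjoint_neighbourhoods[of "\<sigma> z0"] \<sigma>(2)[OF z0] by metis
  have "\<forall>a. \<exists>N. a \<in> \<sigma> z0 \<longrightarrow> open N \<and> z0 \<in> N \<and> (\<forall>z'\<in>Z. z' \<in> N \<longrightarrow> \<sigma> z' \<inter> (ball a e \<inter> D a) \<noteq> {})"
    using hits_openE[OF \<sigma>(1) z0] D e by (metis IntI centre_in_ball open_Int open_ball)
  then obtain N where N: "\<And>a. a \<in> \<sigma> z0 \<Longrightarrow> open (N a) \<and> z0 \<in> N a \<and> (\<forall>z'\<in>Z. z' \<in> N a \<longrightarrow> \<sigma> z' \<inter> (ball a e \<inter> D a) \<noteq> {})"
    by metis
  define M where "M = (\<Inter>a\<in>\<sigma> z0. N a)"
  have M: "open M" "z0 \<in> M" using N \<sigma>(2)[OF z0] by (auto simp: M_def)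
  define f where "f = (\<lambda>z a. SOME b. b \<in> \<sigma> z \<and> b \<in> ball a e \<inter> D a)"
  have f: "f z a \<in> \<sigma> z" "f z a \<in> ball a e" "f z a \<in> D a" if "a \<in> \<sigma> z0" "z \<in> Z" "z \<in> M" for a z
  proof -
    have "\<exists>b. b \<in> \<sigma> z \<and> b \<in> ball a e \<inter> D a" using N[OF that(1)] that by (auto simp: M_def)
    from someI_ex[OF this] show "f z a \<in> \<sigma> z" "f z a \<in> ball a e" "f z a \<in> D a" by (auto simp: f_def)
  qed
  have "bij_betw (f z) (\<sigma> z0) (\<sigma> z)" if z: "z \<in> Z" "z \<in> M" for z
  proof -
    have inj: "inj_on (f z) (\<sigma> z0)"
    proof (rule inj_onI, rule ccontr)
      fix a b assume ab: "a \<in> \<sigma> z0" "b \<in> \<sigma> z0" "f z a = f z b" "a \<noteq> b"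
      then show False using D(2)[OF ab(1,2,4)] f(3)[OF ab(1) z] f(3)[OF ab(2) z] by auto
    qed
    moreover have "f z ` \<sigma> z0 = \<sigma> z"
      by (rule card_subset_eq) (use z f \<sigma>(2) z0 card_image[OF inj] in auto)
    ultimately show ?thesis by (simp add: bij_betw_def)
  qed
  then show ?thesis using that[of M f] M f(2) by auto
qed

text \<open>Compactness gives one separation constant and one time step valid for all parameters,
  and the extension is a composite of short moves over equal steps. The parameter space
  \<open>K\<close> later carries a homotopy between loops.\<close>

lemma isotopy_extension:
  fixes \<sigma> :: "real \<times> 'k::metric_space \<Rightarrow> complex set"
  assumes K: "compact K" and \<sigma>: "hits_open ({0..1} \<times> K) \<sigma>"
    "\<And>z. z \<in> {0..1} \<times> K \<Longrightarrow> finite (\<sigma> z) \<and> card (\<sigma> z) = n"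
    and \<Omega>: "open \<Omega>" "\<And>z. z \<in> {0..1} \<times> K \<Longrightarrow> \<sigma> z \<subseteq> \<Omega>"
  shows "\<exists>\<Phi> \<Psi>. homeo_family ({0..1} \<times> K) \<Omega> \<Phi> \<Psi> \<and>
    (\<forall>t\<in>{0..1}. \<forall>k\<in>K. \<Phi> (t, k) ` \<sigma> (0, k) = \<sigma> (t, k)) \<and> (\<forall>k\<in>K. \<Phi> (0, k) = (\<lambda>x. x))"
proof -
  define Z where "Z = {0..1::real} \<times> K"
  have Z: "compact Z" unfolding Z_def using K by (intro compact_Times) auto
  note \<sigma> = \<sigma>[folded Z_def]
  note \<Omega> = \<Omega>(1) \<Omega>(2)[folded Z_def]
  have "\<exists>\<delta>>0. \<forall>z\<in>Z. separated \<delta> (\<sigma> z) \<and> (\<forall>a\<in>\<sigma> z. ball a \<delta> \<subseteq> \<Omega>)"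
  proof (rule compact_uniform[OF Z])
    fix z0 assume z0: "z0 \<in> Z"
    have "\<exists>e>0. \<forall>a\<in>\<sigma> z0. ball a e \<subseteq> \<Omega> \<and> (\<forall>b\<in>\<sigma> z0. a \<noteq> b \<longrightarrow> e \<le> dist a b)"
    proof -
      have "\<forall>a\<in>\<sigma> z0. \<exists>e>0. ball a e \<subseteq> \<Omega> \<and> (\<forall>b\<in>\<sigma> z0. a \<noteq> b \<longrightarrow> e \<le> dist a b)"
      proof
        fix a assume a: "a \<in> \<sigma> z0"
        obtain e1 where e1: "e1 > 0" "ball a e1 \<subseteq> \<Omega>" using \<Omega> z0 a by (meson open_contains_ball subsetD)
        obtain e2 where e2: "e2 > 0" "\<forall>b\<in>\<sigma> z0. b \<noteq> a \<longrightarrow> e2 \<le> dist a b"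
          using finite_set_avoid[of "\<sigma> z0" a] \<sigma>(2)[OF z0] by blast
        show "\<exists>e>0. ball a e \<subseteq> \<Omega> \<and> (\<forall>b\<in>\<sigma> z0. a \<noteq> b \<longrightarrow> e \<le> dist a b)"
          using e1 e2 by (intro exI[of _ "min e1 e2"]) (auto intro: subset_ball[THEN subset_trans] min.coboundedI2)
      qed
      then obtain e where e: "\<And>a. a \<in> \<sigma> z0 \<Longrightarrow> e a > 0 \<and> ball a (e a) \<subseteq> \<Omega> \<and> (\<forall>b\<in>\<sigma> z0. a \<noteq> b \<longrightarrow> e a \<le> dist a b)"
        by metis
      define d where "d = Min (insert 1 (e ` \<sigma> z0))"
      have "0 < d" unfolding d_def using \<sigma>(2)[OF z0] e by (subst Min_gr_iff) auto
      moreover have "d \<le> e a" if "a \<in> \<sigma> z0" for a unfolding d_def using \<sigma>(2)[OF z0] that by (intro Min_le) auto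
      ultimately show ?thesis using e by (intro exI[of _ d]) (meson order_trans subset_ball)
    qed
    then obtain e where e: "e > 0" "\<And>a. a \<in> \<sigma> z0 \<Longrightarrow> ball a e \<subseteq> \<Omega>"
      "\<And>a b. a \<in> \<sigma> z0 \<Longrightarrow> b \<in> \<sigma> z0 \<Longrightarrow> a \<noteq> b \<Longrightarrow> e \<le> dist a b" by blast
    \<comment> \<open>Two points at distance \<open>e\<close> that each move by less than
      \<open>e/4\<close> remain \<open>e/2\<close> apart, and a ball of radius \<open>e/2\<close>
      around a moved point stays in the ball of radius \<open>e\<close> around the old one.\<close>
    obtain N f where N: "open N" "z0 \<in> N" "\<And>z. z \<in> Z \<Longrightarrow> z \<in> N \<Longrightarrow> bij_betw (f z) (\<sigma> z0) (\<sigma> z)"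
      "\<And>z a. z \<in> Z \<Longrightarrow> z \<in> N \<Longrightarrow> a \<in> \<sigma> z0 \<Longrightarrow> dist a (f z a) < e/4"
      using nearby_configuration[OF \<sigma> z0, of "e/4"] e(1) by auto
    have "separated (e/2) (\<sigma> z) \<and> (\<forall>a\<in>\<sigma> z. ball a (e/2) \<subseteq> \<Omega>)" if z: "z \<in> Z \<inter> N" for z
    proof
      show "separated (e/2) (\<sigma> z)" unfolding separated_def
      proof (intro ballI impI)
        fix x y assume "x \<in> \<sigma> z" "y \<in> \<sigma> z" "x \<noteq> y"
        moreover have "f z ` \<sigma> z0 = \<sigma> z" using N(3)[of z] z unfolding bij_betw_def by auto
        ultimately obtain a b where ab: "a \<in> \<sigma> z0" "b \<in> \<sigma> z0" "x = f z a" "y = f z b" by blast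
        have "a \<noteq> b" using \<open>x \<noteq> y\<close> ab by auto
        then have "e \<le> dist a b" using e ab by auto
        also have "\<dots> \<le> dist a x + dist x y + dist y b"
          using dist_triangle[of a b x] dist_triangle[of x b y] by linarith
        finally show "e/2 \<le> dist x y" using N(4)[of z a] N(4)[of z b] z ab by (auto simp: dist_commute)
      qed
      show "\<forall>a\<in>\<sigma> z. ball a (e/2) \<subseteq> \<Omega>"
      proof
        fix x assume "x \<in> \<sigma> z"
        then obtain a where a: "a \<in> \<sigma> z0" "x = f z a" using N(3)[of z] z unfolding bij_betw_def by auto
        have "dist a x < e/4" using N(4)[of z a] z a by auto
        then have "ball x (e/2) \<subseteq> ball a e"
        proof (intro subsetI)
          fix y assume "y \<in> ball x (e/2)"
          then show "y \<in> ball a e" using dist_triangle[of a y x] \<open>dist a x < e/4\<close> e(1) by auto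
        qed
        then show "ball x (e/2) \<subseteq> \<Omega>" using e(2)[OF a(1)] by auto
      qed
    qed
    then show "\<exists>N. open N \<and> z0 \<in> N \<and> (\<exists>\<delta>>0. \<forall>z'\<in>Z \<inter> N. separated \<delta> (\<sigma> z') \<and> (\<forall>a\<in>\<sigma> z'. ball a \<delta> \<subseteq> \<Omega>))"
      using N(1,2) e(1) by (metis half_gt_zero)
  next
    fix z and \<delta> \<delta>' :: real assume "separated \<delta> (\<sigma> z) \<and> (\<forall>a\<in>\<sigma> z. ball a \<delta> \<subseteq> \<Omega>)" "0 < \<delta>'" "\<delta>' \<le> \<delta>"
    then show "separated \<delta>' (\<sigma> z) \<and> (\<forall>a\<in>\<sigma> z. ball a \<delta>' \<subseteq> \<Omega>)"
      unfolding separated_def by (meson order_trans subset_ball)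
  qed
  then obtain \<delta> where \<delta>: "\<delta> > 0" "\<And>z. z \<in> Z \<Longrightarrow> separated \<delta> (\<sigma> z)" "\<And>z a. z \<in> Z \<Longrightarrow> a \<in> \<sigma> z \<Longrightarrow> ball a \<delta> \<subseteq> \<Omega>"
    by blast
  \<comment> \<open>The displacement bound under which \<open>short_move\<close> applies.\<close>
  define \<eta> where "\<eta> = \<delta> / (4 * (real n + 1))"
  have \<eta>: "\<eta> > 0" using \<delta> by (simp add: \<eta>_def)
  have "\<forall>z. \<exists>N. z \<in> Z \<longrightarrow> open N \<and> z \<in> N \<and> (\<forall>u\<in>Z \<inter> N. \<forall>v\<in>Z \<inter> N. \<forall>a\<in>\<sigma> u. \<exists>b\<in>\<sigma> v. dist a b < \<eta>)"
  proof (intro allI)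
    fix z0 show "\<exists>N. z0 \<in> Z \<longrightarrow> open N \<and> z0 \<in> N \<and> (\<forall>u\<in>Z \<inter> N. \<forall>v\<in>Z \<inter> N. \<forall>a\<in>\<sigma> u. \<exists>b\<in>\<sigma> v. dist a b < \<eta>)"
    proof (cases "z0 \<in> Z")
      case True
      then obtain N f where N: "open N" "z0 \<in> N" "\<And>z. z \<in> Z \<Longrightarrow> z \<in> N \<Longrightarrow> bij_betw (f z) (\<sigma> z0) (\<sigma> z)"
        "\<And>z a. z \<in> Z \<Longrightarrow> z \<in> N \<Longrightarrow> a \<in> \<sigma> z0 \<Longrightarrow> dist a (f z a) < \<eta>/2"
        using nearby_configuration[OF \<sigma>, of z0 "\<eta>/2"] \<eta> by auto
      have "\<exists>b\<in>\<sigma> v. dist a b < \<eta>" if uv: "u \<in> Z \<inter> N" "v \<in> Z \<inter> N" "a \<in> \<sigma> u" for u v a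
      proof -
        obtain c where c: "c \<in> \<sigma> z0" "a = f u c" using N(3)[of u] uv unfolding bij_betw_def by auto
        have "f v c \<in> \<sigma> v" using N(3)[of v] uv c unfolding bij_betw_def by auto
        moreover have "dist a (f v c) < \<eta>"
          using dist_triangle3[of a "f v c" c] N(4)[of u c] N(4)[of v c] uv c by auto
        ultimately show ?thesis by blast
      qed
      then show ?thesis using N(1,2) by blast
    qed auto
  qed
  then obtain N where N: "\<And>z. z \<in> Z \<Longrightarrow> open (N z) \<and> z \<in> N z \<and>
     (\<forall>u\<in>Z \<inter> N z. \<forall>v\<in>Z \<inter> N z. \<forall>a\<in>\<sigma> u. \<exists>b\<in>\<sigma> v. dist a b < \<eta>)" by metis
  \<comment> \<open>A Lebesgue number of the cover by the sets \<open>N z\<close>: parameters closer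
    than \<open>d\<close> lie in a common one.\<close>
  obtain d where d: "d > 0" "\<And>z. z \<in> Z \<Longrightarrow> \<exists>c\<in>Z. ball z d \<subseteq> N c"
  proof -
    have 1: "Z \<subseteq> \<Union> (N ` Z)" and 2: "\<And>B. B \<in> N ` Z \<Longrightarrow> open B" using N by auto
    obtain e where e: "0 < e" "\<forall>x\<in>Z. \<exists>G\<in>N ` Z. ball x e \<subseteq> G"
      by (rule Heine_Borel_lemma[OF Z 1 2]) auto
    have "\<exists>c\<in>Z. ball z e \<subseteq> N c" if "z \<in> Z" for z using bspec[OF e(2) that] by (rule bexE) auto
    then show ?thesis using that[OF e(1)] by simp
  qed
  have near: "\<exists>b\<in>\<sigma> v. dist a b < \<eta>" if "u \<in> Z" "v \<in> Z" "dist u v < d" "a \<in> \<sigma> u" for u v a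
  proof -
    have "\<exists>c\<in>Z. ball u d \<subseteq> N c" by (rule d(2)[OF that(1)])
    then obtain c where c: "c \<in> Z" "ball u d \<subseteq> N c" by blast
    have "u \<in> Z \<inter> N c" "v \<in> Z \<inter> N c" using c(2) that d(1) by auto
    then show ?thesis using N[OF c(1)] that(4) by blast
  qed
  obtain M :: nat where M: "M > 0" "1 / real M < d"
    using d(1) by (metis One_nat_def Suc_le_eq nat_approx_posE of_nat_0_less_iff zero_less_Suc)
  \<comment> \<open>\<open>min t (j / M)\<close> freezes the motion at time \<open>j / M\<close>.
    Each stage is thereby a family over all of \<open>Z\<close>, and successive stages differ by a
    short move.\<close>
  have "\<exists>\<Phi> \<Psi>. homeo_family Z \<Omega> \<Phi> \<Psi> \<and> (\<forall>t\<in>{0..1}. \<forall>k\<in>K. \<Phi> (t, k) ` \<sigma> (0, k) = \<sigma> (min t (real j / real M), k)) \<and>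
     (\<forall>k\<in>K. \<Phi> (0, k) = (\<lambda>x. x))" if "j \<le> M" for j
    using that
  proof (induction j)
    case 0
    show ?case by (rule exI[of _ "\<lambda>z x. x"], rule exI[of _ "\<lambda>z x. x"]) (auto simp: homeo_family_id)
  next
    case (Suc j)
    then obtain \<Phi> \<Psi> where \<Phi>: "homeo_family Z \<Omega> \<Phi> \<Psi>" "\<forall>t\<in>{0..1}. \<forall>k\<in>K. \<Phi> (t, k) ` \<sigma> (0, k) = \<sigma> (min t (real j / real M), k)"
      "\<forall>k\<in>K. \<Phi> (0, k) = (\<lambda>x. x)" by auto
    define a where "a = (\<lambda>z::real \<times> 'k. (min (fst z) (real j / real M), snd z))"
    define b where "b = (\<lambda>z::real \<times> 'k. (min (fst z) (real (Suc j) / real M), snd z))"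
    have ab: "a z \<in> Z" "b z \<in> Z" if "z \<in> Z" for z using that Suc M by (auto simp: Z_def a_def b_def)
    have "dist (a z) (b z) < d" for z
    proof -
      have step: "dist (min x y, k) (min x (y + e), k) \<le> e" if "0 \<le> e" for x y e :: real and k :: 'k
        using that by (auto simp: dist_Pair_Pair dist_real_def min_def)
      have "real (Suc j) / real M = real j / real M + 1 / real M" by (simp add: add_divide_distrib)
      then have "dist (a z) (b z) \<le> 1 / real M"
        unfolding a_def b_def using step[of "1 / real M"] by simp
      then show ?thesis using M by simp
    qed
    note close = near[OF ab this]
    have ca: "continuous_on Z a" "continuous_on Z b" unfolding a_def b_def by (intro continuous_intros)+
    \<comment> \<open>For the change of parameter by \<open>a\<close> and \<open>b\<close>,
      \<open>hits_open_image\<close> is used with \<open>h = snd\<close>; the factor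
      \<open>{0}\<close> is a dummy.\<close>
    have cs: "continuous_on ({0::real} \<times> (UNIV :: complex set)) snd" by (intro continuous_intros)
    have ho: "hits_open Z (\<lambda>z. \<sigma> (a z))" "hits_open Z (\<lambda>z. \<sigma> (b z))"
      using hits_open_image[OF \<sigma>(1), of "{0::real}" UNIV snd Z "\<lambda>_. 0" a]
        hits_open_image[OF \<sigma>(1), of "{0::real}" UNIV snd Z "\<lambda>_. 0" b] ca ab cs
      by simp_all
    have "\<exists>\<Phi>' \<Psi>'. homeo_family Z \<Omega> \<Phi>' \<Psi>' \<and> (\<forall>z\<in>Z. \<Phi>' z ` \<sigma> (a z) = \<sigma> (b z)) \<and>
        (\<forall>z\<in>Z. \<sigma> (a z) = \<sigma> (b z) \<longrightarrow> \<Phi>' z = (\<lambda>x. x))"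
    proof (rule short_move[OF ho(1) _ ho(2) _ \<delta>(1), of n])
      fix z assume z: "z \<in> Z"
      show "finite (\<sigma> (a z)) \<and> card (\<sigma> (a z)) = n" "finite (\<sigma> (b z)) \<and> card (\<sigma> (b z)) = n"
        using \<sigma>(2) ab[OF z] by blast+
      show "separated \<delta> (\<sigma> (a z)) \<and> separated \<delta> (\<sigma> (b z))" using \<delta>(2) ab[OF z] by blast
      fix x assume x: "x \<in> \<sigma> (a z)"
      show "ball x \<delta> \<subseteq> \<Omega>" by (rule \<delta>(3)[OF ab(1)[OF z] x])
      show "\<exists>y\<in>\<sigma> (b z). dist x y < \<delta> / (4 * (real n + 1))" using close[OF z z x] by (simp add: \<eta>_def)
    qed
    then obtain \<Phi>' \<Psi>' where \<Phi>': "homeo_family Z \<Omega> \<Phi>' \<Psi>'" "\<forall>z\<in>Z. \<Phi>' z ` \<sigma> (a z) = \<sigma> (b z)"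
      "\<forall>z\<in>Z. \<sigma> (a z) = \<sigma> (b z) \<longrightarrow> \<Phi>' z = (\<lambda>x. x)" by blast
    show ?case
    proof (intro exI conjI ballI)
      show "homeo_family Z \<Omega> (\<lambda>z x. \<Phi>' z (\<Phi> z x)) (\<lambda>z x. \<Psi> z (\<Psi>' z x))"
        by (rule homeo_family_comp[OF \<Phi>'(1) \<Phi>(1)])
      fix k assume k: "k \<in> K"
      have "a (0, k) = (0, k)" "b (0, k) = (0, k)" by (auto simp: a_def b_def)
      then show "(\<lambda>x. \<Phi>' (0, k) (\<Phi> (0, k) x)) = (\<lambda>x. x)" using \<Phi>(3) \<Phi>'(3) k by (simp add: Z_def)
      fix t :: real assume t: "t \<in> {0..1}"
      have "(\<lambda>x. \<Phi>' (t, k) (\<Phi> (t, k) x)) ` \<sigma> (0, k) = \<Phi>' (t, k) ` \<sigma> (a (t, k))"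
        using \<Phi>(2) t k by (simp add: a_def flip: image_image)
      also have "\<dots> = \<sigma> (b (t, k))" using \<Phi>'(2) t k by (simp add: Z_def)
      finally show "(\<lambda>x. \<Phi>' (t, k) (\<Phi> (t, k) x)) ` \<sigma> (0, k) = \<sigma> (min t (real (Suc j) / real M), k)"
        by (simp add: b_def)
    qed
  qed
  from this[of M] obtain \<Phi> \<Psi> where \<Phi>: "homeo_family Z \<Omega> \<Phi> \<Psi>"
    "\<And>t k. t \<in> {0..1} \<Longrightarrow> k \<in> K \<Longrightarrow> \<Phi> (t, k) ` \<sigma> (0, k) = \<sigma> (min t (real M / real M), k)"
    "\<forall>k\<in>K. \<Phi> (0, k) = (\<lambda>x. x)" by blast
  have "\<Phi> (t, k) ` \<sigma> (0, k) = \<sigma> (t, k)" if "t \<in> {0..1}" "k \<in> K" for t k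
    using \<Phi>(2)[OF that] that(1) M(1) by (simp add: min_absorb1)
  then show ?thesis using \<Phi>(1,3) unfolding Z_def by blast
qed

section \<open>The punctured disk\<close>

text \<open>Points outside \<open>\<Omega>\<close> are fixed, so by injectivity no point of
  \<open>X\<close> can leave \<open>X\<close>. The curve \<open>z\<close> selects a one-parameter
  family: it is used along the time axis and, at the final time, along the homotopy
  parameter.\<close>

lemma homeo_family_ambient:
  assumes \<Phi>: "homeo_family Z \<Omega> \<Phi> \<Psi>" and \<Omega>: "\<Omega> \<subseteq> X"
    and z: "continuous_on {0..1} z" "\<And>t. t \<in> {0..1} \<Longrightarrow> z t \<in> Z"
  shows "ambient X (\<lambda>t. \<Phi> (z t)) (\<lambda>t. \<Psi> (z t))"
proof -
  have inv: "\<Phi> k (\<Psi> k x) = x" "\<Psi> k (\<Phi> k x) = x" "x \<notin> \<Omega> \<Longrightarrow> \<Phi> k x = x" if "k \<in> Z" for k x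
    using \<Phi> that by (auto simp: homeo_family_def)
  have \<Phi>X: "\<Phi> k x \<in> X" if "k \<in> Z" "x \<in> X" for k x
    using inv[OF that(1)] that(2) \<Omega> by (metis subsetD)
  have \<Psi>X: "\<Psi> k x \<in> X" if "k \<in> Z" "x \<in> X" for k x
    using inv[OF that(1)] that(2) \<Omega> by (metis subsetD)
  have cz: "continuous_on ({0..1} \<times> X) (\<lambda>p. z (fst p))"
    by (rule continuous_on_compose2[OF z(1)]) (auto intro!: continuous_intros)
  have "continuous_on ({0..1} \<times> X) (\<lambda>p. \<Phi> (z (fst p)) (snd p))"
    by (rule joint_compose[where T = Z and Y = UNIV]) (use \<Phi> z(2) cz in \<open>auto simp: homeo_family_def intro!: continuous_intros\<close>)
  moreover have "continuous_on ({0..1} \<times> X) (\<lambda>p. \<Psi> (z (fst p)) (snd p))"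
    by (rule joint_compose[where T = Z and Y = UNIV]) (use \<Phi> z(2) cz in \<open>auto simp: homeo_family_def intro!: continuous_intros\<close>)
  ultimately show ?thesis using inv z(2) \<Phi>X \<Psi>X unfolding ambient_def by blast
qed

lemma homeomorphismD:
  assumes "homeomorphism S T f g"
  shows "x \<in> S \<Longrightarrow> f x \<in> T" "x \<in> S \<Longrightarrow> g (f x) = x" "y \<in> T \<Longrightarrow> g y \<in> S" "y \<in> T \<Longrightarrow> f (g y) = y"
    "continuous_on S f" "continuous_on T g"
  using assms by (auto simp: homeomorphism_def)

lemma homeo_class_fixing:
  assumes lc: "locally compact Y" "locally connected Y" and M: "M \<subseteq> Y"
  shows "homeo_class Y (homeos_fixing Y M)"
proof
  show "homeos_fixing Y M \<subseteq> homeos Y" by (auto simp: homeos_fixing_def)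
  have bd: "bd Y \<subseteq> Y" by (auto simp: bd_def)
  have "(\<lambda>x\<in>Y. x) ` M = M" using M by force
  then show "(\<lambda>x\<in>Y. x) \<in> homeos_fixing Y M"
    using id_homeos bd by (auto simp: homeos_fixing_def)
  fix f g assume fg: "f \<in> homeos_fixing Y M" "g \<in> homeos_fixing Y M" "(\<lambda>x\<in>Y. f (g x)) \<in> homeos Y"
  have "(\<lambda>x\<in>Y. f (g x)) ` M = f ` g ` M" using M by force
  then show "(\<lambda>x\<in>Y. f (g x)) \<in> homeos_fixing Y M"
    using fg bd by (auto simp: homeos_fixing_def)
next
  fix f g assume fg: "f \<in> homeos_fixing Y M" "g \<in> homeos Y" "homeomorphism Y Y f g"
  have inv: "\<And>x. x \<in> Y \<Longrightarrow> g (f x) = x" using fg by (auto simp: homeomorphism_def)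
  have "g ` M = g ` f ` M" using fg by (simp add: homeos_fixing_def)
  also have "\<dots> = M" using inv M by force
  finally have "g ` M = M" .
  moreover have "g x = x" if "x \<in> bd Y" for x
    using fg(1) inv[of x] that by (auto simp: homeos_fixing_def bd_def)
  ultimately show "g \<in> homeos_fixing Y M" using fg by (simp add: homeos_fixing_def)
qed (use lc in auto)

section \<open>Topology of the punctured disk and its boundary\<close>

locale punctured_disk =
  fixes D Q :: "complex set"
  assumes disk: "D homeomorphic cball (0::complex) 1" and finite_punctures: "finite Q"
    and punctures_interior: "Q \<subseteq> interior D"
begin

abbreviation "X \<equiv> D - Q"

lemma compact_disk: "compact D"
  using disk homeomorphic_compactness compact_cball by blast

text \<open>Invariance of domain, applied to the chart and to its inverse, matches the interior of
  \<open>D\<close> with the open unit disk.\<close>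

lemma disk_chart:
  obtains \<theta> \<theta>' where "homeomorphism D (cball (0::complex) 1) \<theta> \<theta>'" "\<theta> ` interior D = ball 0 1"
proof -
  obtain \<theta> \<theta>' where h: "homeomorphism D (cball (0::complex) 1) \<theta> \<theta>'"
    using disk unfolding homeomorphic_def by blast
  have c: "continuous_on D \<theta>" "continuous_on (cball 0 1) \<theta>'" "inj_on \<theta> D" "inj_on \<theta>' (cball 0 1)"
    using h unfolding homeomorphism_def by (auto intro: inj_on_inverseI)
  have "open (\<theta>' ` ball 0 1)"
    by (intro invariance_of_domain open_ball continuous_on_subset[OF c(2)] inj_on_subset[OF c(4)] ball_subset_cball)
  moreover have "\<theta>' ` ball 0 1 \<subseteq> D" using homeomorphismD(3)[OF h] by auto
  ultimately have 1: "\<theta>' ` ball 0 1 \<subseteq> interior D" by (rule interior_maximal[rotated])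
  have "open (\<theta> ` interior D)"
    by (intro invariance_of_domain open_interior continuous_on_subset[OF c(1)] inj_on_subset[OF c(3)] interior_subset)
  moreover have "\<theta> ` interior D \<subseteq> cball 0 1" using homeomorphismD(1)[OF h] interior_subset[of D] by blast
  ultimately have 2: "\<theta> ` interior D \<subseteq> ball 0 1" using interior_maximal[of "\<theta> ` interior D" "cball 0 1"] by simp
  have "ball 0 1 \<subseteq> \<theta> ` interior D"
  proof
    fix x assume x: "x \<in> ball (0::complex) 1"
    then have "\<theta> (\<theta>' x) = x" using homeomorphismD(4)[OF h] by auto
    then show "x \<in> \<theta> ` interior D" using 1 x by (metis imageI subsetD)
  qed
  then show ?thesis using that[OF h] 2 by blast
qed

lemma interior_punctured: "interior X = interior D - Q"
proof -
  have "open (interior D - Q)" using finite_punctures by (simp add: finite_imp_closed open_Diff)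
  then have "interior D - Q \<subseteq> interior X" using interior_subset[of D] by (intro interior_maximal) auto
  moreover have "interior X \<subseteq> interior D" by (rule interior_mono) auto
  moreover have "interior X \<subseteq> X" by (rule interior_subset)
  ultimately show ?thesis by auto
qed

text \<open>The punctures lie in the interior of \<open>D\<close> and are removed, so only the
  boundary of the disk itself remains.\<close>

lemma bd_punctured: "bd X = D - interior D"
  using interior_punctured punctures_interior interior_subset[of D] by (auto simp: bd_def)

lemma locally_compact_punctured: "locally compact X"
proof -
  have "closedin (top_of_set D) Q"
    using finite_punctures punctures_interior interior_subset[of D]
    by (intro closed_subset finite_imp_closed) auto
  moreover have "locally compact D" using compact_disk by (simp add: closed_imp_locally_compact compact_imp_closed)
  ultimately show ?thesis by (rule locally_diff_closed[rotated])
qed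

lemma locally_connected_punctured: "locally connected X"
proof -
  have "closedin (top_of_set D) Q"
    using finite_punctures punctures_interior interior_subset[of D]
    by (intro closed_subset finite_imp_closed) auto
  moreover have "locally connected D"
    using homeomorphic_locally[OF disk, of connected connected] homeomorphic_connectedness
      convex_imp_locally_connected[OF convex_cball] by metis
  ultimately show ?thesis by (rule locally_diff_closed[rotated])
qed

lemma ambient_interior:
  assumes "ambient X F G" "t \<in> {0..1}" "x \<in> interior X"
  shows "F t x \<in> interior X"
proof -
  have h: "homeomorphism X X (F t) (G t)" by (rule ambient_homeomorphism[OF assms(1,2)])
  have "open (F t ` interior X)"
    using h interior_subset[of X] by (intro invariance_of_domain)
      (auto simp: homeomorphism_def intro: continuous_on_subset inj_on_inverseI[of _ "G t"])
  moreover have "F t ` interior X \<subseteq> X" using h interior_subset[of X] unfolding homeomorphism_def by blast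
  ultimately show ?thesis using assms(3) interior_maximal by blast
qed

text \<open>Supplies the compact set that a push off the boundary is asked to leave pointwise
  fixed.\<close>

lemma ambient_trace_compact:
  assumes "ambient X F G" "b \<subseteq> interior X" "finite b"
  shows "compact ((\<lambda>z. F (fst z) (snd z)) ` ({0..1} \<times> b))"
    "(\<lambda>z. F (fst z) (snd z)) ` ({0..1} \<times> b) \<subseteq> interior X"
proof -
  have "continuous_on ({0..1} \<times> b) (\<lambda>z. F (fst z) (snd z))"
    by (rule continuous_on_subset[OF ambient_cont[OF assms(1)]]) (use assms interior_subset[of X] in auto)
  then show "compact ((\<lambda>z. F (fst z) (snd z)) ` ({0..1} \<times> b))"
    using assms by (intro compact_continuous_image) (auto intro: compact_Times finite_imp_compact)
  show "(\<lambda>z. F (fst z) (snd z)) ` ({0..1} \<times> b) \<subseteq> interior X"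
    using ambient_interior[OF assms(1)] assms(2) by force
qed

text \<open>A radial contraction of a collar of the boundary.\<close>

lemma collar_push:
  assumes C: "compact C" "C \<subseteq> interior D"
  obtains c where "continuous_on ({0..1} \<times> D) (\<lambda>z. c (fst z) (snd z))"
    "\<And>s x. s \<in> {0..1::real} \<Longrightarrow> x \<in> D \<Longrightarrow> c s x \<in> D" "\<And>x. x \<in> D \<Longrightarrow> c 0 x = x"
    "\<And>s. s \<in> {0..1} \<Longrightarrow> inj_on (c s) D" "\<And>x. x \<in> D \<Longrightarrow> c 1 x \<in> interior D"
    "\<And>s x. s \<in> {0..1} \<Longrightarrow> x \<in> C \<Longrightarrow> c s x = x"
proof -
  obtain \<theta> \<theta>' where h: "homeomorphism D (cball (0::complex) 1) \<theta> \<theta>'" and int: "\<theta> ` interior D = ball 0 1"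
    by (rule disk_chart)
  have CD: "C \<subseteq> D" using C interior_subset[of D] by auto
  have "compact (\<theta> ` C)"
    using h CD C by (intro compact_continuous_image) (auto simp: homeomorphism_def intro: continuous_on_subset)
  moreover have "\<theta> ` C \<subseteq> ball 0 1" using int C by auto
  ultimately obtain \<rho> where \<rho>: "0 < \<rho>" "\<rho> < 1" "\<theta> ` C \<subseteq> cball 0 \<rho>"
  proof (cases "\<theta> ` C = {}")
    case True
    then show ?thesis using that[of "1/2"] by auto
  next
    case False
    assume *: "compact (\<theta> ` C)" "\<theta> ` C \<subseteq> ball 0 1"
    obtain x where x: "x \<in> \<theta> ` C" "\<And>y. y \<in> \<theta> ` C \<Longrightarrow> norm y \<le> norm x"
      using continuous_attains_sup[OF *(1) False, of norm] by (auto intro: continuous_intros)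
    have "norm x < 1" using x * by auto
    then show ?thesis using that[of "max (1/2) (norm x)"] x(2) by (force simp: le_max_iff_disj)
  qed
  \<comment> \<open>The resulting radial map multiplies the excess of \<open>norm z\<close> over
    \<open>\<rho>\<close> by \<open>1 - s/2\<close>. The denominator
    \<open>max \<rho> (norm z)\<close> equals \<open>norm z\<close> wherever the excess is positive
    and stays away from 0 elsewhere.\<close>
  define a where "a = (\<lambda>s z. 1 - s / 2 * (max 0 (norm z - \<rho>) / max \<rho> (norm (z::complex))))"
  define k where "k = (\<lambda>s z. of_real (a s z) * z)"
  have frac: "0 \<le> max 0 (norm z - \<rho>) / max \<rho> (norm z)" "max 0 (norm z - \<rho>) / max \<rho> (norm z) \<le> 1" for z :: complex
    using \<rho> by (auto simp: divide_le_eq max_def)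
  have a: "1/2 \<le> a s z" "a s z \<le> 1" if "s \<in> {0..1}" for s z
  proof -
    have "s / 2 * (max 0 (norm z - \<rho>) / max \<rho> (norm z)) \<le> 1/2 * 1"
      using that frac by (intro mult_mono) auto
    moreover have "0 \<le> s / 2 * (max 0 (norm z - \<rho>) / max \<rho> (norm z))"
      using that frac by (intro mult_nonneg_nonneg) auto
    ultimately show "1/2 \<le> a s z" "a s z \<le> 1" by (auto simp: a_def)
  qed
  have nk: "norm (k s z) = norm z - s / 2 * max 0 (norm z - \<rho>)" if "s \<in> {0..1}" for s z
  proof -
    have "norm (k s z) = a s z * norm z"
      using a[OF that, of z] by (simp add: k_def norm_mult)
    also have "\<dots> = norm z - s / 2 * max 0 (norm z - \<rho>)"
    proof (cases "norm z \<le> \<rho>")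
      case False
      then have nz: "norm z \<noteq> 0" using \<rho> by linarith
      have "a s z = 1 - s / 2 * ((norm z - \<rho>) / norm z)" using False by (simp add: a_def)
      moreover have "(norm z - \<rho>) / norm z * norm z = norm z - \<rho>" using nz by simp
      ultimately have "a s z * norm z = norm z - s / 2 * (norm z - \<rho>)"
        by (simp only: left_diff_distrib mult.assoc mult_1)
      then show ?thesis using False by simp
    qed (simp add: a_def)
    finally show ?thesis .
  qed
  have kin: "k s z \<in> cball 0 1" if "s \<in> {0..1}" "z \<in> cball 0 1" for s z
  proof -
    have "0 \<le> s / 2 * max 0 (norm z - \<rho>)" using that by auto
    moreover have "norm z \<le> 1" using that by simp
    ultimately have "norm (k s z) \<le> 1" using nk[OF that(1), of z] by linarith
    then show ?thesis by simp
  qed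
  have k1: "k 1 z \<in> ball 0 1" if "z \<in> cball 0 1" for z
  proof -
    have "norm (k 1 z) = norm z - max 0 (norm z - \<rho>) / 2" using nk[of 1 z] by simp
    moreover have "norm z \<le> 1" using that by simp
    ultimately have "norm (k 1 z) < 1" using \<rho>(2) by (cases "norm z \<le> \<rho>") (simp_all add: field_simps)
    then show ?thesis by simp
  qed
  have kinj: "z = w" if s: "s \<in> {0..1}" and eq: "k s z = k s w" for s z w
  proof -
    \<comment> \<open>The radius is transformed by a strictly increasing map, so the image
      determines \<open>norm z\<close>; this in turn determines the scaling factor
      \<open>a s z\<close>.\<close>
    have mono: "norm (k s u) < norm (k s v)" if "norm u < norm v" for u v
    proof -
      define mu mv where "mu = max 0 (norm u - \<rho>)" and "mv = max 0 (norm v - \<rho>)"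
      have m: "0 \<le> mv - mu" "mv - mu \<le> norm v - norm u" using that by (auto simp: mu_def mv_def)
      have "s / 2 * (mv - mu) \<le> 1/2 * (norm v - norm u)"
        by (rule mult_mono) (use s m in auto)
      then have "s / 2 * mv - s / 2 * mu \<le> norm v / 2 - norm u / 2"
        by (simp add: right_diff_distrib)
      then show ?thesis
        using nk[OF s, of u, folded mu_def] nk[OF s, of v, folded mv_def] that by linarith
    qed
    have "norm z = norm w" using mono[of z w] mono[of w z] eq by (metis less_irrefl linorder_cases)
    then have "a s z = a s w" by (simp add: a_def)
    then show ?thesis using eq a[OF s, of z] by (auto simp: k_def)
  qed
  have kC: "k s z = z" if "z \<in> cball 0 \<rho>" for s z
    using that by (simp add: k_def a_def)
  have ck: "continuous_on UNIV (\<lambda>z. k (fst z) (snd z))"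
    unfolding k_def a_def by (intro continuous_intros) (use \<rho> in \<open>auto simp: max_def\<close>)
  define c where "c = (\<lambda>s x. \<theta>' (k s (\<theta> x)))"
  note \<theta> = homeomorphismD(1,2)[OF h] and \<theta>' = homeomorphismD(3,4)[OF h]
  show ?thesis
  proof
    have "continuous_on ({0..1} \<times> D) (\<lambda>z. \<theta> (snd z))"
      by (rule continuous_on_compose2[OF homeomorphismD(5)[OF h]]) (auto intro!: continuous_intros)
    then have "continuous_on ({0..1} \<times> D) (\<lambda>z. k (fst z) (\<theta> (snd z)))"
      using continuous_on_compose2[OF ck continuous_on_Pair[OF continuous_on_fst[OF continuous_on_id]], of "{0..1} \<times> D" "\<lambda>z. \<theta> (snd z)"]
      by simp
    then show "continuous_on ({0..1} \<times> D) (\<lambda>z. c (fst z) (snd z))"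
      unfolding c_def
      by (rule continuous_on_compose2[OF homeomorphismD(6)[OF h]]) (use kin \<theta>(1) in force)
    show "c s x \<in> D" if "s \<in> {0..1}" "x \<in> D" for s x
      using kin[OF that(1) \<theta>(1)[OF that(2)]] \<theta>' by (simp add: c_def)
    show "c 0 x = x" if "x \<in> D" for x using \<theta>[OF that] by (simp add: c_def k_def a_def)
    show "inj_on (c s) D" if "s \<in> {0..1}" for s
    proof (rule inj_onI)
      fix x y assume xy: "x \<in> D" "y \<in> D" "c s x = c s y"
      have "\<theta> (c s x) = \<theta> (c s y)" using xy(3) by simp
      then have "k s (\<theta> x) = k s (\<theta> y)"
        unfolding c_def \<theta>'(2)[OF kin[OF that \<theta>(1)[OF xy(1)]]] \<theta>'(2)[OF kin[OF that \<theta>(1)[OF xy(2)]]] .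
      then have "\<theta> x = \<theta> y" by (rule kinj[OF that])
      then have "\<theta>' (\<theta> x) = \<theta>' (\<theta> y)" by simp
      then show "x = y" unfolding \<theta>(2)[OF xy(1)] \<theta>(2)[OF xy(2)] .
    qed
    show "c 1 x \<in> interior D" if "x \<in> D" for x
    proof -
      have "k 1 (\<theta> x) \<in> \<theta> ` interior D" unfolding int by (rule k1[OF \<theta>(1)[OF that]])
      then obtain y where y: "y \<in> interior D" "\<theta> y = k 1 (\<theta> x)" by (metis imageE)
      then have "\<theta>' (\<theta> y) = y" using \<theta>(2)[of y] interior_subset[of D] by blast
      then have "\<theta>' (k 1 (\<theta> x)) = y" unfolding y(2) .
      then show ?thesis using y by (simp add: c_def)
    qed
    show "c s x = x" if "s \<in> {0..1}" "x \<in> C" for s x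
    proof -
      have "x \<in> D" "\<theta> x \<in> cball 0 \<rho>" using that(2) CD \<rho>(3) by blast+
      then show ?thesis using kC[of "\<theta> x" s] \<theta>(2)[of x] by (simp only: c_def)
    qed
  qed
qed

text \<open>A collar push that fixes the punctures is injective on \<open>D\<close> and hence acts
  on configurations in the punctured disk. The set \<open>C\<close> is left to the caller, since the
  loops that must not change differ from use to use.\<close>

lemma push_configurations:
  assumes C: "compact C" "C \<subseteq> interior D" "Q \<subseteq> C"
  obtains c where
    "\<And>Z (\<sigma> :: 'z::topological_space \<Rightarrow> complex set) (u :: 'z \<Rightarrow> real) n. continuous_map (top_of_set Z) (conf n (top_of_set X)) \<sigma> \<Longrightarrow>
        continuous_on Z u \<Longrightarrow> u ` Z \<subseteq> {0..1} \<Longrightarrow> continuous_map (top_of_set Z) (conf n (top_of_set X)) (\<lambda>z. c (u z) ` \<sigma> z)"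
    "\<And>x. x \<in> X \<Longrightarrow> c 0 x = x" "\<And>x. x \<in> X \<Longrightarrow> c 1 x \<in> interior X"
    "\<And>s x. s \<in> {0..1::real} \<Longrightarrow> x \<in> C \<Longrightarrow> c s x = x"
proof -
  obtain c where c: "continuous_on ({0..1} \<times> D) (\<lambda>z. c (fst z) (snd z))"
    "\<And>s x. s \<in> {0..1::real} \<Longrightarrow> x \<in> D \<Longrightarrow> c s x \<in> D" "\<And>x. x \<in> D \<Longrightarrow> c 0 x = x"
    "\<And>s. s \<in> {0..1} \<Longrightarrow> inj_on (c s) D" "\<And>x. x \<in> D \<Longrightarrow> c 1 x \<in> interior D"
    "\<And>s x. s \<in> {0..1} \<Longrightarrow> x \<in> C \<Longrightarrow> c s x = x"
    by (rule collar_push[OF C(1,2)]) (rule that)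
  have QD: "Q \<subseteq> D" using punctures_interior interior_subset[of D] by auto
  have cX: "c s x \<in> X" if "s \<in> {0..1}" "x \<in> X" for s x
  proof -
    \<comment> \<open>A puncture is fixed by \<open>c s\<close>, so by injectivity no other point
      lands on it.\<close>
    have "c s x \<notin> Q"
    proof
      assume q: "c s x \<in> Q"
      then have "c s (c s x) = c s x" using c(6) that C(3) by auto
      then have "c s x = x" using c(2,4) that by (meson DiffD1 inj_onD)
      then show False using q that by auto
    qed
    then show ?thesis using c(2) that by auto
  qed
  show ?thesis
  proof
    fix Z and \<sigma> :: "'z \<Rightarrow> complex set" and u :: "'z \<Rightarrow> real" and n
    assume \<sigma>: "continuous_map (top_of_set Z) (conf n (top_of_set X)) \<sigma>"
      and u: "continuous_on Z u" "u ` Z \<subseteq> {0..1}"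
    then have \<sigma>': "\<And>z. z \<in> Z \<Longrightarrow> \<sigma> z \<subseteq> X \<and> finite (\<sigma> z) \<and> card (\<sigma> z) = n" "hits_open Z \<sigma>"
      by (auto simp: continuous_map_conf_iff)
    have "hits_open Z (\<lambda>x. (\<lambda>a. (\<lambda>z. c (fst z) (snd z)) (u x, a)) ` \<sigma> x)"
      by (rule hits_open_image[OF \<sigma>'(2) c(1) _ u(1)]) (use \<sigma>'(1) u in \<open>auto intro: continuous_intros\<close>)
    moreover have "c (u z) ` \<sigma> z \<subseteq> X \<and> finite (c (u z) ` \<sigma> z) \<and> card (c (u z) ` \<sigma> z) = n" if "z \<in> Z" for z
    proof -
      have "u z \<in> {0..1}" using u that by auto
      then have "inj_on (c (u z)) (\<sigma> z)" using c(4) \<sigma>'(1)[OF that] by (meson Diff_subset inj_on_subset subset_trans)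
      then show ?thesis using \<sigma>'(1)[OF that] cX \<open>u z \<in> {0..1}\<close> by (auto simp: card_image)
    qed
    ultimately show "continuous_map (top_of_set Z) (conf n (top_of_set X)) (\<lambda>z. c (u z) ` \<sigma> z)"
      by (simp add: continuous_map_conf_iff)
  next
    show "c 0 x = x" if "x \<in> X" for x using c(3) that by auto
    show "c 1 x \<in> interior X" if "x \<in> X" for x
      using c(5)[of x] cX[of 1 x] that interior_punctured by auto
    show "c s x = x" if "s \<in> {0..1::real}" "x \<in> C" for s x using c(6) that by auto
  qed
qed

lemma isotopy_extension_disk:
  fixes \<sigma> :: "real \<times> real \<Rightarrow> complex set"
  assumes \<sigma>: "continuous_map (top_of_set ({0..1} \<times> {0..1})) (conf n (top_of_set X)) \<sigma>"
    "\<And>z. z \<in> {0..1} \<times> {0..1} \<Longrightarrow> \<sigma> z \<subseteq> interior X"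
  obtains \<Phi> \<Psi> where "homeo_family ({0..1} \<times> {0..1}) (interior X) \<Phi> \<Psi>"
    "\<And>t s. t \<in> {0..1} \<Longrightarrow> s \<in> {0..1} \<Longrightarrow> \<Phi> (t, s) ` \<sigma> (0, s) = \<sigma> (t, s)"
    "\<And>s. s \<in> {0..1} \<Longrightarrow> \<Phi> (0, s) = (\<lambda>x. x)"
proof -
  have "\<exists>\<Phi> \<Psi>. homeo_family ({0..1} \<times> {0..1}) (interior X) \<Phi> \<Psi> \<and>
    (\<forall>t\<in>{0..1}. \<forall>k\<in>{0..1}. \<Phi> (t, k) ` \<sigma> (0, k) = \<sigma> (t, k)) \<and> (\<forall>k\<in>{0..1}. \<Phi> (0, k) = (\<lambda>x. x))"
    by (rule isotopy_extension[where n = n]) (use \<sigma> in \<open>auto simp: continuous_map_conf_iff\<close>)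
  then obtain \<Phi> \<Psi> where "homeo_family ({0..1} \<times> {0..1}) (interior X) \<Phi> \<Psi>"
    "\<forall>t\<in>{0..1}. \<forall>k\<in>{0..1}. \<Phi> (t, k) ` \<sigma> (0, k) = \<sigma> (t, k)" "\<forall>k\<in>{0..1}. \<Phi> (0, k) = (\<lambda>x. x)" by blast
  then show ?thesis by (intro that[of \<Phi> \<Psi>]) auto
qed

lemma trace_conf:
  assumes "ambient X F G" "b \<subseteq> X" "finite b" "card b = n"
  shows "continuous_map (top_of_set {0..1}) (conf n (top_of_set X)) (\<lambda>t. F t ` b)"
proof -
  have "hits_open {0..1} (\<lambda>t. (\<lambda>i. F t i) ` b)"
    using assms by (intro hits_open_family) (auto intro!: ambient_compose[OF assms(1)] continuous_intros)
  moreover have "F t ` b \<subseteq> X \<and> finite (F t ` b) \<and> card (F t ` b) = n" if "t \<in> {0..1}" for t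
  proof -
    have "inj_on (F t) b"
      using ambient_inv[OF assms(1), of t] that assms(2) by (intro inj_on_inverseI[of _ "G t"]) auto
    then show ?thesis using assms ambient_in[OF assms(1), of t] that by (auto simp: card_image)
  qed
  ultimately show ?thesis by (simp add: continuous_map_conf_iff)
qed

text \<open>The collar push is chosen to fix \<open>b\<close> as well as the punctures, so pushing
  the loop inwards is a homotopy of loops based at \<open>b\<close>. The pushed loop lies in the
  interior, where isotopy extension applies.\<close>

lemma ambient_loop_extension:
  assumes b: "b \<subseteq> interior X" and p: "p \<in> loops (conf n (top_of_set X)) b"
  obtains p' F G where "p' \<in> loops (conf n (top_of_set X)) b" "loop_homotopic (conf n (top_of_set X)) b p p'"
    "ambient X F G" "\<And>x. x \<in> X \<Longrightarrow> F 0 x = x" "\<And>t x. t \<in> {0..1} \<Longrightarrow> x \<in> bd X \<Longrightarrow> F t x = x"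
    "\<And>t. t \<in> {0..1} \<Longrightarrow> F t ` b = p' t"
proof -
  note pl = loopsD[OF p]
  have fb: "finite b" using continuous_map_image_subset_topspace[OF pl(1)] pl(2) by (force simp: topspace_conf)
  have "compact (Q \<union> b)" using fb finite_punctures by (auto intro: finite_imp_compact)
  moreover have "Q \<union> b \<subseteq> interior D" using punctures_interior b interior_punctured by auto
  ultimately obtain c where c: "\<And>Z (\<sigma> :: real \<times> real \<Rightarrow> complex set) u n. continuous_map (top_of_set Z) (conf n (top_of_set X)) \<sigma> \<Longrightarrow>
        continuous_on Z u \<Longrightarrow> u ` Z \<subseteq> {0..1} \<Longrightarrow> continuous_map (top_of_set Z) (conf n (top_of_set X)) (\<lambda>z. c (u z) ` \<sigma> z)"
    "\<And>x. x \<in> X \<Longrightarrow> c 0 x = x" "\<And>x. x \<in> X \<Longrightarrow> c 1 x \<in> interior X"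
    "\<And>s x. s \<in> {0..1::real} \<Longrightarrow> x \<in> Q \<union> b \<Longrightarrow> c s x = x"
    by (rule push_configurations[where ?'z = "real \<times> real", of "Q \<union> b", OF _ _ Un_upper1]) (rule that)
  have cb: "c s ` b = b" if "s \<in> {0..1}" for s using c(4)[OF that] by (force simp: image_iff)
  have "continuous_map (top_of_set ({0..1} \<times> {0..1})) (top_of_set {0..1}) (snd :: real \<times> real \<Rightarrow> real)"
    "continuous_map (top_of_set ({0..1} \<times> {0..1})) (top_of_set {0..1}) (fst :: real \<times> real \<Rightarrow> real)"
    by (auto intro!: continuous_intros)
  from this[THEN continuous_map_compose, OF pl(1)]
  have c2: "continuous_map (top_of_set ({0..1} \<times> {0..1})) (conf n (top_of_set X)) (\<lambda>z::real \<times> real. p (snd z))"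
    "continuous_map (top_of_set ({0..1} \<times> {0..1})) (conf n (top_of_set X)) (\<lambda>z::real \<times> real. p (fst z))"
    by (auto simp: o_def)
  have c3: "continuous_map (top_of_set ({0..1} \<times> {0..1})) (conf n (top_of_set X)) (\<lambda>z. c (fst z) ` p (snd z))"
    by (rule c(1)[OF c2(1)]) (auto intro!: continuous_intros)
  \<comment> \<open>The second coordinate is a dummy parameter; the isotopy is read off at parameter
    0.\<close>
  have c4: "continuous_map (top_of_set ({0..1} \<times> {0..1})) (conf n (top_of_set X)) (\<lambda>z::real \<times> real. c 1 ` p (fst z))"
    by (rule c(1)[OF c2(2)]) (auto intro!: continuous_intros)
  have pX: "p t \<subseteq> X" if "t \<in> {0..1}" for t
    using continuous_map_image_subset_topspace[OF pl(1)] that by (force simp: topspace_conf)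
  have c0: "c 0 ` p t = p t" if "t \<in> {0..1}" for t
    using c(2) pX[OF that] by (force simp: image_iff)
  define p' where "p' = (\<lambda>t. c 1 ` p t)"
  have hom: "loop_homotopic (conf n (top_of_set X)) b p p'"
    unfolding loop_homotopic_iff
    by (rule exI, intro conjI, rule c3) (use c0 cb pl p'_def in auto)
  have p'l: "p' \<in> loops (conf n (top_of_set X)) b"
    using homotopic_with_imp_continuous_maps[OF hom] homotopic_with_imp_property[OF hom] by (auto simp: loops_def pathin_def)
  obtain \<Phi> \<Psi> where \<Phi>: "homeo_family ({0..1} \<times> {0..1}) (interior X) \<Phi> \<Psi>"
    "\<And>t s. t \<in> {0..1} \<Longrightarrow> s \<in> {0..1::real} \<Longrightarrow> \<Phi> (t, s) ` (c 1 ` p (fst (0::real, s))) = c 1 ` p (fst (t, s))"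
    "\<And>s. s \<in> {0..1} \<Longrightarrow> \<Phi> (0, s) = (\<lambda>x. x)"
    by (rule isotopy_extension_disk[OF c4]) (use c(3) pX in force)+
  have amb: "ambient X (\<lambda>t. \<Phi> (t, 0)) (\<lambda>t. \<Psi> (t, 0))"
    by (rule homeo_family_ambient[OF \<Phi>(1) interior_subset]) (auto intro!: continuous_intros)
  show ?thesis
  proof (rule that[OF p'l hom amb])
    show "\<Phi> (0, 0) x = x" for x using \<Phi>(3) by simp
    show "\<Phi> (t, 0) x = x" if "t \<in> {0..1}" "x \<in> bd X" for t x
      using \<Phi>(1) that by (auto simp: homeo_family_def bd_def)
    show "\<Phi> (t, 0) ` b = p' t" if "t \<in> {0..1}" for t
      using \<Phi>(2)[OF that, of 0] pl cb[of 1] by (simp add: p'_def)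
  qed
qed

text \<open>The homotopy is a two-parameter motion of \<open>b\<close> and extends to a family
  \<open>\<Phi> (t, s)\<close>. The two end maps are joined to \<open>\<Phi> (1, 0)\<close> and
  \<open>\<Phi> (1, 1)\<close>, and these are joined to each other by varying
  \<open>s\<close>.\<close>

lemma homotopic_loops_isotopic:
  assumes b: "b \<subseteq> interior X" "finite b" "card b = n"
    and H: "ambient X H G" "\<And>x. x \<in> X \<Longrightarrow> H 0 x = x" "\<And>t x. t \<in> {0..1} \<Longrightarrow> x \<in> bd X \<Longrightarrow> H t x = x"
    and H': "ambient X H' G'" "\<And>x. x \<in> X \<Longrightarrow> H' 0 x = x" "\<And>t x. t \<in> {0..1} \<Longrightarrow> x \<in> bd X \<Longrightarrow> H' t x = x"
    and hom: "loop_homotopic (conf n (top_of_set X)) b (\<lambda>t. H t ` b) (\<lambda>t. H' t ` b)"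
  shows "path_component_of (homeo_space X (homeos_fixing X b)) (restrict (H 1) X) (restrict (H' 1) X)"
proof -
  have bX: "b \<subseteq> X" using b interior_subset[of X] by auto
  interpret A: homeo_class X "homeos_fixing X b"
    by (rule homeo_class_fixing[OF locally_compact_punctured locally_connected_punctured bX])
  define tr where "tr = (\<lambda>F :: real \<Rightarrow> complex \<Rightarrow> complex. (\<lambda>z. F (fst z) (snd z)) ` ({0..1} \<times> b))"
  \<comment> \<open>With the tracks of \<open>H\<close> and \<open>H'\<close> inside
    \<open>C\<close>, both given loops stay unchanged while the homotopy between them is pushed off
    the boundary.\<close>
  define C where "C = Q \<union> (tr H \<union> tr H')"
  have C: "compact C" "C \<subseteq> interior D" "Q \<subseteq> C"
    using ambient_trace_compact[OF H(1) b(1,2)] ambient_trace_compact[OF H'(1) b(1,2)] finite_punctures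
      punctures_interior interior_punctured unfolding C_def tr_def by (auto intro!: compact_Un finite_imp_compact[OF finite_punctures])
  obtain c where c: "\<And>Z (\<sigma> :: real \<times> real \<Rightarrow> complex set) u n. continuous_map (top_of_set Z) (conf n (top_of_set X)) \<sigma> \<Longrightarrow>
        continuous_on Z u \<Longrightarrow> u ` Z \<subseteq> {0..1} \<Longrightarrow> continuous_map (top_of_set Z) (conf n (top_of_set X)) (\<lambda>z. c (u z) ` \<sigma> z)"
    "\<And>x. x \<in> X \<Longrightarrow> c 0 x = x" "\<And>x. x \<in> X \<Longrightarrow> c 1 x \<in> interior X"
    "\<And>s x. s \<in> {0..1::real} \<Longrightarrow> x \<in> C \<Longrightarrow> c s x = x"
    by (rule push_configurations[where ?'z = "real \<times> real", OF C]) (rule that)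
  have cH: "c 1 ` F t ` b = F t ` b" if "t \<in> {0..1}" "tr F \<subseteq> C" for F t
  proof -
    have "F t x \<in> C" if "x \<in> b" for x using that \<open>t \<in> {0..1}\<close> \<open>tr F \<subseteq> C\<close> by (force simp: tr_def)
    then show ?thesis using c(4)[of 1] by (force simp: image_iff)
  qed
  have H0: "H 0 ` b = b" using H(2) bX by (force simp: image_iff)
  have "tr H \<subseteq> C" by (auto simp: C_def)
  then have cb: "c 1 ` b = b" using cH[of 0 H] H0 by simp
  obtain h where h: "continuous_map (top_of_set ({0..1} \<times> {0..1})) (conf n (top_of_set X)) h"
    "\<forall>t\<in>{0..1}. h (0, t) = H t ` b" "\<forall>t\<in>{0..1}. h (1, t) = H' t ` b"
    "\<forall>s\<in>{0..1::real}. h (s, 0::real) = b \<and> h (s, 1) = b"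
    using hom unfolding loop_homotopic_iff by metis
  \<comment> \<open>\<open>loop_homotopic\<close> puts the homotopy parameter first, isotopy
    extension puts time first.\<close>
  have "continuous_map (top_of_set ({0..1} \<times> {0..1})) (top_of_set ({0..1} \<times> {0..1})) (\<lambda>z::real \<times> real. (snd z, fst z))"
    by (auto intro!: continuous_intros)
  from continuous_map_compose[OF this h(1)]
  have hs: "continuous_map (top_of_set ({0..1} \<times> {0..1})) (conf n (top_of_set X)) (\<lambda>z. h (snd z, fst z))"
    by (simp add: o_def)
  define \<sigma> where "\<sigma> = (\<lambda>z. c 1 ` h (snd z, fst z))"
  have c\<sigma>: "continuous_map (top_of_set ({0..1} \<times> {0..1})) (conf n (top_of_set X)) \<sigma>"
    unfolding \<sigma>_def by (rule c(1)[OF hs]) (auto intro!: continuous_intros)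
  have hX: "h z \<subseteq> X" if "z \<in> {0..1} \<times> {0..1}" for z
    using continuous_map_image_subset_topspace[OF h(1)] that by (force simp: topspace_conf)
  have \<sigma>int: "\<sigma> z \<subseteq> interior X" if "z \<in> {0..1} \<times> {0..1}" for z
    using hX[of "(snd z, fst z)"] c(3) that by (force simp: \<sigma>_def)
  obtain \<Phi> \<Psi> where \<Phi>: "homeo_family ({0..1} \<times> {0..1}) (interior X) \<Phi> \<Psi>"
    "\<And>t s. t \<in> {0..1} \<Longrightarrow> s \<in> {0..1} \<Longrightarrow> \<Phi> (t, s) ` \<sigma> (0, s) = \<sigma> (t, s)"
    "\<And>s. s \<in> {0..1} \<Longrightarrow> \<Phi> (0, s) = (\<lambda>x. x)"
    by (rule isotopy_extension_disk[OF c\<sigma> \<sigma>int]) blast+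
  have \<sigma>b: "\<sigma> (0, s) = b" "\<sigma> (1, s) = b" if "s \<in> {0..1}" for s
    using h(4) that cb by (auto simp: \<sigma>_def)
  have \<Phi>b: "\<Phi> (t, s) ` b = \<sigma> (t, s)" if "t \<in> {0..1}" "s \<in> {0..1}" for t s
    using \<Phi>(2)[OF that] \<sigma>b that by simp
  have \<Phi>bd: "\<Phi> z x = x" "\<Psi> z x = x" if "z \<in> {0..1} \<times> {0..1}" "x \<in> bd X" for z x
  proof -
    have "x \<notin> interior X" using that by (simp add: bd_def)
    then show "\<Phi> z x = x" using \<Phi>(1) that(1) unfolding homeo_family_def by blast
    then show "\<Psi> z x = x" using \<Phi>(1) that(1) unfolding homeo_family_def by metis
  qed
  have amb: "ambient X (\<lambda>t. \<Phi> (t, s)) (\<lambda>t. \<Psi> (t, s))" if "s \<in> {0..1}" for s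
    by (rule homeo_family_ambient[OF \<Phi>(1) interior_subset]) (use that in \<open>auto intro!: continuous_intros\<close>)
  have or: "orientation_preserving X (\<Phi> (1, s))" if "s \<in> {0..1}" for s
    by (rule orientation_preserving_ambient[OF amb[OF that]]) (use \<Phi>(3)[OF that] orientation_preserving_id in auto)
  have bdX: "bd X \<subseteq> X" by (auto simp: bd_def)
  have fixI: "restrict f X \<in> homeos_fixing X b"
    if "restrict f X \<in> homeos X" "f ` b = b" "\<And>x. x \<in> bd X \<Longrightarrow> f x = x" for f
  proof -
    have "restrict f X ` b = f ` b" using bX by force
    then show ?thesis using that bdX by (auto simp: homeos_fixing_def)
  qed
  have main: "A.isotopic (restrict (\<Phi> (1, s)) X) (restrict (F 1) X)"
    if s: "s \<in> {0..1}" and F: "ambient X F F'" "\<And>x. x \<in> X \<Longrightarrow> F 0 x = x"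
      "\<And>t x. t \<in> {0..1} \<Longrightarrow> x \<in> bd X \<Longrightarrow> F t x = x" "tr F \<subseteq> C" "\<forall>t\<in>{0..1}. h (s, t) = F t ` b" for s F F'
  proof -
    have \<Phi>F: "\<Phi> (t, s) ` b = F t ` b" if "t \<in> {0..1}" for t
      using \<Phi>b[OF that s] F(5) that cH[OF that F(4)] by (simp add: \<sigma>_def)
    have \<Phi>1: "\<Phi> (1, s) ` b = b" using \<Phi>b[of 1 s] \<sigma>b[OF s] s by simp
    have inv: "\<Phi> (t, s) (\<Psi> (t, s) x) = x" "\<Psi> (t, s) (\<Phi> (t, s) x) = x" if "t \<in> {0..1}" for t x
      using \<Phi>(1) that s by (auto simp: homeo_family_def)
    \<comment> \<open>The isotopy \<open>\<Phi> (1, s) \<circ> \<Psi> (t, s) \<circ> F t\<close>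
      runs from \<open>\<Phi> (1, s)\<close> to \<open>F 1\<close>. It preserves \<open>b\<close> at
      all times because \<open>F t\<close> and \<open>\<Phi> (t, s)\<close> carry \<open>b\<close>
      to the same configuration.\<close>
    note a1 = ambient_comp[OF ambient_const[OF ambient_homeomorphism[OF amb[OF s], of 1, simplified]]
        ambient_comp[OF ambient_sym[OF amb[OF s]] F(1)]]
    have "A.isotopic (restrict (\<lambda>x. \<Phi> (1, s) (\<Psi> (0, s) (F 0 x))) X) (restrict (\<lambda>x. \<Phi> (1, s) (\<Psi> (1, s) (F 1 x))) X)"
    proof (rule A.isotopicI[OF a1])
      fix t :: real assume t: "t \<in> {0..1}"
      show "restrict (\<lambda>x. \<Phi> (1, s) (\<Psi> (t, s) (F t x))) X \<in> homeos_fixing X b"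
      proof (rule fixI)
        have "\<Phi> (1, s) (\<Psi> (0, s) (F 0 x)) = \<Phi> (1, s) x" if "x \<in> X" for x
          using inv(2)[of 0 x] \<Phi>(3)[OF s] F(2)[OF that] by simp
        then show "restrict (\<lambda>x. \<Phi> (1, s) (\<Psi> (t, s) (F t x))) X \<in> homeos X"
          using or[OF s] orientation_preserving_cong[of X "\<lambda>x. \<Phi> (1, s) (\<Psi> (0, s) (F 0 x))" "\<Phi> (1, s)"]
          by (intro restrict_ambient_homeos[OF a1 _ t]) auto
        have "\<Psi> (t, s) ` F t ` b = b" unfolding \<Phi>F[OF t, symmetric] using inv(2)[OF t] by (simp add: image_image)
        moreover have "(\<lambda>x. \<Phi> (1, s) (\<Psi> (t, s) (F t x))) ` b = \<Phi> (1, s) ` \<Psi> (t, s) ` F t ` b"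
          by (simp add: image_image)
        ultimately show "(\<lambda>x. \<Phi> (1, s) (\<Psi> (t, s) (F t x))) ` b = b"
          using \<Phi>1 by simp
        show "\<Phi> (1, s) (\<Psi> (t, s) (F t x)) = x" if "x \<in> bd X" for x
          using F(3)[OF t that] \<Phi>bd that t s by simp
      qed
    qed
    moreover have "restrict (\<lambda>x. \<Phi> (1, s) (\<Psi> (0, s) (F 0 x))) X = restrict (\<Phi> (1, s)) X"
      using inv(2)[of 0] \<Phi>(3)[OF s] F(2) by (intro restrict_ext) simp
    moreover have "(\<lambda>x. \<Phi> (1, s) (\<Psi> (1, s) (F 1 x))) = F 1" using inv(1)[of 1] by simp
    ultimately show ?thesis by simp
  qed
  have 1: "A.isotopic (restrict (\<Phi> (1, 0)) X) (restrict (H 1) X)"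
    by (rule main[OF _ H]) (use h in \<open>auto simp: C_def\<close>)
  have 2: "A.isotopic (restrict (\<Phi> (1, 1)) X) (restrict (H' 1) X)"
    by (rule main[OF _ H']) (use h in \<open>auto simp: C_def\<close>)
  \<comment> \<open>On the edge at time 1 of the square the configuration is constantly
    \<open>b\<close>, so varying \<open>s\<close> there stays among the maps that preserve
    \<open>b\<close>.\<close>
  have a2: "ambient X (\<lambda>s. \<Phi> (1, s)) (\<lambda>s. \<Psi> (1, s))"
    by (rule homeo_family_ambient[OF \<Phi>(1) interior_subset]) (auto intro!: continuous_intros)
  have 3: "A.isotopic (restrict (\<Phi> (1, 0)) X) (restrict (\<Phi> (1, 1)) X)"
  proof (rule A.isotopicI[OF a2])
    fix s :: real assume s: "s \<in> {0..1}"
    show "restrict (\<Phi> (1, s)) X \<in> homeos_fixing X b"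
      using restrict_ambient_homeos[OF a2 or[of 0] s] \<Phi>b[of 1 s] \<sigma>b[OF s] \<Phi>bd s by (intro fixI) auto
  qed
  show ?thesis
    by (rule path_component_of_trans[OF path_component_of_trans[OF path_component_of_sym[OF 1] 3] 2])
qed

section \<open>Moving configurations onto the boundary\<close>

lemma path_connected_avoiding:
  assumes "finite R"
  shows "path_connected (D - R)"
proof -
  obtain \<theta> \<theta>' where h: "homeomorphism D (cball (0::complex) 1) \<theta> \<theta>'" by (rule disk_chart)
  have "\<not> collinear (cball (0::complex) 1)" by (simp add: collinear_aff_dim aff_dim_cball)
  then have pc: "path_connected (cball (0::complex) 1 - \<theta> ` (R \<inter> D))"
    using assms by (intro path_connected_convex_diff_countable) (auto intro: countable_finite)
  have eq: "D - R = \<theta>' ` (cball 0 1 - \<theta> ` (R \<inter> D))"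
  proof (intro equalityI subsetI)
    fix x assume x: "x \<in> D - R"
    then have \<theta>x: "\<theta>' (\<theta> x) = x" "\<theta> x \<in> cball 0 1" using homeomorphismD(1,2)[OF h] by auto
    moreover have "\<theta> x \<notin> \<theta> ` (R \<inter> D)"
    proof
      assume "\<theta> x \<in> \<theta> ` (R \<inter> D)"
      then obtain y where "y \<in> R" "y \<in> D" "\<theta> x = \<theta> y" by auto
      then have "x = y" using \<theta>x(1) homeomorphismD(2)[OF h \<open>y \<in> D\<close>] by metis
      then show False using x \<open>y \<in> R\<close> by simp
    qed
    ultimately show "x \<in> \<theta>' ` (cball 0 1 - \<theta> ` (R \<inter> D))" by (metis DiffI imageI)
  next
    fix x assume "x \<in> \<theta>' ` (cball 0 1 - \<theta> ` (R \<inter> D))"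
    then obtain z where z: "z \<in> cball 0 1" "z \<notin> \<theta> ` (R \<inter> D)" "x = \<theta>' z" by auto
    then have "x \<in> D" "\<theta> x = z" using homeomorphismD(3,4)[OF h] by auto
    then show "x \<in> D - R" using z(2) by blast
  qed
  show ?thesis unfolding eq
    by (intro path_connected_continuous_image pc continuous_on_subset[OF homeomorphismD(6)[OF h]]) auto
qed

lemma boundary_point_avoiding:
  assumes "finite R"
  obtains x where "x \<in> D - interior D" "x \<notin> R"
proof -
  obtain \<theta> \<theta>' where h: "homeomorphism D (cball (0::complex) 1) \<theta> \<theta>'" and int: "\<theta> ` interior D = ball 0 1"
    by (rule disk_chart)
  have "infinite (sphere (0::complex) 1)"
  proof
    have "connected (sphere (0::complex) 1)" by (rule connected_sphere) simp
    moreover assume "finite (sphere (0::complex) 1)"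
    ultimately have "sphere (0::complex) 1 = {} \<or> (\<exists>a. sphere (0::complex) 1 = {a})"
      using connected_finite_iff_sing by metis
    then obtain a where "sphere (0::complex) 1 \<subseteq> {a}" by auto
    moreover have "1 \<in> sphere (0::complex) 1" "- 1 \<in> sphere (0::complex) 1" by auto
    ultimately have "(1::complex) = - 1" by blast
    then show False by simp
  qed
  then obtain z where z: "z \<in> sphere 0 1" "z \<notin> \<theta> ` R"
    using assms by (meson finite_imageI finite_subset subsetI)
  then have "z \<in> cball 0 1" by auto
  then have \<theta>z: "\<theta>' z \<in> D" "\<theta> (\<theta>' z) = z" by (rule homeomorphismD[OF h])+
  have "\<theta>' z \<notin> interior D"
  proof
    assume "\<theta>' z \<in> interior D"
    then have "z \<in> ball 0 1" using int \<theta>z(2) by (metis imageI)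
    then show False using z(1) by simp
  qed
  moreover have "\<theta>' z \<notin> R" using z(2) \<theta>z(2) by (metis imageI)
  ultimately show ?thesis using that[of "\<theta>' z"] \<theta>z(1) by simp
qed

text \<open>Induction on \<open>k\<close> moves one point at a time: point \<open>k\<close> runs to
  a free boundary point while all others wait at their current ends. Removing finitely many points
  does not disconnect the disk, so its path can avoid the others and the punctures.\<close>

lemma paths_to_boundary:
  fixes x :: "nat \<Rightarrow> complex"
  assumes x: "\<And>i. i < n \<Longrightarrow> x i \<in> X" "inj_on x {..<n}" and "k \<le> n"
  shows "\<exists>\<gamma>. (\<forall>i<n. path (\<gamma> i) \<and> path_image (\<gamma> i) \<subseteq> X \<and> pathstart (\<gamma> i) = x i \<and> (i < k \<longrightarrow> pathfinish (\<gamma> i) \<in> bd X)) \<and>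
    (\<forall>s\<in>{0..1}. inj_on (\<lambda>i. \<gamma> i s) {..<n})"
  using \<open>k \<le> n\<close>
proof (induction k)
  case 0
  show ?case
    by (rule exI[of _ "\<lambda>i. linepath (x i) (x i)"]) (use x in \<open>auto simp: inj_on_def path_def pathstart_def\<close>)
next
  case (Suc k)
  then obtain \<gamma> where \<gamma>0: "\<forall>i<n. path (\<gamma> i) \<and> path_image (\<gamma> i) \<subseteq> X \<and> pathstart (\<gamma> i) = x i \<and> (i < k \<longrightarrow> pathfinish (\<gamma> i) \<in> bd X)"
    "\<forall>s\<in>{0..1}. inj_on (\<lambda>i. \<gamma> i s) {..<n}" by auto
  then have \<gamma>: "\<And>i. i < n \<Longrightarrow> path (\<gamma> i) \<and> path_image (\<gamma> i) \<subseteq> X \<and> pathstart (\<gamma> i) = x i \<and> (i < k \<longrightarrow> pathfinish (\<gamma> i) \<in> bd X)"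
    "\<And>s. s \<in> {0..1} \<Longrightarrow> inj_on (\<lambda>i. \<gamma> i s) {..<n}" by blast+
  define R where "R = Q \<union> (\<lambda>i. pathfinish (\<gamma> i)) ` ({..<n} - {k})"
  have R: "finite R" using finite_punctures by (simp add: R_def)
  obtain y where y: "y \<in> D - interior D" "y \<notin> R" by (rule boundary_point_avoiding[OF R])
  have k: "k < n" using Suc by simp
  have endX: "pathfinish (\<gamma> i) \<in> X" if "i < n" for i using \<gamma>(1)[OF that] pathfinish_in_path_image by blast
  have "pathfinish (\<gamma> k) \<notin> R"
  proof
    assume "pathfinish (\<gamma> k) \<in> R"
    then obtain i where "i < n" "i \<noteq> k" "\<gamma> k 1 = \<gamma> i 1" using endX[OF k] by (auto simp: R_def pathfinish_def)
    then show False using \<gamma>(2)[of 1] k by (auto simp: inj_on_def)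
  qed
  then have "pathfinish (\<gamma> k) \<in> D - R" "y \<in> D - R" using endX[OF k] y by auto
  then obtain \<delta> where \<delta>: "path \<delta>" "path_image \<delta> \<subseteq> D - R" "pathstart \<delta> = pathfinish (\<gamma> k)" "pathfinish \<delta> = y"
    using path_connected_avoiding[OF R] unfolding path_connected_def by blast
  define \<gamma>' where "\<gamma>' = (\<lambda>i. \<gamma> i +++ (if i = k then \<delta> else linepath (pathfinish (\<gamma> i)) (pathfinish (\<gamma> i))))"
  have \<delta>X: "path_image \<delta> \<subseteq> X" using \<delta>(2) by (auto simp: R_def)
  show ?case
  proof (intro exI[of _ \<gamma>'] conjI allI impI ballI)
    fix i assume i: "i < n"
    show "path (\<gamma>' i)" "pathstart (\<gamma>' i) = x i" using \<gamma>(1)[OF i] \<delta> by (auto simp: \<gamma>'_def)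
    show "path_image (\<gamma>' i) \<subseteq> X"
      unfolding \<gamma>'_def by (rule subset_path_image_join) (use \<gamma>(1)[OF i] \<delta>X endX[OF i] in auto)
    show "pathfinish (\<gamma>' i) \<in> bd X" if "i < Suc k"
      using \<gamma>(1)[OF i] \<delta>(4) y that bd_punctured by (auto simp: \<gamma>'_def)
  next
    fix s :: real assume s: "s \<in> {0..1}"
    show "inj_on (\<lambda>i. \<gamma>' i s) {..<n}"
    proof (cases "s \<le> 1/2")
      case True
      then have "\<gamma>' i s = \<gamma> i (2 * s)" for i by (simp add: \<gamma>'_def joinpaths_def)
      then show ?thesis using \<gamma>(2)[of "2 * s"] s True by auto
    next
      case False
      have ev: "\<gamma>' i s = (if i = k then \<delta> (2 * s - 1) else \<gamma> i 1)" for i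
        using False by (simp add: \<gamma>'_def joinpaths_def linepath_refl pathfinish_def)
      have "\<delta> (2 * s - 1) \<in> path_image \<delta>" unfolding path_image_def using s False by auto
      then have "\<delta> (2 * s - 1) \<notin> R" using \<delta>(2) by auto
      then have "\<delta> (2 * s - 1) \<noteq> \<gamma> i 1" if "i < n" "i \<noteq> k" for i using that by (auto simp: R_def pathfinish_def)
      moreover then have "\<gamma> i 1 \<noteq> \<delta> (2 * s - 1)" if "i < n" "i \<noteq> k" for i using that by metis
      ultimately show ?thesis using \<gamma>(2)[of 1] unfolding inj_on_def ev by (auto split: if_splits)
    qed
  qed
qed

text \<open>A loop of homeomorphisms fixing the boundary drags a path to the boundary along, and this
  contracts the loop of configurations that it traces.\<close>

lemma loop_of_homeos_null:
  assumes b: "b \<subseteq> X" "finite b" "card b = n"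
    and H: "ambient X H G" "\<And>x. x \<in> X \<Longrightarrow> H 0 x = x" "\<And>x. x \<in> X \<Longrightarrow> H 1 x = x"
      "\<And>t x. t \<in> {0..1} \<Longrightarrow> x \<in> bd X \<Longrightarrow> H t x = x"
  shows "loop_homotopic (conf n (top_of_set X)) b (\<lambda>t. H t ` b) (\<lambda>_. b)"
proof -
  obtain x where "bij_betw x {..<n} b" using b by (metis card_lessThan finite_lessThan finite_same_card_bij)
  then have x: "inj_on x {..<n}" "x ` {..<n} = b" by (auto simp: bij_betw_def)
  have "x i \<in> X" if "i < n" for i using x b that by auto
  from paths_to_boundary[OF this x(1) le_refl]
  obtain \<gamma> where \<gamma>: "\<And>i. i < n \<Longrightarrow> path (\<gamma> i) \<and> path_image (\<gamma> i) \<subseteq> X \<and> pathstart (\<gamma> i) = x i \<and> pathfinish (\<gamma> i) \<in> bd X"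
    "\<And>s. s \<in> {0..1} \<Longrightarrow> inj_on (\<lambda>i. \<gamma> i s) {..<n}" by blast
  have \<gamma>X: "\<gamma> i s \<in> X" if "i < n" "s \<in> {0..1}" for i s
    using \<gamma>(1)[OF that(1)] that(2) unfolding path_image_def by blast
  have \<gamma>b: "(\<lambda>i. \<gamma> i 0) ` {..<n} = b"
    using \<gamma>(1) x(2) by (auto simp: pathstart_def)
  define R where "R = (\<lambda>s. (\<lambda>i. \<gamma> i s) ` {..<n})"
  have R: "continuous_map (top_of_set {0..1}) (conf n (top_of_set X)) R"
    unfolding continuous_map_conf_iff R_def
  proof (intro conjI ballI hits_open_family)
    show "continuous_on {0..1} (\<gamma> i)" if "i \<in> {..<n}" for i using \<gamma>(1) that by (auto simp: path_def)
    show "card ((\<lambda>i. \<gamma> i s) ` {..<n}) = n" if "s \<in> {0..1}" for s using \<gamma>(2)[OF that] by (simp add: card_image)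
  qed (use \<gamma>X in auto)
  \<comment> \<open>The time of \<open>H\<close> is set against the parameter of the paths to the
    boundary. The loop to be contracted is the side of the square where this parameter is 0.\<close>
  define T where "T = (\<lambda>z. (\<lambda>i. H (fst z) (\<gamma> i (snd z))) ` {..<n})"
  have T: "continuous_map (top_of_set ({0..1} \<times> {0..1})) (conf n (top_of_set X)) T"
    unfolding continuous_map_conf_iff T_def
  proof (intro conjI ballI hits_open_family)
    show "continuous_on ({0..1} \<times> {0..1}) (\<lambda>z. H (fst z) (\<gamma> i (snd z)))" if "i \<in> {..<n}" for i
    proof (rule ambient_compose[OF H(1)])
      show "continuous_on ({0..1} \<times> {0..1}) (\<lambda>z::real \<times> real. \<gamma> i (snd z))"
      proof (rule continuous_on_compose2[of "{0..1}" "\<gamma> i"])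
        show "continuous_on {0..1} (\<gamma> i)" using \<gamma>(1)[of i] that by (simp add: path_def)
        show "continuous_on ({0..1} \<times> {0..1}) (snd :: real \<times> real \<Rightarrow> real)" by (intro continuous_intros)
      qed auto
    qed (use \<gamma>X that in \<open>auto intro!: continuous_intros\<close>)
    fix z assume z: "z \<in> {0..1::real} \<times> {0..1::real}"
    obtain t s where ts: "z = (t, s)" "t \<in> {0..1}" "s \<in> {0..1}" using z by blast
    then show "(\<lambda>i. H (fst z) (\<gamma> i (snd z))) ` {..<n} \<subseteq> X"
      using ambient_in[OF H(1), of t] \<gamma>X by auto
    have "inj_on (\<lambda>i. H (fst z) (\<gamma> i (snd z))) {..<n}"
    proof (rule inj_onI)
      fix i j assume ij: "i \<in> {..<n}" "j \<in> {..<n}" "H (fst z) (\<gamma> i (snd z)) = H (fst z) (\<gamma> j (snd z))"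
      have "G t (H t (\<gamma> i s)) = \<gamma> i s" "G t (H t (\<gamma> j s)) = \<gamma> j s"
        using ambient_inv[OF H(1), of t] ts \<gamma>X ij(1,2) by simp_all
      moreover have "H t (\<gamma> i s) = H t (\<gamma> j s)" using ij(3) unfolding ts(1) fst_conv snd_conv .
      ultimately have "\<gamma> i s = \<gamma> j s" by metis
      then show "i = j" using \<gamma>(2)[OF ts(3)] ij(1,2) by (auto simp: inj_on_def)
    qed
    then show "card ((\<lambda>i. H (fst z) (\<gamma> i (snd z))) ` {..<n}) = n" by (simp add: card_image)
  qed auto
  \<comment> \<open>\<open>v\<close> runs along the other three sides of the square, a third of the
    time on each, and \<open>w\<close> is its second coordinate. On these sides \<open>H\<close>
    moves none of the points: at times 0 and 1 it is the identity, and at path parameter 1 they are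
    on the boundary. Hence \<open>T (v t)\<close> only retraces \<open>R\<close> out and
    back.\<close>
  define w where "w = (\<lambda>t::real. min 1 (min (3 * t) (3 - 3 * t)))"
  define v where "v = (\<lambda>t::real. (max 0 (min 1 (3 * t - 1)), w t))"
  have cw: "continuous_on {0..1} w" unfolding w_def by (intro continuous_intros)
  have cv: "continuous_on {0..1} v" unfolding v_def by (intro continuous_intros cw)
  have w01: "w t \<in> {0..1}" if "t \<in> {0..1}" for t using that by (auto simp: w_def)
  have vK: "v t \<in> {0..1} \<times> {0..1}" if "t \<in> {0..1}" for t using w01[OF that] by (auto simp: v_def)
  have Tv: "T (v t) = R (w t)" if t: "t \<in> {0..1}" for t
  proof -
    have "H (fst (v t)) (\<gamma> i (w t)) = \<gamma> i (w t)" if i: "i < n" for i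
    proof -
      consider "t \<le> 1/3" | "2/3 \<le> t" | "1/3 \<le> t" "t \<le> 2/3" by linarith
      then show ?thesis
      proof cases
        case 1
        then show ?thesis using H(2)[OF \<gamma>X[OF i w01[OF t]]] by (simp add: v_def)
      next
        case 2
        then show ?thesis using H(3)[OF \<gamma>X[OF i w01[OF t]]] by (simp add: v_def)
      next
        case 3
        then have "w t = 1" by (simp add: w_def)
        moreover have "\<gamma> i 1 \<in> bd X" using \<gamma>(1)[OF i] by (simp add: pathfinish_def)
        ultimately show ?thesis using H(4)[of "fst (v t)" "\<gamma> i 1"] vK[OF t] by (auto simp: mem_Times_iff)
      qed
    qed
    then show ?thesis by (auto simp: T_def R_def v_def)
  qed
  have v01: "v 0 = (0, 0)" "v 1 = (1, 0)" by (auto simp: v_def w_def)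
  have R0: "R 0 = b" using \<gamma>b by (simp add: R_def)
  have T0: "T (t, 0) = H t ` b" for t
    unfolding T_def fst_conv snd_conv \<gamma>b[symmetric] by (simp add: image_image)
  have H01: "H 0 ` b = b" "H 1 ` b = b" using H(2,3) b by (force simp: image_iff)+
  have "loop_homotopic (conf n (top_of_set X)) b (\<lambda>t. H t ` b) (\<lambda>t. R (w t))"
    by (rule square_homotopic[OF _ T, where u = "\<lambda>t. (t, 0)" and v = v])
      (use cv vK v01 Tv T0 H01 in \<open>auto intro!: continuous_intros convex_Times\<close>)
  moreover have "loop_homotopic (conf n (top_of_set X)) b (\<lambda>t. R (w t)) (\<lambda>_. b)"
    by (rule square_homotopic[OF _ R, where u = w and v = "\<lambda>_. 0"])
      (use cw w01 R0 in \<open>auto simp: w_def\<close>)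
  ultimately show ?thesis by (rule homotopic_with_trans)
qed

end

section \<open>Proper actions on planar surfaces with quotient a disk\<close>

text \<open>In the chart the boundary is the unit circle, which is connected with more than one
  point and so has no isolated points.\<close>

lemma (in punctured_disk) boundary_no_isolated:
  assumes y: "y \<in> D - interior D" and W: "openin (top_of_set D) W" "y \<in> W"
  obtains y' where "y' \<in> W" "y' \<noteq> y" "y' \<in> D - interior D"
proof -
  obtain \<theta> \<theta>' where h: "homeomorphism D (cball (0::complex) 1) \<theta> \<theta>'" and int: "\<theta> ` interior D = ball 0 1"
    by (rule disk_chart)
  have \<theta>: "\<And>x. x \<in> D \<Longrightarrow> \<theta> x \<in> cball 0 1 \<and> \<theta>' (\<theta> x) = x" using homeomorphismD[OF h] by simp
  have \<theta>': "\<And>x. x \<in> cball 0 1 \<Longrightarrow> \<theta>' x \<in> D \<and> \<theta> (\<theta>' x) = x" using homeomorphismD[OF h] by simp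
  have bnd: "x \<in> interior D \<longleftrightarrow> \<theta> x \<in> ball 0 1" if "x \<in> D" for x
    using int \<theta> that interior_subset[of D] by (metis imageE imageI subsetD)
  have "openin (top_of_set (cball 0 1)) (cball 0 1 \<inter> \<theta>' -` W)"
    using h W unfolding homeomorphism_def by (metis continuous_on_open)
  then obtain T where T: "open T" "cball 0 1 \<inter> \<theta>' -` W = cball 0 1 \<inter> T" by (auto simp: openin_open)
  have sph: "\<theta> y \<in> sphere 0 1" using bnd[of y] \<theta>[of y] y by auto
  have "\<theta> y \<in> cball 0 1 \<inter> \<theta>' -` W" using \<theta>[of y] y W by auto
  then have "\<theta> y \<in> T" using T(2) by blast
  have "sphere (0::complex) 1 \<noteq> {x}" for x
  proof
    assume *: "sphere (0::complex) 1 = {x}"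
    have "1 \<in> {x}" "- 1 \<in> {x}" unfolding *[symmetric] by auto
    then show False by auto
  qed
  moreover have "connected (sphere (0::complex) 1)" by (rule connected_sphere) simp
  ultimately have "\<theta> y islimpt sphere 0 1" using sph by (intro connected_imp_perfect) auto
  then obtain z where z: "z \<in> sphere 0 1" "z \<in> T" "z \<noteq> \<theta> y"
    using T(1) \<open>\<theta> y \<in> T\<close> unfolding islimpt_def by blast
  then have zc: "z \<in> cball 0 1" by auto
  then have "\<theta>' z \<in> W" using T(2) z by blast
  moreover have "\<theta>' z \<noteq> y" using \<theta>'[OF zc] z(3) by auto
  moreover have "\<theta>' z \<in> D - interior D" using \<theta>'[OF zc] bnd[of "\<theta>' z"] z(1) by auto
  ultimately show ?thesis by (rule that)
qed

lemma (in punctured_disk) boundary_nonempty: "D - interior D \<noteq> {}"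
  using boundary_point_avoiding[of "{}"] by auto

section \<open>Locally finite sets\<close>

lemma locally_finite_closed:
  fixes T :: "'a::heine_borel set"
  assumes fin: "\<And>K. compact K \<Longrightarrow> finite (T \<inter> K)"
  shows "closed T" and "\<exists>e>0. ball x e \<inter> T \<subseteq> {x}"
proof -
  have iso: "\<exists>e>0. ball x e \<inter> T \<subseteq> {x}" for x
  proof -
    have "finite (T \<inter> cball x 1)" by (intro fin) auto
    then obtain d where d: "d > 0" "\<forall>y\<in>T \<inter> cball x 1. y \<noteq> x \<longrightarrow> d \<le> dist x y"
      using finite_set_avoid by blast
    have "ball x (min d 1) \<inter> T \<subseteq> {x}" using d(2) by force
    then show ?thesis using d(1) by (intro exI[of _ "min d 1"]) auto
  qed
  then show "\<exists>e>0. ball x e \<inter> T \<subseteq> {x}" .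
  show "closed T" unfolding closed_limpt
  proof (intro allI impI)
    fix x assume x: "x islimpt T"
    obtain e where e: "e > 0" "ball x e \<inter> T \<subseteq> {x}" using iso by blast
    obtain y where "y \<in> T" "y \<in> ball x e" "y \<noteq> x"
      using x e(1) unfolding islimpt_def by (metis centre_in_ball open_ball)
    then show "x \<in> T" using e(2) by auto
  qed
qed

text \<open>A puncture has a connected punctured neighbourhood, so a separation of the punctured set
  extends to a separation of the whole set.\<close>

lemma connected_minus_locally_finite:
  fixes S :: "'a::euclidean_space set"
  assumes dim: "2 \<le> DIM('a)" and S: "connected S" and T: "T \<subseteq> interior S" and fin: "\<And>K. compact K \<Longrightarrow> finite (T \<inter> K)"
  shows "connected (S - T)"
proof (rule ccontr)
  assume "\<not> connected (S - T)"
  then obtain A B where AB: "openin (top_of_set (S - T)) A" "openin (top_of_set (S - T)) B"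
    "S - T \<subseteq> A \<union> B" "A \<inter> B = {}" "A \<noteq> {}" "B \<noteq> {}"
    unfolding connected_openin by blast
  have sub: "A \<subseteq> S - T" "B \<subseteq> S - T" by (rule openin_imp_subset[OF AB(1)] openin_imp_subset[OF AB(2)])+
  have "\<forall>t. \<exists>e. t \<in> T \<longrightarrow> e > 0 \<and> ball t e \<subseteq> S \<and> ball t e \<inter> T = {t}"
  proof
    fix t show "\<exists>e. t \<in> T \<longrightarrow> e > 0 \<and> ball t e \<subseteq> S \<and> ball t e \<inter> T = {t}"
    proof (cases "t \<in> T")
      case True
      obtain e1 where "e1 > 0" "ball t e1 \<subseteq> S" using T True by (meson mem_interior subsetD)
      moreover obtain e2 where "e2 > 0" "ball t e2 \<inter> T \<subseteq> {t}" using locally_finite_closed(2)[OF fin, of t] by blast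
      ultimately show ?thesis using True by (intro exI[of _ "min e1 e2"]) auto
    qed auto
  qed
  then obtain e where e: "\<And>t. t \<in> T \<Longrightarrow> e t > 0 \<and> ball t (e t) \<subseteq> S \<and> ball t (e t) \<inter> T = {t}" by metis
  define P where "P = (\<lambda>t. ball t (e t) - {t})"
  have P: "P t \<subseteq> S - T" if "t \<in> T" for t using e[OF that] by (auto simp: P_def)
  have "P t \<subseteq> A \<or> P t \<subseteq> B" if "t \<in> T" for t
  proof (rule ccontr)
    assume "\<not> (P t \<subseteq> A \<or> P t \<subseteq> B)"
    then have ne: "A \<inter> P t \<noteq> {}" "B \<inter> P t \<noteq> {}" using P[OF that] AB(3) by blast+
    have "connected (P t)" unfolding P_def by (rule connected_punctured_ball[OF dim])
    moreover have "openin (top_of_set (P t)) (U \<inter> P t)" if "openin (top_of_set (S - T)) U" for U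
    proof -
      from that have "\<exists>O1. open O1 \<and> U = (S - T) \<inter> O1" by (auto simp: openin_open)
      then obtain O1 where "open O1" "U = (S - T) \<inter> O1" by blast
      then have "U \<inter> P t = P t \<inter> O1" using P[OF \<open>t \<in> T\<close>] by blast
      then show ?thesis using \<open>open O1\<close> by (simp add: openin_open_Int)
    qed
    note this[OF AB(1)] this[OF AB(2)]
    moreover have "P t \<subseteq> (A \<inter> P t) \<union> (B \<inter> P t)" using P[OF that] AB(3) by blast
    moreover have "(A \<inter> P t) \<inter> (B \<inter> P t) = {}" using AB(4) by blast
    ultimately show False using ne unfolding connected_openin by meson
  qed
  note PAB = this
  define A' where "A' = A \<union> {t \<in> T. P t \<subseteq> A}"
  define B' where "B' = B \<union> {t \<in> T. \<not> P t \<subseteq> A}"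
  have cT: "closed T" by (rule locally_finite_closed(1)[OF fin])
  have opST: "openin (top_of_set S) (S - T)"
    using cT by (metis Diff_eq open_Compl openin_open_Int)
  have ext: "openin (top_of_set S) (U \<union> {t \<in> T. t \<in> W})"
    if U: "openin (top_of_set (S - T)) U" and W: "\<And>t. t \<in> T \<Longrightarrow> t \<in> W \<Longrightarrow> P t \<subseteq> U" for U W
  proof (subst openin_subopen, intro ballI)
    fix x assume x: "x \<in> U \<union> {t \<in> T. t \<in> W}"
    have oU: "openin (top_of_set S) U" using U opST openin_trans by blast
    show "\<exists>V. openin (top_of_set S) V \<and> x \<in> V \<and> V \<subseteq> U \<union> {t \<in> T. t \<in> W}"
    proof (cases "x \<in> U")
      case True
      then show ?thesis using oU by blast
    next
      case False
      then have xT: "x \<in> T" "x \<in> W" using x by auto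
      have "openin (top_of_set S) (ball x (e x))" using e[OF xT(1)] by (simp add: open_subset)
      moreover have "ball x (e x) \<subseteq> U \<union> {t \<in> T. t \<in> W}" using W[OF xT] xT by (auto simp: P_def)
      ultimately show ?thesis using e[OF xT(1)] by (intro exI[of _ "ball x (e x)"]) auto
    qed
  qed
  have "openin (top_of_set S) A'" unfolding A'_def using ext[OF AB(1), of "{t. P t \<subseteq> A}"] by simp
  moreover have "openin (top_of_set S) B'" 
  proof -
    have "openin (top_of_set S) (B \<union> {t \<in> T. t \<in> {t. \<not> P t \<subseteq> A}})"
      by (rule ext[OF AB(2)]) (use PAB in blast)
    then show ?thesis by (simp only: B'_def mem_Collect_eq)
  qed
  moreover have "S \<subseteq> A' \<union> B'" using AB(3) by (auto simp: A'_def B'_def)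
  moreover have "A' \<inter> B' = {}" using AB(4) sub by (auto simp: A'_def B'_def)
  moreover have "A' \<noteq> {}" "B' \<noteq> {}" using AB(5,6) by (auto simp: A'_def B'_def)
  ultimately show False using S unfolding connected_openin by meson
qed

text \<open>Isolates what the covering argument takes from the orbifold: a proper action on a closed
  planar set, a locally finite set \<open>C\<close> of points with nontrivial stabilizer, and a disk
  as orbit space.\<close>

locale disk_quotient = group_action G S act for G (structure) and S :: "complex set" and act +
  fixes q :: "complex \<Rightarrow> complex" and D C :: "complex set"
  assumes closed_surface: "closed S" and connected_surface: "connected S"
    and locally_connected_surface: "locally connected S"
    and act_continuous: "\<And>\<gamma>. \<gamma> \<in> carrier G \<Longrightarrow> continuous_on S (act \<gamma>)"
    and proper: "\<And>K. compact K \<Longrightarrow> K \<subseteq> S \<Longrightarrow> finite {\<gamma> \<in> carrier G. act \<gamma> ` K \<inter> K \<noteq> {}}"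
    and cone_eq: "{x \<in> S. stabilizer G act x \<noteq> {\<one>}} = C"
    and cone_interior: "C \<subseteq> interior S"
    and cone_locally_finite: "\<And>K. compact K \<Longrightarrow> finite (C \<inter> K)"
    and finite_cone_image: "finite (q ` C)"
    and orbit_disk: "orbit_disk G act S q D"
begin

section \<open>Orbits, free neighbourhoods and the orbit map\<close>

lemma group_G: "group G"
  using group_hom group_hom.axioms(1) by blast

lemma inv_closed: "\<gamma> \<in> carrier G \<Longrightarrow> inv \<gamma> \<in> carrier G"
  using group_G by (simp add: group.inv_closed)

lemma act_in: "\<gamma> \<in> carrier G \<Longrightarrow> x \<in> S \<Longrightarrow> act \<gamma> x \<in> S"
  using element_image by blast

lemma act_one: "x \<in> S \<Longrightarrow> act \<one> x = x"
  using id_eq_one by (metis restrict_apply')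

lemma act_inv: "\<gamma> \<in> carrier G \<Longrightarrow> x \<in> S \<Longrightarrow> act (inv \<gamma>) (act \<gamma> x) = x"
  using orbit_sym_aux by blast

lemma act_inv': "\<gamma> \<in> carrier G \<Longrightarrow> x \<in> S \<Longrightarrow> act \<gamma> (act (inv \<gamma>) x) = x"
  using act_inv[of "inv \<gamma>" x] inv_closed group.inv_inv[OF group_G] by simp

lemma act_image_open:
  assumes "\<gamma> \<in> carrier G" "openin (top_of_set S) U"
  shows "openin (top_of_set S) (act \<gamma> ` U)"
proof -
  have US: "U \<subseteq> S" using assms(2) openin_imp_subset by auto
  have eq: "act \<gamma> ` U = S \<inter> act (inv \<gamma>) -` U"
  proof (intro equalityI subsetI)
    fix x assume "x \<in> act \<gamma> ` U"
    then obtain u where u: "u \<in> U" "x = act \<gamma> u" by auto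
    then have "u \<in> S" using US by auto
    then show "x \<in> S \<inter> act (inv \<gamma>) -` U" using u act_in assms(1) act_inv by auto
  next
    fix x assume x: "x \<in> S \<inter> act (inv \<gamma>) -` U"
    then have "x = act \<gamma> (act (inv \<gamma>) x)" using act_inv' assms(1) by auto
    then show "x \<in> act \<gamma> ` U" using x by (metis IntD2 imageI vimageD)
  qed
  have "continuous_on S (act (inv \<gamma>))" "act (inv \<gamma>) ` S = S" using act_continuous surj_prop inv_closed assms(1) by auto
  then have "openin (top_of_set S) (S \<inter> act (inv \<gamma>) -` U)" using assms(2) continuous_on_open by metis
  then show ?thesis unfolding eq .
qed

lemma act_interior: "\<gamma> \<in> carrier G \<Longrightarrow> x \<in> interior S \<Longrightarrow> act \<gamma> x \<in> interior S"
proof -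
  assume \<gamma>: "\<gamma> \<in> carrier G" and x: "x \<in> interior S"
  have "open (act \<gamma> ` interior S)"
    using act_continuous[OF \<gamma>] inj_prop[OF \<gamma>] interior_subset[of S]
    by (intro invariance_of_domain) (auto intro: continuous_on_subset inj_on_subset)
  moreover have "act \<gamma> ` interior S \<subseteq> S" using act_in \<gamma> interior_subset[of S] by auto
  ultimately show ?thesis using x interior_maximal by blast
qed

lemma q_image: "q ` S = D"
  using orbit_disk by (simp add: orbit_disk_def quotient_map_def)

lemma q_in: "x \<in> S \<Longrightarrow> q x \<in> D"
  using q_image by blast

lemma q_continuous: "continuous_on S q"
  using orbit_disk quotient_imp_continuous_map by (fastforce simp: orbit_disk_def)

lemma q_eq_iff:
  assumes "x \<in> S" "y \<in> S"
  shows "q x = q y \<longleftrightarrow> (\<exists>\<gamma>\<in>carrier G. y = act \<gamma> x)"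
proof -
  have "q x = q y \<longleftrightarrow> orbit G act x = orbit G act y" using orbit_disk assms by (simp add: orbit_disk_def)
  also have "\<dots> \<longleftrightarrow> y \<in> orbit G act x"
  proof
    assume "orbit G act x = orbit G act y"
    then show "y \<in> orbit G act x" using orbit_refl assms by auto
  next
    assume y: "y \<in> orbit G act x"
    have oS: "orbit G act z \<subseteq> S" if "z \<in> S" for z using that act_in by (auto simp: orbit_def)
    have x: "x \<in> orbit G act y" using orbit_sym assms y by blast
    show "orbit G act x = orbit G act y"
      using orbit_trans[OF assms _ y] orbit_trans[OF assms(2,1) _ x] oS assms by blast
  qed
  also have "\<dots> \<longleftrightarrow> (\<exists>\<gamma>\<in>carrier G. y = act \<gamma> x)" by (auto simp: orbit_def)
  finally show ?thesis .
qed

lemma q_act: "\<gamma> \<in> carrier G \<Longrightarrow> x \<in> S \<Longrightarrow> q (act \<gamma> x) = q x"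
  using q_eq_iff[of x "act \<gamma> x"] act_in by auto

text \<open>The full preimage of the image of \<open>U\<close> is the union of the translates of
  \<open>U\<close>, and \<open>q\<close> is a quotient map.\<close>

lemma q_open:
  assumes U: "openin (top_of_set S) U"
  shows "openin (top_of_set D) (q ` U)"
proof -
  have US: "U \<subseteq> S" using U openin_imp_subset by auto
  have "{x \<in> S. q x \<in> q ` U} = (\<Union>\<gamma>\<in>carrier G. act \<gamma> ` U)"
  proof (intro equalityI subsetI)
    fix x assume "x \<in> {x \<in> S. q x \<in> q ` U}"
    then obtain u where "x \<in> S" "u \<in> U" "q u = q x" by auto
    then show "x \<in> (\<Union>\<gamma>\<in>carrier G. act \<gamma> ` U)" using q_eq_iff[of u x] US by blast
  next
    fix x assume "x \<in> (\<Union>\<gamma>\<in>carrier G. act \<gamma> ` U)"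
    then obtain \<gamma> u where g: "\<gamma> \<in> carrier G" "u \<in> U" "x = act \<gamma> u" by blast
    then have "u \<in> S" using US by auto
    then show "x \<in> {x \<in> S. q x \<in> q ` U}" using g act_in q_act by auto
  qed
  moreover have "openin (top_of_set S) (\<Union>\<gamma>\<in>carrier G. act \<gamma> ` U)"
    by (intro openin_Union) (use act_image_open U in auto)
  moreover have "openin (top_of_set S) {x \<in> S. q x \<in> W} \<longleftrightarrow> openin (top_of_set D) W" if "W \<subseteq> D" for W
    using orbit_disk that by (simp add: orbit_disk_def quotient_map_def)
  from this[of "q ` U"] have "openin (top_of_set S) {x \<in> S. q x \<in> q ` U} \<longleftrightarrow> openin (top_of_set D) (q ` U)"
    using US q_image by blast
  ultimately show ?thesis by simp
qed

lemma cone_subset: "C \<subseteq> S"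
  using cone_eq by auto

lemma free_off_cone: "x \<in> S \<Longrightarrow> x \<notin> C \<Longrightarrow> \<gamma> \<in> carrier G \<Longrightarrow> act \<gamma> x = x \<Longrightarrow> \<gamma> = \<one>"
  using cone_eq by (auto simp: stabilizer_def)

lemma cone_stabilizer:
  assumes "x \<in> C"
  obtains \<gamma> where "\<gamma> \<in> carrier G" "\<gamma> \<noteq> \<one>" "act \<gamma> x = x"
proof -
  have "x \<in> S" "stabilizer G act x \<noteq> {\<one>}" using assms cone_eq by auto
  moreover have "\<one> \<in> stabilizer G act x" using stabilizer_one_closed \<open>x \<in> S\<close> by blast
  ultimately obtain \<gamma> where "\<gamma> \<in> stabilizer G act x" "\<gamma> \<noteq> \<one>" by blast
  then show ?thesis using that by (auto simp: stabilizer_def)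
qed

text \<open>Conjugation by \<open>\<gamma>\<close> carries a nontrivial element fixing
  \<open>x\<close> to one fixing \<open>act \<gamma> x\<close>; the converse is the same statement
  for \<open>inv \<gamma>\<close>.\<close>

lemma act_cone:
  assumes \<gamma>: "\<gamma> \<in> carrier G" and x: "x \<in> S"
  shows "act \<gamma> x \<in> C \<longleftrightarrow> x \<in> C"
proof -
  have imp: "act \<gamma> x \<in> C" if \<gamma>: "\<gamma> \<in> carrier G" and x: "x \<in> C" for \<gamma> x
  proof -
    interpret group G by (rule group_G)
    have xS: "x \<in> S" using x cone_subset by auto
    obtain \<delta> where \<delta>: "\<delta> \<in> carrier G" "\<delta> \<noteq> \<one>" "act \<delta> x = x" using x by (rule cone_stabilizer)
    define \<epsilon> where "\<epsilon> = \<gamma> \<otimes> (\<delta> \<otimes> inv \<gamma>)"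
    have "act \<epsilon> (act \<gamma> x) = act \<gamma> x"
      unfolding \<epsilon>_def using \<gamma> \<delta> xS by (simp add: composition_rule act_in act_inv)
    moreover have "\<epsilon> \<in> carrier G" using \<gamma> \<delta> by (simp add: \<epsilon>_def)
    moreover have "\<epsilon> \<noteq> \<one>"
    proof
      assume "\<epsilon> = \<one>"
      moreover have "\<epsilon> \<otimes> \<gamma> = \<gamma> \<otimes> \<delta>" using \<gamma> \<delta> by (simp add: \<epsilon>_def m_assoc)
      ultimately have "\<gamma> \<otimes> \<delta> = \<gamma>" using \<gamma> by simp
      then show False using \<gamma> \<delta> by simp
    qed
    ultimately show ?thesis using free_off_cone[of "act \<gamma> x" \<epsilon>] act_in \<gamma> xS by blast
  qed
  show ?thesis
    using imp[of \<gamma> x] imp[of "inv \<gamma>" "act \<gamma> x"] act_inv[OF \<gamma> x] \<gamma> x inv_closed by auto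
qed

text \<open>By properness only finitely many elements carry \<open>S \<inter> cball x 1\<close> to a
  set meeting it. Each of them other than \<open>\<one>\<close> moves \<open>x\<close>, which a
  small neighbourhood detects; all remaining elements move the whole set off itself.\<close>

lemma free_neighbourhood:
  assumes x: "x \<in> S" "x \<notin> C"
  obtains U where "openin (top_of_set S) U" "x \<in> U"
    "\<And>\<gamma>. \<gamma> \<in> carrier G \<Longrightarrow> \<gamma> \<noteq> \<one> \<Longrightarrow> act \<gamma> ` U \<inter> U = {}"
proof -
  define K where "K = S \<inter> cball x 1"
  have K: "compact K" "K \<subseteq> S" using closed_surface by (auto simp: K_def intro: closed_Int_compact)
  define \<Gamma> where "\<Gamma> = {\<gamma> \<in> carrier G. act \<gamma> ` K \<inter> K \<noteq> {}} - {\<one>}"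
  have fin: "finite \<Gamma>" unfolding \<Gamma>_def using proper[OF K] by auto
  have "\<forall>\<gamma>. \<exists>U. \<gamma> \<in> \<Gamma> \<longrightarrow> openin (top_of_set S) U \<and> x \<in> U \<and> act \<gamma> ` U \<inter> U = {}"
  proof
    fix \<gamma> show "\<exists>U. \<gamma> \<in> \<Gamma> \<longrightarrow> openin (top_of_set S) U \<and> x \<in> U \<and> act \<gamma> ` U \<inter> U = {}"
    proof (cases "\<gamma> \<in> \<Gamma>")
      case True
      then have \<gamma>: "\<gamma> \<in> carrier G" "\<gamma> \<noteq> \<one>" by (auto simp: \<Gamma>_def)
      then have "act \<gamma> x \<noteq> x" using free_off_cone x by blast
      then obtain A B where AB: "open A" "open B" "act \<gamma> x \<in> A" "x \<in> B" "A \<inter> B = {}" using hausdorff by metis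
      define U where "U = (S \<inter> act \<gamma> -` A) \<inter> (S \<inter> B)"
      have "openin (top_of_set S) U" unfolding U_def
        using act_continuous[OF \<gamma>(1)] AB by (intro openin_Int continuous_openin_preimage_gen openin_open_Int)
      moreover have "x \<in> U" "act \<gamma> ` U \<inter> U = {}" using AB x by (auto simp: U_def)
      ultimately show ?thesis by blast
    qed auto
  qed
  then obtain U where U: "\<And>\<gamma>. \<gamma> \<in> \<Gamma> \<Longrightarrow> openin (top_of_set S) (U \<gamma>) \<and> x \<in> U \<gamma> \<and> act \<gamma> ` U \<gamma> \<inter> U \<gamma> = {}" by metis
  define W where "W = (S \<inter> ball x 1) \<inter> (S \<inter> (\<Inter>\<gamma>\<in>\<Gamma>. U \<gamma>))"
  have "openin (top_of_set S) (S \<inter> (\<Inter>\<gamma>\<in>\<Gamma>. U \<gamma>))"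
  proof (cases "\<Gamma> = {}")
    case False
    then show ?thesis using fin U by (intro openin_Int openin_INT2) auto
  qed simp
  moreover have "openin (top_of_set S) (S \<inter> ball x 1)" by (simp add: openin_open_Int)
  ultimately have "openin (top_of_set S) W" unfolding W_def by (rule openin_Int[rotated])
  moreover have "x \<in> W" using x U by (auto simp: W_def)
  moreover have "act \<gamma> ` W \<inter> W = {}" if \<gamma>: "\<gamma> \<in> carrier G" "\<gamma> \<noteq> \<one>" for \<gamma>
  proof (cases "\<gamma> \<in> \<Gamma>")
    case True
    then show ?thesis using U[OF True] unfolding W_def by blast
  next
    case False
    then have "act \<gamma> ` K \<inter> K = {}" using \<gamma> by (auto simp: \<Gamma>_def)
    moreover have "W \<subseteq> K" by (auto simp: W_def K_def)
    ultimately show ?thesis by blast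
  qed
  ultimately show ?thesis by (rule that)
qed

lemma free_neighbourhood_inj:
  assumes U: "U \<subseteq> S" "\<And>\<gamma>. \<gamma> \<in> carrier G \<Longrightarrow> \<gamma> \<noteq> \<one> \<Longrightarrow> act \<gamma> ` U \<inter> U = {}"
  shows "inj_on q U"
proof (rule inj_onI)
  fix x y assume xy: "x \<in> U" "y \<in> U" "q x = q y"
  then obtain \<gamma> where \<gamma>: "\<gamma> \<in> carrier G" "y = act \<gamma> x" using q_eq_iff[of x y] U(1) by blast
  then have "\<gamma> = \<one>" using U(2) xy by blast
  then show "x = y" using \<gamma> act_one xy U(1) by auto
qed

text \<open>The compact set \<open>L\<close> contains the points of \<open>R\<close> together with
  their possible images in \<open>K\<close>, so properness bounds the group elements
  involved.\<close>

lemma locally_finite_saturation: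
  assumes "finite R" "R \<subseteq> S" "compact K"
  shows "finite (saturation G act R \<inter> K)"
proof -
  define L where "L = (S \<inter> K) \<union> R"
  have L: "compact L" "L \<subseteq> S" unfolding L_def using assms
    by (auto intro: compact_Un[OF closed_Int_compact[OF closed_surface] finite_imp_compact])
  have "saturation G act R \<inter> K \<subseteq> (\<Union>\<gamma>\<in>{\<gamma> \<in> carrier G. act \<gamma> ` L \<inter> L \<noteq> {}}. act \<gamma> ` R)"
  proof
    fix y assume y: "y \<in> saturation G act R \<inter> K"
    then obtain x \<gamma> where x: "x \<in> R" "\<gamma> \<in> carrier G" "y = act \<gamma> x" by (auto simp: saturation_def orbit_def)
    then have "y \<in> S" using assms(2) act_in by auto
    then have "y \<in> L" "x \<in> L" using y x by (auto simp: L_def)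
    then show "y \<in> (\<Union>\<gamma>\<in>{\<gamma> \<in> carrier G. act \<gamma> ` L \<inter> L \<noteq> {}}. act \<gamma> ` R)" using x by blast
  qed
  moreover have "finite (\<Union>\<gamma>\<in>{\<gamma> \<in> carrier G. act \<gamma> ` L \<inter> L \<noteq> {}}. act \<gamma> ` R)"
    using proper[OF L] assms(1) by auto
  ultimately show ?thesis by (rule finite_subset)
qed

lemma mem_saturation: "R \<subseteq> S \<Longrightarrow> x \<in> S \<Longrightarrow> x \<in> saturation G act R \<longleftrightarrow> q x \<in> q ` R"
proof -
  assume R: "R \<subseteq> S" and x: "x \<in> S"
  have "x \<in> saturation G act R \<longleftrightarrow> (\<exists>r\<in>R. \<exists>\<gamma>\<in>carrier G. x = act \<gamma> r)"
    by (auto simp: saturation_def orbit_def)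
  also have "\<dots> \<longleftrightarrow> (\<exists>r\<in>R. q r = q x)" using q_eq_iff[OF _ x] R by blast
  also have "\<dots> \<longleftrightarrow> q x \<in> q ` R" by (simp add: image_iff eq_commute[of "q x"])
  finally show ?thesis .
qed

lemma saturation_subset: "R \<subseteq> S \<Longrightarrow> saturation G act R \<subseteq> S"
  using act_in by (auto simp: saturation_def orbit_def)

text \<open>Away from the cone points this is invariance of domain; a cone point cannot go to the boundary
  because cone points are isolated whereas boundary points of a disk are not.\<close>

lemma q_interior_iff:
  assumes x: "x \<in> S"
  shows "q x \<in> interior D \<longleftrightarrow> x \<in> interior S"
proof -
  interpret P: punctured_disk D "{}"
    using orbit_disk by unfold_locales (auto simp: orbit_disk_def)
  have free: "q y \<in> interior D" if y: "y \<in> interior S" "y \<notin> C" for y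
  proof -
    have yS: "y \<in> S" using y interior_subset by auto
    obtain U where U: "openin (top_of_set S) U" "y \<in> U" "\<And>\<gamma>. \<gamma> \<in> carrier G \<Longrightarrow> \<gamma> \<noteq> \<one> \<Longrightarrow> act \<gamma> ` U \<inter> U = {}"
      using free_neighbourhood[OF yS y(2)] by metis
    have US: "U \<subseteq> S" using U(1) openin_imp_subset by auto
    obtain T where T: "open T" "U = S \<inter> T" using U(1) by (auto simp: openin_open)
    have "open (q ` (T \<inter> interior S))"
    proof (rule invariance_of_domain)
      have sub: "T \<inter> interior S \<subseteq> U" using T interior_subset by auto
      show "continuous_on (T \<inter> interior S) q" using q_continuous sub US continuous_on_subset by blast
      show "inj_on q (T \<inter> interior S)" using free_neighbourhood_inj[OF US U(3)] sub inj_on_subset by blast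
    qed (use T in auto)
    moreover have "q ` (T \<inter> interior S) \<subseteq> D" using q_in interior_subset[of S] by auto
    moreover have "q y \<in> q ` (T \<inter> interior S)" using y U(2) T by auto
    ultimately show ?thesis using interior_maximal by blast
  qed
  show ?thesis
  proof
    assume xi: "x \<in> interior S"
    show "q x \<in> interior D"
    proof (rule ccontr)
      assume n: "q x \<notin> interior D"
      then have "x \<in> C" using free xi by blast
      obtain e1 where e1: "e1 > 0" "ball x e1 \<subseteq> S" using xi by (meson mem_interior)
      obtain e2 where e2: "e2 > 0" "ball x e2 \<inter> C \<subseteq> {x}"
        using locally_finite_closed(2)[OF cone_locally_finite, of x] by blast
      define B where "B = ball x (min e1 e2)"
      have B: "open B" "B \<subseteq> S" "x \<in> B" "B \<inter> C \<subseteq> {x}" using e1 e2 by (auto simp: B_def)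
      have BI: "B \<subseteq> interior S" using B interior_maximal by blast
      have "openin (top_of_set D) (q ` B)" using B by (intro q_open open_subset)
      then obtain y where y: "y \<in> q ` B" "y \<noteq> q x" "y \<in> D - interior D"
        using P.boundary_no_isolated[of "q x" "q ` B"] n q_in x B(3) by blast
      then obtain z where z: "z \<in> B" "y = q z" "z \<noteq> x" by auto
      then have "z \<notin> C" using B by auto
      then show False using free[of z] z BI y by auto
    qed
  next
    assume qi: "q x \<in> interior D"
    show "x \<in> interior S"
    proof (cases "x \<in> C")
      case False
      obtain U where U: "openin (top_of_set S) U" "x \<in> U" "\<And>\<gamma>. \<gamma> \<in> carrier G \<Longrightarrow> \<gamma> \<noteq> \<one> \<Longrightarrow> act \<gamma> ` U \<inter> U = {}"
        using free_neighbourhood[OF x False] by metis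
      have US: "U \<subseteq> S" using U(1) openin_imp_subset by auto
      \<comment> \<open>Cutting down to the preimage of \<open>interior D\<close> makes the image
        \<open>W\<close> open in the plane, so that invariance of domain applies to the local
        inverse of \<open>q\<close>.\<close>
      define U' where "U' = U \<inter> (S \<inter> q -` interior D)"
      have U'o: "openin (top_of_set S) U'"
        unfolding U'_def using U q_continuous by (intro openin_Int continuous_openin_preimage_gen) auto
      have U'U: "U' \<subseteq> U" by (auto simp: U'_def)
      have inj: "inj_on q U'" using free_neighbourhood_inj[OF US U(3)] U'U inj_on_subset by blast
      define W where "W = q ` U'"
      have "openin (top_of_set D) W" unfolding W_def by (rule q_open[OF U'o])
      moreover have WI: "W \<subseteq> interior D" by (auto simp: W_def U'_def)
      ultimately have "open W"
        by (metis inf.absorb_iff2 interior_subset open_interior openin_open_eq openin_subset_trans)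
      have "continuous_on W (inv_into U' q)"
      proof (rule continuous_on_inverse_open_map)
        show "continuous_on U' q" using q_continuous U'U US by (meson continuous_on_subset)
        show "q ` U' = W" by (simp add: W_def)
        show "inv_into U' q (q y) = y" if "y \<in> U'" for y using inj that by simp
        show "openin (top_of_set W) (q ` V)" if "openin (top_of_set U') V" for V
        proof -
          have "openin (top_of_set S) V" using that U'o openin_trans by blast
          then have "openin (top_of_set D) (q ` V)" by (rule q_open)
          moreover have "q ` V \<subseteq> W" using openin_imp_subset[OF that] by (auto simp: W_def)
          ultimately show ?thesis using WI interior_subset[of D] by (meson openin_subset_trans subset_trans)
        qed
      qed
      moreover have "inj_on (inv_into U' q) W" by (simp add: W_def inj_on_inv_into)
      ultimately have "open (inv_into U' q ` W)" using \<open>open W\<close> invariance_of_domain by blast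
      moreover have "inv_into U' q ` W = U'" unfolding W_def by (rule inv_into_image_cancel[OF inj subset_refl])
      ultimately have "U' \<subseteq> interior S" using U'U US by (intro interior_maximal) auto
      moreover have "x \<in> U'" using U(2) x qi by (auto simp: U'_def)
      ultimately show ?thesis by blast
    qed (use cone_interior in auto)
  qed
qed

end

section \<open>Lifting isotopies\<close>

text \<open>The inverse isotopy applied to the sphere of radius \<open>e\<close> gives the compact
  set \<open>J\<close> of points that ever reach this sphere, and it misses \<open>c\<close>. The
  track of a small punctured ball away from \<open>J\<close> is connected, avoids the sphere and
  starts inside it, hence never leaves.\<close>

lemma isotopy_near_puncture:
  fixes Y :: "complex set"
  assumes H: "ambient Y H G" "\<And>x. x \<in> Y \<Longrightarrow> H 0 x = x" and c: "c \<notin> Y" and e: "0 < e" "cball c e - {c} \<subseteq> Y"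
  shows "\<exists>d>0. d \<le> e \<and> (\<forall>t\<in>{0..1}. \<forall>x\<in>ball c d - {c}. H t x \<in> ball c e)"
proof -
  define J where "J = (\<lambda>z. G (fst z) (snd z)) ` ({0..1} \<times> sphere c e)"
  have sph: "sphere c e \<subseteq> Y" using e by auto
  have "compact J" unfolding J_def
    by (intro compact_continuous_image continuous_on_subset[OF ambient_cont[OF ambient_sym[OF H(1)]]] compact_Times)
      (use sph in auto)
  moreover have "c \<notin> J" using ambient_in[OF ambient_sym[OF H(1)]] sph c by (force simp: J_def)
  ultimately obtain d0 where d0: "d0 > 0" "\<forall>x\<in>J. d0 \<le> dist c x"
    using separate_point_closed[of J c] compact_imp_closed by auto
  define d where "d = min d0 e"
  define B where "B = ball c d - {c}"
  have d: "d > 0" "d \<le> e" using d0 e by (auto simp: d_def)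
  have "ball c d \<subseteq> cball c e" using d by auto
  then have BY: "B \<subseteq> Y" using e(2) unfolding B_def by blast
  define I where "I = (\<lambda>z. H (fst z) (snd z)) ` ({0..1} \<times> B)"
  have "connected B" unfolding B_def by (rule connected_punctured_ball) simp
  then have "connected ({0..1::real} \<times> B)" by (intro connected_Times) auto
  then have con: "connected I" unfolding I_def
    by (intro connected_continuous_image continuous_on_subset[OF ambient_cont[OF H(1)]]) (use BY in auto)
  have dis: "I \<inter> frontier (ball c e) = {}"
  proof (rule ccontr)
    assume "I \<inter> frontier (ball c e) \<noteq> {}"
    then obtain w where w: "w \<in> I" "w \<in> sphere c e"
      using frontier_ball[OF e(1), of c] by blast
    then obtain t x where tx: "t \<in> {0..1}" "x \<in> B" "H t x \<in> sphere c e"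
      unfolding I_def by force
    have "x = G t (H t x)" using ambient_inv[OF H(1), of t x] tx BY by auto
    then have "x \<in> J" unfolding J_def using tx by force
    then show False using d0(2) tx(2) by (auto simp: B_def d_def)
  qed
  have "c + of_real (d / 2) \<in> B" using d by (auto simp: B_def dist_norm)
  then have "H 0 (c + of_real (d / 2)) \<in> I" "H 0 (c + of_real (d / 2)) = c + of_real (d / 2)"
    using H(2) BY by (force simp: I_def)+
  moreover have "c + of_real (d / 2) \<in> ball c e" using d by (auto simp: dist_norm)
  ultimately have "I \<inter> ball c e \<noteq> {}" by auto
  then have "I - ball c e = {}" using connected_Int_frontier[OF con, of "ball c e"] dis by blast
  then have "H t x \<in> ball c e" if "t \<in> {0..1}" "x \<in> B" for t x using that by (force simp: I_def)
  then show ?thesis using d unfolding B_def by blast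
qed

lemma extension_continuous:
  fixes Y C :: "complex set"
  assumes H: "ambient Y H G" "\<And>x. x \<in> Y \<Longrightarrow> H 0 x = x" and C: "closed C" "Y \<inter> C = {}"
    and punct: "\<And>c. c \<in> C \<Longrightarrow> \<exists>e>0. ball c e - {c} \<subseteq> Y"
  shows "continuous_on ({0..1} \<times> (Y \<union> C)) (\<lambda>z. if snd z \<in> C then snd z else H (fst z) (snd z))"
proof (rule continuous_on_eq_continuous_within[THEN iffD2], rule ballI)
  let ?h = "\<lambda>z. if snd z \<in> C then snd z else H (fst z) (snd z)"
  fix z assume z: "z \<in> {0..1::real} \<times> (Y \<union> C)"
  show "continuous (at z within {0..1} \<times> (Y \<union> C)) ?h"
    unfolding continuous_within_topological
  proof (intro allI impI)
    fix B assume B: "open B" "?h z \<in> B"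
    show "\<exists>A. open A \<and> z \<in> A \<and> (\<forall>y\<in>{0..1} \<times> (Y \<union> C). y \<in> A \<longrightarrow> ?h y \<in> B)"
    proof (cases "snd z \<in> C")
      case False
      then have "z \<in> {0..1} \<times> Y" "H (fst z) (snd z) \<in> B" using z B by auto
      then obtain A where A: "open A" "z \<in> A" "\<forall>y\<in>{0..1} \<times> Y. y \<in> A \<longrightarrow> H (fst y) (snd y) \<in> B"
        using ambient_cont[OF H(1)] B(1) unfolding continuous_on_topological by blast
      show ?thesis
      proof (intro exI[of _ "A \<inter> (UNIV \<times> - C)"] conjI ballI impI)
        show "open (A \<inter> UNIV \<times> - C)" using A C by (intro open_Int open_Times) auto
        show "z \<in> A \<inter> UNIV \<times> - C" using A False by (auto simp: mem_Times_iff)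
        fix y assume "y \<in> {0..1::real} \<times> (Y \<union> C)" "y \<in> A \<inter> UNIV \<times> - C"
        then have "y \<in> {0..1} \<times> Y" "y \<in> A" "snd y \<notin> C" by auto
        then show "?h y \<in> B" using bspec[OF A(3), of y] by simp
      qed
    next
      case True
      then obtain e0 where e0: "e0 > 0" "ball (snd z) e0 - {snd z} \<subseteq> Y" using punct by blast
      obtain e1 where e1: "e1 > 0" "ball (snd z) e1 \<subseteq> B" using B True by (auto simp: open_contains_ball)
      \<comment> \<open>The factor \<open>1/2\<close> lets the closed ball fit into the open
        punctured neighbourhood.\<close>
      define e where "e = min (e0 / 2) e1"
      have e: "e > 0" "cball (snd z) e - {snd z} \<subseteq> Y" "ball (snd z) e \<subseteq> B"
        using e0 e1 by (auto simp: e_def intro!: subsetD[OF e0(2)] subsetD[OF e1(2)])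
      have "snd z \<notin> Y" using True C by auto
      then obtain d where d: "d > 0" "d \<le> e" "\<forall>t\<in>{0..1}. \<forall>x\<in>ball (snd z) d - {snd z}. H t x \<in> ball (snd z) e"
        using isotopy_near_puncture[OF H _ e(1,2)] by blast
      show ?thesis
      proof (intro exI[of _ "UNIV \<times> ball (snd z) d"] conjI ballI impI)
        show "open (UNIV \<times> ball (snd z) d)" by (intro open_Times) auto
        show "z \<in> UNIV \<times> ball (snd z) d" using d by (auto simp: mem_Times_iff)
        fix y assume y: "y \<in> {0..1::real} \<times> (Y \<union> C)" "y \<in> UNIV \<times> ball (snd z) d"
        show "?h y \<in> B"
        proof (cases "snd y \<in> C")
          case True
          have "snd y \<in> ball (snd z) e" using y d(2) by auto
          then show ?thesis using True e(3) by auto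
        next
          case False
          then have "snd y \<in> ball (snd z) d - {snd z}" using y \<open>snd z \<in> C\<close> by auto
          then have "H (fst y) (snd y) \<in> ball (snd z) e" using d(3) y by auto
          then show ?thesis using False e(3) by auto
        qed
      qed
    qed
  qed
qed

text \<open>The inverse family also starts at the identity, so the continuity argument at the
  punctures applies to \<open>H\<close> and \<open>G\<close> alike.\<close>

lemma ambient_extend:
  fixes Y C :: "complex set"
  assumes H: "ambient Y H G" "\<And>x. x \<in> Y \<Longrightarrow> H 0 x = x" and C: "closed C" "Y \<inter> C = {}"
    and punct: "\<And>c. c \<in> C \<Longrightarrow> \<exists>e>0. ball c e - {c} \<subseteq> Y"
  shows "ambient (Y \<union> C) (\<lambda>t x. if x \<in> C then x else H t x) (\<lambda>t x. if x \<in> C then x else G t x)"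
proof -
  have G0: "G 0 x = x" if "x \<in> Y" for x using ambient_inv[OF H(1), of 0 x] H(2) that by simp
  note hc = extension_continuous[OF H C punct] extension_continuous[OF ambient_sym[OF H(1)] G0 C punct]
  have "H t x \<in> Y - C \<and> G t x \<in> Y - C \<and> G t (H t x) = x \<and> H t (G t x) = x" if "t \<in> {0..1}" "x \<in> Y" for t x
    using ambient_in[OF H(1), of t x] ambient_in[OF ambient_sym[OF H(1)], of t x] ambient_inv[OF H(1), of t x]
      ambient_inv[OF ambient_sym[OF H(1)], of t x] that C by auto
  then show ?thesis using hc unfolding ambient_def by auto
qed

section \<open>The covering of the punctured disk\<close>

locale punctured_quotient = disk_quotient +
  fixes R :: "complex set"
  assumes finite_R: "finite R" and R_interior: "R \<subseteq> interior S" and R_cone: "R \<inter> C = {}"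
begin

text \<open>In the usual notation \<open>SL\<close> is \<Sigma>(L) and \<open>X\<close> is D(L,N);
  \<open>Y\<close> is the part of \<open>SL\<close> on which the group acts freely.\<close>

abbreviation "SL \<equiv> S - saturation G act R"
abbreviation "Y \<equiv> SL - C"
abbreviation "X \<equiv> D - q ` (R \<union> C)"

lemma R_subset: "R \<subseteq> S"
  using R_interior interior_subset by blast

sublocale P: punctured_disk D "q ` (R \<union> C)"
proof
  show "D homeomorphic cball (0::complex) 1" using orbit_disk by (simp add: orbit_disk_def)
  show "finite (q ` (R \<union> C))" using finite_R finite_cone_image by (simp add: image_Un)
  show "q ` (R \<union> C) \<subseteq> interior D"
    using q_interior_iff R_interior cone_interior interior_subset[of S] by blast
qed

lemma saturation_R_interior: "saturation G act R \<subseteq> interior S"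
  using R_interior act_interior by (auto simp: saturation_def orbit_def)

lemma saturation_R_cone: "saturation G act R \<inter> C = {}"
  using R_cone R_subset act_cone by (auto simp: saturation_def orbit_def)

lemma closed_saturation: "closed (saturation G act R)"
  by (rule locally_finite_closed(1)[OF locally_finite_saturation[OF finite_R R_subset]])

lemma closed_cone: "closed C"
  by (rule locally_finite_closed(1)[OF cone_locally_finite])

lemma q_cone: "x \<in> S \<Longrightarrow> q x \<in> q ` C \<longleftrightarrow> x \<in> C"
proof
  assume x: "x \<in> S" "q x \<in> q ` C"
  then obtain c where c: "c \<in> C" "q c = q x" by (metis imageE)
  then obtain \<gamma> where "\<gamma> \<in> carrier G" "x = act \<gamma> c" using q_eq_iff[of c x] x(1) cone_subset by blast
  then show "x \<in> C" using act_cone c(1) cone_subset by blast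
qed blast

lemma mem_Y: "x \<in> S \<Longrightarrow> q x \<in> X \<longleftrightarrow> x \<in> Y"
  using mem_saturation[OF R_subset] q_cone q_in by (auto simp: image_Un)

lemma q_Y: "x \<in> Y \<Longrightarrow> q x \<in> X"
  using mem_Y by blast

lemma act_SL: "\<gamma> \<in> carrier G \<Longrightarrow> x \<in> SL \<Longrightarrow> act \<gamma> x \<in> SL"
  using mem_saturation[OF R_subset] act_in q_act by auto

lemma act_Y: "\<gamma> \<in> carrier G \<Longrightarrow> x \<in> Y \<Longrightarrow> act \<gamma> x \<in> Y"
  using act_SL act_cone by auto

lemma Y_image: "q ` Y = X"
proof
  show "X \<subseteq> q ` Y"
  proof
    fix y assume y: "y \<in> X"
    then obtain x where "x \<in> S" "y = q x" using q_image by auto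
    then show "y \<in> q ` Y" using mem_Y y by blast
  qed
  show "q ` Y \<subseteq> X" by (rule image_subsetI) (rule q_Y)
qed

lemma openin_SL: "openin (top_of_set S) SL" and openin_Y: "openin (top_of_set S) Y"
proof -
  have "SL = S \<inter> - saturation G act R" "Y = S \<inter> - (saturation G act R \<union> C)" by auto
  then show "openin (top_of_set S) SL" "openin (top_of_set S) Y"
    using closed_saturation closed_cone by (metis open_Compl openin_open_Int closed_Un)+
qed

lemma locally_compact_SL: "locally compact SL" and locally_compact_Y: "locally compact Y"
  and locally_connected_SL: "locally connected SL" and locally_connected_Y: "locally connected Y"
  using locally_open_subset[OF closed_imp_locally_compact[OF closed_surface]] openin_SL openin_Y
    locally_open_subset[OF locally_connected_surface] by blast+

lemma bd_SL: "bd SL = S - interior S"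
proof -
  have "open (interior S - saturation G act R)" using closed_saturation by (simp add: open_Diff)
  then have "interior S - saturation G act R \<subseteq> interior SL" using interior_subset[of S] by (intro interior_maximal) auto
  moreover have "interior SL \<subseteq> interior S" by (rule interior_mono) auto
  ultimately show ?thesis using saturation_R_interior by (auto simp: bd_def)
qed

lemma bd_SL_Y: "bd SL \<subseteq> Y"
  using bd_SL saturation_R_interior cone_interior by auto

lemma q_bd: "x \<in> S \<Longrightarrow> q x \<in> bd X \<longleftrightarrow> x \<in> bd SL"
  using P.bd_punctured bd_SL q_interior_iff q_in by auto

text \<open>Supplies a point at which two lifts can be compared.\<close>

lemma bd_SL_nonempty: "bd SL \<noteq> {}"
proof -
  obtain y where y: "y \<in> D - interior D" using P.boundary_nonempty by auto
  then obtain x where "x \<in> S" "y = q x" using q_image by auto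
  then show ?thesis using y q_bd[of x] P.bd_punctured by auto
qed

text \<open>Connectedness lets a single value determine a self-map of \<open>Y\<close> that covers a
  given map of the disk.\<close>

lemma connected_Y: "connected Y"
proof -
  have "connected (S - (saturation G act R \<union> C))"
  proof (rule connected_minus_locally_finite[OF _ connected_surface])
    show "saturation G act R \<union> C \<subseteq> interior S" using saturation_R_interior cone_interior by auto
    show "finite ((saturation G act R \<union> C) \<inter> K)" if "compact K" for K
      using locally_finite_saturation[OF finite_R R_subset that] cone_locally_finite[OF that] by (simp add: Int_Un_distrib2)
  qed simp
  then show ?thesis by (simp add: Diff_eq Int_assoc)
qed

text \<open>Over the image of a free neighbourhood the sheets are the translates of that
  neighbourhood.\<close>

lemma covering: "covering_space Y q X"
proof
  show cY: "continuous_on Y q" by (rule continuous_on_subset[OF q_continuous]) auto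
  show "q ` Y = X" by (rule Y_image)
  fix y assume "y \<in> X"
  then obtain x where x: "x \<in> Y" "y = q x" using Y_image by (metis imageE)
  obtain U0 where U0: "openin (top_of_set S) U0" "x \<in> U0" "\<And>\<gamma>. \<gamma> \<in> carrier G \<Longrightarrow> \<gamma> \<noteq> \<one> \<Longrightarrow> act \<gamma> ` U0 \<inter> U0 = {}"
    using free_neighbourhood[of x] x by (metis DiffE)
  define U where "U = U0 \<inter> Y"
  have "act \<gamma> ` U \<inter> U \<subseteq> act \<gamma> ` U0 \<inter> U0" for \<gamma> by (auto simp: U_def)
  then have U4: "\<And>\<gamma>. \<gamma> \<in> carrier G \<Longrightarrow> \<gamma> \<noteq> \<one> \<Longrightarrow> act \<gamma> ` U \<inter> U = {}" using U0(3) by blast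
  have U: "openin (top_of_set S) U" "x \<in> U" "U \<subseteq> Y" "\<And>\<gamma>. \<gamma> \<in> carrier G \<Longrightarrow> \<gamma> \<noteq> \<one> \<Longrightarrow> act \<gamma> ` U \<inter> U = {}"
    using openin_Int[OF U0(1) openin_Y] U0(2) x(1) U4 unfolding U_def by (simp_all only: IntI Int_lower2)
  have US: "U \<subseteq> S" using U by auto
  have injU: "inj_on q U" by (rule free_neighbourhood_inj[OF US U(4)])
  have toX: "openin (top_of_set X) (q ` W)" if "openin (top_of_set S) W" "W \<subseteq> Y" for W
  proof (rule openin_subset_trans[OF q_open[OF that(1)]])
    show "q ` W \<subseteq> X" using that(2) q_Y by (intro image_subsetI) (simp only: subsetD)
  qed blast
  show "\<exists>T. y \<in> T \<and> openin (top_of_set X) T \<and>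
      (\<exists>v. \<Union> v = Y \<inter> q -` T \<and> (\<forall>u\<in>v. openin (top_of_set Y) u) \<and> pairwise disjnt v \<and> (\<forall>u\<in>v. \<exists>p. homeomorphism u T q p))"
  proof (intro exI[of _ "q ` U"] conjI exI[of _ "(\<lambda>\<gamma>. act \<gamma> ` U) ` carrier G"] ballI)
    show "y \<in> q ` U" using x U by auto
    show "openin (top_of_set X) (q ` U)" using toX U by auto
    show "\<Union> ((\<lambda>\<gamma>. act \<gamma> ` U) ` carrier G) = Y \<inter> q -` (q ` U)"
    proof (intro equalityI subsetI)
      fix z assume "z \<in> \<Union> ((\<lambda>\<gamma>. act \<gamma> ` U) ` carrier G)"
      then obtain \<gamma> u where g: "\<gamma> \<in> carrier G" "u \<in> U" "z = act \<gamma> u" by blast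
      then have "u \<in> Y" "u \<in> S" using U US by auto
      then show "z \<in> Y \<inter> q -` (q ` U)" using g act_Y[of \<gamma> u] q_act[of \<gamma> u] by auto
    next
      fix z assume z: "z \<in> Y \<inter> q -` (q ` U)"
      then obtain u where u: "u \<in> U" "q z = q u" by auto
      then obtain \<gamma> where "\<gamma> \<in> carrier G" "z = act \<gamma> u" using q_eq_iff[of u z] US z by auto
      then show "z \<in> \<Union> ((\<lambda>\<gamma>. act \<gamma> ` U) ` carrier G)" using u by blast
    qed
    show "pairwise disjnt ((\<lambda>\<gamma>. act \<gamma> ` U) ` carrier G)"
    proof (rule pairwiseI)
      fix A B assume "A \<in> (\<lambda>\<gamma>. act \<gamma> ` U) ` carrier G" "B \<in> (\<lambda>\<gamma>. act \<gamma> ` U) ` carrier G" "A \<noteq> B"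
      then obtain \<gamma> \<delta> where g: "\<gamma> \<in> carrier G" "\<delta> \<in> carrier G" "A = act \<gamma> ` U" "B = act \<delta> ` U" by auto
      \<comment> \<open>If two sheets meet, the common point comes from a single \<open>a\<close> in
        \<open>U\<close>, because \<open>q\<close> is injective there. Then
        \<open>inv \<delta> \<otimes> \<gamma>\<close> fixes \<open>a\<close>, hence is trivial, and
        the sheets coincide.\<close>
      show "disjnt A B"
      proof (rule ccontr)
        assume "\<not> disjnt A B"
        then obtain a b where ab: "a \<in> U" "b \<in> U" "act \<gamma> a = act \<delta> b" using g by (auto simp: disjnt_def)
        have "q (act \<gamma> a) = q a" "q (act \<delta> b) = q b" using q_act[OF g(1), of a] q_act[OF g(2), of b] ab US by blast+
        then have "q a = q b" using ab(3) by simp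
        then have "a = b" using injU ab(1,2) by (simp add: inj_on_def)
        define \<epsilon> where "\<epsilon> = inv \<delta> \<otimes> \<gamma>"
        interpret group G by (rule group_G)
        have \<epsilon>: "\<epsilon> \<in> carrier G" using g by (simp add: \<epsilon>_def)
        have aS: "a \<in> S" using ab(1) US by blast
        have "act \<epsilon> a = act (inv \<delta>) (act \<gamma> a)" unfolding \<epsilon>_def by (rule composition_rule[OF aS inv_closed[OF g(2)] g(1)])
        also have "\<dots> = act (inv \<delta>) (act \<delta> a)" using ab(3) \<open>a = b\<close> by (simp only:)
        also have "\<dots> = a" by (rule act_inv[OF g(2) aS])
        finally have "act \<epsilon> a = a" .
        then have "a \<in> act \<epsilon> ` U \<inter> U" using ab(1) by (metis IntI imageI)
        then have "\<epsilon> = \<one>" using U(4)[OF \<epsilon>] by (metis empty_iff)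
        moreover have "\<delta> \<otimes> \<epsilon> = \<gamma>" using g(1,2) by (simp add: \<epsilon>_def m_assoc[symmetric])
        ultimately have "\<gamma> = \<delta>" using g(2) by simp
        then show False using \<open>A \<noteq> B\<close> g by simp
      qed
    qed
    fix u assume "u \<in> (\<lambda>\<gamma>. act \<gamma> ` U) ` carrier G"
    then obtain \<gamma> where g: "\<gamma> \<in> carrier G" "u = act \<gamma> ` U" by auto
    have uS: "openin (top_of_set S) u" using g act_image_open U(1) by auto
    have uY: "u \<subseteq> Y" using g U(3) act_Y by blast
    show oY: "openin (top_of_set Y) u" using uS uY by (rule openin_subset_trans) auto
    have "\<exists>p. homeomorphism u (q ` U) q p"
    proof (rule homeomorphism_injective_open_map)
      show "continuous_on u q" using cY uY continuous_on_subset by blast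
      have qa: "q (act \<gamma> a) = q a" if "a \<in> U" for a using q_act g(1) that US by auto
      then show "q ` u = q ` U" using g(2) by (simp add: image_image cong: image_cong)
      show "inj_on q u"
      proof (rule inj_onI)
        fix s t assume "s \<in> u" "t \<in> u" "q s = q t"
        then obtain a b where ab: "a \<in> U" "b \<in> U" "s = act \<gamma> a" "t = act \<gamma> b" using g by auto
        then have "q a = q b" using qa \<open>q s = q t\<close> by simp
        then have "a = b" using inj_onD[OF injU] ab by blast
        then show "s = t" using ab by simp
      qed
      show "openin (top_of_set (q ` U)) (q ` W)" if "openin (top_of_set u) W" for W
      proof -
        have WS: "openin (top_of_set S) W" using that uS openin_trans by blast
        have "W \<subseteq> u" using that openin_imp_subset by auto
        then have "q ` W \<subseteq> q ` u" by (rule image_mono)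
        then have sub: "q ` W \<subseteq> q ` U" unfolding \<open>q ` u = q ` U\<close> .
        have "q ` U \<subseteq> D" unfolding q_image[symmetric] by (rule image_mono[OF US])
        then show ?thesis by (rule openin_subset_trans[OF q_open[OF WS] sub])
      qed
    qed blast
    then show "\<exists>p. homeomorphism u (q ` U) q p" .
  qed
qed

section \<open>Lifts of isotopies by unique path lifting\<close>

lemma path_lift_unique:
  assumes a: "continuous_on {0..1} a" "\<And>t. t \<in> {0..1::real} \<Longrightarrow> a t \<in> Y"
    and b: "continuous_on {0..1} b" "\<And>t. t \<in> {0..1} \<Longrightarrow> b t \<in> Y"
    and eq: "\<And>t. t \<in> {0..1} \<Longrightarrow> q (a t) = q (b t)" "a 0 = b 0" and t: "t \<in> {0..1}"
  shows "a t = b t"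
proof (rule covering_space_lift_unique[OF covering, of a 0 b "{0..1}" "\<lambda>t. q (a t)"])
  show "continuous_on {0..1} (\<lambda>t. q (a t))"
    by (rule continuous_on_compose2[OF covering_space_imp_continuous[OF covering] a(1)]) (use a in auto)
  show "(\<lambda>t. q (a t)) \<in> {0..1} \<rightarrow> X" using q_Y a(2) by blast
qed (use assms in auto)

text \<open>The start at the identity is built in, which makes the lift unique. Its behaviour under
  inversion, the group action and the boundary follows each time from two lifts of one path with a
  common start.\<close>

definition lifts :: "(real \<Rightarrow> complex \<Rightarrow> complex) \<Rightarrow> (real \<Rightarrow> complex \<Rightarrow> complex) \<Rightarrow> bool" where
  "lifts H K \<longleftrightarrow> (\<forall>x\<in>Y. H 0 x = x) \<and> (\<forall>t\<in>{0..1}. \<forall>x\<in>Y. q (H t x) = K t (q x))"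

text \<open>Both sides lift the constant path at \<open>q x\<close>.\<close>

lemma lift_inverse:
  assumes H: "continuous_on ({0..1} \<times> Y) (\<lambda>z. H (fst z) (snd z))" "\<And>t x. t \<in> {0..1} \<Longrightarrow> x \<in> Y \<Longrightarrow> H t x \<in> Y" "lifts H K"
    and H': "continuous_on ({0..1} \<times> Y) (\<lambda>z. H' (fst z) (snd z))" "\<And>t x. t \<in> {0..1} \<Longrightarrow> x \<in> Y \<Longrightarrow> H' t x \<in> Y" "lifts H' K'"
    and K: "ambient X K K'" and t: "t \<in> {0..1}" and x: "x \<in> Y"
  shows "H' t (H t x) = x"
proof (rule path_lift_unique[of "\<lambda>t. H' t (H t x)" "\<lambda>_. x", OF _ _ _ _ _ _ t])
  show "continuous_on {0..1} (\<lambda>t. H' t (H t x))"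
    by (rule joint_compose[OF H'(1)], intro continuous_intros, rule joint_compose[OF H(1)])
      (use H(2) x in \<open>auto intro!: continuous_intros\<close>)
  show "q (H' t (H t x)) = q x" if t: "t \<in> {0..1}" for t
  proof -
    have "q (H' t (H t x)) = K' t (K t (q x))" using H(2,3) H'(3) t x by (simp add: lifts_def del: Diff_iff)
    then show ?thesis using ambient_inv[OF K, of t "q x"] t q_Y[OF x] by (simp del: Diff_iff)
  qed
qed (use H H' x in \<open>auto simp: lifts_def simp del: Diff_iff\<close>)

text \<open>The homotopy lifting property is applied to \<open>K\<close> and separately to its
  inverse; uniqueness makes the two lifts inverse to each other.\<close>

lemma lift_exists:
  assumes K: "ambient X K K'" "\<And>x. x \<in> X \<Longrightarrow> K 0 x = x"
  obtains H H' where "ambient Y H H'" "lifts H K"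
proof -
  have lift: "\<exists>H. continuous_on ({0..1} \<times> Y) (\<lambda>z. H (fst z) (snd z)) \<and> (\<forall>t\<in>{0..1}. \<forall>x\<in>Y. H t x \<in> Y) \<and> lifts H K"
    if K: "ambient X K K'" "\<And>x. x \<in> X \<Longrightarrow> K 0 x = x" for K K'
  proof -
    have cq: "continuous_on ({0..1} \<times> Y) (\<lambda>z::real \<times> complex. q (snd z))"
      by (rule continuous_on_compose2[OF covering_space_imp_continuous[OF covering]]) (auto intro!: continuous_intros)
    have 1: "continuous_on ({0..1} \<times> Y) (\<lambda>z. K (fst z) (q (snd z)))"
    proof (rule ambient_compose[OF K(1) _ cq])
      fix z assume "z \<in> {0..1::real} \<times> Y"
      then have z: "fst z \<in> {0..1}" "snd z \<in> Y" by (simp_all only: mem_Times_iff)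
      then show "0 \<le> fst z" "fst z \<le> 1" by auto
      show "q (snd z) \<in> X" by (rule q_Y[OF z(2)])
    qed (intro continuous_intros)
    have 2: "(\<lambda>z. K (fst z) (q (snd z))) \<in> {0..1} \<times> Y \<rightarrow> X"
    proof (rule Pi_I)
      fix z assume "z \<in> {0..1::real} \<times> Y"
      then obtain t x where "z = (t, x)" "t \<in> {0..1}" "x \<in> Y" by blast
      then show "K (fst z) (q (snd z)) \<in> X" using ambient_in[OF K(1), of t "q x"] q_Y[of x] by simp
    qed
    obtain k where k: "continuous_on ({0..1} \<times> Y) k" "k \<in> ({0..1} \<times> Y) \<rightarrow> Y"
      "\<And>y. y \<in> Y \<Longrightarrow> k (0, y) = y" "\<And>z. z \<in> {0..1} \<times> Y \<Longrightarrow> K (fst z) (q (snd z)) = q (k z)"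
      by (rule covering_space_lift_homotopy[OF covering 1 2, of "\<lambda>x. x"]) (use K(2) q_Y in \<open>auto simp del: Diff_iff\<close>)
    show ?thesis
    proof (intro exI[of _ "\<lambda>t x. k (t, x)"] conjI ballI)
      show "continuous_on ({0..1} \<times> Y) (\<lambda>z. k (fst z, snd z))" using k(1) by simp
      have 4: "K t (q x) = q (k (t, x))" if "t \<in> {0..1}" "x \<in> Y" for t x
        using k(4)[of "(t, x)"] that by (simp del: Diff_iff)
      show "lifts (\<lambda>t x. k (t, x)) K" using k(3) 4 by (simp add: lifts_def del: Diff_iff)
      fix t :: real and x assume "t \<in> {0..1}" "x \<in> Y"
      then show "k (t, x) \<in> Y" using k(2) by blast
    qed
  qed
  obtain H where H: "continuous_on ({0..1} \<times> Y) (\<lambda>z. H (fst z) (snd z))" "\<forall>t\<in>{0..1}. \<forall>x\<in>Y. H t x \<in> Y" "lifts H K"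
    using lift[OF K] by blast
  have K'0: "K' 0 x = x" if "x \<in> X" for x using ambient_inv[OF K(1), of 0 x] K(2)[OF that] that by simp
  obtain H' where H': "continuous_on ({0..1} \<times> Y) (\<lambda>z. H' (fst z) (snd z))" "\<forall>t\<in>{0..1}. \<forall>x\<in>Y. H' t x \<in> Y" "lifts H' K'"
    using lift[OF ambient_sym[OF K(1)] K'0] by blast
  have "H' t (H t x) = x" "H t (H' t x) = x" if "t \<in> {0..1}" "x \<in> Y" for t x
    using lift_inverse[OF H(1) _ H(3) H'(1) _ H'(3) K(1) that] lift_inverse[OF H'(1) _ H'(3) H(1) _ H(3) ambient_sym[OF K(1)] that]
      H(2) H'(2) by blast+
  then have "ambient Y H H'" using H H' unfolding ambient_def by blast
  then show ?thesis using H(3) by (rule that)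
qed

text \<open>Both sides lift the path \<open>K t (q x)\<close> and start at
  \<open>act \<gamma> x\<close>.\<close>

lemma lift_equivariant:
  assumes H: "ambient Y H H'" "lifts H K" and \<gamma>: "\<gamma> \<in> carrier G" and t: "t \<in> {0..1}" and x: "x \<in> Y"
  shows "H t (act \<gamma> x) = act \<gamma> (H t x)"
proof (rule path_lift_unique[of "\<lambda>t. H t (act \<gamma> x)" "\<lambda>t. act \<gamma> (H t x)", OF _ _ _ _ _ _ t])
  have HY: "H t z \<in> Y" if "t \<in> {0..1}" "z \<in> Y" for t z using ambient_in[OF H(1)] that by simp
  show "continuous_on {0..1} (\<lambda>t. H t (act \<gamma> x))"
    by (rule ambient_compose[OF H(1)]) (use act_Y[OF \<gamma> x] in \<open>auto intro!: continuous_intros simp del: Diff_iff\<close>)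
  have "continuous_on {0..1} (\<lambda>t. H t x)"
    by (rule ambient_compose[OF H(1)]) (use x in \<open>auto intro!: continuous_intros simp del: Diff_iff\<close>)
  then show "continuous_on {0..1} (\<lambda>t. act \<gamma> (H t x))"
    by (rule continuous_on_compose2[OF act_continuous[OF \<gamma>]]) (use HY x in auto)
  show "H t (act \<gamma> x) \<in> Y" "act \<gamma> (H t x) \<in> Y" if "t \<in> {0..1}" for t
    using HY[OF that] act_Y[OF \<gamma>] x by (simp_all del: Diff_iff)
  show "q (H t (act \<gamma> x)) = q (act \<gamma> (H t x))" if "t \<in> {0..1}" for t
  proof -
    have "H t x \<in> S" "x \<in> S" using HY[OF that x] x by auto
    then show ?thesis using H(2) act_Y[OF \<gamma> x] x that q_act[OF \<gamma>] by (simp add: lifts_def del: Diff_iff)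
  qed
  show "H 0 (act \<gamma> x) = act \<gamma> (H 0 x)" using H(2) act_Y[OF \<gamma> x] x by (simp add: lifts_def del: Diff_iff)
qed

text \<open>The image of a boundary point does not move downstairs, so the point itself follows a
  lift of a constant path.\<close>

lemma lift_bd:
  assumes H: "ambient Y H H'" "lifts H K" and K: "\<And>t y. t \<in> {0..1} \<Longrightarrow> y \<in> bd X \<Longrightarrow> K t y = y"
    and t: "t \<in> {0..1}" and x: "x \<in> bd SL"
  shows "H t x = x"
proof (rule path_lift_unique[of "\<lambda>t. H t x" "\<lambda>t. x", OF _ _ _ _ _ _ t])
  have xY: "x \<in> Y" using x bd_SL_Y by auto
  have xS: "x \<in> S" using xY by auto
  show "continuous_on {0..1} (\<lambda>t. H t x)"
    by (rule ambient_compose[OF H(1)]) (use xY in \<open>auto intro!: continuous_intros simp del: Diff_iff\<close>)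
  show "H t x \<in> Y" "x \<in> Y" if "t \<in> {0..1}" for t using ambient_in[OF H(1)] that xY by simp_all
  show "q (H t x) = q x" if "t \<in> {0..1}" for t
    using H(2) xY that K[OF that, of "q x"] q_bd[OF xS] x by (simp add: lifts_def del: Diff_iff)
  show "H 0 x = x" using H(2) xY by (simp add: lifts_def del: Diff_iff)
qed simp

section \<open>Filling in the cone points\<close>

definition fill :: "(real \<Rightarrow> complex \<Rightarrow> complex) \<Rightarrow> real \<Rightarrow> complex \<Rightarrow> complex" where
  "fill H t x = (if x \<in> C then x else H t x)"

lemma Y_Un_cone: "Y \<union> C = SL"
  using cone_subset saturation_R_cone by auto

text \<open>Cone points are isolated from each other and from the orbits of \<open>R\<close>, so
  each has a punctured ball inside \<open>Y\<close>.\<close>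

lemma ambient_fill:
  assumes H: "ambient Y H H'" "\<And>x. x \<in> Y \<Longrightarrow> H 0 x = x"
  shows "ambient SL (fill H) (fill H')"
proof -
  have "\<exists>e>0. ball c e - {c} \<subseteq> Y" if c: "c \<in> C" for c
  proof -
    obtain e1 where e1: "e1 > 0" "ball c e1 \<subseteq> S" using c cone_interior by (meson mem_interior subsetD)
    obtain e2 where e2: "e2 > 0" "ball c e2 \<inter> C \<subseteq> {c}" using locally_finite_closed(2)[OF cone_locally_finite, of c] by blast
    obtain e3 where e3: "e3 > 0" "ball c e3 \<inter> saturation G act R \<subseteq> {c}"
      using locally_finite_closed(2)[OF locally_finite_saturation[OF finite_R R_subset], of c] by blast
    have "ball c (min e1 (min e2 e3)) - {c} \<subseteq> Y" using e1(2) e2(2) e3(2) by (auto simp: subset_iff)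
    then show ?thesis using e1(1) e2(1) e3(1) by (intro exI[of _ "min e1 (min e2 e3)"]) auto
  qed
  from ambient_extend[OF H closed_cone _ this] show ?thesis
    unfolding Y_Un_cone fill_def[abs_def] by blast
qed

lemma homeos_orb_iff: "f \<in> homeos_orb G act SL M \<longleftrightarrow> f \<in> homeos SL \<and>
    (\<forall>\<gamma>\<in>carrier G. \<forall>x\<in>SL. f (act \<gamma> x) = act \<gamma> (f x)) \<and> (\<forall>x\<in>bd SL. f x = x) \<and>
    f ` saturation G act M = saturation G act M"
  by (auto simp: homeos_orb_def equivariant_homeos_def homeos_fixing_def)

text \<open>With \<open>M = {}\<close> the condition on \<open>K t\<close> holds at every time and
  yields isotopies in the unmarked group. With marked points it is met at those times when
  \<open>K t\<close> returns their images to themselves.\<close>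

lemma fill_homeos_orb:
  assumes H: "ambient Y H H'" "lifts H K" and K: "\<And>t y. t \<in> {0..1} \<Longrightarrow> y \<in> bd X \<Longrightarrow> K t y = y"
    and t: "t \<in> {0..1}" and M: "M \<subseteq> Y" "K t ` q ` M = q ` M"
  shows "restrict (fill H t) SL \<in> homeos_orb G act SL M"
proof -
  have H0: "H 0 x = x" if "x \<in> Y" for x using H(2) that by (simp add: lifts_def del: Diff_iff)
  have F0: "fill H 0 x = x" if "x \<in> SL" for x using H0[of x] that by (auto simp: fill_def)
  have 1: "restrict (fill H t) SL \<in> homeos SL" by (rule ambient_id_homeos[OF ambient_fill[OF H(1) H0] F0 t])
  have 2: "restrict (fill H t) SL (act \<gamma> x) = act \<gamma> (restrict (fill H t) SL x)" if "\<gamma> \<in> carrier G" "x \<in> SL" for \<gamma> x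
    using that act_SL[OF that] act_cone[OF that(1), of x] lift_equivariant[OF H that(1) t, of x] by (auto simp: fill_def)
  have 3: "restrict (fill H t) SL x = x" if "x \<in> bd SL" for x
    using lift_bd[OF H K t that] bd_SL_Y that by (auto simp: fill_def)
  have MS: "M \<subseteq> S" using M(1) by auto
  have satM: "x \<in> saturation G act M \<longleftrightarrow> x \<in> Y \<and> q x \<in> q ` M" for x
  proof
    assume x: "x \<in> saturation G act M"
    then have xS: "x \<in> S" using saturation_subset[OF MS] by auto
    then have qx: "q x \<in> q ` M" using x mem_saturation[OF MS] by blast
    then obtain m where "m \<in> M" "q x = q m" by blast
    then have "q x \<in> X" using q_Y[of m] M(1) by (simp only: subsetD)
    then show "x \<in> Y \<and> q x \<in> q ` M" using mem_Y[OF xS] qx by blast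
  next
    assume "x \<in> Y \<and> q x \<in> q ` M"
    then show "x \<in> saturation G act M" using mem_saturation[OF MS] by auto
  qed
  have qH: "q (H t x) = K t (q x)" if "x \<in> Y" for x using H(2) t that by (simp add: lifts_def del: Diff_iff)
  have HY: "H t x \<in> Y" "H' t x \<in> Y" "H t (H' t x) = x" if "x \<in> Y" for x
    using H(1) t that unfolding ambient_def by blast+
  have "H t ` saturation G act M = saturation G act M"
  proof (intro equalityI subsetI)
    fix y assume "y \<in> H t ` saturation G act M"
    then obtain x where x: "x \<in> Y" "q x \<in> q ` M" "y = H t x" using satM by auto
    then have "q y \<in> q ` M" using qH[OF x(1)] M(2) by (metis imageI)
    then show "y \<in> saturation G act M" using satM x HY(1)[OF x(1)] by simp
  next
    fix y assume "y \<in> saturation G act M"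
    then have y: "y \<in> Y" "q y \<in> q ` M" using satM by auto
    have "q y \<in> K t ` q ` M" unfolding M(2) by (rule y(2))
    then obtain m where m: "m \<in> M" "K t (q m) = q y" by force
    have mY: "m \<in> Y" using m M(1) by auto
    have "q (H t m) = q y" using qH[OF mY] m by simp
    moreover have "H t m \<in> S" "y \<in> S" using HY(1)[OF mY] y by auto
    \<comment> \<open>The point \<open>y\<close> is determined by its image only up to a group
      element, and equivariance moves that element inside \<open>H t\<close>.\<close>
    ultimately obtain \<gamma> where g: "\<gamma> \<in> carrier G" "y = act \<gamma> (H t m)" using q_eq_iff by blast
    have "y = H t (act \<gamma> m)" using lift_equivariant[OF H g(1) t mY] g(2) by simp
    moreover have "act \<gamma> m \<in> saturation G act M" using m g(1) by (auto simp: saturation_def orbit_def)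
    ultimately show "y \<in> H t ` saturation G act M" by blast
  qed
  moreover have "restrict (fill H t) SL ` saturation G act M = H t ` saturation G act M"
    by (rule image_cong) (use satM in \<open>auto simp: fill_def\<close>)
  ultimately show ?thesis using 1 2 3 by (simp add: homeos_orb_iff del: Diff_iff)
qed

lemma saturation_SL: "M \<subseteq> SL \<Longrightarrow> saturation G act M \<subseteq> SL"
proof
  fix x assume M: "M \<subseteq> SL" and "x \<in> saturation G act M"
  then obtain m \<gamma> where m: "m \<in> M" "\<gamma> \<in> carrier G" "x = act \<gamma> m" by (auto simp: saturation_def orbit_def)
  then have "m \<in> SL" using M by (simp only: subsetD)
  then show "x \<in> SL" unfolding m(3) by (rule act_SL[OF m(2)])
qed

lemma homeo_class_orb:
  assumes M: "M \<subseteq> SL"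
  shows "homeo_class SL (homeos_orb G act SL M)"
proof
  have MS: "saturation G act M \<subseteq> SL" by (rule saturation_SL[OF M])
  have bdS: "bd SL \<subseteq> SL" by (auto simp: bd_def)
  have SLin: "f x \<in> SL" if "f \<in> homeos SL" "x \<in> SL" for f x
    using that unfolding homeos_def by (blast dest: homeomorphismD(1))
  show "homeos_orb G act SL M \<subseteq> homeos SL" by (auto simp: homeos_orb_iff)
  have "(\<lambda>x\<in>SL. x) ` saturation G act M = saturation G act M" using MS by force
  then show "(\<lambda>x\<in>SL. x) \<in> homeos_orb G act SL M"
    unfolding homeos_orb_iff using id_homeos bdS act_SL by (auto simp del: Diff_iff)
  fix f g assume fg: "f \<in> homeos_orb G act SL M" "g \<in> homeos_orb G act SL M" "(\<lambda>x\<in>SL. f (g x)) \<in> homeos SL"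
  have "(\<lambda>x\<in>SL. f (g x)) ` saturation G act M = f ` g ` saturation G act M" using MS by force
  then show "(\<lambda>x\<in>SL. f (g x)) \<in> homeos_orb G act SL M"
    using fg bdS act_SL SLin unfolding homeos_orb_iff by (auto simp del: Diff_iff)
next
  have MS: "saturation G act M \<subseteq> SL" by (rule saturation_SL[OF M])
  fix f g assume fg: "f \<in> homeos_orb G act SL M" "g \<in> homeos SL" "homeomorphism SL SL f g"
  note inv = homeomorphismD[OF fg(3)]
  have "g ` saturation G act M = g ` f ` saturation G act M" using fg by (simp add: homeos_orb_iff)
  also have "\<dots> = saturation G act M" using inv(2) MS by (force simp: image_image)
  finally have 1: "g ` saturation G act M = saturation G act M" .
  have 2: "g x = x" if "x \<in> bd SL" for x
  proof -
    have "f x = x" "x \<in> SL" using fg(1) that by (auto simp: homeos_orb_iff bd_def)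
    then show ?thesis using inv(2) by metis
  qed
  have 3: "g (act \<gamma> x) = act \<gamma> (g x)" if "\<gamma> \<in> carrier G" "x \<in> SL" for \<gamma> x
  proof -
    have "f (act \<gamma> (g x)) = act \<gamma> (f (g x))" using fg(1) inv(3)[OF that(2)] that(1) by (simp add: homeos_orb_iff del: Diff_iff)
    then have "f (act \<gamma> (g x)) = act \<gamma> x" using inv(4)[OF that(2)] by simp
    then show ?thesis using inv(2)[OF act_SL[OF that(1) inv(3)[OF that(2)]]] by simp
  qed
  show "g \<in> homeos_orb G act SL M" unfolding homeos_orb_iff using 1 2 3 fg(2) by blast
qed (rule locally_compact_SL locally_connected_SL)+

section \<open>Equivariant isotopies fix the cone points and descend\<close>

lemma cone_fixed:
  assumes F: "ambient SL F F'" "\<And>x. x \<in> SL \<Longrightarrow> F 0 x = x"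
    "\<And>t. t \<in> {0..1} \<Longrightarrow> F t \<in> homeos_orb G act SL {}" and c: "c \<in> C" and t: "t \<in> {0..1}"
  shows "F t c = c"
proof -
  have cSL: "c \<in> SL" using c cone_subset saturation_R_cone by auto
  obtain \<gamma> where \<gamma>: "\<gamma> \<in> carrier G" "\<gamma> \<noteq> \<one>" "act \<gamma> c = c" using c by (rule cone_stabilizer)
  \<comment> \<open>By equivariance \<open>F s c\<close> is fixed by the nontrivial
    \<open>\<gamma>\<close> that fixes \<open>c\<close>, so it is again a cone point.\<close>
  have FC: "F s c \<in> C" if s: "s \<in> {0..1}" for s
  proof -
    have "F s c \<in> S" using ambient_in[OF F(1), of s c] s cSL by auto
    moreover have "act \<gamma> (F s c) = F s c" using F(3)[OF s] \<gamma> cSL unfolding homeos_orb_iff by metis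
    ultimately show ?thesis using free_off_cone \<gamma> by blast
  qed
  have ct: "continuous_on {0..1} (\<lambda>s. F s c)"
    by (rule ambient_compose[OF F(1)]) (use cSL in \<open>auto intro!: continuous_intros\<close>)
  have con: "connected ((\<lambda>s. F s c) ` {0..1})" by (intro connected_continuous_image ct) auto
  have "compact ((\<lambda>s. F s c) ` {0..1})" by (intro compact_continuous_image ct) auto
  \<comment> \<open>The path of images of \<open>c\<close> runs in the locally finite set
    \<open>C\<close>. Its image is compact, hence finite, and being connected it is a single
    point.\<close>
  from cone_locally_finite[OF this] have "finite ((\<lambda>s. F s c) ` {0..1})"
    using FC by (simp add: Int_absorb1 image_subset_iff)
  then have "(\<lambda>s. F s c) ` {0..1} = {} \<or> (\<exists>a. (\<lambda>s. F s c) ` {0..1} = {a})"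
    using connected_finite_iff_sing[OF con] by simp
  then obtain a where "(\<lambda>s. F s c) ` {0..1} = {a}" by auto
  then have "F t c = a" "F 0 c = a" using t by (auto simp: set_eq_iff image_iff) (metis atLeastAtMost_iff zero_le_one order_refl)+
  then show ?thesis using F(2)[OF cSL] by simp
qed

lemma descends_continuous:
  assumes F: "continuous_on ({0..1} \<times> Y) (\<lambda>z. F (fst z) (snd z))" "\<And>t x. t \<in> {0..1} \<Longrightarrow> x \<in> Y \<Longrightarrow> F t x \<in> Y"
    and K: "\<And>t x. t \<in> {0..1} \<Longrightarrow> x \<in> Y \<Longrightarrow> K t (q x) = q (F t x)"
  shows "continuous_on ({0..1::real} \<times> X) (\<lambda>z. K (fst z) (snd z))"
  unfolding continuous_on_topological
proof (intro ballI allI impI)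
  fix z B assume z: "z \<in> {0..1} \<times> X" and B: "open B" "K (fst z) (snd z) \<in> B"
  obtain x where x: "x \<in> Y" "snd z = q x" using z Y_image by (metis imageE mem_Times_iff)
  have t: "fst z \<in> {0..1}" using z by auto
  have c: "continuous_on ({0..1} \<times> Y) (\<lambda>z. q (F (fst z) (snd z)))"
    by (rule continuous_on_compose2[OF covering_space_imp_continuous[OF covering] F(1)]) (use F(2) in auto)
  have "q (F (fst z) x) \<in> B" using B K[OF t x(1)] x(2) by simp
  then have "\<exists>A. open A \<and> (fst z, x) \<in> A \<and> (\<forall>y\<in>{0..1} \<times> Y. y \<in> A \<longrightarrow> q (F (fst y) (snd y)) \<in> B)"
    using c[unfolded continuous_on_topological, THEN bspec, of "(fst z, x)"] t x(1) B(1) by auto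
  then obtain A where A: "open A" "(fst z, x) \<in> A" "\<And>y. y \<in> {0..1} \<times> Y \<Longrightarrow> y \<in> A \<Longrightarrow> q (F (fst y) (snd y)) \<in> B"
    by blast
  obtain A1 A2 where A12: "open A1" "open A2" "(fst z, x) \<in> A1 \<times> A2" "A1 \<times> A2 \<subseteq> A"
    using open_prod_elim[OF A(1,2)] by metis
  \<comment> \<open>Openness of \<open>q\<close> turns a neighbourhood of \<open>x\<close> into one
    of \<open>q x\<close>, each point of which has a preimage in \<open>A2\<close>. Continuity
    upstairs then passes to the quotient with the time parameter kept.\<close>
  have "openin (top_of_set S) (Y \<inter> A2)" using openin_Y A12(2) openin_Int_open by blast
  then have "openin (top_of_set D) (q ` (Y \<inter> A2))" by (rule q_open)
  then obtain A3 where A3: "open A3" "q ` (Y \<inter> A2) = D \<inter> A3" by (auto simp: openin_open)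
  show "\<exists>A. open A \<and> z \<in> A \<and> (\<forall>y\<in>{0..1} \<times> X. y \<in> A \<longrightarrow> K (fst y) (snd y) \<in> B)"
  proof (intro exI[of _ "A1 \<times> A3"] conjI ballI impI)
    show "open (A1 \<times> A3)" using A12 A3 by (intro open_Times)
    have "q x \<in> q ` (Y \<inter> A2)" using x(1) A12(3) by blast
    then have "q x \<in> A3" using A3(2) by blast
    then show "z \<in> A1 \<times> A3" using A12(3) x(2) by (auto simp: mem_Times_iff)
    fix y assume y: "y \<in> {0..1} \<times> X" "y \<in> A1 \<times> A3"
    then have "snd y \<in> D \<inter> A3" by auto
    then obtain w where w: "w \<in> Y" "w \<in> A2" "snd y = q w" using A3(2) by blast
    have ty: "fst y \<in> {0..1}" "fst y \<in> A1" using y by auto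
    have "(fst y, w) \<in> A" using A12(4) ty w by blast
    then have "q (F (fst y) w) \<in> B" using A(3)[of "(fst y, w)"] ty w by (simp del: Diff_iff)
    then show "K (fst y) (snd y) \<in> B" using K[OF ty(1) w(1)] w(3) by simp
  qed
qed

text \<open>Equivariance makes the induced maps on orbits well defined, and fixed cone points keep
  \<open>F\<close> inside \<open>Y\<close>. Boundary points of \<open>X\<close> are images of
  boundary points of \<open>SL\<close>, which \<open>F\<close> fixes.\<close>

lemma descend:
  assumes F: "ambient SL F F'" "\<And>x. x \<in> SL \<Longrightarrow> F 0 x = x"
    "\<And>t. t \<in> {0..1} \<Longrightarrow> F t \<in> homeos_orb G act SL {}"
  obtains K K' where "ambient X K K'" "\<And>x. x \<in> X \<Longrightarrow> K 0 x = x"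
    "\<And>t x. t \<in> {0..1} \<Longrightarrow> x \<in> Y \<Longrightarrow> K t (q x) = q (F t x)"
    "\<And>t y. t \<in> {0..1} \<Longrightarrow> y \<in> bd X \<Longrightarrow> K t y = y" "ambient Y F F'"
proof -
  have FS: "F t x \<in> SL" "F' t x \<in> SL" "F' t (F t x) = x" "F t (F' t x) = x" if "t \<in> {0..1}" "x \<in> SL" for t x
    using F(1) that unfolding ambient_def by blast+
  have CSL: "C \<subseteq> SL" using cone_subset saturation_R_cone by auto
  have FC: "F t c = c" "F' t c = c" if "t \<in> {0..1}" "c \<in> C" for t c
    using cone_fixed[OF F that(2,1)] FS(3)[OF that(1), of c] CSL that(2) by auto
  have FY: "F t x \<in> Y" "F' t x \<in> Y" if "t \<in> {0..1}" "x \<in> Y" for t x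
  proof -
    have xSL: "x \<in> SL" "x \<notin> C" using that by auto
    show "F t x \<in> Y" using FS[OF that(1) xSL(1)] FC(2)[OF that(1), of "F t x"] xSL(2) by auto
    show "F' t x \<in> Y" using FS[OF that(1) xSL(1)] FC(1)[OF that(1), of "F' t x"] xSL(2) by auto
  qed
  have ambY: "ambient Y F F'"
    unfolding ambient_def
  proof (intro conjI ballI)
    show "continuous_on ({0..1} \<times> Y) (\<lambda>z. F (fst z) (snd z))"
      by (rule continuous_on_subset[OF ambient_cont[OF F(1)]]) auto
    show "continuous_on ({0..1} \<times> Y) (\<lambda>z. F' (fst z) (snd z))"
      by (rule continuous_on_subset[OF ambient_cont[OF ambient_sym[OF F(1)]]]) auto
    fix t :: real and x assume t: "t \<in> {0..1}" and x: "x \<in> Y"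
    show "F t x \<in> Y" "F' t x \<in> Y" by (rule FY[OF t x])+
    have "x \<in> SL" using x by auto
    then show "F' t (F t x) = x" "F t (F' t x) = x" by (rule FS(3,4)[OF t])+
  qed
  have eqv: "F t (act \<gamma> x) = act \<gamma> (F t x)" if "t \<in> {0..1}" "\<gamma> \<in> carrier G" "x \<in> SL" for t \<gamma> x
    using F(3)[OF that(1)] that(2,3) unfolding homeos_orb_iff by blast
  have eqv': "F' t (act \<gamma> x) = act \<gamma> (F' t x)" if "t \<in> {0..1}" "\<gamma> \<in> carrier G" "x \<in> SL" for t \<gamma> x
  proof -
    have "F t (act \<gamma> (F' t x)) = act \<gamma> x" using eqv[OF that(1,2) FS(2)[OF that(1,3)]] FS(4)[OF that(1,3)] by simp
    then show ?thesis using FS(3)[OF that(1) act_SL[OF that(2) FS(2)[OF that(1,3)]]] by simp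
  qed
  \<comment> \<open>An arbitrary set-theoretic section of \<open>q\<close>. Equivariance makes
    \<open>K\<close> and \<open>K'\<close> independent of it, and their continuity is obtained from
    that of \<open>F\<close> and \<open>F'\<close> instead.\<close>
  define s where "s = (\<lambda>y. SOME x. x \<in> Y \<and> q x = y)"
  have s: "s y \<in> Y" "q (s y) = y" if "y \<in> X" for y
  proof -
    have "\<exists>x. x \<in> Y \<and> q x = y" using that Y_image by (metis imageE)
    from someI_ex[OF this] show "s y \<in> Y" "q (s y) = y" by (auto simp: s_def)
  qed
  define K where "K = (\<lambda>t y. q (F t (s y)))"
  define K' where "K' = (\<lambda>t y. q (F' t (s y)))"
  have sx: "\<exists>\<gamma>\<in>carrier G. s (q x) = act \<gamma> x" if "x \<in> Y" for x
  proof -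
    have "s (q x) \<in> S" "x \<in> S" "q x = q (s (q x))" using s[OF q_Y[OF that]] that by auto
    then show ?thesis using q_eq_iff by blast
  qed
  have KF: "K t (q x) = q (F t x)" "K' t (q x) = q (F' t x)" if "t \<in> {0..1}" "x \<in> Y" for t x
  proof -
    from sx[OF that(2)] obtain \<gamma> where g: "\<gamma> \<in> carrier G" "s (q x) = act \<gamma> x" by blast
    have xSL: "x \<in> SL" using that by auto
    show "K t (q x) = q (F t x)" using eqv[OF that(1) g(1) xSL] g FS(1)[OF that(1) xSL] q_act by (simp add: K_def)
    show "K' t (q x) = q (F' t x)" using eqv'[OF that(1) g(1) xSL] g FS(2)[OF that(1) xSL] q_act by (simp add: K'_def)
  qed
  have "ambient X K K'"
    unfolding ambient_def
  proof (intro conjI ballI)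
    show "continuous_on ({0..1} \<times> X) (\<lambda>z. K (fst z) (snd z))"
      by (rule descends_continuous[OF ambient_cont[OF ambY] FY(1) KF(1)])
    show "continuous_on ({0..1} \<times> X) (\<lambda>z. K' (fst z) (snd z))"
      by (rule descends_continuous[OF ambient_cont[OF ambient_sym[OF ambY]] FY(2) KF(2)])
    fix t :: real and y assume t: "t \<in> {0..1}" and "y \<in> X"
    then obtain x where x: "x \<in> Y" "y = q x" using Y_image by (metis imageE)
    have xSL: "x \<in> SL" using x by auto
    show "K t y \<in> X" "K' t y \<in> X" using KF[OF t x(1)] x FY[OF t x(1)] q_Y by (simp_all del: Diff_iff)
    show "K' t (K t y) = y" "K t (K' t y) = y"
      using KF[OF t x(1)] KF(2)[OF t FY(1)[OF t x(1)]] KF(1)[OF t FY(2)[OF t x(1)]] x FS[OF t xSL] by (simp_all del: Diff_iff)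
  qed
  moreover have "K 0 y = y" if "y \<in> X" for y
    using s[OF that] F(2)[of "s y"] by (simp add: K_def)
  moreover have "K t y = y" if "t \<in> {0..1}" "y \<in> bd X" for t y
  proof -
    have "y \<in> X" using that by (auto simp: bd_def)
    then obtain x where x: "x \<in> Y" "y = q x" using Y_image by (metis imageE)
    have "x \<in> S" using x by auto
    then have "x \<in> bd SL" using q_bd x that by blast
    then have "F t x = x" using F(3)[OF that(1)] unfolding homeos_orb_iff by blast
    then show ?thesis using KF(1)[OF that(1) x(1)] x by simp
  qed
  ultimately show ?thesis using that KF(1) ambY by blast
qed

end

section \<open>Point-pushing\<close>

lemma isotopyD:
  assumes "isotopy Y A F" "A \<subseteq> homeos Y" "locally compact Y" "locally connected Y"
  obtains G where "ambient Y F G" "\<And>x. x \<in> Y \<Longrightarrow> F 0 x = x" "\<And>t. t \<in> {0..1} \<Longrightarrow> F t \<in> A"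
proof -
  have F: "pathin (homeo_space Y A) F" "F 0 = (\<lambda>x\<in>Y. x)" using assms(1) by (auto simp: isotopy_def)
  obtain G where "ambient Y F G" using pathin_homeo_spaceD(1)[OF assms(3,4,2) F(1)] by blast
  then show ?thesis
    by (rule that) (use F(2) pathin_homeo_spaceD(2)[OF assms(3,4,2) F(1)] in auto)
qed

lemma isotopyI:
  assumes "ambient Y F G" "\<And>x. x \<in> Y \<Longrightarrow> F 0 x = x" "\<And>t. t \<in> {0..1} \<Longrightarrow> restrict (F t) Y \<in> A"
  shows "isotopy Y A (\<lambda>t. restrict (F t) Y)"
  using pathin_homeo_spaceI[OF assms(1,3)] assms(2) unfolding isotopy_def by auto

lemma loop_homotopic_cong:
  assumes "\<And>t. t \<in> {0..1} \<Longrightarrow> p t = p' t" "\<And>t. t \<in> {0..1} \<Longrightarrow> q t = q' t"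
  shows "loop_homotopic X b p q \<longleftrightarrow> loop_homotopic X b p' q'"
  unfolding loop_homotopic_iff using assms by simp

text \<open>A loop is a total function on the reals of which only the values on
  \<open>{0..1}\<close> matter, so equality of loops is needed only there.\<close>

lemma loops_cong:
  assumes "\<And>t. t \<in> {0..1} \<Longrightarrow> p t = p' t" "p \<in> loops X b"
  shows "p' \<in> loops X b" "loop_class X b p = loop_class X b p'"
proof -
  have "continuous_map (top_of_set {0..1}) X p'"
    by (rule continuous_map_eq[OF loopsD(1)[OF assms(2)]]) (use assms(1) in auto)
  then show p': "p' \<in> loops X b" using loopsD(2,3)[OF assms(2)] assms(1)[of 0] assms(1)[of 1] by (simp add: loops_def pathin_def)
  have "loop_homotopic X b p p" using loopsD[OF assms(2)] by (simp add: homotopic_with_refl)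
  then have "loop_homotopic X b p p'"
    using loop_homotopic_cong[where p = p and p' = p and q = p and q' = p' and X = X and b = b] assms(1) by simp
  then show "loop_class X b p = loop_class X b p'" using loop_class_eq_iff[OF assms(2) p'] by simp
qed

section \<open>Independence of the choices in point-pushing\<close>

locale marked_quotient = punctured_quotient +
  fixes M :: "complex set" and n :: nat
  assumes marked_Y: "M \<subseteq> Y" and marked_interior: "M \<subseteq> interior S" and finite_M: "finite M"
    and card_M: "card M = n" and inj_M: "inj_on q M"
begin

abbreviation "b \<equiv> q ` M"
abbreviation "A \<equiv> homeos_orb G act SL M"
abbreviation "B \<equiv> homeos_orb G act SL {}"

lemma b_interior: "b \<subseteq> interior X"
proof (rule image_subsetI)
  fix x assume "x \<in> M"
  then have "x \<in> Y" "x \<in> interior S" using marked_Y marked_interior by (simp_all only: subsetD)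
  then have "q x \<in> X" "q x \<in> interior D" using q_Y q_interior_iff[of x] by blast+
  then show "q x \<in> interior X" using P.interior_punctured by auto
qed

lemma b_X: "b \<subseteq> X"
  using b_interior interior_subset by blast

lemma b_card: "finite b" "card b = n"
  using finite_M card_M inj_M by (auto simp: card_image)

lemma M_SL: "M \<subseteq> SL"
  using marked_Y by auto

sublocale O: homeo_pair SL A B
proof -
  interpret O1: homeo_class SL A by (rule homeo_class_orb[OF M_SL])
  interpret O2: homeo_class SL B by (rule homeo_class_orb) simp
  show "homeo_pair SL A B"
  proof
    show "A \<subseteq> B"
    proof
      fix f assume "f \<in> A"
      moreover have "saturation G act {} = {}" by (simp add: saturation_def)
      ultimately show "f \<in> B" unfolding homeos_orb_iff by (simp del: Diff_iff)
    qed
  qed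
qed

lemma homeo_class_X: "N \<subseteq> X \<Longrightarrow> homeo_class X (homeos_fixing X N)"
  by (rule homeo_class_fixing[OF P.locally_compact_punctured P.locally_connected_punctured])

sublocale D: homeo_class X "homeos_fixing X b"
  by (rule homeo_class_X[OF b_X])

lemma fixing_homeos: "homeos_fixing X N \<subseteq> homeos X"
  by (auto simp: homeos_fixing_def)

lemma isotopy_XD:
  assumes "isotopy X (homeos_fixing X {}) K"
  obtains K' where "ambient X K K'" "\<And>x. x \<in> X \<Longrightarrow> K 0 x = x" "\<And>t y. t \<in> {0..1} \<Longrightarrow> y \<in> bd X \<Longrightarrow> K t y = y"
    "\<And>t. t \<in> {0..1} \<Longrightarrow> K t \<in> homeos X"
proof -
  obtain K' where K: "ambient X K K'" "\<And>x. x \<in> X \<Longrightarrow> K 0 x = x" "\<And>t. t \<in> {0..1} \<Longrightarrow> K t \<in> homeos_fixing X {}"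
    by (rule isotopyD[OF assms fixing_homeos P.locally_compact_punctured P.locally_connected_punctured]) (rule that)
  show ?thesis by (rule that[OF K(1,2)]) (use K(3) in \<open>auto simp: homeos_fixing_def\<close>)
qed

text \<open>A different representing loop with a different extending isotopy has an isotopic end map
  by \<open>homotopic_loops_isotopic\<close>. The description is therefore unique and may be
  computed from any isotopy tracing a loop of the class.\<close>

lemma push_eq:
  assumes p: "p \<in> loops (conf n (top_of_set X)) b" and K: "isotopy X (homeos_fixing X {}) K"
    and Kp: "\<And>t. t \<in> {0..1} \<Longrightarrow> K t ` b = p t"
  shows "push X b (loop_class (conf n (top_of_set X)) b p) = mapping_class X (homeos_fixing X b) (K 1)"
  unfolding push_def
proof (rule the_equality)
  let ?l = "loop_class (conf n (top_of_set X)) b p"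
  have "p \<in> ?l" using p loopsD[OF p] by (simp add: mem_loop_class homotopic_with_refl)
  then show "\<exists>p\<in>?l. \<exists>H. isotopy X (homeos_fixing X {}) H \<and> (\<forall>t\<in>{0..1}. H t ` b = p t) \<and>
      mapping_class X (homeos_fixing X b) (K 1) = mapping_class X (homeos_fixing X b) (H 1)"
    using K Kp by blast
  fix c assume "\<exists>p\<in>?l. \<exists>H. isotopy X (homeos_fixing X {}) H \<and> (\<forall>t\<in>{0..1}. H t ` b = p t) \<and>
      c = mapping_class X (homeos_fixing X b) (H 1)"
  then obtain p' H where H: "p' \<in> ?l" "isotopy X (homeos_fixing X {}) H" "\<And>t. t \<in> {0..1} \<Longrightarrow> H t ` b = p' t"
    "c = mapping_class X (homeos_fixing X b) (H 1)" by blast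
  obtain K' where K': "ambient X K K'" "\<And>x. x \<in> X \<Longrightarrow> K 0 x = x" "\<And>t y. t \<in> {0..1} \<Longrightarrow> y \<in> bd X \<Longrightarrow> K t y = y"
    "\<And>t. t \<in> {0..1} \<Longrightarrow> K t \<in> homeos X" by (rule isotopy_XD[OF K]) (rule that)
  obtain H' where H': "ambient X H H'" "\<And>x. x \<in> X \<Longrightarrow> H 0 x = x" "\<And>t y. t \<in> {0..1} \<Longrightarrow> y \<in> bd X \<Longrightarrow> H t y = y"
    "\<And>t. t \<in> {0..1} \<Longrightarrow> H t \<in> homeos X" by (rule isotopy_XD[OF H(2)]) (rule that)
  have "loop_homotopic (conf n (top_of_set X)) b p p'" using H(1) by (simp add: mem_loop_class)
  then have "loop_homotopic (conf n (top_of_set X)) b (\<lambda>t. K t ` b) (\<lambda>t. H t ` b)"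
    using loop_homotopic_cong[of "\<lambda>t. K t ` b" p "\<lambda>t. H t ` b" p'] Kp H(3) by simp
  from P.homotopic_loops_isotopic[OF b_interior b_card K'(1,2,3) H'(1,2,3) this]
  have "D.isotopic (restrict (K 1) X) (restrict (H 1) X)" .
  moreover have "restrict (K 1) X = K 1" "restrict (H 1) X = H 1"
    using K'(4)[of 1] H'(4)[of 1] by (simp_all add: homeos_def extensional_restrict)
  ultimately have "D.isotopic (K 1) (H 1)" by simp
  then show "c = mapping_class X (homeos_fixing X b) (K 1)"
    using D.mapping_class_eq_iff[of "K 1" "H 1"] D.isotopic_mem H(4) by blast
qed

text \<open>Both maps are lifts of one map from \<open>Y\<close> to \<open>X\<close> through the
  covering, and \<open>Y\<close> is connected.\<close>

lemma cover_lift_unique: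
  assumes f: "continuous_on Y f" "\<And>x. x \<in> Y \<Longrightarrow> f x \<in> Y" and g: "continuous_on Y g" "\<And>x. x \<in> Y \<Longrightarrow> g x \<in> Y"
    and eq: "\<And>x. x \<in> Y \<Longrightarrow> q (f x) = q (g x)" and a: "a \<in> Y" "f a = g a" and x: "x \<in> Y"
  shows "f x = g x"
proof (rule covering_space_lift_unique[where ?g1.0 = f and ?g2.0 = g and p = q and c = Y and S = X and T = Y and f = "\<lambda>x. q (f x)" and a = a])
  show "continuous_on Y (\<lambda>x. q (f x))"
    by (rule continuous_on_compose2[OF covering_space_imp_continuous[OF covering] f(1)]) (use f(2) in blast)
  show "(\<lambda>x. q (f x)) \<in> Y \<rightarrow> X" using q_Y f(2) by blast
  show "f \<in> Y \<rightarrow> Y" "g \<in> Y \<rightarrow> Y" using f(2) g(2) by blast+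
  show "q (f x) = q (f x)" for x ..
qed (fact covering a f(1) g(1) eq connected_Y x)+

text \<open>A competing isotopy \<open>K2\<close> may differ from \<open>K\<close> along the way;
  only its end map is isotopic to \<open>K 1\<close> through maps preserving \<open>b\<close>.
  Lifting this isotopy between the end maps yields one from \<open>F 1\<close> to a lift of
  \<open>K2 1\<close>, and comparison at a boundary point shows that this lift agrees with
  \<open>H2 1\<close> on \<open>Y\<close>.\<close>

lemma phi_eq:
  assumes F: "ambient SL F F'" "\<forall>x\<in>SL. F 0 x = x" "\<forall>t\<in>{0..1}. F t \<in> B" "F 1 \<in> A"
    and FY: "ambient Y F F'"
    and K: "isotopy X (homeos_fixing X {}) K" "\<And>t x. t \<in> {0..1} \<Longrightarrow> x \<in> Y \<Longrightarrow> K t (q x) = q (F t x)" "K 1 ` b = b"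
  shows "phi_map G act SL C X q M (mapping_class X (homeos_fixing X b) (K 1)) = mapping_class SL A (F 1)"
  unfolding phi_map_def
proof (rule the_equality)
  let ?c = "mapping_class X (homeos_fixing X b) (K 1)"
  obtain K' where K': "ambient X K K'" "\<And>x. x \<in> X \<Longrightarrow> K 0 x = x" "\<And>t y. t \<in> {0..1} \<Longrightarrow> y \<in> bd X \<Longrightarrow> K t y = y"
    "\<And>t. t \<in> {0..1} \<Longrightarrow> K t \<in> homeos X" by (rule isotopy_XD[OF K(1)]) (rule that)
  have K1: "K 1 \<in> homeos_fixing X b" using K(3) K'(3,4) by (auto simp: homeos_fixing_def)
  have SLY: "x \<in> SL" if "x \<in> Y" for x using that by auto
  have CSL: "C \<subseteq> SL" using cone_subset saturation_R_cone by auto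
  have F1ext: "restrict (F 1) SL = F 1" by (rule O.A.restrict_mem[OF F(4)])
  have F1C: "F 1 c = c" if "c \<in> C" for c using cone_fixed[OF F(1) F(2)[rule_format] F(3)[rule_format] that, of 1] by simp
  show "\<exists>K H. isotopy X (homeos_fixing X {}) K \<and> K 1 \<in> ?c \<and> isotopy Y (equivariant_homeos G act Y) H \<and>
     (\<forall>t\<in>{0..1}. \<forall>x\<in>Y. q (H t x) = K t (q x)) \<and>
     mapping_class SL A (F 1) = mapping_class SL A (\<lambda>x\<in>SL. if x \<in> C then x else H 1 x)"
  proof (rule exI[of _ K], rule exI[of _ "\<lambda>t. restrict (F t) Y"], intro conjI ballI)
    show "isotopy X (homeos_fixing X {}) K" by (rule K(1))
    show "K 1 \<in> ?c" using D.isotopic_refl[OF K1] by (simp add: D.mem_mapping_class)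
    show "isotopy Y (equivariant_homeos G act Y) (\<lambda>t. restrict (F t) Y)"
    proof (rule isotopyI[OF FY])
      show F0: "F 0 x = x" if "x \<in> Y" for x using F(2)[rule_format, OF SLY[OF that]] .
      fix t :: real assume t: "t \<in> {0..1}"
      have "restrict (F t) Y \<in> homeos Y" by (rule ambient_id_homeos[OF FY F0 t])
      moreover have "restrict (F t) Y (act \<gamma> x) = act \<gamma> (restrict (F t) Y x)" if "\<gamma> \<in> carrier G" "x \<in> Y" for \<gamma> x
        using F(3)[rule_format, OF t] that SLY[OF that(2)] act_Y[OF that] by (simp add: homeos_orb_iff del: Diff_iff)
      ultimately show "restrict (F t) Y \<in> equivariant_homeos G act Y" by (simp add: equivariant_homeos_def del: Diff_iff)
    qed
    show "q (restrict (F t) Y x) = K t (q x)" if "t \<in> {0..1}" "x \<in> Y" for t x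
      using K(2)[OF that] that by (simp del: Diff_iff)
    have "(\<lambda>x\<in>SL. if x \<in> C then x else restrict (F 1) Y x) = restrict (F 1) SL"
      by (rule restrict_ext) (use F1C in auto)
    then show "mapping_class SL A (F 1) = mapping_class SL A (\<lambda>x\<in>SL. if x \<in> C then x else restrict (F 1) Y x)"
      using F1ext by simp
  qed
  fix d assume "\<exists>K H. isotopy X (homeos_fixing X {}) K \<and> K 1 \<in> ?c \<and> isotopy Y (equivariant_homeos G act Y) H \<and>
     (\<forall>t\<in>{0..1}. \<forall>x\<in>Y. q (H t x) = K t (q x)) \<and>
     d = mapping_class SL A (\<lambda>x\<in>SL. if x \<in> C then x else H 1 x)"
  then obtain K2 H2 where 2: "isotopy X (homeos_fixing X {}) K2" "K2 1 \<in> ?c" "isotopy Y (equivariant_homeos G act Y) H2"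
     "\<forall>t\<in>{0..1}. \<forall>x\<in>Y. q (H2 t x) = K2 t (q x)"
     "d = mapping_class SL A (\<lambda>x\<in>SL. if x \<in> C then x else H2 1 x)" by blast
  obtain K2' where K2': "ambient X K2 K2'" "\<And>x. x \<in> X \<Longrightarrow> K2 0 x = x" "\<And>t y. t \<in> {0..1} \<Longrightarrow> y \<in> bd X \<Longrightarrow> K2 t y = y"
    "\<And>t. t \<in> {0..1} \<Longrightarrow> K2 t \<in> homeos X" by (rule isotopy_XD[OF 2(1)]) (rule that)
  have "equivariant_homeos G act Y \<subseteq> homeos Y" by (auto simp: equivariant_homeos_def)
  then obtain H2' where H2': "ambient Y H2 H2'" "\<And>x. x \<in> Y \<Longrightarrow> H2 0 x = x" "\<And>t. t \<in> {0..1} \<Longrightarrow> H2 t \<in> equivariant_homeos G act Y"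
    using isotopyD[OF 2(3) _ locally_compact_Y locally_connected_Y] by metis
  have l2: "lifts H2 K2" using H2'(2) 2(4) unfolding lifts_def by blast
  have "D.isotopic (K 1) (K2 1)" using 2(2) by (simp add: D.mem_mapping_class)
  then obtain J J' where J: "ambient X J J'" "\<forall>t\<in>{0..1}. J t \<in> homeos_fixing X b" "J 0 = K 1" "J 1 = K2 1"
    by (rule D.isotopicE)
  \<comment> \<open>Composing with the inverse of \<open>K 1\<close> turns the isotopy
    \<open>J\<close> from \<open>K 1\<close> to \<open>K2 1\<close> into one that starts at the
    identity, as lifting requires.\<close>
  define N where "N = (\<lambda>t x. J t (K' 1 x))"
  have hK: "homeomorphism X X (K' 1) (K 1)" using ambient_homeomorphism[OF ambient_sym[OF K'(1)], of 1] by simp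
  note K1inv = homeomorphismD[OF hK]
  have ambN: "ambient X N (\<lambda>t x. K 1 (J' t x))"
    unfolding N_def by (rule ambient_comp[OF J(1) ambient_const[OF hK]])
  have N0: "N 0 x = x" if "x \<in> X" for x using K1inv(2)[OF that] J(3) by (simp add: N_def)
  obtain L L' where L: "ambient Y L L'" "lifts L N" by (rule lift_exists[OF ambN N0])
  have Nbd: "N t y = y" if "t \<in> {0..1}" "y \<in> bd X" for t y
  proof -
    have "y \<in> X" using that by (auto simp: bd_def)
    then have "K' 1 y = y" using K1inv(4)[of y] K'(3)[of 1 y] that by simp
    then show ?thesis using J(2) that by (simp add: N_def homeos_fixing_def)
  qed
  have Nb: "N t ` b = b" if "t \<in> {0..1}" for t
  proof -
    have "K' 1 ` b = K' 1 ` K 1 ` b" using K(3) by simp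
    also have "\<dots> = (\<lambda>x. K' 1 (K 1 x)) ` b" by (simp only: image_image)
    also have "\<dots> = (\<lambda>x. x) ` b" by (rule image_cong[OF refl]) (use K1inv(4) b_X in blast)
    finally have "K' 1 ` b = b" by simp
    moreover have "N t ` b = J t ` K' 1 ` b" by (simp only: N_def image_image)
    ultimately show ?thesis using J(2) that by (simp add: homeos_fixing_def)
  qed
  have L0: "L 0 x = x" if "x \<in> Y" for x using L(2) that unfolding lifts_def by blast
  have LA: "restrict (fill L t) SL \<in> A" if "t \<in> {0..1}" for t
    by (rule fill_homeos_orb[OF L Nbd that marked_Y Nb[OF that]])
  have "O.A.isotopic (restrict (fill L 0) SL) (restrict (fill L 1) SL)"
    by (rule O.A.isotopicI[OF ambient_fill[OF L(1) L0] LA])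
  moreover have "restrict (fill L 0) SL = (\<lambda>x\<in>SL. x)" by (rule restrict_ext) (use L0 in \<open>auto simp: fill_def\<close>)
  ultimately have "O.A.isotopic (\<lambda>x\<in>SL. x) (restrict (fill L 1) SL)" by simp
  from O.isotopic_comp_right[OF O.null_isotopic_id this F(4)]
  have iso: "O.A.isotopic (\<lambda>x\<in>SL. (\<lambda>x\<in>SL. x) (F 1 x)) (\<lambda>x\<in>SL. restrict (fill L 1) SL (F 1 x))" .
  have F1SL: "F 1 x \<in> SL" if "x \<in> SL" for x using ambient_in[OF F(1), of 1 x] that by simp
  have F1Y: "F 1 x \<in> Y" if "x \<in> Y" for x using ambient_in[OF FY, of 1 x] that by simp
  have e1: "(\<lambda>x\<in>SL. (\<lambda>x\<in>SL. x) (F 1 x)) = F 1"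
  proof -
    have "(\<lambda>x\<in>SL. (\<lambda>x\<in>SL. x) (F 1 x)) = restrict (F 1) SL"
      by (rule restrict_ext) (use F1SL in \<open>simp del: Diff_iff\<close>)
    then show ?thesis unfolding F1ext .
  qed
  \<comment> \<open>\<open>L 1 \<circ> F 1\<close> and \<open>H2 1\<close> both lift
    \<open>K2 1\<close> and both fix the boundary point \<open>a\<close>.\<close>
  obtain a where a: "a \<in> bd SL" using bd_SL_nonempty by blast
  have aY: "a \<in> Y" using a bd_SL_Y by blast
  have eqY: "L 1 (F 1 x) = H2 1 x" if x: "x \<in> Y" for x
  proof (rule cover_lift_unique[where f = "\<lambda>x. L 1 (F 1 x)" and g = "H2 1" and a = a, OF _ _ _ _ _ aY _ x])
    have cF: "continuous_on Y (F 1)" using homeomorphismD(5)[OF ambient_homeomorphism[OF FY, of 1]] by simp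
    have cL: "continuous_on Y (L 1)" using homeomorphismD(5)[OF ambient_homeomorphism[OF L(1), of 1]] by simp
    show "continuous_on Y (\<lambda>x. L 1 (F 1 x))" by (rule continuous_on_compose2[OF cL cF]) (use F1Y in blast)
    show "continuous_on Y (H2 1)" using homeomorphismD(5)[OF ambient_homeomorphism[OF H2'(1), of 1]] by simp
    show "L 1 (F 1 x) \<in> Y" if "x \<in> Y" for x using ambient_in[OF L(1), of 1, OF _ _ F1Y[OF that]] by simp
    show "H2 1 x \<in> Y" if "x \<in> Y" for x using ambient_in[OF H2'(1), of 1, OF _ _ that] by simp
    show "q (L 1 (F 1 x)) = q (H2 1 x)" if x: "x \<in> Y" for x
    proof -
      have "q (L 1 (F 1 x)) = N 1 (q (F 1 x))" using L(2) F1Y[OF x] unfolding lifts_def by simp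
      also have "\<dots> = N 1 (K 1 (q x))" using K(2)[of 1 x] x by simp
      also have "\<dots> = K2 1 (q x)" using K1inv(4)[OF q_Y[OF x]] J(4) by (simp add: N_def)
      also have "\<dots> = q (H2 1 x)" using 2(4) x by simp
      finally show ?thesis .
    qed
    have "F 1 a = a" using F(3)[rule_format, of 1] a by (simp add: homeos_orb_iff)
    moreover have "L 1 a = a" by (rule lift_bd[OF L Nbd _ a]) auto
    moreover have "H2 1 a = a" by (rule lift_bd[OF H2'(1) l2 K2'(3) _ a]) auto
    ultimately show "L 1 (F 1 a) = H2 1 a" by simp
  qed
  have e2: "(\<lambda>x\<in>SL. restrict (fill L 1) SL (F 1 x)) = (\<lambda>x\<in>SL. if x \<in> C then x else H2 1 x)"
  proof (rule restrict_ext)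
    fix x assume x: "x \<in> SL"
    show "restrict (fill L 1) SL (F 1 x) = (if x \<in> C then x else H2 1 x)"
    proof (cases "x \<in> C")
      case True
      then show ?thesis using x F1C[OF True] by (simp add: fill_def)
    next
      case False
      then have xY: "x \<in> Y" using x by auto
      have "F 1 x \<notin> C" using F1Y[OF xY] by auto
      then show ?thesis using False F1SL[OF x] eqY[OF xY] by (simp add: fill_def del: Diff_iff)
    qed
  qed
  have "O.A.isotopic (F 1) (\<lambda>x\<in>SL. if x \<in> C then x else H2 1 x)" using iso unfolding e1 e2 .
  then have "mapping_class SL A (F 1) = mapping_class SL A (\<lambda>x\<in>SL. if x \<in> C then x else H2 1 x)"
    by (rule iffD2[OF O.A.mapping_class_eq_iff[OF F(4)]])
  then show "d = mapping_class SL A (F 1)" unfolding 2(5) by (rule sym)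
qed

section \<open>Traces of equivariant isotopies as loops of configurations\<close>

lemma descend_isotopy:
  assumes F: "ambient SL F F'" "\<forall>x\<in>SL. F 0 x = x" "\<forall>t\<in>{0..1}. F t \<in> B"
  obtains K K' where "ambient X K K'" "\<And>x. x \<in> X \<Longrightarrow> K 0 x = x"
    "\<And>t x. t \<in> {0..1} \<Longrightarrow> x \<in> Y \<Longrightarrow> K t (q x) = q (F t x)"
    "\<And>t y. t \<in> {0..1} \<Longrightarrow> y \<in> bd X \<Longrightarrow> K t y = y" "ambient Y F F'"
  by (rule descend[OF F(1) F(2)[rule_format] F(3)[rule_format]], assumption, assumption) (rule that)

text \<open>Descending \<open>F\<close> gives an isotopy with the prescribed trace, which evaluates
  \<open>push\<close>. Conversely \<open>F\<close> is the lift of this isotopy, which evaluates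
  \<open>phi_map\<close>, so that one isotopy serves both definite descriptions.\<close>

lemma push_orb_trace:
  assumes F: "ambient SL F F'" "\<forall>x\<in>SL. F 0 x = x" "\<forall>t\<in>{0..1}. F t \<in> B" "F 1 \<in> A"
  shows "(\<lambda>t. q ` F t ` M) \<in> loops (conf n (top_of_set X)) b"
    and "push_orb G act SL C X q M (loop_class (conf n (top_of_set X)) b (\<lambda>t. q ` F t ` M)) = mapping_class SL A (F 1)"
proof -
  obtain K K' where K: "ambient X K K'" "\<And>x. x \<in> X \<Longrightarrow> K 0 x = x"
    "\<And>t x. t \<in> {0..1} \<Longrightarrow> x \<in> Y \<Longrightarrow> K t (q x) = q (F t x)"
    "\<And>t y. t \<in> {0..1} \<Longrightarrow> y \<in> bd X \<Longrightarrow> K t y = y" "ambient Y F F'"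
    by (rule descend_isotopy[OF F(1-3)]) (rule that)
  have Kb: "K t ` b = q ` F t ` M" if "t \<in> {0..1}" for t
    unfolding image_image by (rule image_cong[OF refl]) (rule K(3)[OF that], use marked_Y in blast)
  have bdX: "bd X \<subseteq> X" by (auto simp: bd_def)
  define k where "k = (\<lambda>t. restrict (K t) X)"
  have kX: "k t y = K t y" if "y \<in> X" for t y using that by (simp add: k_def del: Diff_iff)
  have iso: "isotopy X (homeos_fixing X {}) k" unfolding k_def
  proof (rule isotopyI[OF K(1,2)])
    fix t :: real assume t: "t \<in> {0..1}"
    show "restrict (K t) X \<in> homeos_fixing X {}"
      using ambient_id_homeos[OF K(1,2) t] K(4)[OF t] bdX by (auto simp: homeos_fixing_def)
  qed
  have kb: "k t ` b = K t ` b" for t by (rule image_cong[OF refl]) (rule kX, use b_X in blast)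
  \<comment> \<open>\<open>F 1\<close> preserves the saturation of \<open>M\<close>, whose image
    under \<open>q\<close> is \<open>b\<close>; the inclusion is an equality by counting.\<close>
  have K1b: "K 1 ` b = b"
  proof (rule card_subset_eq[OF b_card(1)])
    show "K 1 ` b \<subseteq> b" unfolding Kb[of 1, simplified]
    proof (intro image_subsetI)
      fix y assume "y \<in> F 1 ` M"
      then obtain m where m: "m \<in> M" "y = F 1 m" by auto
      have MS: "M \<subseteq> S" using M_SL by auto
      have "m \<in> saturation G act M" using mem_saturation[OF MS, of m] m MS by blast
      then have "y \<in> saturation G act M" using F(4) m unfolding homeos_orb_iff by blast
      moreover have "y \<in> S" using calculation saturation_subset[OF MS] by blast
      ultimately show "q y \<in> b" using mem_saturation[OF MS] by blast
    qed
    have "K' 1 (K 1 y) = y" if "y \<in> b" for y using ambient_inv[OF K(1), of 1 y] that b_X by auto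
    then show "card (K 1 ` b) = card b" by (intro card_image inj_on_inverseI[of _ "K' 1"])
  qed
  have "K 0 ` b = (\<lambda>y. y) ` b" by (rule image_cong[OF refl]) (rule K(2), use b_X in blast)
  then have K0b: "K 0 ` b = b" by simp
  have tr: "continuous_map (top_of_set {0..1}) (conf n (top_of_set X)) (\<lambda>t. K t ` b)"
    by (rule P.trace_conf[OF K(1) b_X b_card])
  have Kl: "(\<lambda>t. K t ` b) \<in> loops (conf n (top_of_set X)) b"
    using tr K0b K1b by (simp add: loops_def pathin_def)
  show l: "(\<lambda>t. q ` F t ` M) \<in> loops (conf n (top_of_set X)) b"
    by (rule loops_cong(1)[OF Kb Kl])
  have "push X b (loop_class (conf n (top_of_set X)) b (\<lambda>t. q ` F t ` M)) = mapping_class X (homeos_fixing X b) (k 1)"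
    by (rule push_eq[OF l iso]) (simp only: kb Kb)
  moreover have "phi_map G act SL C X q M (mapping_class X (homeos_fixing X b) (k 1)) = mapping_class SL A (F 1)"
    by (rule phi_eq[OF F K(5) iso]) (use K(3) kX q_Y kb K1b in \<open>simp_all del: Diff_iff\<close>)
  ultimately show "push_orb G act SL C X q M (loop_class (conf n (top_of_set X)) b (\<lambda>t. q ` F t ` M)) = mapping_class SL A (F 1)"
    by (simp add: push_orb_def)
qed

text \<open>The isotopy that extends a suitable representative is lifted and filled in. Its end map
  preserves the marked orbits because the loop of configurations closes up.\<close>

lemma loop_class_trace:
  assumes "l \<in> carrier (pi1 (conf n (top_of_set X)) b)"
  obtains F F' where "ambient SL F F'" "\<forall>x\<in>SL. F 0 x = x" "\<forall>t\<in>{0..1}. F t \<in> B" "F 1 \<in> A"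
    "l = loop_class (conf n (top_of_set X)) b (\<lambda>t. q ` F t ` M)"
proof -
  obtain p where p: "p \<in> loops (conf n (top_of_set X)) b" "l = loop_class (conf n (top_of_set X)) b p"
    using assms by (auto simp: pi1_carrier)
  obtain p' K K' where K: "p' \<in> loops (conf n (top_of_set X)) b" "loop_homotopic (conf n (top_of_set X)) b p p'"
    "ambient X K K'" "\<And>x. x \<in> X \<Longrightarrow> K 0 x = x" "\<And>t x. t \<in> {0..1} \<Longrightarrow> x \<in> bd X \<Longrightarrow> K t x = x"
    "\<And>t. t \<in> {0..1} \<Longrightarrow> K t ` b = p' t"
    by (rule P.ambient_loop_extension[OF b_interior p(1)]) (rule that)
  obtain H H' where H: "ambient Y H H'" "lifts H K" by (rule lift_exists[OF K(3,4)])
  have H0: "H 0 x = x" if "x \<in> Y" for x using H(2) that unfolding lifts_def by blast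
  define F where "F = (\<lambda>t. restrict (fill H t) SL)"
  have FSL: "F t x = fill H t x" if "x \<in> SL" for t x using that by (simp add: F_def del: Diff_iff)
  have amb: "ambient SL F (fill H')" by (rule ambient_cong[OF ambient_fill[OF H(1) H0]]) (use FSL in auto)
  have F0: "\<forall>x\<in>SL. F 0 x = x"
  proof
    fix x assume "x \<in> SL"
    then show "F 0 x = x" using FSL[of x 0] H0[of x] by (auto simp: fill_def)
  qed
  have FB: "\<forall>t\<in>{0..1}. F t \<in> B"
    unfolding F_def by (intro ballI fill_homeos_orb[OF H K(5)]) auto
  have "K 1 ` b = b" using K(6)[of 1] loopsD(3)[OF K(1)] by simp
  then have FA: "F 1 \<in> A" unfolding F_def by (intro fill_homeos_orb[OF H K(5) _ marked_Y]) auto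
  have tr: "p' t = q ` F t ` M" if t: "t \<in> {0..1}" for t
  proof -
    have "q (F t m) = K t (q m)" if "m \<in> M" for m
    proof -
      have mY: "m \<in> Y" using that marked_Y by blast
      then have "m \<in> SL" "m \<notin> C" by auto
      then have "F t m = H t m" using FSL[of m t] by (simp add: fill_def)
      then show ?thesis using H(2) t mY unfolding lifts_def by simp
    qed
    then show ?thesis using K(6)[OF t] by (simp add: image_image)
  qed
  have "l = loop_class (conf n (top_of_set X)) b p'" using loop_class_eq_iff[OF p(1) K(1)] K(2) p(2) by simp
  also have "\<dots> = loop_class (conf n (top_of_set X)) b (\<lambda>t. q ` F t ` M)" by (rule loops_cong(2)[OF tr K(1)])
  finally show ?thesis using that[OF amb F0 FB FA] by simp
qed

text \<open>Running the two isotopies with independent times gives a square of configurations. The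
  joined loop follows two sides of it and the composite isotopy follows the diagonal.\<close>

lemma trace_comp:
  assumes F1: "ambient SL F1 F1'" "\<forall>x\<in>SL. F1 0 x = x" "\<forall>t\<in>{0..1}. F1 t \<in> B" "F1 1 \<in> A"
    and F2: "ambient SL F2 F2'" "\<forall>x\<in>SL. F2 0 x = x" "\<forall>t\<in>{0..1}. F2 t \<in> B" "F2 1 \<in> A"
  shows "loop_homotopic (conf n (top_of_set X)) b (join_loops (\<lambda>t. q ` F2 t ` M) (\<lambda>t. q ` F1 t ` M)) (\<lambda>t. q ` (\<lambda>x. F1 t (F2 t x)) ` M)"
proof -
  obtain K1 K1' where K1: "ambient X K1 K1'" "\<And>x. x \<in> X \<Longrightarrow> K1 0 x = x"
    "\<And>t x. t \<in> {0..1} \<Longrightarrow> x \<in> Y \<Longrightarrow> K1 t (q x) = q (F1 t x)"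
    "\<And>t y. t \<in> {0..1} \<Longrightarrow> y \<in> bd X \<Longrightarrow> K1 t y = y" "ambient Y F1 F1'"
    by (rule descend_isotopy[OF F1(1-3)]) (rule that)
  obtain K2 K2' where K2: "ambient X K2 K2'" "\<And>x. x \<in> X \<Longrightarrow> K2 0 x = x"
    "\<And>t x. t \<in> {0..1} \<Longrightarrow> x \<in> Y \<Longrightarrow> K2 t (q x) = q (F2 t x)"
    "\<And>t y. t \<in> {0..1} \<Longrightarrow> y \<in> bd X \<Longrightarrow> K2 t y = y" "ambient Y F2 F2'"
    by (rule descend_isotopy[OF F2(1-3)]) (rule that)
  have MY: "m \<in> Y" if "m \<in> M" for m using marked_Y that by blast
  have F2Y: "F2 t x \<in> Y" if "t \<in> {0..1}" "x \<in> Y" for t x using ambient_in[OF K2(5)] that by simp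
  define T where "T = (\<lambda>z. (\<lambda>y. K1 (fst z) (K2 (snd z) y)) ` b)"
  have K2X: "K2 s y \<in> X" if "s \<in> {0..1}" "y \<in> X" for s y using ambient_in[OF K2(1)] that by simp
  have bX: "y \<in> X" if "y \<in> b" for y using b_X that by blast
  have T: "continuous_map (top_of_set ({0..1} \<times> {0..1})) (conf n (top_of_set X)) T"
    unfolding continuous_map_conf_iff T_def
  proof (intro conjI ballI hits_open_family)
    fix y assume y: "y \<in> b"
    show "continuous_on ({0..1} \<times> {0..1}) (\<lambda>z. K1 (fst z) (K2 (snd z) y))"
    proof (rule ambient_compose[OF K1(1)])
      show "continuous_on ({0..1} \<times> {0..1}) (\<lambda>z::real \<times> real. K2 (snd z) y)"
        by (rule ambient_compose[OF K2(1)]) (use bX[OF y] in \<open>auto intro!: continuous_intros simp del: Diff_iff\<close>)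
      show "K2 (snd z) y \<in> X" if "z \<in> {0..1} \<times> {0..1}" for z using K2X[OF _ bX[OF y], of "snd z"] that by (simp add: mem_Times_iff del: Diff_iff)
    qed (auto intro!: continuous_intros)
  next
    fix z :: "real \<times> real" assume z: "z \<in> {0..1} \<times> {0..1}"
    obtain s t where st: "z = (s, t)" "s \<in> {0..1}" "t \<in> {0..1}" using z by blast
    show "(\<lambda>y. K1 (fst z) (K2 (snd z) y)) ` b \<subseteq> X"
    proof (rule image_subsetI)
      fix y assume "y \<in> b"
      show "K1 (fst z) (K2 (snd z) y) \<in> X"
        using ambient_in[OF K1(1), of s, OF _ _ K2X[OF st(3) bX[OF \<open>y \<in> b\<close>]]] st by simp
    qed
    show "finite ((\<lambda>y. K1 (fst z) (K2 (snd z) y)) ` b)" using b_card by simp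
    have "K2' t (K1' s (K1 s (K2 t y))) = y" if "y \<in> b" for y
      using ambient_inv[OF K1(1), of s, OF _ _ K2X[OF st(3) bX[OF that]]] ambient_inv[OF K2(1), of t, OF _ _ bX[OF that]] st by simp
    then have "inj_on (\<lambda>y. K1 s (K2 t y)) b" by (intro inj_on_inverseI[of _ "\<lambda>y. K2' t (K1' s y)"])
    then show "card ((\<lambda>y. K1 (fst z) (K2 (snd z) y)) ` b) = n" using b_card(2) st by (simp add: card_image)
  qed
  have Tq: "T (s, t) = q ` (\<lambda>x. F1 s (F2 t x)) ` M" if "s \<in> {0..1}" "t \<in> {0..1}" for s t
    unfolding T_def image_image fst_conv snd_conv
    by (rule image_cong[OF refl]) (use K2(3)[OF that(2) MY] K1(3)[OF that(1) F2Y[OF that(2) MY]] in simp)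
  have id1: "F1 0 (F2 t m) = F2 t m" if "t \<in> {0..1}" "m \<in> M" for t m
    using F1(2)[rule_format, of "F2 t m"] F2Y[OF that(1) MY[OF that(2)]] by auto
  have T0: "T (0, t) = q ` F2 t ` M" if t: "t \<in> {0..1}" for t
  proof -
    have "T (0, t) = q ` (\<lambda>x. F1 0 (F2 t x)) ` M" using t by (intro Tq) auto
    also have "(\<lambda>x. F1 0 (F2 t x)) ` M = F2 t ` M" by (rule image_cong[OF refl]) (rule id1[OF t])
    finally show ?thesis .
  qed
  have K2b: "K2 1 ` b = b"
  proof -
    have "K2 1 ` b = q ` F2 1 ` M" unfolding image_image by (rule image_cong[OF refl]) (use K2(3)[of 1] MY in simp)
    also have "\<dots> = b" using loopsD(3)[OF push_orb_trace(1)[OF F2]] by simp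
    finally show ?thesis .
  qed
  have T1: "T (s, 1) = q ` F1 s ` M" if s: "s \<in> {0..1}" for s
  proof -
    have "T (s, 1) = K1 s ` K2 1 ` b" by (simp add: T_def image_image)
    also have "\<dots> = K1 s ` b" using K2b by simp
    also have "\<dots> = q ` F1 s ` M" unfolding image_image by (rule image_cong[OF refl]) (use K1(3)[OF s] MY in simp)
    finally show ?thesis .
  qed
  have b01: "T (0, 0) = b" "T (1, 1) = b"
    using T0[of 0] T1[of 1] loopsD(2)[OF push_orb_trace(1)[OF F2]] loopsD(3)[OF push_orb_trace(1)[OF F1]] by simp_all
  \<comment> \<open>The path \<open>u\<close> runs \<open>F2\<close> to its end while
    \<open>F1\<close> waits and then runs \<open>F1\<close>; on the second side \<open>K2 1\<close>
    has already returned \<open>b\<close> to itself.\<close>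
  show ?thesis
    by (rule square_homotopic[OF _ T, where u = "\<lambda>t. (max 0 (2 * t - 1), min 1 (2 * t))" and v = "\<lambda>t. (t, t)"])
      (use T0 T1 Tq b01 in \<open>auto intro!: continuous_intros convex_Times simp: join_loops_def\<close>)
qed

theorem birman_exact_sequence:
  "short_exact (pi1 (conf n (top_of_set X)) b) (map_id_orb G act SL M) (map_id_orb_unmarked G act SL)
     (push_orb G act SL C X q M) (forget_orb G act SL) \<and> trivial_group (map_id_orb_unmarked G act SL)"
proof -
  let ?\<pi> = "pi1 (conf n (top_of_set X)) b"
  let ?push = "push_orb G act SL C X q M"
  interpret U: homeo_pair SL B B by unfold_locales simp
  have m: "map_id_orb G act SL M = mcg_pure SL A B" by (simp add: map_id_orb_def)
  have ucar: "carrier (map_id_orb_unmarked G act SL) = {mapping_class SL B (\<lambda>x\<in>SL. x)}"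
  proof -
    have "mapping_class SL B f = mapping_class SL B (\<lambda>x\<in>SL. x)" if "O.B.isotopic (\<lambda>x\<in>SL. x) f" for f
      using O.B.mapping_class_eq_iff[OF O.B.id_mem, of f] that by simp
    moreover have "O.B.isotopic (\<lambda>x\<in>SL. x) (\<lambda>x\<in>SL. x)" by (rule O.B.isotopic_refl[OF O.B.id_mem])
    ultimately have "{mapping_class SL B f | f. O.B.isotopic (\<lambda>x\<in>SL. x) f} = {mapping_class SL B (\<lambda>x\<in>SL. x)}"
      by blast
    then show ?thesis unfolding map_id_orb_unmarked_def by (simp del: Diff_iff)
  qed
  \<comment> \<open>The unmarked group is the kernel for the pair \<open>B\<close>, \<open>B\<close>
    with nothing to forget, so its group structure comes from the same construction as in the marked
    case.\<close>
  have u: "map_id_orb_unmarked G act SL = mcg_pure SL B B"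
  proof -
    have "carrier (mcg_pure SL B B) = {mapping_class SL B (\<lambda>x\<in>SL. x)}"
    proof -
      have "mapping_class SL B f = mapping_class SL B (\<lambda>x\<in>SL. x)" if "f \<in> U.null_isotopic" for f
        using O.B.mapping_class_eq_iff[OF O.B.id_mem, of f] that by (simp add: U.null_isotopic_def)
      then show ?thesis using U.null_isotopic_id unfolding U.mcg_pure_carrier by blast
    qed
    then show ?thesis using ucar unfolding map_id_orb_unmarked_def mcg_pure_def by (simp del: Diff_iff)
  qed
  have gu: "group (map_id_orb_unmarked G act SL)" unfolding u by (rule U.group_mcg_pure)
  have one_u: "\<one>\<^bsub>map_id_orb_unmarked G act SL\<^esub> = mapping_class SL B (\<lambda>x\<in>SL. x)"
    unfolding u by (rule U.mcg_pure_one)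
  have triv: "trivial_group (map_id_orb_unmarked G act SL)"
    using gu ucar one_u by (simp add: trivial_group_def)
  have gm: "group (map_id_orb G act SL M)" unfolding m by (rule O.group_mcg_pure)
  have b_conf: "b \<in> topspace (conf n (top_of_set X))" using b_X b_card by (simp add: topspace_conf)
  then have gp: "group ?\<pi>" by (rule group_pi1)
  \<comment> \<open>The carrier is the kernel of the forgetful map by definition. Every class goes
    to the trivial one, and exactness in the middle amounts to surjectivity of the push.\<close>
  have forget: "forget_orb G act SL c = mapping_class SL B (\<lambda>x\<in>SL. x)" if "c \<in> carrier (map_id_orb G act SL M)" for c
    using that by (simp add: m mcg_pure_def kernel_def mcg_def forget_orb_def)
  have null: "F 1 \<in> O.null_isotopic"
    if "ambient SL F F'" "\<forall>x\<in>SL. F 0 x = x" "\<forall>t\<in>{0..1}. F t \<in> B" "F 1 \<in> A" for F F'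
  proof -
    have "O.B.isotopic (restrict (F 0) SL) (restrict (F 1) SL)"
      by (rule O.B.isotopicI[OF that(1)]) (use that(3) O.B.restrict_mem in simp)
    moreover have "restrict (F 0) SL = (\<lambda>x\<in>SL. x)" by (rule restrict_ext) (rule that(2)[rule_format])
    ultimately show ?thesis using that(4) O.A.restrict_mem[OF that(4)] by (simp add: O.null_isotopic_def)
  qed
  have hom: "?push \<in> hom ?\<pi> (map_id_orb G act SL M)"
  proof (rule homI)
    fix l assume "l \<in> carrier ?\<pi>"
    then obtain F F' where F: "ambient SL F F'" "\<forall>x\<in>SL. F 0 x = x" "\<forall>t\<in>{0..1}. F t \<in> B" "F 1 \<in> A"
      "l = loop_class (conf n (top_of_set X)) b (\<lambda>t. q ` F t ` M)" by (rule loop_class_trace) (rule that)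
    then show "?push l \<in> carrier (map_id_orb G act SL M)"
      using push_orb_trace(2)[OF F(1-4)] null[OF F(1-4)] by (simp add: m O.mcg_pure_carrier)
  next
    fix l1 l2 assume l: "l1 \<in> carrier ?\<pi>" "l2 \<in> carrier ?\<pi>"
    obtain F1 F1' where F1: "ambient SL F1 F1'" "\<forall>x\<in>SL. F1 0 x = x" "\<forall>t\<in>{0..1}. F1 t \<in> B" "F1 1 \<in> A"
      "l1 = loop_class (conf n (top_of_set X)) b (\<lambda>t. q ` F1 t ` M)" by (rule loop_class_trace[OF l(1)]) (rule that)
    obtain F2 F2' where F2: "ambient SL F2 F2'" "\<forall>x\<in>SL. F2 0 x = x" "\<forall>t\<in>{0..1}. F2 t \<in> B" "F2 1 \<in> A"
      "l2 = loop_class (conf n (top_of_set X)) b (\<lambda>t. q ` F2 t ` M)" by (rule loop_class_trace[OF l(2)]) (rule that)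
    note n1 = null[OF F1(1-4)] and n2 = null[OF F2(1-4)]
    note p1 = push_orb_trace[OF F1(1-4)] and p2 = push_orb_trace[OF F2(1-4)]
    define F where "F = (\<lambda>t. \<lambda>x\<in>SL. F1 t (F2 t x))"
    have F2SL: "F2 t x \<in> SL" if "t \<in> {0..1}" "x \<in> SL" for t x using ambient_in[OF F2(1)] that by simp
    have FSL: "F t x = F1 t (F2 t x)" if "x \<in> SL" for t x using that by (simp add: F_def del: Diff_iff)
    have amb: "ambient SL F (\<lambda>t x. F2' t (F1' t x))"
      by (rule ambient_cong[OF ambient_comp[OF F1(1) F2(1)]]) (use FSL in auto)
    have F0: "\<forall>x\<in>SL. F 0 x = x"
      using FSL F2(2) F1(2) by (simp del: Diff_iff)
    have FB: "\<forall>t\<in>{0..1}. F t \<in> B"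
    proof
      fix t :: real assume t: "t \<in> {0..1}"
      have "F2 t \<in> homeos SL" using F2(3)[rule_format, OF t] O.B.sub_homeos by blast
      from comp_id_component_homeos[OF F1(1) F1(2)[rule_format] this t] have "F t \<in> homeos SL" by (simp add: F_def)
      then show "F t \<in> B" using O.B.comp_mem[OF F1(3)[rule_format, OF t] F2(3)[rule_format, OF t]] by (simp add: F_def)
    qed
    have "F 1 \<in> O.null_isotopic" using O.null_isotopic_comp[OF n1 n2] by (simp add: F_def)
    then have FA: "F 1 \<in> A" by (rule O.null_isotopic_sub)
    note p = push_orb_trace[OF amb F0 FB FA]
    have eq: "q ` F t ` M = q ` (\<lambda>x. F1 t (F2 t x)) ` M" for t
      by (rule arg_cong[where f = "(`) q"], rule image_cong[OF refl], rule FSL) (use M_SL in blast)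
    have "loop_class (conf n (top_of_set X)) b (join_loops (\<lambda>t. q ` F2 t ` M) (\<lambda>t. q ` F1 t ` M)) =
        loop_class (conf n (top_of_set X)) b (\<lambda>t. q ` F t ` M)"
      using loop_class_eq_iff[OF join_loops_in[OF p2(1) p1(1)] p(1)] trace_comp[OF F1(1-4) F2(1-4)] unfolding eq by simp
    then have "l1 \<otimes>\<^bsub>?\<pi>\<^esub> l2 = loop_class (conf n (top_of_set X)) b (\<lambda>t. q ` F t ` M)"
      using pi1_mult[OF p1(1) p2(1)] F1(5) F2(5) by simp
    then have "?push (l1 \<otimes>\<^bsub>?\<pi>\<^esub> l2) = mapping_class SL A (F 1)" using p(2) by simp
    also have "\<dots> = ?push l1 \<otimes>\<^bsub>map_id_orb G act SL M\<^esub> ?push l2"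
      using O.mcg_pure_mult[OF n1 n2] p1(2) p2(2) F1(5) F2(5) by (simp add: m F_def)
    finally show "?push (l1 \<otimes>\<^bsub>?\<pi>\<^esub> l2) = ?push l1 \<otimes>\<^bsub>map_id_orb G act SL M\<^esub> ?push l2" .
  qed
  interpret push: group_hom ?\<pi> "map_id_orb G act SL M" ?push
    by (rule group_hom.intro[OF gp gm]) (simp add: group_hom_axioms_def hom)
  have inj: "inj_on ?push (carrier ?\<pi>)"
  proof (rule push.trivial_ker_imp_inj)
    have "l = \<one>\<^bsub>?\<pi>\<^esub>" if l: "l \<in> kernel ?\<pi> (map_id_orb G act SL M) ?push" for l
    proof -
      have l': "l \<in> carrier ?\<pi>" "?push l = \<one>\<^bsub>map_id_orb G act SL M\<^esub>" using l by (auto simp: kernel_def)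
      obtain F F' where F: "ambient SL F F'" "\<forall>x\<in>SL. F 0 x = x" "\<forall>t\<in>{0..1}. F t \<in> B" "F 1 \<in> A"
        "l = loop_class (conf n (top_of_set X)) b (\<lambda>t. q ` F t ` M)" by (rule loop_class_trace[OF l'(1)]) (rule that)
      note pF = push_orb_trace[OF F(1-4)]
      have "mapping_class SL A (\<lambda>x\<in>SL. x) = mapping_class SL A (F 1)"
        using l'(2) pF(2) F(5) O.mcg_pure_one by (simp add: m)
      then have "O.A.isotopic (\<lambda>x\<in>SL. x) (F 1)" using O.A.mapping_class_eq_iff[OF O.A.id_mem] by simp
      \<comment> \<open>\<open>T\<close> has the same end map as \<open>F\<close> but preserves the
        marked orbits throughout.\<close>
      then obtain T T' where T: "ambient SL T T'" "\<forall>t\<in>{0..1}. T t \<in> A" "T 0 = (\<lambda>x\<in>SL. x)" "T 1 = F 1"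
        by (rule O.A.isotopicE)
      have TB: "\<forall>t\<in>{0..1}. T t \<in> B" using T(2) O.sub by blast
      have T0: "\<forall>x\<in>SL. T 0 x = x" using T(3) by simp
      obtain K K' where K: "ambient X K K'" "\<And>x. x \<in> X \<Longrightarrow> K 0 x = x"
        "\<And>t x. t \<in> {0..1} \<Longrightarrow> x \<in> Y \<Longrightarrow> K t (q x) = q (F t x)"
        "\<And>t y. t \<in> {0..1} \<Longrightarrow> y \<in> bd X \<Longrightarrow> K t y = y" "ambient Y F F'"
        by (rule descend_isotopy[OF F(1-3)]) (rule that)
      obtain R R' where R: "ambient X R R'" "\<And>x. x \<in> X \<Longrightarrow> R 0 x = x"
        "\<And>t x. t \<in> {0..1} \<Longrightarrow> x \<in> Y \<Longrightarrow> R t (q x) = q (T t x)"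
        "\<And>t y. t \<in> {0..1} \<Longrightarrow> y \<in> bd X \<Longrightarrow> R t y = y" "ambient Y T T'"
        by (rule descend_isotopy[OF T(1) T0 TB]) (rule that)
      have Rinv: "R' t (R t y) = y" "R t (R' t y) = y" "R' t y \<in> X" if "t \<in> {0..1}" "y \<in> X" for t y
        using R(1) that unfolding ambient_def by blast+
      have MY: "m \<in> Y" if "m \<in> M" for m using marked_Y that by blast
      have bX: "y \<in> X" if "y \<in> b" for y using b_X that by blast
      have Rb: "R' t ` b = b" if t: "t \<in> {0..1}" for t
      proof -
        have MS: "M \<subseteq> S" using M_SL by auto
        have "R t ` b \<subseteq> b"
        proof (rule image_subsetI)
          fix y assume "y \<in> b"
          then obtain w where w: "w \<in> M" "y = q w" by auto
          have "w \<in> saturation G act M" using mem_saturation[OF MS, of w] w MS by blast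
          then have s: "T t w \<in> saturation G act M" using T(2) t unfolding homeos_orb_iff by blast
          then have "T t w \<in> S" using saturation_subset[OF MS] by blast
          then have "q (T t w) \<in> b" using mem_saturation[OF MS] s by blast
          then show "R t y \<in> b" using R(3)[OF t MY[OF w(1)]] w by simp
        qed
        moreover have "card (R t ` b) = card b"
          by (intro card_image inj_on_inverseI[of _ "R' t"]) (rule Rinv(1)[OF t bX])
        ultimately have eq: "R t ` b = b" using card_subset_eq[OF b_card(1)] by simp
        have "R' t ` R t ` b = (\<lambda>y. R' t (R t y)) ` b" by (rule image_image)
        also have "\<dots> = (\<lambda>y. y) ` b" by (rule image_cong[OF refl]) (rule Rinv(1)[OF t bX])
        finally have "R' t ` R t ` b = (\<lambda>y. y) ` b" .
        then show ?thesis unfolding eq by simp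
      qed
      \<comment> \<open>\<open>R t\<close> preserves \<open>b\<close>, so \<open>K t\<close>
        preceded by the inverse of \<open>R t\<close> traces the same loop of configurations as
        \<open>K t\<close>; at times 0 and 1 it is the identity.\<close>
      note ambKR = ambient_comp[OF K(1) ambient_sym[OF R(1)]]
      have "loop_homotopic (conf n (top_of_set X)) b (\<lambda>t. (\<lambda>y. K t (R' t y)) ` b) (\<lambda>_. b)"
      proof (rule P.loop_of_homeos_null[OF b_X b_card ambKR])
        show "K 0 (R' 0 y) = y" if "y \<in> X" for y
          using K(2)[of "R' 0 y"] Rinv[of 0 y] R(2)[of "R' 0 y"] that by simp
        show "K 1 (R' 1 y) = y" if y: "y \<in> X" for y
        proof -
          have ry: "R' 1 y \<in> X" using Rinv(3)[of 1 y] y by simp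
          then have "R' 1 y \<in> q ` Y" by (simp only: Y_image)
          then obtain x where x: "x \<in> Y" "R' 1 y = q x" by (rule imageE)
          have "K 1 (q x) = R 1 (q x)" using K(3)[of 1 x] R(3)[of 1 x] x(1) T(4) by simp
          then show ?thesis using Rinv(2)[of 1 y] y x(2) by simp
        qed
        show "K t (R' t y) = y" if "t \<in> {0..1}" "y \<in> bd X" for t y
        proof -
          have "y \<in> X" using that by (auto simp: bd_def)
          then have "R' t y = y" using Rinv(1)[OF that(1), of y] R(4)[OF that] by simp
          then show ?thesis using K(4)[OF that] by simp
        qed
      qed
      moreover have "(\<lambda>y. K t (R' t y)) ` b = q ` F t ` M" if t: "t \<in> {0..1}" for t
      proof -
        have "(\<lambda>y. K t (R' t y)) ` b = K t ` R' t ` b" by (simp only: image_image)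
        also have "\<dots> = K t ` b" by (simp only: Rb[OF t])
        also have "\<dots> = q ` F t ` M" unfolding image_image by (rule image_cong[OF refl]) (rule K(3)[OF t MY])
        finally show ?thesis .
      qed
      ultimately have "loop_homotopic (conf n (top_of_set X)) b (\<lambda>t. q ` F t ` M) (\<lambda>_. b)"
        using loop_homotopic_cong[of "\<lambda>t. (\<lambda>y. K t (R' t y)) ` b" "\<lambda>t. q ` F t ` M" "\<lambda>_. b" "\<lambda>_. b"] by simp
      moreover have "(\<lambda>_. b) \<in> loops (conf n (top_of_set X)) b"
        using b_conf by (simp add: loops_def pathin_const)
      ultimately show ?thesis
        using loop_class_eq_iff[OF pF(1), of "\<lambda>_. b"] F(5) by (simp add: pi1_one)
    qed
    moreover have "\<one>\<^bsub>?\<pi>\<^esub> \<in> kernel ?\<pi> (map_id_orb G act SL M) ?push"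
      by (simp add: kernel_def)
    ultimately show "kernel ?\<pi> (map_id_orb G act SL M) ?push = {\<one>\<^bsub>?\<pi>\<^esub>}" by blast
  qed
  have surj: "?push ` carrier ?\<pi> = carrier (map_id_orb G act SL M)"
  proof
    show "?push ` carrier ?\<pi> \<subseteq> carrier (map_id_orb G act SL M)" using push.hom_closed by blast
    show "carrier (map_id_orb G act SL M) \<subseteq> ?push ` carrier ?\<pi>"
    proof
      fix c assume "c \<in> carrier (map_id_orb G act SL M)"
      then obtain f where f: "f \<in> O.null_isotopic" "c = mapping_class SL A f" by (auto simp: m O.mcg_pure_carrier)
      obtain F F' where F: "ambient SL F F'" "\<forall>t\<in>{0..1}. F t \<in> B" "F 0 = (\<lambda>x\<in>SL. x)" "F 1 = f"
        using f(1) by (rule O.null_isotopicE)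
      have F0: "\<forall>x\<in>SL. F 0 x = x" using F(3) by simp
      have FA: "F 1 \<in> A" using F(4) O.null_isotopic_sub[OF f(1)] by simp
      note p = push_orb_trace[OF F(1) F0 F(2) FA]
      show "c \<in> ?push ` carrier ?\<pi>" using p f(2) F(4) by (force simp: pi1_carrier)
    qed
  qed
  have hf: "group_hom (map_id_orb G act SL M) (map_id_orb_unmarked G act SL) (forget_orb G act SL)"
  proof (rule group_hom.intro[OF gm gu], simp add: group_hom_axioms_def, rule homI)
    fix c d assume "c \<in> carrier (map_id_orb G act SL M)" "d \<in> carrier (map_id_orb G act SL M)"
    moreover then have "c \<otimes>\<^bsub>map_id_orb G act SL M\<^esub> d \<in> carrier (map_id_orb G act SL M)"
      using group.is_monoid[OF gm] by (simp add: monoid.m_closed)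
    moreover have "\<one>\<^bsub>map_id_orb_unmarked G act SL\<^esub> \<otimes>\<^bsub>map_id_orb_unmarked G act SL\<^esub> \<one>\<^bsub>map_id_orb_unmarked G act SL\<^esub> = \<one>\<^bsub>map_id_orb_unmarked G act SL\<^esub>"
      using group.is_monoid[OF gu] by (simp add: monoid.one_closed)
    ultimately show "forget_orb G act SL (c \<otimes>\<^bsub>map_id_orb G act SL M\<^esub> d) =
        forget_orb G act SL c \<otimes>\<^bsub>map_id_orb_unmarked G act SL\<^esub> forget_orb G act SL d"
      using forget one_u by simp
  qed (simp add: forget ucar)
  have "kernel (map_id_orb G act SL M) (map_id_orb_unmarked G act SL) (forget_orb G act SL) = carrier (map_id_orb G act SL M)"
    using forget one_u by (auto simp: kernel_def)
  moreover have "forget_orb G act SL ` carrier (map_id_orb G act SL M) = carrier (map_id_orb_unmarked G act SL)"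
    using forget ucar group.is_monoid[OF gm] monoid.one_closed by (auto simp: image_iff)
  ultimately show ?thesis
    using triv push.group_hom_axioms hf inj surj unfolding short_exact_def by simp
qed

end

section \<open>The exact sequence of an orbifold surface\<close>

text \<open>The half-plane charts are locally connected because a half-plane is convex.\<close>

lemma planar_surface_locally_connected:
  assumes "planar_surface S"
  shows "locally connected S"
proof (rule locallyI)
  fix w x assume w: "openin (top_of_set S) w" "x \<in> w"
  then have "x \<in> S" using openin_imp_subset by blast
  then obtain U W where U: "x \<in> U" "openin (top_of_set S) U"
    "openin (top_of_set {w. 0 \<le> Im w}) W" "U homeomorphic W"
    using assms unfolding planar_surface_def by metis
  have "locally connected W"
    by (rule locally_open_subset[OF convex_imp_locally_connected U(3)]) (rule convex_halfspace_Im_ge)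
  then have "locally connected U"
    using homeomorphic_locally[OF U(4), of connected connected] homeomorphic_connectedness by blast
  moreover have "openin (top_of_set U) (U \<inter> w)"
    using w(1) U(2) by (metis inf.cobounded1 openin_Int openin_imp_subset openin_subset_trans)
  ultimately obtain A B where A: "openin (top_of_set U) A" "connected B" "x \<in> A" "A \<subseteq> B" "B \<subseteq> U \<inter> w"
    using U(1) w(2) unfolding locally_def by (metis IntI)
  have "openin (top_of_set S) A" using A(1) U(2) openin_trans by blast
  then show "\<exists>U V. openin (top_of_set S) U \<and> connected V \<and> x \<in> U \<and> U \<subseteq> V \<and> V \<subseteq> w"
    using A by blast
qed

section \<open>Cone points and fundamental domain of the orbifold\<close>

context orbifold_surface
begin

abbreviation "cones \<equiv> V ` bs_vertices G g N"

lemma surfaceD: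
  "closed S" "planar_surface S" "contractible S"
  "embedded_graph (bs_vertices G g N) (bs_edges G N) V E \<subseteq> interior S"
  using surface unfolding regular_neighbourhood_def by - (elim conjE, assumption)+

lemma domainD:
  "(\<Union>\<gamma>\<in>carrier G. act \<gamma> ` F) = S"
  "\<forall>\<gamma>\<in>carrier G. \<gamma> \<noteq> \<one> \<longrightarrow> act \<gamma> ` interior F \<inter> F = {}"
  "{x \<in> F. stabilizer G act x \<noteq> {\<one>}} = base_vertex G g V ` {..<N}"
  "base_vertex G g V ` {..<N} \<subseteq> frontier F"
  using domain unfolding fundamental_disk_def by - (elim conjE, assumption)+

lemma cone_in_interior: "cones \<subseteq> interior S"
  using surfaceD(4) unfolding embedded_graph_def by blast

lemma cone_finite_compact:
  assumes "compact K"
  shows "finite (cones \<inter> K)"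
proof -
  have "finite {v \<in> bs_vertices G g N. V v \<in> K}"
    using embedding assms unfolding planar_embedding_def by blast
  moreover have "cones \<inter> K = V ` {v \<in> bs_vertices G g N. V v \<in> K}" by blast
  ultimately show ?thesis by simp
qed

lemma base_coset:
  assumes "\<nu> < N"
  shows "\<one> <# cyclic_factor G g \<nu> = cyclic_factor G g \<nu>" "(\<nu>, cyclic_factor G g \<nu>) \<in> bs_vertices G g N"
proof -
  interpret grp: group G using group_hom group_hom.axioms(1) by blast
  have "cyclic_factor G g \<nu> \<subseteq> carrier G"
    unfolding cyclic_factor_def using gen_carrier[OF assms] by (simp add: grp.generate_incl)
  then show *: "\<one> <# cyclic_factor G g \<nu> = cyclic_factor G g \<nu>" by (rule grp.lcos_mult_one)
  have "(\<nu>, \<one> <# cyclic_factor G g \<nu>) \<in> bs_vertices G g N"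
    using assms grp.one_closed unfolding bs_vertices_def by blast
  then show "(\<nu>, cyclic_factor G g \<nu>) \<in> bs_vertices G g N" unfolding * .
qed

lemma base_vertex_cone: "\<nu> < N \<Longrightarrow> base_vertex G g V \<nu> \<in> cones"
  using base_coset(2) by (simp add: base_vertex_def)

lemma cone_orbit_base_vertex:
  assumes "c \<in> cones"
  obtains \<gamma> \<nu> where "\<gamma> \<in> carrier G" "\<nu> < N" "c = act \<gamma> (base_vertex G g V \<nu>)"
proof -
  obtain \<gamma> \<nu> where c: "\<gamma> \<in> carrier G" "\<nu> < N" "c = V (\<nu>, \<gamma> <# cyclic_factor G g \<nu>)"
    using assms by (auto simp: bs_vertices_def)
  then show ?thesis using that act_vertex[OF c(1) base_coset(2)[OF c(2)]] by (simp add: base_vertex_def)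
qed

text \<open>Outside \<open>S\<close> all \<open>act \<gamma>\<close> take the junk value \<open>undefined\<close>, so that stabilizers are not trivial there
  either.\<close>

lemma domain_subset: "F \<subseteq> S"
proof (rule ccontr)
  assume "\<not> F \<subseteq> S"
  then obtain x where x: "x \<in> F" "x \<notin> S" by blast
  interpret grp: group G using group_hom group_hom.axioms(1) by blast
  have und: "act \<one> x = undefined" using x(2) by (simp flip: id_eq_one)
  moreover have "act \<one> x \<in> S" using domainD(1) x grp.one_closed by blast
  ultimately have "act \<one> x \<noteq> x" using x(2) by metis
  then have "stabilizer G act x \<noteq> {\<one>}" unfolding stabilizer_def by blast
  then have "x \<in> base_vertex G g V ` {..<N}" using x(1) domainD(3) by blast
  then have "x \<in> cones" using base_vertex_cone by blast
  then show False using cone_in_interior interior_subset x(2) by blast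
qed

lemma interior_domain:
  assumes "x \<in> interior F"
  shows "x \<in> interior S" "x \<notin> cones"
proof -
  show "x \<in> interior S" using interior_mono[OF domain_subset] assms by blast
  have xF: "x \<in> F" "x \<notin> frontier F" using assms interior_subset by (auto simp: frontier_def)
  then have "stabilizer G act x = {\<one>}" using domainD(3,4) by blast
  then show "x \<notin> cones" unfolding cone_points[symmetric] by simp
qed

lemma interior_domain_orbit:
  assumes "x \<in> interior F" "y \<in> interior F" "\<gamma> \<in> carrier G" "y = act \<gamma> x"
  shows "y = x"
proof (cases "\<gamma> = \<one>")
  case True
  have "x \<in> S" using interior_domain(1)[OF assms(1)] interior_subset by blast
  then show ?thesis using assms(4) True by (simp flip: id_eq_one)
next
  case False
  then have "act \<gamma> ` interior F \<inter> F = {}" using domainD(2) assms(3) by blast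
  moreover have "y \<in> F" using assms(2) interior_subset by blast
  ultimately show ?thesis using assms(1,4) by blast
qed

lemma disk_quotient:
  assumes "orbit_disk G act S q D"
  shows "disk_quotient G S act q D cones"
proof
  show "closed S" "connected S" "locally connected S"
    by (rule surfaceD contractible_imp_connected planar_surface_locally_connected)+
  show "continuous_on S (act \<gamma>)" if "\<gamma> \<in> carrier G" for \<gamma>
    using act_homeo[OF that] by (auto simp: homeos_def homeomorphism_def)
  show "finite {\<gamma> \<in> carrier G. act \<gamma> ` K \<inter> K \<noteq> {}}" if "compact K" "K \<subseteq> S" for K by (rule act_proper[OF that])
  show "{x \<in> S. stabilizer G act x \<noteq> {\<one>}} = cones" by (rule cone_points)
  show "cones \<subseteq> interior S" by (rule cone_in_interior)
  show "finite (cones \<inter> K)" if "compact K" for K by (rule cone_finite_compact[OF that])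
  show "orbit_disk G act S q D" by (rule assms)
  \<comment> \<open>Each cone point is a translate of one of the \<open>N\<close> base vertices, so
    there are at most \<open>N\<close> images in the disk.\<close>
  have "q ` cones \<subseteq> (\<lambda>\<nu>. q (base_vertex G g V \<nu>)) ` {..<N}"
  proof (rule image_subsetI)
    fix c assume "c \<in> cones"
    then obtain \<gamma> \<nu> where c: "\<gamma> \<in> carrier G" "\<nu> < N" "c = act \<gamma> (base_vertex G g V \<nu>)"
      by (rule cone_orbit_base_vertex)
    have S: "base_vertex G g V \<nu> \<in> S" using base_vertex_cone[OF c(2)] cone_in_interior interior_subset by blast
    then have "c \<in> S" "c \<in> orbit G act (base_vertex G g V \<nu>)"
      using c element_image by (auto simp: orbit_def)
    then have "orbit G act c = orbit G act (base_vertex G g V \<nu>)"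
      using S orbit_sym orbit_trans element_image by (smt (verit) Collect_cong mem_Collect_eq orbit_def subset_antisym subsetI)
    then have "q c = q (base_vertex G g V \<nu>)" using assms S \<open>c \<in> S\<close> unfolding orbit_disk_def by blast
    then show "q c \<in> (\<lambda>\<nu>. q (base_vertex G g V \<nu>)) ` {..<N}" using c(2) by blast
  qed
  then show "finite (q ` cones)" by (rule finite_subset) simp
qed

text \<open>Different interior points of the fundamental domain lie in different orbits. The marked
  points therefore stay distinct in the disk and apart from the punctures, and they are not cone
  points since those lie on the frontier of \<open>F\<close> or outside it.\<close>

lemma marked_quotient:
  fixes r p :: "nat \<Rightarrow> complex"
  assumes "orbit_disk G act S q D" "r ` {..<L} \<subseteq> interior F"
    "p ` {..<n} \<subseteq> interior F - r ` {..<L}" "inj_on p {..<n}"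
  shows "marked_quotient G S act q D cones (r ` {..<L}) (p ` {..<n}) n"
proof -
  interpret Q: disk_quotient G S act q D cones by (rule disk_quotient[OF assms(1)])
  have pF: "p ` {..<n} \<subseteq> interior F" using assms(3) by blast
  have FS: "x \<in> S" if "x \<in> interior F" for x using that interior_domain(1) interior_subset by blast
  have orb: "x = y" if xy: "x \<in> interior F" "y \<in> interior F" "q x = q y" for x y
  proof -
    obtain \<gamma> where \<gamma>: "\<gamma> \<in> carrier G" "y = act \<gamma> x"
      using iffD1[OF Q.q_eq_iff[OF FS[OF xy(1)] FS[OF xy(2)]] xy(3)] by (rule bexE)
    show ?thesis by (rule interior_domain_orbit[OF xy(1,2) \<gamma>, symmetric])
  qed
  show ?thesis
  proof
    show "finite (r ` {..<L})" "finite (p ` {..<n})" "card (p ` {..<n}) = n"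
      using assms(4) by (auto simp: card_image)
    show "r ` {..<L} \<subseteq> interior S" "r ` {..<L} \<inter> cones = {}" "p ` {..<n} \<subseteq> interior S"
      using interior_domain assms(2) pF by blast+
    show "inj_on q (p ` {..<n})" using orb pF by (intro inj_onI) blast
    show "p ` {..<n} \<subseteq> S - saturation G act (r ` {..<L}) - cones"
    proof
      fix x assume x: "x \<in> p ` {..<n}"
      then have xF: "x \<in> interior F" using pF by blast
      have "x \<notin> saturation G act (r ` {..<L})"
      proof
        assume "x \<in> saturation G act (r ` {..<L})"
        moreover have "r ` {..<L} \<subseteq> S" using assms(2) FS by blast
        ultimately have "q x \<in> q ` r ` {..<L}" using Q.mem_saturation FS[OF xF] by blast
        then obtain y where y: "y \<in> r ` {..<L}" "q x = q y" by (rule imageE)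
        then have "x = y" using orb[OF xF] assms(2) by blast
        then show False using x y(1) assms(3) by blast
      qed
      then show "x \<in> S - saturation G act (r ` {..<L}) - cones"
        using FS[OF xF] interior_domain(2)[OF xF] by blast
    qed
  qed
qed

end

theorem theoremA:
  fixes G :: "'g monoid" and S F D :: "complex set" and N L n :: nat
    and act :: "'g \<Rightarrow> complex \<Rightarrow> complex" and m :: "nat \<Rightarrow> nat" and g :: "nat \<Rightarrow> 'g"
    and V :: "nat \<times> 'g set \<Rightarrow> complex" and E :: "nat \<times> 'g \<Rightarrow> real \<Rightarrow> complex"
    and q :: "complex \<Rightarrow> complex" and r p :: "nat \<Rightarrow> complex"
  assumes orbifold: "orbifold_surface G S act N m g V E F"
    and punctures: "r ` {..<L} \<subseteq> interior F" "inj_on (\<lambda>i. orbit G act (r i)) {..<L}"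
    and marked: "1 \<le> n" "p ` {..<n} \<subseteq> interior F - r ` {..<L}" "inj_on p {..<n}"
    and disk: "orbit_disk G act S q D"
  defines "SL \<equiv> S - saturation G act (r ` {..<L})"
    and "C \<equiv> V ` bs_vertices G g N"
    and "P \<equiv> p ` {..<n}"
  defines "DLN \<equiv> D - q ` (r ` {..<L} \<union> C)"
  shows "short_exact (pi1 (conf n (top_of_set DLN)) (q ` P))
                     (map_id_orb G act SL P) (map_id_orb_unmarked G act SL)
                     (push_orb G act SL C DLN q P) (forget_orb G act SL)
       \<and> trivial_group (map_id_orb_unmarked G act SL)"
  unfolding SL_def C_def P_def DLN_def
  by (rule marked_quotient.birman_exact_sequence[OF orbifold_surface.marked_quotient[OF orbifold disk punctures(1) marked(2,3)]])

end
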